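(* Let $(M,\omega)$ be a special Kähler manifold whose Kähler metric is complete. Then the curvature tensor of the Kähler metric of $M$ vanishes identically.
   Context: Let $M$ be a Kähler manifold with Kähler form $\omega$ (with positive definite Kähler metric) and complex structure $I$, regarded as a $TM$-valued one-form $I\in\Omega^1(M,TM)$. A special Kähler structure on $M$ is a real connection $\nabla$ on the tangent bundle $TM$ which is flat, torsion-free and symplectic (that is, $\nabla\omega=0$), and which satisfies $d_\nabla I=0$, where $d_\nabla:\Omega^p(M,TM)\to\Omega^{p+1}(M,TM)$ is the exterior covariant derivative induced by $\nabla$. Explicitly, $d_\nabla I=0$ means $(\nabla_X I)Y=(\nabla_Y I)X$ for all vector fields $X,Y$. A special Kähler manifold is a Kähler manifold equipped with a special Kähler structure. The connection $\nabla$ is in general different from the Levi-Civita connection. "Curvature tensor" refers to the curvature of the Levi-Civita connection of the Kähler metric (not to that of $\nabla$, which is flat by definition), and "complete" means that the Kähler metric is a complete Riemannian metric. *)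

theory Defs
  imports "HOL-Analysis.Analysis" "HOL-Library.Function_Algebras"
begin

(* Throughout, the manifold is the whole type 'a, and sums, differences, products and 0 of
   functions are the pointwise ones.  Function values off the relevant domain (functions outside
   an open set U, tensors on non-tangent vectors, ...) are irrelevant junk. *)

section \<open>Smooth maps between open subsets of normed spaces\<close>

primrec Ck_on ::
    "nat \<Rightarrow> 'b::real_normed_vector set \<Rightarrow> ('b \<Rightarrow> 'c::real_normed_vector) \<Rightarrow> bool" where
  "Ck_on 0 S f \<longleftrightarrow> continuous_on S f"
| "Ck_on (Suc k) S f \<longleftrightarrow>
     (\<forall>x\<in>S. f differentiable (at x)) \<and> (\<forall>v. Ck_on k S (\<lambda>x. frechet_derivative f (at x) v))"

definition Cinf_on :: "'b::real_normed_vector set \<Rightarrow> ('b \<Rightarrow> 'c::real_normed_vector) \<Rightarrow> bool" where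
  "Cinf_on S f \<longleftrightarrow> (\<forall>k. Ck_on k S f)"

section \<open>Complex manifolds\<close>

type_synonym ('a, 'n) atlas = "('a set \<times> ('a \<Rightarrow> complex ^ 'n)) set"

definition complex_atlas ::
    "('a::{t2_space, second_countable_topology}, 'n::finite) atlas \<Rightarrow> bool" where
  "complex_atlas A \<longleftrightarrow>
     (\<Union>(U, \<phi>)\<in>A. U) = UNIV \<and>
     (\<forall>(U, \<phi>)\<in>A. open U \<and> open (\<phi> ` U) \<and> homeomorphism U (\<phi> ` U) \<phi> (inv_into U \<phi>)) \<and>
     (\<forall>(U, \<phi>)\<in>A. \<forall>(V, \<psi>)\<in>A. let \<tau> = (\<lambda>x. \<psi> (inv_into U \<phi> x)) in
        Cinf_on (\<phi> ` (U \<inter> V)) \<tau> \<and>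
        (\<forall>x\<in>\<phi> ` (U \<inter> V). \<forall>v.
           frechet_derivative \<tau> (at x) (\<i> *s v) = \<i> *s frechet_derivative \<tau> (at x) v))"

definition smooth_fun_on ::
    "('a::topological_space, 'n::finite) atlas \<Rightarrow> 'a set \<Rightarrow> ('a \<Rightarrow> real) \<Rightarrow> bool" where
  "smooth_fun_on A W f \<longleftrightarrow>
     (\<forall>(U, \<phi>)\<in>A. Cinf_on (\<phi> ` (W \<inter> U)) (\<lambda>x. f (inv_into U \<phi> x)))"

definition smooth_fun_at ::
    "('a::topological_space, 'n::finite) atlas \<Rightarrow> 'a \<Rightarrow> ('a \<Rightarrow> real) \<Rightarrow> bool" where
  "smooth_fun_at A p f \<longleftrightarrow> (\<exists>W. open W \<and> p \<in> W \<and> smooth_fun_on A W f)"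

section \<open>Tangent vectors and vector fields\<close>

(* A tangent vector at p is a derivation of the germs at p of smooth real functions.  It is set
   to 0 on functions that are not smooth near p, so that equality is equality of derivations. *)

type_synonym 'a tvec = "('a \<Rightarrow> real) \<Rightarrow> real"

abbreviation tscale :: "real \<Rightarrow> 'a tvec \<Rightarrow> 'a tvec"  (infixr "*\<^sub>T" 75) where
  "c *\<^sub>T v \<equiv> (\<lambda>f. c * v f)"

definition tangent_space ::
    "('a::topological_space, 'n::finite) atlas \<Rightarrow> 'a \<Rightarrow> 'a tvec set" where
  "tangent_space A p = {v.
     (\<forall>f g. smooth_fun_at A p f \<longrightarrow> smooth_fun_at A p g \<longrightarrow>
        v (f + g) = v f + v g \<and>
        v (f * g) = v f * g p + f p * v g \<and>
        ((\<forall>\<^sub>F q in nhds p. f q = g q) \<longrightarrow> v f = v g)) \<and>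
     (\<forall>c f. smooth_fun_at A p f \<longrightarrow> v (\<lambda>q. c * f q) = c * v f) \<and>
     (\<forall>f. \<not> smooth_fun_at A p f \<longrightarrow> v f = 0)}"

definition vector_field_on ::
    "('a::topological_space, 'n::finite) atlas \<Rightarrow> 'a set \<Rightarrow> ('a \<Rightarrow> 'a tvec) \<Rightarrow> bool" where
  "vector_field_on A U X \<longleftrightarrow>
     (\<forall>p\<in>U. X p \<in> tangent_space A p) \<and>
     (\<forall>W f. open W \<longrightarrow> W \<subseteq> U \<longrightarrow> smooth_fun_on A W f \<longrightarrow> smooth_fun_on A W (\<lambda>p. X p f))"

definition lie_bracket ::
    "('a::topological_space, 'n::finite) atlas \<Rightarrow>
     ('a \<Rightarrow> 'a tvec) \<Rightarrow> ('a \<Rightarrow> 'a tvec) \<Rightarrow> 'a \<Rightarrow> 'a tvec" where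
  "lie_bracket A X Y p = (\<lambda>f.
     if smooth_fun_at A p f then X p (\<lambda>q. Y q f) - Y p (\<lambda>q. X q f) else 0)"

section \<open>Tensor fields\<close>

definition bilinear_form_field ::
    "('a::topological_space, 'n::finite) atlas \<Rightarrow> ('a \<Rightarrow> 'a tvec \<Rightarrow> 'a tvec \<Rightarrow> real) \<Rightarrow> bool" where
  "bilinear_form_field A b \<longleftrightarrow>
     (\<forall>p. \<forall>u\<in>tangent_space A p. \<forall>v\<in>tangent_space A p. \<forall>w\<in>tangent_space A p. \<forall>c.
        b p (u + v) w = b p u w + b p v w \<and>
        b p w (u + v) = b p w u + b p w v \<and>
        b p (c *\<^sub>T v) w = c * b p v w \<and>
        b p w (c *\<^sub>T v) = c * b p w v) \<and>
     (\<forall>U X Y. open U \<longrightarrow> vector_field_on A U X \<longrightarrow> vector_field_on A U Y \<longrightarrow>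
        smooth_fun_on A U (\<lambda>p. b p (X p) (Y p)))"

definition two_form ::
    "('a::topological_space, 'n::finite) atlas \<Rightarrow> ('a \<Rightarrow> 'a tvec \<Rightarrow> 'a tvec \<Rightarrow> real) \<Rightarrow> bool" where
  "two_form A \<omega> \<longleftrightarrow> bilinear_form_field A \<omega> \<and>
     (\<forall>p. \<forall>v\<in>tangent_space A p. \<omega> p v v = 0)"

definition closed_two_form ::
    "('a::topological_space, 'n::finite) atlas \<Rightarrow> ('a \<Rightarrow> 'a tvec \<Rightarrow> 'a tvec \<Rightarrow> real) \<Rightarrow> bool" where
  "closed_two_form A \<omega> \<longleftrightarrow> two_form A \<omega> \<and>
     (\<forall>U X Y Z. open U \<longrightarrow> vector_field_on A U X \<longrightarrow> vector_field_on A U Y \<longrightarrow>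
        vector_field_on A U Z \<longrightarrow> (\<forall>p\<in>U.
          X p (\<lambda>q. \<omega> q (Y q) (Z q)) - Y p (\<lambda>q. \<omega> q (X q) (Z q)) + Z p (\<lambda>q. \<omega> q (X q) (Y q))
          - \<omega> p (lie_bracket A X Y p) (Z p) + \<omega> p (lie_bracket A X Z p) (Y p)
          - \<omega> p (lie_bracket A Y Z p) (X p) = 0))"

(* the differential at p of the C^n-valued map \<phi>, applied to a tangent vector v at p *)
definition chart_differential :: "('a \<Rightarrow> complex ^ 'n::finite) \<Rightarrow> 'a tvec \<Rightarrow> complex ^ 'n" where
  "chart_differential \<phi> v =
     (\<chi> k. Complex (v (\<lambda>q. Re (\<phi> q $ k))) (v (\<lambda>q. Im (\<phi> q $ k))))"

(* I is the endomorphism of the tangent bundle which the holomorphic charts of A identify with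
   multiplication by the imaginary unit; this determines I on tangent vectors. *)
definition complex_structure ::
    "('a::topological_space, 'n::finite) atlas \<Rightarrow> ('a \<Rightarrow> 'a tvec \<Rightarrow> 'a tvec) \<Rightarrow> bool" where
  "complex_structure A I \<longleftrightarrow>
     (\<forall>p. \<forall>v\<in>tangent_space A p. I p v \<in> tangent_space A p \<and>
        (\<forall>(U, \<phi>)\<in>A. p \<in> U \<longrightarrow>
           chart_differential \<phi> (I p v) = \<i> *s chart_differential \<phi> v))"

section \<open>Connections on the tangent bundle\<close>

(* D p v Y is the covariant derivative at p of the vector field Y (defined near p) in the
   direction of the tangent vector v at p. *)

type_synonym 'a connection = "'a \<Rightarrow> 'a tvec \<Rightarrow> ('a \<Rightarrow> 'a tvec) \<Rightarrow> 'a tvec"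

definition connection ::
    "('a::topological_space, 'n::finite) atlas \<Rightarrow> 'a connection \<Rightarrow> bool" where
  "connection A D \<longleftrightarrow>
     (\<forall>U Y Z h. open U \<longrightarrow> vector_field_on A U Y \<longrightarrow> vector_field_on A U Z \<longrightarrow>
        smooth_fun_on A U h \<longrightarrow>
        vector_field_on A U (\<lambda>p. D p (Z p) Y) \<and>
        (\<forall>p\<in>U. \<forall>v\<in>tangent_space A p. \<forall>w\<in>tangent_space A p. \<forall>c.
           D p v Y \<in> tangent_space A p \<and>
           D p (v + w) Y = D p v Y + D p w Y \<and>
           D p (c *\<^sub>T v) Y = c *\<^sub>T D p v Y \<and>
           D p v (Y + Z) = D p v Y + D p v Z \<and>
           D p v (\<lambda>q. h q *\<^sub>T Y q) = v h *\<^sub>T Y p + h p *\<^sub>T D p v Y \<and>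
           ((\<forall>q\<in>U. Y q = Z q) \<longrightarrow> D p v Y = D p v Z)))"

definition torsion_free ::
    "('a::topological_space, 'n::finite) atlas \<Rightarrow> 'a connection \<Rightarrow> bool" where
  "torsion_free A D \<longleftrightarrow>
     (\<forall>U X Y. open U \<longrightarrow> vector_field_on A U X \<longrightarrow> vector_field_on A U Y \<longrightarrow>
        (\<forall>p\<in>U. D p (X p) Y - D p (Y p) X = lie_bracket A X Y p))"

definition curvature ::
    "('a::topological_space, 'n::finite) atlas \<Rightarrow> 'a connection \<Rightarrow>
     ('a \<Rightarrow> 'a tvec) \<Rightarrow> ('a \<Rightarrow> 'a tvec) \<Rightarrow> ('a \<Rightarrow> 'a tvec) \<Rightarrow> 'a \<Rightarrow> 'a tvec" where
  "curvature A D X Y Z p =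
     D p (X p) (\<lambda>q. D q (Y q) Z) - D p (Y p) (\<lambda>q. D q (X q) Z) - D p (lie_bracket A X Y p) Z"

definition curvature_vanishes ::
    "('a::topological_space, 'n::finite) atlas \<Rightarrow> 'a connection \<Rightarrow> bool" where
  "curvature_vanishes A D \<longleftrightarrow>
     (\<forall>U X Y Z. open U \<longrightarrow> vector_field_on A U X \<longrightarrow> vector_field_on A U Y \<longrightarrow>
        vector_field_on A U Z \<longrightarrow> (\<forall>p\<in>U. curvature A D X Y Z p = 0))"

definition cov_deriv_form ::
    "'a connection \<Rightarrow> ('a \<Rightarrow> 'a tvec \<Rightarrow> 'a tvec \<Rightarrow> real) \<Rightarrow>
     ('a \<Rightarrow> 'a tvec) \<Rightarrow> ('a \<Rightarrow> 'a tvec) \<Rightarrow> ('a \<Rightarrow> 'a tvec) \<Rightarrow> 'a \<Rightarrow> real" where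
  "cov_deriv_form D b X Y Z p =
     X p (\<lambda>q. b q (Y q) (Z q)) - b p (D p (X p) Y) (Z p) - b p (Y p) (D p (X p) Z)"

definition parallel_form ::
    "('a::topological_space, 'n::finite) atlas \<Rightarrow> 'a connection \<Rightarrow>
     ('a \<Rightarrow> 'a tvec \<Rightarrow> 'a tvec \<Rightarrow> real) \<Rightarrow> bool" where
  "parallel_form A D b \<longleftrightarrow>
     (\<forall>U X Y Z. open U \<longrightarrow> vector_field_on A U X \<longrightarrow> vector_field_on A U Y \<longrightarrow>
        vector_field_on A U Z \<longrightarrow> (\<forall>p\<in>U. cov_deriv_form D b X Y Z p = 0))"

definition cov_deriv_endo ::
    "'a connection \<Rightarrow> ('a \<Rightarrow> 'a tvec \<Rightarrow> 'a tvec) \<Rightarrow>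
     ('a \<Rightarrow> 'a tvec) \<Rightarrow> ('a \<Rightarrow> 'a tvec) \<Rightarrow> 'a \<Rightarrow> 'a tvec" where
  "cov_deriv_endo D I X Y p = D p (X p) (\<lambda>q. I q (Y q)) - I p (D p (X p) Y)"

section \<open>Riemannian metrics\<close>

definition riemannian_metric ::
    "('a::topological_space, 'n::finite) atlas \<Rightarrow> ('a \<Rightarrow> 'a tvec \<Rightarrow> 'a tvec \<Rightarrow> real) \<Rightarrow> bool" where
  "riemannian_metric A g \<longleftrightarrow> bilinear_form_field A g \<and>
     (\<forall>p. \<forall>v\<in>tangent_space A p. \<forall>w\<in>tangent_space A p. g p v w = g p w v) \<and>
     (\<forall>p. \<forall>v\<in>tangent_space A p. v \<noteq> 0 \<longrightarrow> g p v v > 0)"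

definition levi_civita ::
    "('a::topological_space, 'n::finite) atlas \<Rightarrow> ('a \<Rightarrow> 'a tvec \<Rightarrow> 'a tvec \<Rightarrow> real) \<Rightarrow>
     'a connection \<Rightarrow> bool" where
  "levi_civita A g D \<longleftrightarrow> connection A D \<and> torsion_free A D \<and> parallel_form A D g"

definition piecewise_C1_curve ::
    "('a::topological_space, 'n::finite) atlas \<Rightarrow> (real \<Rightarrow> 'a) \<Rightarrow> bool" where
  "piecewise_C1_curve A \<gamma> \<longleftrightarrow> continuous_on {0..1} \<gamma> \<and>
     (\<forall>(U, \<phi>)\<in>A. \<forall>a b. 0 \<le> a \<longrightarrow> b \<le> 1 \<longrightarrow> \<gamma> ` {a..b} \<subseteq> U \<longrightarrow>
        (\<lambda>t. \<phi> (\<gamma> t)) piecewise_C1_differentiable_on {a..b})"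

(* meaningful only where the curve is differentiable, i.e. for all but finitely many t *)
definition velocity ::
    "('a::topological_space, 'n::finite) atlas \<Rightarrow> (real \<Rightarrow> 'a) \<Rightarrow> real \<Rightarrow> 'a tvec" where
  "velocity A \<gamma> t = (\<lambda>f. if smooth_fun_at A (\<gamma> t) f then deriv (\<lambda>s. f (\<gamma> s)) t else 0)"

definition curve_length ::
    "('a::topological_space, 'n::finite) atlas \<Rightarrow> ('a \<Rightarrow> 'a tvec \<Rightarrow> 'a tvec \<Rightarrow> real) \<Rightarrow>
     (real \<Rightarrow> 'a) \<Rightarrow> ennreal" where
  "curve_length A g \<gamma> =
     (\<integral>\<^sup>+t\<in>{0..1}. ennreal (sqrt (g (\<gamma> t) (velocity A \<gamma> t) (velocity A \<gamma> t))) \<partial>lborel)"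

(* infinite for points in different connected components *)
definition riemannian_dist ::
    "('a::topological_space, 'n::finite) atlas \<Rightarrow> ('a \<Rightarrow> 'a tvec \<Rightarrow> 'a tvec \<Rightarrow> real) \<Rightarrow>
     'a \<Rightarrow> 'a \<Rightarrow> ennreal" where
  "riemannian_dist A g p q =
     (INF \<gamma>\<in>{\<gamma>. piecewise_C1_curve A \<gamma> \<and> \<gamma> 0 = p \<and> \<gamma> 1 = q}. curve_length A g \<gamma>)"

definition complete_metric ::
    "('a::topological_space, 'n::finite) atlas \<Rightarrow> ('a \<Rightarrow> 'a tvec \<Rightarrow> 'a tvec \<Rightarrow> real) \<Rightarrow> bool" where
  "complete_metric A g \<longleftrightarrow>
     (\<forall>x :: nat \<Rightarrow> 'a.
        (\<forall>e>0. \<exists>N. \<forall>m\<ge>N. \<forall>n\<ge>N. riemannian_dist A g (x m) (x n) < e) \<longrightarrow>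
        (\<exists>l. (\<lambda>n. riemannian_dist A g (x n) l) \<longlonglongrightarrow> 0))"

section \<open>Kaehler and special Kaehler structures\<close>

(* Convention: \<omega>(v, w) = g(I v, w), equivalently g(v, w) = \<omega>(v, I w). *)
definition kaehler_metric ::
    "('a \<Rightarrow> 'a tvec \<Rightarrow> 'a tvec) \<Rightarrow> ('a \<Rightarrow> 'a tvec \<Rightarrow> 'a tvec \<Rightarrow> real) \<Rightarrow>
     'a \<Rightarrow> 'a tvec \<Rightarrow> 'a tvec \<Rightarrow> real" where
  "kaehler_metric I \<omega> p v w = \<omega> p v (I p w)"

definition kaehler_manifold ::
    "('a::{t2_space, second_countable_topology}, 'n::finite) atlas \<Rightarrow>
     ('a \<Rightarrow> 'a tvec \<Rightarrow> 'a tvec) \<Rightarrow> ('a \<Rightarrow> 'a tvec \<Rightarrow> 'a tvec \<Rightarrow> real) \<Rightarrow> bool" where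
  "kaehler_manifold A I \<omega> \<longleftrightarrow>
     complex_atlas A \<and> complex_structure A I \<and> closed_two_form A \<omega> \<and>
     (\<forall>p. \<forall>v\<in>tangent_space A p. \<forall>w\<in>tangent_space A p. \<omega> p (I p v) (I p w) = \<omega> p v w) \<and>
     riemannian_metric A (kaehler_metric I \<omega>)"

definition special_kaehler_structure ::
    "('a::topological_space, 'n::finite) atlas \<Rightarrow>
     ('a \<Rightarrow> 'a tvec \<Rightarrow> 'a tvec) \<Rightarrow> ('a \<Rightarrow> 'a tvec \<Rightarrow> 'a tvec \<Rightarrow> real) \<Rightarrow>
     'a connection \<Rightarrow> bool" where
  "special_kaehler_structure A I \<omega> nabla \<longleftrightarrow>
     connection A nabla \<and> curvature_vanishes A nabla \<and> torsion_free A nabla \<and> parallel_form A nabla \<omega> \<and>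
     (\<forall>U X Y. open U \<longrightarrow> vector_field_on A U X \<longrightarrow> vector_field_on A U Y \<longrightarrow>
        (\<forall>p\<in>U. cov_deriv_endo nabla I X Y p = cov_deriv_endo nabla I Y X p))"

definition special_kaehler_manifold ::
    "('a::{t2_space, second_countable_topology}, 'n::finite) atlas \<Rightarrow>
     ('a \<Rightarrow> 'a tvec \<Rightarrow> 'a tvec) \<Rightarrow> ('a \<Rightarrow> 'a tvec \<Rightarrow> 'a tvec \<Rightarrow> real) \<Rightarrow>
     'a connection \<Rightarrow> bool" where
  "special_kaehler_manifold A I \<omega> nabla \<longleftrightarrow>
     kaehler_manifold A I \<omega> \<and> special_kaehler_structure A I \<omega> nabla"

end

theory Submission
  imports Defs
begin

text \<open>In \<open>\<nabla>\<close>-flat coordinates the Kaehler form is constant and the derivative \<open>T(a, b, c)\<close> of \<open>g(b, c)\<close> in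
  direction \<open>a\<close> is totally symmetric; the point is that \<open>T = 0\<close>. Suppose \<open>T(w, w, w) = \<mu> > 0\<close> for a unit
  vector \<open>w\<close> at \<open>q\<close>, and let \<open>\<delta>\<close> be a small dimensional constant. If \<open>T < (1 + \<delta>) \<mu>\<close> on all unit vectors at
  points within distance \<open>1 / \<mu>\<close> of \<open>q\<close>, then by Gronwall's inequality \<open>g\<close> stays within a factor \<open>2\<close> of its value at
  \<open>q\<close> along rays, and completeness lets the flat coordinates at \<open>q\<close> be developed over a Euclidean ball of
  radius \<open>1 / (16 \<mu>)\<close>. Maximize \<open>T(w, w, w) - \<kappa> |y|\<^sup>2\<close> over points \<open>y\<close> of a smaller ball and unit vectors \<open>w\<close> at \<open>y\<close>.
  At an interior maximum, second variation along nearly parallel curves, together with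
  \<open>g = \<omega>(\<cdot>, J \<cdot>)\<close> and \<open>J\<^sup>2 = -1\<close>, yields a Bochner-type inequality that is violated for \<open>\<kappa>\<close> small against \<open>\<mu>\<^sup>3\<close>; at a
  boundary maximum \<open>T \<ge> (1 + \<delta>) \<mu>\<close>. So there always is a point within distance \<open>1 / \<mu>\<close> with value at least
  \<open>(1 + \<delta>) \<mu>\<close>. Iterating, the distances are summable while the values grow geometrically, which contradicts
  local boundedness of \<open>T\<close> at the limit point. Hence \<open>T = 0\<close>, the metric is constant in \<open>\<nabla>\<close>-flat coordinates, and
  they are flat for the Levi-Civita connection as well.\<close>

section \<open>Calculus of smooth maps\<close>

text \<open>On a noncompact manifold the cubic form need not attain a maximum, so every maximum is
  taken over a compact ball in flat coordinates. On unit vectors \<open>T\<close> scales like an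
  inverse length, which makes 1/\<mu> the natural radius at a point with value \<mu>. The inequality
  at an interior maximum rests on one matrix fact. Let c(s) be the Gram matrix of g along the line
  in direction v, in a frame orthonormal at s = 0. It is symplectic, c J c = J, and three
  differentiations give tr c'' = tr A^2, tr c''' = 3 tr(A c'') and tr A^3 = 0 for A = c'(0). By
  total symmetry of \<open>T\<close> and commuting flat derivatives, the second variations summed
  over the frame involve only these traces; they cancel up to 3/4 T(v,v,v) tr A^2, which is at least
  3/4 T(v,v,v)^3. Neither geodesics nor the curvature of the metric enter: rays are straight lines
  in flat coordinates. These coordinates are smooth but in general not holomorphic, and their
  development over a ball is a local diffeomorphism that need not be injective; \<open>param\<close>
  and \<open>locally_flat\<close> are shaped by this.\<close>

abbreviation dd :: "('b::real_normed_vector \<Rightarrow> 'c::real_normed_vector) \<Rightarrow> 'b \<Rightarrow> 'b \<Rightarrow> 'c" where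
  "dd f v x \<equiv> frechet_derivative f (at x) v"

lemma dd_eqI: "(f has_derivative f') (at x) \<Longrightarrow> dd f v x = f' v"
  by (metis frechet_derivative_at)

text \<open>Differentiability is not assumed: where it fails, both Frechet derivatives are choices
  from the same predicate and therefore equal. Rewriting under \<open>dd\<close> thus never needs a
  differentiability check.\<close>

lemma dd_cong:
  assumes "open S" "x \<in> S" "\<And>z. z \<in> S \<Longrightarrow> f z = g z"
  shows "dd f v x = dd g v x"
proof (cases "f differentiable at x")
  case True
  then show ?thesis using assms frechet_derivative_transform_within_open by metis
next
  case False
  have "\<not> g differentiable at x"
  proof
    assume "g differentiable at x"
    then obtain g' where "(g has_derivative g') (at x)" by (auto simp: differentiable_def)
    then have "(f has_derivative g') (at x)"
      using assms by (metis has_derivative_transform_within_open)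
    then show False using False by (auto simp: differentiable_def)
  qed
  moreover have "(f has_derivative f') (at x) \<longleftrightarrow> (g has_derivative f') (at x)" for f'
    using False \<open>\<not> g differentiable at x\<close> by (auto simp: differentiable_def)
  ultimately show ?thesis by (simp add: frechet_derivative_def)
qed

lemma Ck_on_cong:
  assumes "open S" "\<And>x. x \<in> S \<Longrightarrow> f x = g x"
  shows "Ck_on k S f \<longleftrightarrow> Ck_on k S g"
  using assms
proof (induction k arbitrary: f g)
  case 0
  then show ?case by (auto cong: continuous_on_cong)
next
  case (Suc k)
  have "f differentiable at x \<longleftrightarrow> g differentiable at x" if "x \<in> S" for x
    using Suc.prems that unfolding differentiable_def
    by (metis has_derivative_transform_within_open)
  moreover have "Ck_on k S (dd f v) \<longleftrightarrow> Ck_on k S (dd g v)" for v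
    by (rule Suc.IH[OF Suc.prems(1)]) (use Suc.prems dd_cong[OF Suc.prems(1)] in blast)
  ultimately show ?case by auto
qed

lemma Ck_on_subset: "Ck_on k S f \<Longrightarrow> T \<subseteq> S \<Longrightarrow> Ck_on k T f"
  by (induction k arbitrary: f) (auto intro: continuous_on_subset)

lemma Ck_on_local:
  assumes "\<And>x. x \<in> S \<Longrightarrow> \<exists>T. open T \<and> x \<in> T \<and> Ck_on k (T \<inter> S) f" "open S"
  shows "Ck_on k S f"
  using assms
proof (induction k arbitrary: f)
  case 0
  have "continuous (at x) f" if "x \<in> S" for x
  proof -
    obtain T where T: "open T" "x \<in> T" "Ck_on 0 (T \<inter> S) f" using 0(1)[OF \<open>x \<in> S\<close>] by auto
    then show ?thesis
      using that \<open>open S\<close> continuous_on_eq_continuous_at[of "T \<inter> S" f] by auto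
  qed
  then show ?case by (simp add: continuous_at_imp_continuous_on)
next
  case (Suc k)
  have "f differentiable at x" if "x \<in> S" for x
    using Suc.prems(1)[OF that] that by auto
  moreover have "Ck_on k S (dd f v)" for v
  proof (rule Suc.IH)
    show "\<exists>T. open T \<and> x \<in> T \<and> Ck_on k (T \<inter> S) (dd f v)" if "x \<in> S" for x
      using Suc.prems(1)[OF that] by (metis Ck_on.simps(2))
  qed fact
  ultimately show ?case by simp
qed

lemma Ck_on_continuous: "Ck_on k S f \<Longrightarrow> continuous_on S f"
  by (cases k)
     (auto simp: continuous_at_imp_continuous_on differentiable_imp_continuous_within)

lemma Ck_on_SucD: "Ck_on (Suc k) S f \<Longrightarrow> Ck_on k S f"
proof (induction k arbitrary: f)
  case 0
  then show ?case using Ck_on_continuous by (metis Ck_on.simps(1))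
next
  case (Suc k)
  then show ?case by (metis Ck_on.simps(2))
qed

lemma Ck_on_bounded_linear: "bounded_linear f \<Longrightarrow> Ck_on k S f"
proof (induction k arbitrary: f)
  case 0
  then show ?case by (simp add: linear_continuous_on)
next
  case (Suc k)
  have "dd f v = (\<lambda>x. f v)" for v
    using Suc.prems bounded_linear_imp_has_derivative dd_eqI by blast
  moreover have "Ck_on k S (\<lambda>x. c)" for c :: 'b
    by (induction k arbitrary: c) auto
  ultimately show ?case using Suc.prems
    by (auto intro: bounded_linear_imp_differentiable)
qed

lemma Ck_on_const: "Ck_on k S (\<lambda>x. c)"
  by (induction k arbitrary: c) auto

lemma Ck_on_has_derivative:
  "Ck_on (Suc k) S f \<Longrightarrow> x \<in> S \<Longrightarrow> (f has_derivative (\<lambda>v. dd f v x)) (at x)"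
  using frechet_derivative_works by fastforce

lemma Ck_on_SucI:
  assumes "open S" "\<And>x. x \<in> S \<Longrightarrow> (f has_derivative f' x) (at x)"
    and "\<And>v. Ck_on k S (\<lambda>x. f' x v)"
  shows "Ck_on (Suc k) S f"
proof -
  have "Ck_on k S (dd f v)" for v
    by (subst Ck_on_cong[OF assms(1), of _ "\<lambda>x. f' x v"]) (auto intro: dd_eqI assms)
  then show ?thesis using assms(2) by (auto simp: differentiable_def)
qed

lemma Ck_on_add:
  assumes "open S" "Ck_on k S f" "Ck_on k S g"
  shows "Ck_on k S (\<lambda>x. f x + g x)"
  using assms(2,3)
proof (induction k arbitrary: f g)
  case 0
  then show ?case by (simp add: continuous_on_add)
next
  case (Suc k)
  show ?case
  proof (rule Ck_on_SucI[OF assms(1)])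
    show "((\<lambda>x. f x + g x) has_derivative (\<lambda>v. dd f v x + dd g v x)) (at x)" if "x \<in> S" for x
      using Suc.prems that by (intro has_derivative_add Ck_on_has_derivative)
  qed (use Suc in auto)
qed

lemma Ck_on_bilinear:
  assumes "open S" "bounded_bilinear B" "Ck_on k S f" "Ck_on k S g"
  shows "Ck_on k S (\<lambda>x. B (f x) (g x))"
  using assms(3,4)
proof (induction k arbitrary: f g)
  case 0
  then show ?case using bounded_bilinear.continuous_on[OF assms(2)] by simp
next
  case (Suc k)
  show ?case
  proof (rule Ck_on_SucI[OF assms(1)])
    show "((\<lambda>x. B (f x) (g x)) has_derivative (\<lambda>v. B (f x) (dd g v x) + B (dd f v x) (g x))) (at x)"
      if "x \<in> S" for x
      using Suc.prems that by (intro bounded_bilinear.FDERIV[OF assms(2)] Ck_on_has_derivative)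
    have "Ck_on k S f" "Ck_on k S g" "Ck_on k S (dd f v)" "Ck_on k S (dd g v)" for v
      using Suc.prems Ck_on_SucD by (blast, blast, auto)
    then show "Ck_on k S (\<lambda>x. B (f x) (dd g v x) + B (dd f v x) (g x))" for v
      by (intro Ck_on_add[OF assms(1)] Suc.IH)
  qed
qed

lemma Ck_on_sum:
  assumes "open S" "\<And>i. i \<in> K \<Longrightarrow> Ck_on k S (f i)"
  shows "Ck_on k S (\<lambda>x. \<Sum>i\<in>K. f i x)"
  using assms(2)
proof (induction K rule: infinite_finite_induct)
  case (insert i K)
  then show ?case using Ck_on_add[OF assms(1), of k "f i" "\<lambda>x. \<Sum>i\<in>K. f i x"] by simp
qed (auto simp: Ck_on_const)

lemma Ck_on_componentwise:
  fixes f :: "'b::real_normed_vector \<Rightarrow> 'c::euclidean_space"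
  assumes "open S" "\<And>b. b \<in> Basis \<Longrightarrow> Ck_on k S (\<lambda>x. f x \<bullet> b)"
  shows "Ck_on k S f"
proof -
  have "Ck_on k S (\<lambda>x. \<Sum>b\<in>Basis. (f x \<bullet> b) *\<^sub>R b)"
    by (intro Ck_on_sum Ck_on_bilinear[OF _ bounded_bilinear_scaleR] Ck_on_const assms)
  then show ?thesis by (simp add: euclidean_representation)
qed

lemma dd_linear: "f differentiable at x \<Longrightarrow> linear (\<lambda>v. dd f v x)"
  by (simp add: linear_frechet_derivative)

lemma linear_expand:
  fixes L :: "'b::euclidean_space \<Rightarrow> 'c::real_vector"
  assumes "linear L"
  shows "L w = (\<Sum>b\<in>Basis. (w \<bullet> b) *\<^sub>R L b)"
proof -
  have "L w = L (\<Sum>b\<in>Basis. (w \<bullet> b) *\<^sub>R b)" by (simp add: euclidean_representation)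
  also have "\<dots> = (\<Sum>b\<in>Basis. (w \<bullet> b) *\<^sub>R L b)"
    using assms by (simp add: linear_sum linear_cmul)
  finally show ?thesis .
qed

text \<open>\<open>Ck_on\<close> differentiates in fixed directions only. A direction that varies
  with the point is expanded in the basis, which leaves scalar coefficients times fixed
  directions.\<close>

lemma Ck_on_linear_apply:
  fixes w :: "'d::real_normed_vector \<Rightarrow> 'b::euclidean_space"
  assumes "open S" "\<And>x. x \<in> S \<Longrightarrow> linear (L x)" "\<And>b. b \<in> Basis \<Longrightarrow> Ck_on k S (\<lambda>x. L x b)"
    and "Ck_on k S w"
  shows "Ck_on k S (\<lambda>x. L x (w x))"
proof -
  have "Ck_on k S (\<lambda>x. \<Sum>b\<in>Basis. (w x \<bullet> b) *\<^sub>R L x b)"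
    by (intro Ck_on_sum Ck_on_bilinear[OF _ bounded_bilinear_scaleR]
        Ck_on_bilinear[OF _ bounded_bilinear_inner] Ck_on_const assms)
  then show ?thesis
    by (subst Ck_on_cong[OF assms(1), of _ "\<lambda>x. \<Sum>b\<in>Basis. (w x \<bullet> b) *\<^sub>R L x b"])
       (auto intro: linear_expand assms(2))
qed

text \<open>By the chain rule the derivative is \<open>dd g\<close> at \<open>f x\<close> in the
  moving direction \<open>dd f v x\<close>, which \<open>Ck_on_linear_apply\<close> reduces to fixed
  directions and hence to the induction hypothesis for \<open>dd g b\<close>.\<close>

lemma Ck_on_compose:
  fixes f :: "'d::real_normed_vector \<Rightarrow> 'b::euclidean_space"
  assumes "open S" "open T" "Ck_on k S f" "Ck_on k T g" "f ` S \<subseteq> T"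
  shows "Ck_on k S (\<lambda>x. g (f x))"
  using assms(3,4)
proof (induction k arbitrary: g)
  case 0
  then show ?case using assms(5) by (auto intro: continuous_on_compose2)
next
  case (Suc k)
  show ?case
  proof (rule Ck_on_SucI[OF assms(1)])
    show "((\<lambda>x. g (f x)) has_derivative (\<lambda>v. dd g (dd f v x) (f x))) (at x)" if "x \<in> S" for x
      using has_derivative_compose[OF Ck_on_has_derivative[OF Suc.prems(1) that] Ck_on_has_derivative[OF Suc.prems(2)]]
        assms(5) that by blast
    show "Ck_on k S (\<lambda>x. dd g (dd f v x) (f x))" for v
    proof (rule Ck_on_linear_apply[OF assms(1)])
      show "linear (\<lambda>w. dd g w (f x))" if "x \<in> S" for x
        using that Suc.prems(2) assms(5) by (auto intro!: dd_linear)
      show "Ck_on k S (\<lambda>x. dd g b (f x))" for b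
        using Suc.IH[OF Ck_on_SucD[OF Suc.prems(1)], of "dd g b"] Suc.prems(2) by simp
    qed (use Suc.prems in auto)
  qed
qed

lemma Cinf_onD: "Cinf_on S f \<Longrightarrow> Ck_on k S f"
  by (simp add: Cinf_on_def)

lemma Cinf_on_dd: "Cinf_on S f \<Longrightarrow> Cinf_on S (dd f v)"
  unfolding Cinf_on_def by (metis Ck_on.simps(2))

lemma Cinf_on_has_derivative:
  "Cinf_on S f \<Longrightarrow> x \<in> S \<Longrightarrow> (f has_derivative (\<lambda>v. dd f v x)) (at x)"
  unfolding Cinf_on_def using Ck_on_has_derivative by blast

lemma Cinf_on_differentiable: "Cinf_on S f \<Longrightarrow> x \<in> S \<Longrightarrow> f differentiable at x"
  using Cinf_on_has_derivative differentiable_def by blast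

lemma Cinf_on_continuous: "Cinf_on S f \<Longrightarrow> continuous_on S f"
  by (meson Cinf_onD Ck_on_continuous)

lemma Cinf_on_cong: "open S \<Longrightarrow> (\<And>x. x \<in> S \<Longrightarrow> f x = g x) \<Longrightarrow> Cinf_on S f \<longleftrightarrow> Cinf_on S g"
  unfolding Cinf_on_def using Ck_on_cong by blast

lemma Cinf_on_subset: "Cinf_on S f \<Longrightarrow> T \<subseteq> S \<Longrightarrow> Cinf_on T f"
  unfolding Cinf_on_def using Ck_on_subset by blast

lemma Cinf_on_local:
  assumes "open S" "\<And>x. x \<in> S \<Longrightarrow> \<exists>T. open T \<and> x \<in> T \<and> Cinf_on (T \<inter> S) f"
  shows "Cinf_on S f"
  unfolding Cinf_on_def using assms(2)
  by (intro allI Ck_on_local[OF _ assms(1)]) (meson Cinf_onD)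

lemma Cinf_on_bounded_linear: "bounded_linear f \<Longrightarrow> Cinf_on S f"
  by (simp add: Cinf_on_def Ck_on_bounded_linear)

lemma Cinf_on_const: "Cinf_on S (\<lambda>x. c)"
  by (simp add: Cinf_on_def Ck_on_const)

lemma Cinf_on_id: "Cinf_on S (\<lambda>x. x)"
  by (simp add: Cinf_on_bounded_linear)

lemma Cinf_on_add: "open S \<Longrightarrow> Cinf_on S f \<Longrightarrow> Cinf_on S g \<Longrightarrow> Cinf_on S (\<lambda>x. f x + g x)"
  by (simp add: Cinf_on_def Ck_on_add)

lemma Cinf_on_bilinear:
  "open S \<Longrightarrow> bounded_bilinear B \<Longrightarrow> Cinf_on S f \<Longrightarrow> Cinf_on S g \<Longrightarrow> Cinf_on S (\<lambda>x. B (f x) (g x))"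
  by (simp add: Cinf_on_def Ck_on_bilinear)

lemma Cinf_on_mult:
  fixes f g :: "_ \<Rightarrow> real"
  shows "open S \<Longrightarrow> Cinf_on S f \<Longrightarrow> Cinf_on S g \<Longrightarrow> Cinf_on S (\<lambda>x. f x * g x)"
  using Cinf_on_bilinear[OF _ bounded_bilinear_mult] .

lemma Cinf_on_scaleR:
  "open S \<Longrightarrow> Cinf_on S f \<Longrightarrow> Cinf_on S g \<Longrightarrow> Cinf_on S (\<lambda>x. f x *\<^sub>R g x)"
  using Cinf_on_bilinear[OF _ bounded_bilinear_scaleR] .

lemma Cinf_on_inner:
  "open S \<Longrightarrow> Cinf_on S f \<Longrightarrow> Cinf_on S g \<Longrightarrow> Cinf_on S (\<lambda>x. f x \<bullet> g x)"
  using Cinf_on_bilinear[OF _ bounded_bilinear_inner] .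

lemma Cinf_on_minus:
  "open S \<Longrightarrow> Cinf_on S f \<Longrightarrow> Cinf_on S (\<lambda>x. - f x)"
  using Cinf_on_scaleR[OF _ Cinf_on_const[of S "-1 :: real"], of f] by simp

lemma Cinf_on_diff: "open S \<Longrightarrow> Cinf_on S f \<Longrightarrow> Cinf_on S g \<Longrightarrow> Cinf_on S (\<lambda>x. f x - g x)"
  using Cinf_on_add[OF _ _ Cinf_on_minus, of S f g] by simp

lemma Cinf_on_sum: "open S \<Longrightarrow> (\<And>i. i \<in> K \<Longrightarrow> Cinf_on S (f i)) \<Longrightarrow> Cinf_on S (\<lambda>x. \<Sum>i\<in>K. f i x)"
  by (simp add: Cinf_on_def Ck_on_sum)

lemma Cinf_on_componentwise:
  fixes f :: "'b::real_normed_vector \<Rightarrow> 'c::euclidean_space"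
  shows "open S \<Longrightarrow> (\<And>b. b \<in> Basis \<Longrightarrow> Cinf_on S (\<lambda>x. f x \<bullet> b)) \<Longrightarrow> Cinf_on S f"
  by (simp add: Cinf_on_def Ck_on_componentwise)

lemma Cinf_on_linear_apply:
  fixes w :: "'d::real_normed_vector \<Rightarrow> 'b::euclidean_space"
  shows "open S \<Longrightarrow> (\<And>x. x \<in> S \<Longrightarrow> linear (L x)) \<Longrightarrow>
    (\<And>b. b \<in> Basis \<Longrightarrow> Cinf_on S (\<lambda>x. L x b)) \<Longrightarrow> Cinf_on S w \<Longrightarrow> Cinf_on S (\<lambda>x. L x (w x))"
  by (simp add: Cinf_on_def Ck_on_linear_apply)

lemma Cinf_on_compose:
  fixes f :: "'d::real_normed_vector \<Rightarrow> 'b::euclidean_space"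
  shows "open S \<Longrightarrow> open T \<Longrightarrow> Cinf_on S f \<Longrightarrow> Cinf_on T g \<Longrightarrow> f ` S \<subseteq> T \<Longrightarrow> Cinf_on S (\<lambda>x. g (f x))"
  unfolding Cinf_on_def using Ck_on_compose by blast

text \<open>For solutions of differential equations: the derivative is an expression in f itself, so
  each order of smoothness of f yields the next.\<close>

lemma Cinf_on_bootstrap:
  assumes "open S" "\<And>x. x \<in> S \<Longrightarrow> (f has_derivative f' x) (at x)"
    and "\<And>k v. Ck_on k S f \<Longrightarrow> Ck_on k S (\<lambda>x. f' x v)"
  shows "Cinf_on S f"
proof -
  have "Ck_on k S f" for k
  proof (induction k)
    case 0
    then show ?case
      using assms(1,2) by (metis Ck_on.simps(1) continuous_at_imp_continuous_on has_derivative_continuous)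
  next
    case (Suc k)
    then show ?case using assms Ck_on_SucI by blast
  qed
  then show ?thesis by (simp add: Cinf_on_def)
qed

subsection \<open>Restriction to lines, symmetry of second derivatives\<close>

lemma has_real_derivative_along:
  fixes f :: "'b::real_normed_vector \<Rightarrow> real"
  assumes "(f has_derivative f') (at (y + t *\<^sub>R e))"
  shows "((\<lambda>s. f (y + s *\<^sub>R e)) has_real_derivative f' e) (at t within T)"
proof -
  have "((\<lambda>s. f (y + s *\<^sub>R e)) has_derivative (\<lambda>s. f' (s *\<^sub>R e))) (at t within T)"
    using assms by (intro has_derivative_compose[of _ _ t T f f']) (auto intro!: derivative_eq_intros)
  then show ?thesis
    using has_derivative_bounded_linear[OF assms]
    by (simp add: has_field_derivative_def linear_simps mult_commute_abs)
qed

lemma dd_along: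
  fixes f :: "'b::real_normed_vector \<Rightarrow> real"
  assumes "Cinf_on S f" "y + t *\<^sub>R e \<in> S"
  shows "((\<lambda>s. f (y + s *\<^sub>R e)) has_real_derivative dd f e (y + t *\<^sub>R e)) (at t within T)"
  using has_real_derivative_along[OF Cinf_on_has_derivative[OF assms]] .

text \<open>Two uses of the mean value theorem, first along a and then along b, make the quotient
  equal to the second derivative at a nearby point; continuity does the rest.\<close>

lemma mixed_difference:
  fixes f :: "'b::real_normed_vector \<Rightarrow> real"
  assumes S: "open S" "Ck_on 2 S f" "y \<in> S" "e > 0"
  shows "\<exists>d>0. \<forall>h. 0 < h \<longrightarrow> h < d \<longrightarrow>
    \<bar>(f (y + h *\<^sub>R a + h *\<^sub>R b) - f (y + h *\<^sub>R a) - f (y + h *\<^sub>R b) + f y) / h^2 - dd (dd f a) b y\<bar> < e"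
proof -
  have C2: "Ck_on (Suc (Suc 0)) S f" using S(2) by (simp add: numeral_2_eq_2)
  have da: "Ck_on (Suc 0) S (dd f a)" using C2 by simp
  have cont: "continuous_on S (dd (dd f a) b)" using da by simp
  obtain r where r: "r > 0" "\<And>z. dist z y < r \<Longrightarrow> z \<in> S \<and> \<bar>dd (dd f a) b z - dd (dd f a) b y\<bar> < e"
  proof -
    obtain r1 where r1: "r1 > 0" "ball y r1 \<subseteq> S" using S by (meson openE)
    obtain r2 where r2: "r2 > 0" "\<And>z. z \<in> S \<Longrightarrow> dist z y < r2 \<Longrightarrow> dist (dd (dd f a) b z) (dd (dd f a) b y) < e"
      using continuous_on_iff[THEN iffD1, OF cont, rule_format, OF S(3) S(4)] by auto
    show thesis
      by (rule that[of "min r1 r2"]) (use r1 r2 in \<open>auto simp: dist_real_def dist_commute subset_iff\<close>)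
  qed
  \<comment> \<open>The parallelogram spanned by h a and h b with h < d stays in the ball of radius
    r; the 1 keeps the denominator positive when a = b = 0.\<close>
  define d where "d = r / (norm a + norm b + 1)"
  have "d > 0" using r(1) by (simp add: d_def add_nonneg_pos)
  have near: "dist (y + s *\<^sub>R a + t *\<^sub>R b) y < r" if "0 \<le> s" "s \<le> h" "0 \<le> t" "t \<le> h" "h < d" for s t h
  proof -
    have "dist (y + s *\<^sub>R a + t *\<^sub>R b) y \<le> s * norm a + t * norm b"
      using norm_triangle_ineq[of "s *\<^sub>R a" "t *\<^sub>R b"] that by (simp add: dist_norm add.assoc)
    also have "\<dots> \<le> h * norm a + h * norm b" using that by (intro add_mono mult_right_mono) auto
    also have "\<dots> \<le> h * (norm a + norm b + 1)" using that by (simp add: algebra_simps)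
    also have "\<dots> < d * (norm a + norm b + 1)" using that by (intro mult_strict_right_mono) (auto simp: add_nonneg_pos)
    also have "\<dots> = r"
      using add_nonneg_pos[of "norm a + norm b" 1] by (simp add: d_def)
    finally show ?thesis .
  qed
  show ?thesis
  proof (intro exI conjI allI impI)
    show "d > 0" by fact
    fix h :: real assume h: "0 < h" "h < d"
    define p where "p s = f (y + s *\<^sub>R a + h *\<^sub>R b) - f (y + s *\<^sub>R a)" for s
    have 1: "(p has_real_derivative dd f a (y + s *\<^sub>R a + h *\<^sub>R b) - dd f a (y + s *\<^sub>R a)) (at s)"
      if "0 \<le> s" "s \<le> h" for s
    proof -
      have "((\<lambda>s. f ((y + h *\<^sub>R b) + s *\<^sub>R a)) has_real_derivative dd f a ((y + h *\<^sub>R b) + s *\<^sub>R a)) (at s)"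
        using near[of s h h] that h r(2)[of "y + s *\<^sub>R a + h *\<^sub>R b"]
        by (intro has_real_derivative_along Ck_on_has_derivative[OF C2]) (auto simp: algebra_simps)
      moreover have "((\<lambda>s. f (y + s *\<^sub>R a)) has_real_derivative dd f a (y + s *\<^sub>R a)) (at s)"
        using near[of s h 0] that h r(2)[of "y + s *\<^sub>R a"]
        by (intro has_real_derivative_along Ck_on_has_derivative[OF C2]) auto
      ultimately show ?thesis unfolding p_def by (auto intro!: derivative_eq_intros simp: algebra_simps)
    qed
    obtain s where s: "0 < s" "s < h"
      "p h - p 0 = h * (dd f a (y + s *\<^sub>R a + h *\<^sub>R b) - dd f a (y + s *\<^sub>R a))"
      using MVT2[of 0 h p, OF h(1) 1] by auto
    define q where "q t = dd f a (y + s *\<^sub>R a + t *\<^sub>R b)" for t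
    have 2: "(q has_real_derivative dd (dd f a) b (y + s *\<^sub>R a + t *\<^sub>R b)) (at t)"
      if "0 \<le> t" "t \<le> h" for t
      unfolding q_def using near[of s h t] that h s r(2)[of "y + s *\<^sub>R a + t *\<^sub>R b"]
      by (intro has_real_derivative_along Ck_on_has_derivative[OF da]) auto
    obtain t where t: "0 < t" "t < h" "q h - q 0 = h * dd (dd f a) b (y + s *\<^sub>R a + t *\<^sub>R b)"
      using MVT2[of 0 h q, OF h(1) 2] by auto
    have "f (y + h *\<^sub>R a + h *\<^sub>R b) - f (y + h *\<^sub>R a) - f (y + h *\<^sub>R b) + f y
        = h^2 * dd (dd f a) b (y + s *\<^sub>R a + t *\<^sub>R b)"
      using s(3) t(3) by (simp add: p_def q_def power2_eq_square)
    then show "\<bar>(f (y + h *\<^sub>R a + h *\<^sub>R b) - f (y + h *\<^sub>R a) - f (y + h *\<^sub>R b) + f y) / h^2 - dd (dd f a) b y\<bar> < e"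
      using near[of s h t] s t h r(2)[of "y + s *\<^sub>R a + t *\<^sub>R b"] by simp
  qed
qed

text \<open>The mixed difference is symmetric in a and b, so both iterated derivatives are limits of
  one and the same quotient.\<close>

lemma dd_commute:
  fixes f :: "'b::real_normed_vector \<Rightarrow> real"
  assumes "open S" "Cinf_on S f" "y \<in> S"
  shows "dd (dd f a) b y = dd (dd f b) a y"
proof (rule ccontr)
  assume "\<not> ?thesis"
  then have e: "\<bar>dd (dd f a) b y - dd (dd f b) a y\<bar> / 2 > 0" (is "?e > 0") by simp
  obtain d1 where d1: "d1 > 0" "\<forall>h. 0 < h \<longrightarrow> h < d1 \<longrightarrow>
    \<bar>(f (y + h *\<^sub>R a + h *\<^sub>R b) - f (y + h *\<^sub>R a) - f (y + h *\<^sub>R b) + f y) / h^2 - dd (dd f a) b y\<bar> < ?e"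
    using mixed_difference[OF assms(1) Cinf_onD[OF assms(2)] assms(3) e, of a b] by blast
  obtain d2 where d2: "d2 > 0" "\<forall>h. 0 < h \<longrightarrow> h < d2 \<longrightarrow>
    \<bar>(f (y + h *\<^sub>R b + h *\<^sub>R a) - f (y + h *\<^sub>R b) - f (y + h *\<^sub>R a) + f y) / h^2 - dd (dd f b) a y\<bar> < ?e"
    using mixed_difference[OF assms(1) Cinf_onD[OF assms(2)] assms(3) e, of b a] by blast
  define h where "h = min d1 d2 / 2"
  have h: "0 < h" "h < d1" "h < d2" using d1(1) d2(1) by (auto simp: h_def)
  have eq: "f (y + h *\<^sub>R b + h *\<^sub>R a) - f (y + h *\<^sub>R b) - f (y + h *\<^sub>R a) + f y
    = f (y + h *\<^sub>R a + h *\<^sub>R b) - f (y + h *\<^sub>R a) - f (y + h *\<^sub>R b) + f y"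
    by (simp add: add.commute add.left_commute)
  have *: False if "\<bar>q - X\<bar> < \<bar>X - Y\<bar> / 2" "\<bar>q - Y\<bar> < \<bar>X - Y\<bar> / 2" for q X Y :: real
    using that by (auto simp: abs_if split: if_splits)
  show False
    using *[OF d1(2)[rule_format, OF h(1,2)] d2(2)[rule_format, OF h(1,3), unfolded eq]] .
qed

section \<open>The Bochner-type inequality\<close>

text \<open>If f2 were negative, f' would be negative just to the right of 0, and the mean value
  theorem would push f below f 0. Only the derivative of f' at 0 itself is asked for.\<close>

lemma second_derivative_at_min:
  fixes f :: "real \<Rightarrow> real"
  assumes "e > 0" "\<And>t. \<bar>t\<bar> < e \<Longrightarrow> (f has_real_derivative f' t) (at t)"
    and "(f' has_real_derivative f2) (at 0)" "\<And>t. \<bar>t\<bar> < e \<Longrightarrow> f 0 \<le> f t"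
  shows "0 \<le> f2"
proof (rule ccontr)
  assume "\<not> 0 \<le> f2"
  then have "f2 < 0" by simp
  have f'0: "f' 0 = 0"
    by (rule DERIV_local_min[of f "f' 0" 0 e]) (use assms in auto)
  obtain d where d: "d > 0" "\<And>h. 0 < h \<Longrightarrow> h < d \<Longrightarrow> f' h < f' 0"
    using DERIV_neg_dec_right[OF assms(3) \<open>f2 < 0\<close>] by auto
  define t where "t = min d e / 2"
  have t: "0 < t" "t < d" "t < e" using assms(1) d(1) by (auto simp: t_def)
  obtain s where s: "0 < s" "s < t" "f t - f 0 = t * f' s"
    using MVT2[of 0 t f f', OF t(1)] assms(2) t by auto
  have "t * f' s < 0" using d(2)[of s] s t f'0 by (simp add: mult_pos_neg)
  then show False using s(3) assms(4)[of t] t by simp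
qed

lemma has_real_derivative_zero_near:
  fixes f :: "real \<Rightarrow> real"
  assumes "\<And>s. \<bar>s\<bar> < e \<Longrightarrow> f s = c" "(f has_real_derivative f') (at t)" "\<bar>t\<bar> < e"
  shows "f' = 0"
proof -
  have "open {-e<..<e}" "t \<in> {-e<..<e}" using assms(3) by auto
  moreover have "\<And>s. s \<in> {-e<..<e} \<Longrightarrow> f s = c" using assms(1) by (simp add: abs_less_iff)
  ultimately have "((\<lambda>s. c) has_real_derivative f') (at t)"
    using has_field_derivative_transform_within_open[OF assms(2), of "{-e<..<e}" "\<lambda>s. c"] by auto
  then show ?thesis using DERIV_const DERIV_unique by blast
qed

section \<open>Traces of the derivatives of a symplectic matrix\<close>

lemma matrix_mul_minus:
  fixes X Y :: "real^'k^'k"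
  shows "(- X) ** Y = - (X ** Y)" "X ** (- Y) = - (X ** Y)"
  by (simp_all add: matrix_matrix_mult_def vec_eq_iff sum_negf)

lemma matrix_mul_add_left: "(X + Y) ** Z = X ** Z + Y ** (Z :: real^'k^'k)"
  by (simp add: matrix_matrix_mult_def vec_eq_iff sum.distrib algebra_simps)

lemma trace_minus: "trace (- (X :: real^'k^'k)) = - trace X"
  by (simp add: trace_def sum_negf)

text \<open>The assumptions are the first three derivatives of c J c = J at a point where c = 1,
  with A, A2, A3 the derivatives of c. Multiplied by J on the right, the outer terms of
  \<open>2\<close> and \<open>3\<close> have trace -2 tr A2 and -2 tr A3, and J A J = A evaluates
  the middle ones. The cubic trace vanishes because A anticommutes with J.\<close>

lemma trace_identities:
  fixes J A A2 A3 :: "real^'k^'k"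
  assumes J: "J ** J = - mat 1"
    and 1: "A ** J + J ** A = 0"
    and 2: "A2 ** J + A ** J ** A + A ** J ** A + J ** A2 = 0"
    and 3: "A3 ** J + A2 ** J ** A + A2 ** J ** A + A2 ** J ** A + A ** J ** A2 + A ** J ** A2 + A ** J ** A2
      + J ** A3 = 0"
  shows "trace A2 = trace (A ** A)" "trace A3 = 3 * trace (A ** A2)" "trace (A ** A ** A) = 0"
proof -
  have JA: "J ** A = - (A ** J)" using 1 by (simp add: add_eq_0_iff)
  have JAJ: "J ** A ** J = A"
    by (simp add: JA matrix_mul_minus matrix_mul_assoc[symmetric] J)
  have r: "X ** J ** J = - X" for X :: "real^'k^'k"
    by (simp add: matrix_mul_minus matrix_mul_assoc[symmetric] J)
  have c: "trace (J ** X ** J) = - trace X" for X :: "real^'k^'k"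
    using trace_mul_sym[of J "X ** J"] by (simp add: matrix_mul_assoc r trace_minus)
  have "trace ((A2 ** J + A ** J ** A + A ** J ** A + J ** A2) ** J) = 0"
    by (simp only: 2) (simp add: trace_def matrix_matrix_mult_def)
  moreover have "A ** J ** A ** J = A ** A"
    using JAJ by (metis matrix_mul_assoc)
  ultimately show "trace A2 = trace (A ** A)"
    unfolding matrix_mul_add_left trace_add r c trace_minus by simp
  have "trace ((A3 ** J + A2 ** J ** A + A2 ** J ** A + A2 ** J ** A + A ** J ** A2 + A ** J ** A2 + A ** J ** A2
      + J ** A3) ** J) = 0"
    by (simp only: 3) (simp add: trace_def matrix_matrix_mult_def)
  moreover have "A2 ** J ** A ** J = A2 ** A"
    using JAJ by (metis matrix_mul_assoc)
  moreover have "trace (A ** J ** A2 ** J) = trace (A ** A2)"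
  proof -
    have "trace (A ** J ** A2 ** J) = trace (J ** A ** J ** A2)"
      using trace_mul_sym[of "A ** J ** A2" J] by (simp add: matrix_mul_assoc)
    then show ?thesis by (simp add: JAJ)
  qed
  ultimately show "trace A3 = 3 * trace (A ** A2)"
    using trace_mul_sym[of A2 A] unfolding matrix_mul_add_left trace_add r c trace_minus by simp
  have "trace (A ** A ** A) = trace (J ** A ** J ** A ** A)" by (simp add: JAJ)
  also have "\<dots> = trace (A ** J ** A ** A ** J)"
    using trace_mul_sym[of J "A ** J ** A ** A"] by (simp add: matrix_mul_assoc)
  also have "A ** J ** A ** A ** J = A ** (J ** A) ** A ** J" by (simp add: matrix_mul_assoc)
  also have "\<dots> = - (A ** A ** J ** A ** J)" unfolding JA by (simp add: matrix_mul_minus matrix_mul_assoc)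
  also have "A ** A ** J ** A ** J = A ** A ** (J ** A ** J)" by (simp add: matrix_mul_assoc)
  also have "\<dots> = A ** A ** A" by (simp add: JAJ)
  finally show "trace (A ** A ** A) = 0" by (simp add: trace_minus)
qed

lemma matrix_sandwich_deriv:
  fixes a b :: "'k::finite \<Rightarrow> 'k \<Rightarrow> real \<Rightarrow> real"
  assumes "\<And>i j. (a i j has_real_derivative a' i j) (at s)"
    and "\<And>i j. (b i j has_real_derivative b' i j) (at s)"
  shows "((\<lambda>s. \<Sum>k\<in>UNIV. \<Sum>l\<in>UNIV. a i k s * J k l * b l j s) has_real_derivative
     ((\<Sum>k\<in>UNIV. \<Sum>l\<in>UNIV. a' i k * J k l * b l j s) + (\<Sum>k\<in>UNIV. \<Sum>l\<in>UNIV. a i k s * J k l * b' l j))) (at s)"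
proof -
  have "((\<lambda>s. \<Sum>k\<in>UNIV. \<Sum>l\<in>UNIV. a i k s * J k l * b l j s) has_real_derivative
     (\<Sum>k\<in>UNIV. \<Sum>l\<in>UNIV. a' i k * J k l * b l j s + a i k s * J k l * b' l j)) (at s)"
    by (intro DERIV_sum) (auto intro!: derivative_eq_intros assms simp: algebra_simps)
  then show ?thesis by (simp add: sum.distrib)
qed

lemma sandwich_matrix:
  "(\<Sum>k\<in>UNIV. \<Sum>l\<in>UNIV. (a i k :: real) * J k l * b l j) =
    ((\<chi> i j. a i j) ** (\<chi> i j. J i j) ** (\<chi> i j. b i j)) $ i $ j"
  for a b J :: "'k::finite \<Rightarrow> 'k \<Rightarrow> real"
  by (simp add: matrix_matrix_mult_def sum_distrib_right sum_distrib_left)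
     (subst sum.swap, simp)

text \<open>Differentiates c J c = J three times. The entries remain scalar functions of s, so that
  ordinary real derivatives suffice; matrices are formed only at s = 0, where c is the
  identity.\<close>

lemma symplectic_line_identities:
  fixes c c1 c2 :: "'k::finite \<Rightarrow> 'k \<Rightarrow> real \<Rightarrow> real" and c3 J :: "'k \<Rightarrow> 'k \<Rightarrow> real"
  assumes "e > 0"
    and sand: "\<And>i j s. \<bar>s\<bar> < e \<Longrightarrow> (\<Sum>k\<in>UNIV. \<Sum>l\<in>UNIV. c i k s * J k l * c l j s) = J i j"
    and d1: "\<And>i j s. \<bar>s\<bar> < e \<Longrightarrow> (c i j has_real_derivative c1 i j s) (at s)"
    and d2: "\<And>i j s. \<bar>s\<bar> < e \<Longrightarrow> (c1 i j has_real_derivative c2 i j s) (at s)"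
    and d3: "\<And>i j. (c2 i j has_real_derivative c3 i j) (at 0)"
    and c0: "\<And>i j. c i j 0 = (if i = j then 1 else 0)"
    and JJ: "\<And>i j. (\<Sum>k\<in>UNIV. J i k * J k j) = (if i = j then - 1 else 0)"
  defines "A \<equiv> \<chi> i j. c1 i j 0" and "A2 \<equiv> \<chi> i j. c2 i j 0" and "A3 \<equiv> \<chi> i j. c3 i j"
  shows "trace A2 = trace (A ** A)" "trace A3 = 3 * trace (A ** A2)" "trace (A ** A ** A) = 0"
proof -
  define S where "S a b i j s = (\<Sum>k\<in>UNIV. \<Sum>l\<in>UNIV. a i k s * J k l * b l j s)"
    for a b :: "'k \<Rightarrow> 'k \<Rightarrow> real \<Rightarrow> real" and i j s
  have dS: "((\<lambda>s. S a b i j s) has_real_derivative S a' b i j s + S a b' i j s) (at s)"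
    if "\<And>i j. (a i j has_real_derivative a' i j s) (at s)" "\<And>i j. (b i j has_real_derivative b' i j s) (at s)"
    for a b a' b' i j s
    unfolding S_def by (rule matrix_sandwich_deriv[OF that])
  have D11: "(S c c i j has_real_derivative S c1 c i j s + S c c1 i j s) (at s)" if "\<bar>s\<bar> < e" for i j s
    by (rule dS) (rule d1[OF that])+
  have e1: "S c1 c i j s + S c c1 i j s = 0" if "\<bar>s\<bar> < e" for i j s
    by (rule has_real_derivative_zero_near[OF _ D11[OF that] that, where c = "J i j"]) (simp add: S_def sand)
  have D21: "(S c1 c i j has_real_derivative S c2 c i j s + S c1 c1 i j s) (at s)" if "\<bar>s\<bar> < e" for i j s
    by (rule dS) (rule d1[OF that] d2[OF that])+
  have D12: "(S c c1 i j has_real_derivative S c1 c1 i j s + S c c2 i j s) (at s)" if "\<bar>s\<bar> < e" for i j s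
    by (rule dS) (rule d1[OF that] d2[OF that])+
  have e2: "(S c2 c i j s + S c1 c1 i j s) + (S c1 c1 i j s + S c c2 i j s) = 0" if "\<bar>s\<bar> < e" for i j s
    by (rule has_real_derivative_zero_near[OF _ DERIV_add[OF D21[OF that] D12[OF that]] that]) (rule e1)
  \<comment> \<open>\<open>c3\<close> is merely a value at 0; as a constant function of s it fits
    the shape that \<open>dS\<close> expects.\<close>
  define c3' where "c3' i j s = c3 i j" for i j and s :: real
  have z: "\<bar>0 :: real\<bar> < e" using \<open>e > 0\<close> by simp
  have d3': "(c2 i j has_real_derivative c3' i j 0) (at 0)" for i j using d3 by (simp add: c3'_def)
  have D31: "(S c2 c i j has_real_derivative S c3' c i j 0 + S c2 c1 i j 0) (at 0)" for i j
    by (rule dS) (rule d3' d1[OF z] d2[OF z])+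
  have D22: "(S c1 c1 i j has_real_derivative S c2 c1 i j 0 + S c1 c2 i j 0) (at 0)" for i j
    by (rule dS) (rule d3' d1[OF z] d2[OF z])+
  have D13: "(S c c2 i j has_real_derivative S c1 c2 i j 0 + S c c3' i j 0) (at 0)" for i j
    by (rule dS) (rule d3' d1[OF z] d2[OF z])+
  have e3: "((S c3' c i j 0 + S c2 c1 i j 0) + (S c2 c1 i j 0 + S c1 c2 i j 0)) +
     ((S c2 c1 i j 0 + S c1 c2 i j 0) + (S c1 c2 i j 0 + S c c3' i j 0)) = 0" for i j
    by (rule has_real_derivative_zero_near[OF _ DERIV_add[OF DERIV_add[OF D31 D22] DERIV_add[OF D22 D13]] z])
       (rule e2)
  define Jm where "Jm = (\<chi> i j. J i j)"
  have Sm: "S a b i j 0 = ((\<chi> i j. a i j 0) ** Jm ** (\<chi> i j. b i j 0)) $ i $ j" for a b i j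
    unfolding S_def Jm_def using sandwich_matrix[of "\<lambda>i j. a i j 0" i J "\<lambda>i j. b i j 0" j] .
  have one: "(\<chi> i j. c i j 0) = mat 1" by (simp add: mat_def c0 vec_eq_iff)
  have A: "(\<chi> i j. c1 i j 0) = A" "(\<chi> i j. c2 i j 0) = A2" "(\<chi> i j. c3' i j 0) = A3"
    by (simp_all add: A_def A2_def A3_def c3'_def)
  have JJm: "Jm ** Jm = - mat 1"
    using JJ by (simp add: Jm_def matrix_matrix_mult_def mat_def vec_eq_iff)
  have m1: "A ** Jm + Jm ** A = 0"
    using e1[of 0] \<open>e > 0\<close> by (simp add: Sm one A vec_eq_iff)
  have m2: "A2 ** Jm + A ** Jm ** A + A ** Jm ** A + Jm ** A2 = 0"
    using e2[of 0] \<open>e > 0\<close> by (simp add: Sm one A vec_eq_iff algebra_simps)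
  have m3: "A3 ** Jm + A2 ** Jm ** A + A2 ** Jm ** A + A2 ** Jm ** A + A ** Jm ** A2 + A ** Jm ** A2 + A ** Jm ** A2
      + Jm ** A3 = 0"
    using e3 by (simp add: Sm one A vec_eq_iff algebra_simps)
  show "trace A2 = trace (A ** A)" "trace A3 = 3 * trace (A ** A2)" "trace (A ** A ** A) = 0"
    using trace_identities[OF JJm m1 m2 m3] by auto
qed

lemma linear_family_dd:
  fixes L :: "'e::euclidean_space \<Rightarrow> 'd::real_vector \<Rightarrow> 'c::real_normed_vector"
  assumes "open B" "\<And>y. y \<in> B \<Longrightarrow> linear (L y)" "\<And>b. Cinf_on B (\<lambda>y. L y b)" "y \<in> B"
  shows "linear (\<lambda>b. dd (\<lambda>z. L z b) a y)"
proof (rule linearI)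
  note hd = Cinf_on_has_derivative[OF assms(3,4)]
  fix b c :: 'd and r :: real
  have "dd (\<lambda>z. L z (b + c)) a y = dd (\<lambda>z. L z b + L z c) a y"
    by (rule dd_cong[OF assms(1,4)]) (simp add: assms(2) linear_add)
  also have "\<dots> = dd (\<lambda>z. L z b) a y + dd (\<lambda>z. L z c) a y"
    by (rule dd_eqI) (intro has_derivative_add hd)
  finally show "dd (\<lambda>z. L z (b + c)) a y = dd (\<lambda>z. L z b) a y + dd (\<lambda>z. L z c) a y" .
  have "dd (\<lambda>z. L z (r *\<^sub>R b)) a y = dd (\<lambda>z. r *\<^sub>R L z b) a y"
    by (rule dd_cong[OF assms(1,4)]) (simp add: assms(2) linear_cmul)
  also have "\<dots> = r *\<^sub>R dd (\<lambda>z. L z b) a y"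
    by (rule dd_eqI) (intro has_derivative_scaleR_right hd)
  finally show "dd (\<lambda>z. L z (r *\<^sub>R b)) a y = r *\<^sub>R dd (\<lambda>z. L z b) a y" .
qed

text \<open>The local model of a special Kaehler metric in \<open>\<nabla>\<close>-flat coordinates: \<open>tot\<close> combines \<open>d\<^sub>\<nabla> I = 0\<close> with
  the symmetry of \<open>g\<close>, and the Kaehler form \<open>om\<close> is constant.\<close>

locale cubic_model =
  fixes B :: "'e::euclidean_space set" and g :: "'e \<Rightarrow> 'e \<Rightarrow> 'e \<Rightarrow> real"
  assumes open_B: "open B"
    and lin: "\<And>y a. y \<in> B \<Longrightarrow> linear (g y a)"
    and sym: "\<And>y a b. y \<in> B \<Longrightarrow> g y a b = g y b a"
    and pos: "\<And>y a. y \<in> B \<Longrightarrow> a \<noteq> 0 \<Longrightarrow> g y a a > 0"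
    and smooth: "\<And>a b. Cinf_on B (\<lambda>y. g y a b)"
    and tot: "\<And>y a b c. y \<in> B \<Longrightarrow> dd (\<lambda>z. g z b c) a y = dd (\<lambda>z. g z a c) b y"
begin

definition T :: "'e \<Rightarrow> 'e \<Rightarrow> 'e \<Rightarrow> 'e \<Rightarrow> real" where "T y a b c = dd (\<lambda>z. g z b c) a y"

lemma lin_left: "y \<in> B \<Longrightarrow> linear (\<lambda>a. g y a b)"
  using lin[of y b] sym[of y _ b] by presburger

lemma T_perm: assumes "y \<in> B" shows "T y a b c = T y b a c" "T y a b c = T y a c b"
proof -
  show "T y a b c = T y b a c" using tot[OF assms] by (simp add: T_def)
  show "T y a b c = T y a c b" unfolding T_def
    by (rule dd_cong[OF open_B assms]) (simp add: sym)
qed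

lemma T_lin3: "y \<in> B \<Longrightarrow> linear (T y a b)"
  using linear_family_dd[OF open_B lin smooth, of y b a] by (simp add: T_def[abs_def])

lemma T_lin2: "y \<in> B \<Longrightarrow> linear (\<lambda>b. T y a b c)"
  using T_lin3[of y a c] T_perm(2)[of y a _ c] by presburger

lemma T_lin1: "y \<in> B \<Longrightarrow> linear (\<lambda>a. T y a b c)"
  using T_lin2[of y b c] T_perm(1)[of y _ b c] by presburger

lemma T_smooth: "Cinf_on B (\<lambda>y. T y a b c)"
  unfolding T_def by (rule Cinf_on_dd[OF smooth])

lemma T_diag:
  assumes "y \<in> B"
  shows "T y (s *\<^sub>R v + t *\<^sub>R p) (s *\<^sub>R v + t *\<^sub>R p) (s *\<^sub>R v + t *\<^sub>R p) =
    s^3 * T y v v v + 3 * s^2 * t * T y v v p + 3 * s * t^2 * T y v p p + t^3 * T y p p p"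
proof -
  note l = linear_add[OF T_lin1[OF assms]] linear_add[OF T_lin2[OF assms]] linear_add[OF T_lin3[OF assms]]
    linear_cmul[OF T_lin1[OF assms]] linear_cmul[OF T_lin2[OF assms]] linear_cmul[OF T_lin3[OF assms]]
  have p: "T y p v v = T y v v p" "T y v p v = T y v v p" "T y p p v = T y v p p" "T y p v p = T y v p p"
    using T_perm[OF assms] by metis+
  show ?thesis by (simp add: l p algebra_simps power2_eq_square power3_eq_cube)
qed

lemma g_diag:
  assumes "y \<in> B"
  shows "g y (s *\<^sub>R v + t *\<^sub>R p) (s *\<^sub>R v + t *\<^sub>R p) = s^2 * g y v v + 2 * s * t * g y v p + t^2 * g y p p"
proof -
  note l = linear_add[OF lin[OF assms]] linear_add[OF lin_left[OF assms]]
    linear_cmul[OF lin[OF assms]] linear_cmul[OF lin_left[OF assms]]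
  show ?thesis by (simp add: l sym[OF assms, of p v] algebra_simps power2_eq_square)
qed

lemma T_commute: "y \<in> B \<Longrightarrow> dd (\<lambda>z. T z a b c) d y = dd (\<lambda>z. T z d b c) a y"
  unfolding T_def by (rule dd_commute[OF open_B smooth])

lemma dd_T_perm:
  assumes "y \<in> B"
  shows "dd (\<lambda>z. T z a b c) d y = dd (\<lambda>z. T z b a c) d y"
    "dd (\<lambda>z. T z a b c) d y = dd (\<lambda>z. T z a c b) d y"
  by (rule dd_cong[OF open_B assms], use T_perm in blast)+

end

locale flat_model = cubic_model B g for B :: "'e::euclidean_space set" and g +
  fixes om :: "'e \<Rightarrow> 'e \<Rightarrow> real" and J :: "'e \<Rightarrow> 'e \<Rightarrow> 'e"
  assumes om: "\<And>y a b. y \<in> B \<Longrightarrow> g y a b = om a (J y b)"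
    and om_minus: "\<And>a b. om a (- b) = - om a b"
    and J_lin: "\<And>y. y \<in> B \<Longrightarrow> linear (J y)"
    and JJ: "\<And>y b. y \<in> B \<Longrightarrow> J y (J y b) = - b"
begin

text \<open>The curve \<open>s(t) v + t p\<close> with \<open>p = - A v / 2\<close> over the line \<open>y1 + t f\<close> is parallel for the Levi-Civita connection
  to first order, and \<open>\<zeta>\<close> keeps its length constant to second order.\<close>

lemma second_variation:
  assumes y1: "y1 \<in> B" and v: "g y1 v v = 1" and e: "e > 0" "ball y1 e \<subseteq> B"
    and max: "\<And>y w. y \<in> ball y1 e \<Longrightarrow>
      T y w w w \<le> (T y1 v v v + \<kappa> * (y \<bullet> y - y1 \<bullet> y1)) * (g y w w * sqrt (g y w w))"
    and p: "2 * g y1 v p = - T y1 f v v"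
    and \<zeta>: "dd (\<lambda>z. T z f v v) f y1 + 2 * \<zeta> + 4 * T y1 f v p + 2 * g y1 p p = 0"
  shows "dd (dd (\<lambda>z. T z v v v) f) f y1 + 3 * \<zeta> * T y1 v v v + 6 * dd (\<lambda>z. T z v v p) f y1
      + 6 * T y1 v p p \<le> 2 * \<kappa> * (f \<bullet> f)"
proof -
  define d where "d = min 1 (e / (norm f + 1))"
  have "d > 0" using e(1) by (simp add: d_def add_nonneg_pos)
  have inb: "y1 + t *\<^sub>R f \<in> ball y1 e" if "\<bar>t\<bar> < d" for t
  proof -
    have "\<bar>t\<bar> * norm f \<le> \<bar>t\<bar> * (norm f + 1)" by (simp add: mult_left_mono)
    also have "\<dots> < d * (norm f + 1)" using that by (intro mult_strict_right_mono) (auto simp: add_nonneg_pos)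
    also have "\<dots> \<le> e / (norm f + 1) * (norm f + 1)" by (intro mult_right_mono) (auto simp: d_def)
    also have "\<dots> = e" using norm_ge_zero[of f] by (simp add: add_nonneg_eq_0_iff)
    finally show ?thesis by (simp add: dist_norm)
  qed
  have inB: "y1 + t *\<^sub>R f \<in> B" if "\<bar>t\<bar> < d" for t using inb[OF that] e(2) by blast
  define G where "G a b t = g (y1 + t *\<^sub>R f) a b" for a b t
  define G' where "G' a b t = T (y1 + t *\<^sub>R f) f a b" for a b t
  define C where "C a b c t = T (y1 + t *\<^sub>R f) a b c" for a b c t
  define C' where "C' a b c t = dd (\<lambda>z. T z a b c) f (y1 + t *\<^sub>R f)" for a b c t
  have dG: "(G a b has_real_derivative G' a b t) (at t)" if "\<bar>t\<bar> < d" for a b t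
    unfolding G_def[abs_def] G'_def T_def by (rule dd_along[OF smooth inB[OF that]])
  have dC: "(C a b c has_real_derivative C' a b c t) (at t)" if "\<bar>t\<bar> < d" for a b c t
    unfolding C_def[abs_def] C'_def by (rule dd_along[OF T_smooth inB[OF that]])
  have dG': "(G' a b has_real_derivative C' f a b t) (at t)" if "\<bar>t\<bar> < d" for a b t
    unfolding G'_def[abs_def] C'_def by (rule dd_along[OF T_smooth inB[OF that]])
  have dC': "(C' a b c has_real_derivative dd (dd (\<lambda>z. T z a b c) f) f y1) (at 0)" for a b c
    using dd_along[OF Cinf_on_dd[OF T_smooth[of a b c], of f], of y1 0 f] y1 unfolding C'_def[abs_def] by simp
  define s where "s t = 1 + \<zeta> * t^2 / 2" for t :: real
  define N where "N t = (s t)^2 * G v v t + 2 * s t * t * G v p t + t^2 * G p p t" for t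
  define N' where "N' t = 2 * s t * (\<zeta> * t) * G v v t + (s t)^2 * G' v v t
      + 2 * (\<zeta> * t * t + s t) * G v p t + 2 * s t * t * G' v p t + 2 * t * G p p t + t^2 * G' p p t" for t
  define H where "H t = (s t)^3 * C v v v t + 3 * (s t)^2 * t * C v v p t + 3 * s t * t^2 * C v p p t + t^3 * C p p p t" for t
  define H' where "H' t = 3 * (s t)^2 * (\<zeta> * t) * C v v v t + (s t)^3 * C' v v v t
      + 3 * (2 * s t * (\<zeta> * t) * t + (s t)^2) * C v v p t + 3 * (s t)^2 * t * C' v v p t
      + 3 * (\<zeta> * t * t^2 + s t * (2 * t)) * C v p p t + 3 * s t * t^2 * C' v p p t
      + 3 * t^2 * C p p p t + t^3 * C' p p p t" for t
  have ds: "(s has_real_derivative \<zeta> * t) (at t)" for t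
    unfolding s_def[abs_def] by (auto intro!: derivative_eq_intros)
  have dN: "(N has_real_derivative N' t) (at t)" if "\<bar>t\<bar> < d" for t
    unfolding N_def[abs_def] N'_def
    by (auto intro!: derivative_eq_intros ds dG[OF that] simp: algebra_simps power2_eq_square)
  have dH: "(H has_real_derivative H' t) (at t)" if "\<bar>t\<bar> < d" for t
    unfolding H_def[abs_def] H'_def
    by (auto intro!: derivative_eq_intros ds dC[OF that] simp: algebra_simps power2_eq_square power3_eq_cube)
  have z: "\<bar>0 :: real\<bar> < d" using \<open>d > 0\<close> by simp
  have s0: "s 0 = 1" by (simp add: s_def)
  have G0: "G a b 0 = g y1 a b" "G' a b 0 = T y1 f a b" "C a b c 0 = T y1 a b c"
    "C' a b c 0 = dd (\<lambda>z. T z a b c) f y1" for a b c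
    by (simp_all add: G_def G'_def C_def C'_def)
  have N0: "N 0 = 1" by (simp add: N_def s0 G0 v)
  have N'0: "N' 0 = 0" using p by (simp add: N'_def s0 G0)
  have "(N' has_real_derivative (2 * \<zeta> * G v v 0 + C' f v v 0 + 4 * G' v p 0 + 2 * G p p 0)) (at 0)"
    unfolding N'_def[abs_def]
    by (auto intro!: derivative_eq_intros ds dG[OF z] dG'[OF z] simp: s0 algebra_simps power2_eq_square)
  then have dN': "(N' has_real_derivative 0) (at 0)"
    using \<zeta> v by (simp add: G0 algebra_simps)
  define H2 where "H2 = dd (dd (\<lambda>z. T z v v v) f) f y1 + 3 * \<zeta> * T y1 v v v + 6 * dd (\<lambda>z. T z v v p) f y1
      + 6 * T y1 v p p"
  have "(H' has_real_derivative (3 * \<zeta> * C v v v 0 + dd (dd (\<lambda>z. T z v v v) f) f y1 + 6 * C' v v p 0 + 6 * C v p p 0)) (at 0)"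
    unfolding H'_def[abs_def]
    by (auto intro!: derivative_eq_intros ds dC[OF z] dC' simp: s0 algebra_simps power2_eq_square power3_eq_cube)
  then have dH': "(H' has_real_derivative H2) (at 0)"
    by (simp add: G0 H2_def algebra_simps)
  have Npos: "N t > 0" if "\<bar>t\<bar> < d'" and d': "d' \<le> d" "\<And>t. \<bar>t\<bar> < d' \<Longrightarrow> \<bar>N t - N 0\<bar> < 1" for t d'
    using d'(2)[OF that(1)] N0 by linarith
  have "isCont N 0" using dN[OF z] by (rule DERIV_isCont)
  then obtain d1 where d1: "d1 > 0" "\<And>t. \<bar>t\<bar> < d1 \<Longrightarrow> \<bar>N t - N 0\<bar> < 1"
    unfolding continuous_at_eps_delta by (metis diff_zero dist_real_def zero_less_one)
  define d' where "d' = min d d1"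
  have d': "d' > 0" "d' \<le> d" "\<And>t. \<bar>t\<bar> < d' \<Longrightarrow> N t > 0"
    using d1 \<open>d > 0\<close> N0 by (auto simp: d'_def) (smt (verit) d1(2))
  define l where "l = T y1 v v v"
  define q where "q t = 2 * t * (y1 \<bullet> f) + t^2 * (f \<bullet> f)" for t
  define SQ where "SQ t = sqrt (N t)" for t
  define NN where "NN t = N t * sqrt (N t)" for t
  \<comment> \<open>The assumed upper bound minus the value along the curve. Both agree at t = 0, so
    \<open>Th\<close> is minimal there. Since N' vanishes at 0 together with its derivative, the
    factor \<open>NN\<close> contributes only its value 1 to the second derivative.\<close>
  define Th where "Th t = (l + \<kappa> * q t) * NN t - H t" for t
  define Th' where "Th' t = \<kappa> * (2 * (y1 \<bullet> f) + 2 * t * (f \<bullet> f)) * NN t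
      + (l + \<kappa> * q t) * (3/2 * SQ t * N' t) - H' t" for t
  have dq: "(q has_real_derivative 2 * (y1 \<bullet> f) + 2 * t * (f \<bullet> f)) (at t)" for t
    unfolding q_def[abs_def] by (auto intro!: derivative_eq_intros)
  have dsq: "(NN has_real_derivative 3/2 * sqrt (N t) * N' t) (at t)" if "\<bar>t\<bar> < d'" for t
  proof -
    have "N t > 0" "\<bar>t\<bar> < d" using d' that by auto
    then have "((\<lambda>t. N t * sqrt (N t)) has_real_derivative N' t * sqrt (N t) + (inverse (sqrt (N t)) / 2 * N' t) * N t) (at t)"
      by (intro DERIV_mult dN DERIV_chain2[OF DERIV_real_sqrt])
    moreover have k: "inverse (sqrt (N t)) * N t = sqrt (N t)"
      using \<open>N t > 0\<close> by (simp add: real_div_sqrt divide_inverse_commute[symmetric])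
    have "N' t * sqrt (N t) + (inverse (sqrt (N t)) / 2 * N' t) * N t
        = N' t * sqrt (N t) + N' t / 2 * (inverse (sqrt (N t)) * N t)" by (simp add: algebra_simps)
    then have "N' t * sqrt (N t) + (inverse (sqrt (N t)) / 2 * N' t) * N t = 3/2 * sqrt (N t) * N' t"
      unfolding k by (simp add: algebra_simps)
    ultimately show ?thesis unfolding NN_def[abs_def] by (simp only:)
  qed
  have "0 \<le> 2 * \<kappa> * (f \<bullet> f) - H2"
  proof (rule second_derivative_at_min[OF d'(1)])
    show "(Th has_real_derivative Th' t) (at t)" if "\<bar>t\<bar> < d'" for t
      unfolding Th_def[abs_def] Th'_def
      using that d'(2) by (auto intro!: derivative_eq_intros dsq[OF that] dH dq simp: SQ_def)
    have NN0: "NN 0 = 1" "SQ 0 = 1" by (simp_all add: NN_def SQ_def N0)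
    have "(SQ has_real_derivative 0) (at 0)"
      using DERIV_chain2[OF DERIV_real_sqrt dN[OF z]] N0 N'0 unfolding SQ_def[abs_def] by simp
    then show "(Th' has_real_derivative 2 * \<kappa> * (f \<bullet> f) - H2) (at 0)"
      unfolding Th'_def[abs_def]
      using d'(1) by (auto intro!: derivative_eq_intros dsq dH' dq dN' simp: NN0 N'0 q_def)
    show "Th 0 \<le> Th t" if t: "\<bar>t\<bar> < d'" for t
    proof -
      have tB: "y1 + t *\<^sub>R f \<in> B" "y1 + t *\<^sub>R f \<in> ball y1 e" using inB inb t d'(2) by auto
      have "Th 0 = 0" by (simp add: Th_def NN_def q_def N0 H_def s0 G0 l_def)
      moreover have "g (y1 + t *\<^sub>R f) (s t *\<^sub>R v + t *\<^sub>R p) (s t *\<^sub>R v + t *\<^sub>R p) = N t"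
        unfolding g_diag[OF tB(1)] N_def G_def ..
      moreover have "T (y1 + t *\<^sub>R f) (s t *\<^sub>R v + t *\<^sub>R p) (s t *\<^sub>R v + t *\<^sub>R p) (s t *\<^sub>R v + t *\<^sub>R p) = H t"
        unfolding T_diag[OF tB(1)] H_def C_def ..
      moreover have "(y1 + t *\<^sub>R f) \<bullet> (y1 + t *\<^sub>R f) - y1 \<bullet> y1 = q t"
        by (simp add: q_def inner_add_left inner_add_right inner_commute[of f y1] power2_eq_square algebra_simps)
      ultimately show ?thesis
        using max[OF tB(2), of "s t *\<^sub>R v + t *\<^sub>R p"] by (simp add: Th_def NN_def l_def)
    qed
  qed
  then show ?thesis by (simp add: H2_def)
qed

text \<open>The second variation is summed over f = e a. Symmetry of \<open>T\<close> and commuting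
  derivatives move both f-derivatives onto v, so that only derivatives of the Gram matrix along the
  line in direction v are left. These satisfy \<open>symplectic_line_identities\<close>, and
  everything cancels except a multiple of l tr(A^2).\<close>

theorem interior_maximum_bound:
  fixes e :: "'k::finite \<Rightarrow> 'e"
  assumes y1: "y1 \<in> B" and v: "g y1 v v = 1" and r: "r > 0" "ball y1 r \<subseteq> B"
    and pos: "0 < T y1 v v v" and \<kappa>: "0 \<le> \<kappa>"
    and max: "\<And>y w. y \<in> ball y1 r \<Longrightarrow>
      T y w w w \<le> (T y1 v v v + \<kappa> * (y \<bullet> y - y1 \<bullet> y1)) * (g y w w * sqrt (g y w w))"
    and orth: "\<And>i j. g y1 (e i) (e j) = (if i = j then 1 else 0)"
    and span: "\<And>x. x = (\<Sum>i\<in>UNIV. g y1 x (e i) *\<^sub>R e i)"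
  shows "3 / 4 * T y1 v v v ^ 3 \<le> 2 * \<kappa> * (\<Sum>i\<in>UNIV. e i \<bullet> e i)"
proof -
  define l where "l = T y1 v v v"
  define A where "A = (\<chi> i j. T y1 v (e i) (e j))"
  define A2 where "A2 = (\<chi> i j. dd (\<lambda>z. T z v (e i) (e j)) v y1)"
  define A3 where "A3 = (\<chi> i j. dd (dd (\<lambda>z. T z v (e i) (e j)) v) v y1)"
  \<comment> \<open>Up to sign the matrix of the constant form: g y1 a (J y1 b) = om a (J y1 (J y1
    b)) = - om a b.\<close>
  define Jm where "Jm i j = g y1 (e i) (J y1 (e j))" for i j
  define d where "d = r / (norm v + 1)"
  have nz: "norm v + 1 > 0" by (simp add: add_nonneg_pos)
  have "d > 0" using r(1) nz by (simp add: d_def)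
  have inB: "y1 + s *\<^sub>R v \<in> B" if "\<bar>s\<bar> < d" for s
  proof -
    have "\<bar>s\<bar> * norm v \<le> \<bar>s\<bar> * (norm v + 1)" by (simp add: mult_left_mono)
    also have "\<dots> < d * (norm v + 1)" using that nz by (intro mult_strict_right_mono) auto
    also have "\<dots> = r" using nz by (simp add: d_def)
    finally show ?thesis using r(2) by (auto simp: dist_norm)
  qed
  have lin_sum: "(\<Sum>k\<in>UNIV. g y1 x (e k) * L (e k)) = L x" if "linear L" for L :: "'e \<Rightarrow> real" and x
  proof -
    have "L x = L (\<Sum>k\<in>UNIV. g y1 x (e k) *\<^sub>R e k)" using span[of x] by simp
    also have "\<dots> = (\<Sum>k\<in>UNIV. g y1 x (e k) * L (e k))" using that by (simp add: linear_sum linear_cmul)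
    finally show ?thesis by simp
  qed
  have lgJ: "linear (\<lambda>x. g y1 a (J y1 x))" for a
    using linear_compose[OF J_lin[OF y1] lin[OF y1, of a]] by (simp add: o_def)
  \<comment> \<open>Because \<open>om\<close> is the same at y and y1, the metric at y can be
    written through the metric at y1.\<close>
  have rel: "g y a b = - g y1 a (J y1 (J y b))" if "y \<in> B" for y a b
    using om[OF that, of a b] om[OF y1, of a "J y1 (J y b)"] JJ[OF y1, of "J y b"] om_minus by simp
  have gJJ: "g y1 a (- x) = - g y1 a x" for a x
    using linear_neg[OF lin[OF y1]] .
  \<comment> \<open>The Gram matrix of g y in the frame at y1 is symplectic: it is \<open>om\<close>
    composed with J y, and J y squares to -1.\<close>
  have sand: "(\<Sum>k\<in>UNIV. \<Sum>m\<in>UNIV. g y (e i) (e k) * Jm k m * g y (e m) (e j)) = Jm i j" if y: "y \<in> B" for i j y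
  proof -
    have 1: "(\<Sum>m\<in>UNIV. Jm k m * g y (e m) (e j)) = g y1 (J y (e j)) (e k)" for k
    proof -
      have "(\<Sum>m\<in>UNIV. Jm k m * g y (e m) (e j))
          = - (\<Sum>m\<in>UNIV. g y1 (J y1 (J y (e j))) (e m) * g y1 (e k) (J y1 (e m)))"
        by (simp add: Jm_def rel[OF y] sym[OF y1, of "e _" "J y1 (J y (e j))"] sum_negf mult.commute)
      also have "\<dots> = - g y1 (e k) (J y1 (J y1 (J y (e j))))"
        using lin_sum[OF lgJ] by simp
      also have "\<dots> = g y1 (J y (e j)) (e k)"
        by (simp add: JJ[OF y1] gJJ sym[OF y1, of "e k"])
      finally show ?thesis .
    qed
    have "(\<Sum>k\<in>UNIV. \<Sum>m\<in>UNIV. g y (e i) (e k) * Jm k m * g y (e m) (e j))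
        = (\<Sum>k\<in>UNIV. g y1 (J y (e j)) (e k) * g y (e i) (e k))"
      by (simp add: 1[symmetric] sum_distrib_left sum_distrib_right algebra_simps)
    also have "\<dots> = g y (e i) (J y (e j))" using lin_sum[OF lin[OF y]] by simp
    also have "\<dots> = Jm i j" by (simp add: rel[OF y] JJ[OF y] Jm_def linear_neg[OF J_lin[OF y1]] gJJ)
    finally show ?thesis .
  qed
  have JJm: "(\<Sum>k\<in>UNIV. Jm i k * Jm k j) = (if i = j then - 1 else 0)" for i j
  proof -
    have "(\<Sum>k\<in>UNIV. Jm i k * Jm k j) = (\<Sum>k\<in>UNIV. g y1 (J y1 (e j)) (e k) * g y1 (e i) (J y1 (e k)))"
      by (simp add: Jm_def sym[OF y1, of "e _" "J y1 (e j)"] mult.commute)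
    also have "\<dots> = g y1 (e i) (J y1 (J y1 (e j)))" using lin_sum[OF lgJ] by simp
    also have "\<dots> = (if i = j then - 1 else 0)" by (simp add: JJ[OF y1] gJJ orth)
    finally show ?thesis .
  qed
  have tr: "trace A2 = trace (A ** A)" "trace A3 = 3 * trace (A ** A2)" "trace (A ** A ** A) = 0"
  proof -
    define c where "c i j s = g (y1 + s *\<^sub>R v) (e i) (e j)" for i j s
    define c1 where "c1 i j s = T (y1 + s *\<^sub>R v) v (e i) (e j)" for i j s
    define c2 where "c2 i j s = dd (\<lambda>z. T z v (e i) (e j)) v (y1 + s *\<^sub>R v)" for i j s
    define c3 where "c3 i j = dd (dd (\<lambda>z. T z v (e i) (e j)) v) v y1" for i j
    have d1: "(c i j has_real_derivative c1 i j s) (at s)" if "\<bar>s\<bar> < d" for i j s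
      unfolding c_def[abs_def] c1_def T_def by (rule dd_along[OF smooth inB[OF that]])
    have d2: "(c1 i j has_real_derivative c2 i j s) (at s)" if "\<bar>s\<bar> < d" for i j s
      unfolding c1_def[abs_def] c2_def by (rule dd_along[OF T_smooth inB[OF that]])
    have d3: "(c2 i j has_real_derivative c3 i j) (at 0)" for i j
      using dd_along[OF Cinf_on_dd[OF T_smooth[of v "e i" "e j"], of v], of y1 0 v] y1
      unfolding c2_def[abs_def] c3_def by simp
    have c0: "c i j 0 = (if i = j then 1 else 0)" for i j by (simp add: c_def orth)
    have sa: "(\<Sum>k\<in>UNIV. \<Sum>m\<in>UNIV. c i k s * Jm k m * c m j s) = Jm i j" if "\<bar>s\<bar> < d" for i j s
      unfolding c_def by (rule sand[OF inB[OF that]])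
    have AA: "A = (\<chi> i j. c1 i j 0)" "A2 = (\<chi> i j. c2 i j 0)" "A3 = (\<chi> i j. c3 i j)"
      by (simp_all add: A_def A2_def A3_def c1_def c2_def c3_def)
    show "trace A2 = trace (A ** A)" "trace A3 = 3 * trace (A ** A2)" "trace (A ** A ** A) = 0"
      unfolding AA by (rule symplectic_line_identities[OF \<open>d > 0\<close> sa d1 d2 d3 c0 JJm]; assumption)+
  qed
  have Asym: "A $ i $ j = A $ j $ i" for i j
    using T_perm[OF y1] by (simp add: A_def)
  \<comment> \<open>When the derivative of a metric is totally symmetric, its Levi-Civita
    Christoffel symbol is half of that derivative; p is minus this symbol at (e a, v).\<close>
  define p where "p a = (\<Sum>b\<in>UNIV. (- (A $ a $ b) / 2) *\<^sub>R e b)" for a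
  \<comment> \<open>Solved from the second order length condition, which on the diagonal reads A2 +
    2 \<zeta> - 2 A^2 + A^2 / 2 = 0.\<close>
  define \<zeta> where "\<zeta> a = 3 / 4 * (A ** A) $ a $ a - A2 $ a $ a / 2" for a
  have Lp: "L (p a) = - (\<Sum>b\<in>UNIV. A $ a $ b * L (e b)) / 2" if "linear L" for L :: "'e \<Rightarrow> real" and a
    using that by (simp add: p_def linear_sum linear_cmul linear_neg sum_negf sum_divide_distrib)
  have AA: "(A ** A) $ a $ a = (\<Sum>b\<in>UNIV. A $ a $ b * A $ a $ b)" for a
    by (simp add: matrix_matrix_mult_def Asym[of a])
  have gpp: "g y1 (p a) (p a) = (A ** A) $ a $ a / 4" for a
  proof -
    have "g y1 (e b) (p a) = - A $ a $ b / 2" for b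
      using Lp[OF lin[OF y1], of "e b" a] by (simp add: orth if_distrib cong: if_cong)
    then show ?thesis
      using Lp[OF lin_left[OF y1, of "p a"], of a] by (simp add: AA sum_negf sum_divide_distrib)
  qed
  have Tvb: "T y1 v (e b) (p a) = - (A ** A) $ a $ b / 2" for a b
    using Lp[OF T_lin3[OF y1], of v "e b" a] by (simp add: A_def[symmetric] matrix_matrix_mult_def)
       (simp add: A_def T_perm(2)[OF y1, of v "e b"])
  have ineq: "A3 $ a $ a + 3 * \<zeta> a * l - 3 * (A ** A2) $ a $ a + 3 / 2 * (A ** A ** A) $ a $ a \<le> 2 * \<kappa> * (e a \<bullet> e a)" for a
  proof -
    have L1: "linear (\<lambda>x. dd (\<lambda>z. T z v (e a) x) v y1)"
      by (rule linear_family_dd[OF open_B T_lin3 T_smooth y1])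
    have s1: "dd (\<lambda>z. T z (e a) v v) (e a) y1 = A2 $ a $ a"
    proof -
      have "dd (\<lambda>z. T z (e a) v v) (e a) y1 = dd (\<lambda>z. T z v (e a) v) (e a) y1" by (rule dd_T_perm(1)[OF y1])
      also have "\<dots> = dd (\<lambda>z. T z (e a) (e a) v) v y1" by (rule T_commute[OF y1])
      also have "\<dots> = dd (\<lambda>z. T z (e a) v (e a)) v y1" by (rule dd_T_perm(2)[OF y1])
      also have "\<dots> = dd (\<lambda>z. T z v (e a) (e a)) v y1" by (rule dd_T_perm(1)[OF y1])
      finally show ?thesis by (simp add: A2_def)
    qed
    have s2: "dd (\<lambda>z. T z v v (p a)) (e a) y1 = - (A ** A2) $ a $ a / 2"
    proof -
      have "dd (\<lambda>z. T z v v (p a)) (e a) y1 = dd (\<lambda>z. T z (e a) v (p a)) v y1" by (rule T_commute[OF y1])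
      also have "\<dots> = dd (\<lambda>z. T z v (e a) (p a)) v y1" by (rule dd_T_perm(1)[OF y1])
      also have "\<dots> = - (\<Sum>b\<in>UNIV. A $ a $ b * dd (\<lambda>z. T z v (e a) (e b)) v y1) / 2" by (rule Lp[OF L1])
      also have "\<dots> = - (\<Sum>b\<in>UNIV. A $ a $ b * A2 $ b $ a) / 2"
        by (simp add: A2_def dd_T_perm(2)[OF y1, of v "e a"])
      finally show ?thesis by (simp add: matrix_matrix_mult_def)
    qed
    have s3: "dd (dd (\<lambda>z. T z v v v) (e a)) (e a) y1 = A3 $ a $ a"
    proof -
      have 1: "dd (\<lambda>z. T z v v v) (e a) z = dd (\<lambda>z. T z v v (e a)) v z" if "z \<in> B" for z
        using T_commute[OF that, of v v v "e a"] dd_T_perm[OF that] by metis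
      have 2: "dd (\<lambda>z. T z v v (e a)) (e a) z = dd (\<lambda>z. T z v (e a) (e a)) v z" if "z \<in> B" for z
        using T_commute[OF that, of v v "e a" "e a"] dd_T_perm[OF that] by metis
      have "dd (dd (\<lambda>z. T z v v v) (e a)) (e a) y1 = dd (dd (\<lambda>z. T z v v (e a)) v) (e a) y1"
        by (rule dd_cong[OF open_B y1 1])
      also have "\<dots> = dd (dd (\<lambda>z. T z v v (e a)) (e a)) v y1" by (rule dd_commute[OF open_B T_smooth y1])
      also have "\<dots> = dd (dd (\<lambda>z. T z v (e a) (e a)) v) v y1" by (rule dd_cong[OF open_B y1 2])
      finally show ?thesis by (simp add: A3_def)
    qed
    have s4: "T y1 v (p a) (p a) = (A ** A ** A) $ a $ a / 4"
    proof -
      have "T y1 v (p a) (p a) = - (\<Sum>b\<in>UNIV. A $ a $ b * T y1 v (e b) (p a)) / 2"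
        by (rule Lp[OF T_lin2[OF y1]])
      also have "\<dots> = (\<Sum>b\<in>UNIV. (A ** A) $ a $ b * A $ b $ a) / 4"
        by (simp add: Tvb sum_negf sum_divide_distrib Asym[of _ a] mult.commute)
      finally show ?thesis by (simp add: matrix_matrix_mult_def[of "A ** A"])
    qed
    have s5: "T y1 (e a) v (p a) = - (A ** A) $ a $ a / 2"
      using Tvb[of a a] T_perm(1)[OF y1] by simp
    have s6: "2 * g y1 v (p a) = - T y1 (e a) v v"
    proof -
      have "2 * g y1 v (p a) = - (\<Sum>b\<in>UNIV. g y1 v (e b) * T y1 v (e a) (e b))"
        using Lp[OF lin[OF y1], of v a] by (simp add: A_def mult.commute)
      also have "\<dots> = - T y1 v (e a) v" using lin_sum[OF T_lin3[OF y1]] by simp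
      finally show ?thesis using T_perm(1)[OF y1] by simp
    qed
    show ?thesis
      using second_variation[OF y1 v r max s6, of "\<zeta> a"] s1 s2 s3 s4 s5 gpp[of a]
      by (simp add: l_def \<zeta>_def)
  qed
  have "(\<Sum>a\<in>UNIV. A3 $ a $ a + 3 * \<zeta> a * l - 3 * (A ** A2) $ a $ a + 3 / 2 * (A ** A ** A) $ a $ a)
      = trace A3 + 3 * l * (3 / 4 * trace (A ** A) - trace A2 / 2) - 3 * trace (A ** A2) + 3 / 2 * trace (A ** A ** A)"
    by (simp add: trace_def \<zeta>_def sum.distrib sum_subtractf sum_distrib_left sum_divide_distrib algebra_simps)
  \<comment> \<open>tr A3 cancels 3 tr(A A2), tr A^3 is 0, and tr A2 = tr A^2 leaves 3 l (3/4 - 1/2)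
    tr A^2.\<close>
  also have "\<dots> = 3 / 4 * l * trace (A ** A)" using tr by (simp add: algebra_simps)
  finally have sum: "3 / 4 * l * trace (A ** A) \<le> 2 * \<kappa> * (\<Sum>i\<in>UNIV. e i \<bullet> e i)"
  proof -
    assume *: "(\<Sum>a\<in>UNIV. A3 $ a $ a + 3 * \<zeta> a * l - 3 * (A ** A2) $ a $ a + 3 / 2 * (A ** A ** A) $ a $ a)
      = 3 / 4 * l * trace (A ** A)"
    have "(\<Sum>a\<in>UNIV. A3 $ a $ a + 3 * \<zeta> a * l - 3 * (A ** A2) $ a $ a + 3 / 2 * (A ** A ** A) $ a $ a)
      \<le> (\<Sum>a\<in>UNIV. 2 * \<kappa> * (e a \<bullet> e a))" by (rule sum_mono) (rule ineq)
    then show ?thesis unfolding * sum_distrib_left .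
  qed
  define V where "V a = g y1 v (e a)" for a
  have V1: "(\<Sum>a\<in>UNIV. V a * V a) = 1" using lin_sum[OF lin[OF y1], of v v] v by (simp add: V_def)
  have VA: "(\<Sum>a\<in>UNIV. \<Sum>b\<in>UNIV. V a * V b * A $ a $ b) = l"
  proof -
    have "(\<Sum>a\<in>UNIV. \<Sum>b\<in>UNIV. V a * V b * A $ a $ b) = (\<Sum>a\<in>UNIV. V a * T y1 v (e a) v)"
      using lin_sum[OF T_lin3[OF y1], of v v] by (simp add: V_def A_def sum_distrib_left[symmetric] mult.assoc)
    also have "\<dots> = l" using lin_sum[OF T_lin2[OF y1], of v v] by (simp add: V_def l_def)
    finally show ?thesis .
  qed
  \<comment> \<open>The squared Frobenius distance from A to l V V^T is non-negative; as |V| = 1 and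
    the quadratic form of A at V is l, this says tr A^2 >= l^2.\<close>
  have sq: "(A $ a $ b - l * (V a * V b))^2 = A $ a $ b * A $ a $ b - 2 * l * (V a * V b * A $ a $ b)
      + l^2 * ((V a * V a) * (V b * V b))" for a b
    by (simp add: power2_eq_square algebra_simps)
  have "0 \<le> (\<Sum>a\<in>UNIV. \<Sum>b\<in>UNIV. (A $ a $ b - l * (V a * V b))^2)" by (intro sum_nonneg) simp
  also have "\<dots> = (\<Sum>a\<in>UNIV. \<Sum>b\<in>UNIV. A $ a $ b * A $ a $ b) - 2 * l * (\<Sum>a\<in>UNIV. \<Sum>b\<in>UNIV. V a * V b * A $ a $ b)
      + l^2 * ((\<Sum>a\<in>UNIV. V a * V a) * (\<Sum>b\<in>UNIV. V b * V b))"
    by (simp only: sq sum.distrib sum_subtractf sum_distrib_left[symmetric] sum_product)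
  also have "\<dots> = trace (A ** A) - l^2"
    by (simp add: VA V1 trace_def AA power2_eq_square)
  finally have "l^2 \<le> trace (A ** A)" by simp
  then have "3 / 4 * l * l^2 \<le> 3 / 4 * l * trace (A ** A)"
    using pos by (intro mult_left_mono) (auto simp: l_def)
  then show ?thesis using sum by (simp add: l_def power3_eq_cube power2_eq_square)
qed

end

section \<open>Flat linear total differential equations\<close>

lemma bilinear_basis_bound:
  fixes b :: "'e::euclidean_space \<Rightarrow> 'f::euclidean_space \<Rightarrow> 'c::real_normed_vector"
  assumes "\<And>m. linear (\<lambda>a. b a m)" "\<And>a. linear (b a)" "\<And>i j. i \<in> Basis \<Longrightarrow> j \<in> Basis \<Longrightarrow> norm (b i j) \<le> K i j"
  shows "norm (b a m) \<le> (\<Sum>i\<in>Basis. \<Sum>j\<in>Basis. K i j) * norm a * norm m"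
proof -
  have "b a m = (\<Sum>i\<in>Basis. \<Sum>j\<in>Basis. (a \<bullet> i) *\<^sub>R (m \<bullet> j) *\<^sub>R b i j)"
    by (subst linear_expand[OF assms(1)], subst linear_expand[OF assms(2)]) (simp add: scaleR_sum_right)
  also have "norm \<dots> \<le> (\<Sum>i\<in>Basis. \<Sum>j\<in>Basis. K i j * norm a * norm m)"
  proof (intro sum_norm_le)
    fix i :: 'e and j :: 'f assume ij: "i \<in> Basis" "j \<in> Basis"
    have "norm ((a \<bullet> i) *\<^sub>R (m \<bullet> j) *\<^sub>R b i j) = \<bar>a \<bullet> i\<bar> * (\<bar>m \<bullet> j\<bar> * norm (b i j))" by (simp add: abs_mult)
    also have "\<dots> \<le> norm a * (norm m * K i j)"
      using ij assms(3)[OF ij] Basis_le_norm[of i a] Basis_le_norm[of j m]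
      by (intro mult_mono mult_nonneg_nonneg) auto
    finally show "norm ((a \<bullet> i) *\<^sub>R (m \<bullet> j) *\<^sub>R b i j) \<le> K i j * norm a * norm m" by (simp add: mult_ac)
  qed
  finally show ?thesis by (simp add: sum_distrib_right)
qed

lemma C1_lipschitz:
  fixes f :: "'e::euclidean_space \<Rightarrow> 'c::real_normed_vector"
  assumes "Cinf_on S f" "compact K" "convex K" "K \<subseteq> S"
  shows "\<exists>C\<ge>0. \<forall>x\<in>K. \<forall>y\<in>K. norm (f y - f x) \<le> C * norm (y - x)"
proof -
  have "\<exists>c. \<forall>x\<in>K. norm (dd f b x) \<le> c" for b
  proof -
    have "continuous_on K (dd f b)"
      using Cinf_on_continuous[OF Cinf_on_dd[OF assms(1)]] assms(4) continuous_on_subset by blast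
    then have "bounded (dd f b ` K)" using assms(2) compact_continuous_image compact_imp_bounded by blast
    then show ?thesis by (auto simp: bounded_iff)
  qed
  then obtain c where c: "\<And>b x. x \<in> K \<Longrightarrow> norm (dd f b x) \<le> c b" by metis
  define C where "C = (\<Sum>b\<in>Basis. \<bar>c b\<bar>)"
  have on: "onorm (\<lambda>v. dd f v x) \<le> C" if "x \<in> K" for x
  proof (rule onorm_le)
    fix v
    have "linear (\<lambda>v. dd f v x)"
      using that assms by (intro dd_linear Cinf_on_differentiable[OF assms(1)]) auto
    then have eq: "dd f v x = (\<Sum>b\<in>Basis. (v \<bullet> b) *\<^sub>R dd f b x)" by (rule linear_expand)
    have "norm (dd f v x) \<le> (\<Sum>b\<in>Basis. norm ((v \<bullet> b) *\<^sub>R dd f b x))"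
      by (subst eq) (rule norm_sum)
    also have "\<dots> \<le> (\<Sum>b\<in>Basis. \<bar>c b\<bar> * norm v)"
    proof (intro sum_mono)
      fix b :: 'e assume "b \<in> Basis"
      then show "norm ((v \<bullet> b) *\<^sub>R dd f b x) \<le> \<bar>c b\<bar> * norm v"
        using c[OF that, of b] Basis_le_norm[of b v] by (simp add: mult.commute[of "\<bar>c b\<bar>"] mult_mono)
    qed
    finally show "norm (dd f v x) \<le> C * norm v" by (simp add: C_def sum_distrib_right)
  qed
  have "norm (f y - f x) \<le> C * norm (y - x)" if "x \<in> K" "y \<in> K" for x y
    by (rule differentiable_bound[OF assms(3) _ on])
       (use that assms in \<open>auto intro: has_derivative_at_withinI Cinf_on_has_derivative[OF assms(1)]\<close>)
  moreover have "C \<ge> 0" by (simp add: C_def sum_nonneg)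
  ultimately show ?thesis by blast
qed

lemma C2_taylor:
  fixes f :: "'e::euclidean_space \<Rightarrow> 'c::real_normed_vector"
  assumes "Cinf_on S f" "compact K" "convex K" "K \<subseteq> S"
  shows "\<exists>C\<ge>0. \<forall>x\<in>K. \<forall>y\<in>K. norm (f y - f x - dd f (y - x) x) \<le> C * (norm (y - x))^2"
proof -
  have "\<exists>C\<ge>0. \<forall>x\<in>K. \<forall>y\<in>K. norm (dd f b y - dd f b x) \<le> C * norm (y - x)" for b
    by (rule C1_lipschitz[OF Cinf_on_dd[OF assms(1)] assms(2-)])
  then obtain c where c: "\<And>b. c b \<ge> 0" "\<And>b x y. x \<in> K \<Longrightarrow> y \<in> K \<Longrightarrow> norm (dd f b y - dd f b x) \<le> c b * norm (y - x)"
    by metis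
  define C where "C = (\<Sum>b\<in>Basis. c b)"
  have lin: "linear (\<lambda>v. dd f v x)" if "x \<in> K" for x
    using that assms by (intro dd_linear Cinf_on_differentiable[OF assms(1)]) auto
  have dv: "norm (dd f v y - dd f v x) \<le> C * norm (y - x) * norm v" if "x \<in> K" "y \<in> K" for x y v
  proof -
    have eq: "dd f v z = (\<Sum>b\<in>Basis. (v \<bullet> b) *\<^sub>R dd f b z)" if "z \<in> K" for z
      by (rule linear_expand[OF lin[OF that]])
    have "dd f v y - dd f v x = (\<Sum>b\<in>Basis. (v \<bullet> b) *\<^sub>R (dd f b y - dd f b x))"
      unfolding eq[OF that(1)] eq[OF that(2)] by (simp add: sum_subtractf algebra_simps)
    also have "norm \<dots> \<le> (\<Sum>b\<in>Basis. c b * norm (y - x) * norm v)"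
    proof (intro sum_norm_le)
      fix b :: 'e assume "b \<in> Basis"
      then show "norm ((v \<bullet> b) *\<^sub>R (dd f b y - dd f b x)) \<le> c b * norm (y - x) * norm v"
        using c(2)[OF that, of b] Basis_le_norm[of b v] c(1)[of b]
        by (simp add: mult.commute[of _ "norm v"] mult_mono)
    qed
    finally show ?thesis by (simp add: C_def sum_distrib_right)
  qed
  have "norm (f y - f x - dd f (y - x) x) \<le> C * (norm (y - x))^2" if xy: "x \<in> K" "y \<in> K" for x y
  proof -
    have seg: "closed_segment x y \<subseteq> K" using assms(3) xy by (simp add: closed_segment_subset)
    have "norm ((f y - dd f y x) - (f x - dd f x x)) \<le> (C * norm (y - x)) * norm (y - x)"
    proof (rule differentiable_bound[of "closed_segment x y" "\<lambda>z. f z - dd f z x" "\<lambda>z v. dd f v z - dd f v x"])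
      have hd: "((\<lambda>v. dd f v x) has_derivative (\<lambda>v. dd f v x)) F" for F
        using has_derivative_bounded_linear[OF Cinf_on_has_derivative[OF assms(1)], of x] xy assms(4)
          bounded_linear_imp_has_derivative by blast
      show "((\<lambda>z. f z - dd f z x) has_derivative (\<lambda>v. dd f v z - dd f v x)) (at z within closed_segment x y)"
        if "z \<in> closed_segment x y" for z
        using that seg assms(4)
        by (intro has_derivative_diff hd has_derivative_at_withinI[OF Cinf_on_has_derivative[OF assms(1)]]) auto
      show "onorm (\<lambda>v. dd f v z - dd f v x) \<le> C * norm (y - x)" if z: "z \<in> closed_segment x y" for z
      proof (rule onorm_le)
        fix v :: 'e
        have "norm (z - x) \<le> norm (y - x)"
          using segment_bound1[OF z] by (simp add: norm_minus_commute)
        then have "C * norm (z - x) * norm v \<le> C * norm (y - x) * norm v"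
          using c(1) by (intro mult_mono) (auto simp: C_def sum_nonneg)
        then show "norm (dd f v z - dd f v x) \<le> C * norm (y - x) * norm v"
          using dv[of x z v] z seg xy by auto
      qed
    qed auto
    moreover have "f y - f x - dd f (y - x) x = (f y - dd f y x) - (f x - dd f x x)"
      using linear_diff[OF lin[OF xy(1)], of y x] by simp
    ultimately show ?thesis by (simp only: power2_eq_square mult.assoc)
  qed
  moreover have "C \<ge> 0" by (simp add: C_def sum_nonneg c)
  ultimately show ?thesis by blast
qed

text \<open>At a maximum point s of |u| the mean value inequality gives |u s| <= |u s| / 2 + C. The
  factor 1/2 replaces the exponential of a Gronwall estimate.\<close>

lemma linear_ode_bound:
  fixes u :: "real \<Rightarrow> 'f::real_normed_vector"
  assumes "\<And>t. t \<in> {0..1} \<Longrightarrow> (u has_vector_derivative L t + c t) (at t within {0..1})" "u 0 = 0"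
    and "\<And>t. t \<in> {0..1} \<Longrightarrow> norm (L t) \<le> norm (u t) / 2" "\<And>t. t \<in> {0..1} \<Longrightarrow> norm (c t) \<le> C"
    and "t \<in> {0..1}"
  shows "norm (u t) \<le> 2 * C"
proof -
  have "continuous_on {0..1} u"
    using assms(1) by (meson continuous_on_eq_continuous_within has_vector_derivative_continuous)
  then obtain s where s: "s \<in> {0..1}" "\<And>t. t \<in> {0..1} \<Longrightarrow> norm (u t) \<le> norm (u s)"
    using continuous_attains_sup[of "{0..1::real}" "\<lambda>t. norm (u t)", OF _ _ continuous_on_norm] by auto
  have "C \<ge> 0" using assms(4,5) norm_ge_zero order_trans by blast
  have "norm (u s - u 0) \<le> (norm (u s) / 2 + C) * norm (s - 0)"
  proof (rule differentiable_bound[of "{0..1}" u "\<lambda>t h. h *\<^sub>R (L t + c t)"])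
    show "(u has_derivative (\<lambda>h. h *\<^sub>R (L t + c t))) (at t within {0..1})" if "t \<in> {0..1}" for t
      using assms(1)[OF that] by (simp add: has_vector_derivative_def)
    show "onorm (\<lambda>h. h *\<^sub>R (L t + c t)) \<le> norm (u s) / 2 + C" if "t \<in> {0..1}" for t
    proof (rule onorm_le)
      fix h :: real
      have "norm (L t + c t) \<le> norm (u s) / 2 + C"
        using norm_triangle_ineq[of "L t" "c t"] assms(3,4)[OF that] s(2)[OF that] by simp
      then show "norm (h *\<^sub>R (L t + c t)) \<le> (norm (u s) / 2 + C) * norm h"
        by (simp add: mult.commute mult_left_mono)
    qed
  qed (use s in auto)
  moreover have "(norm (u s) / 2 + C) * norm (s - 0) \<le> norm (u s) / 2 + C"
    using s \<open>C \<ge> 0\<close> by (simp add: mult_left_le)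
  ultimately show ?thesis using s(2)[OF assms(5)] assms(2) by simp
qed

text \<open>The system is dm(a) = A x a (m x). \<open>flat\<close> is its Frobenius condition: the
  two mixed second derivatives that a solution would have agree.\<close>

locale flat_linear_system =
  fixes S :: "'e::euclidean_space set" and A :: "'e \<Rightarrow> 'e \<Rightarrow> 'f::euclidean_space \<Rightarrow> 'f"
  assumes open_S: "open S" and zero_S: "0 \<in> S"
    and lin1: "\<And>x m. x \<in> S \<Longrightarrow> linear (\<lambda>a. A x a m)"
    and lin2: "\<And>x a. x \<in> S \<Longrightarrow> linear (A x a)"
    and smooth: "\<And>a m. Cinf_on S (\<lambda>x. A x a m)"
    and flat: "\<And>x a b m. x \<in> S \<Longrightarrow>
      dd (\<lambda>z. A z a m) b x + A x a (A x b m) = dd (\<lambda>z. A z b m) a x + A x b (A x a m)"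
begin

lemma A_expand: "x \<in> S \<Longrightarrow> A x a m = (\<Sum>i\<in>Basis. \<Sum>j\<in>Basis. (a \<bullet> i) *\<^sub>R (m \<bullet> j) *\<^sub>R A x i j)"
  by (subst linear_expand[OF lin1], simp, subst linear_expand[OF lin2], simp) (simp add: scaleR_sum_right)

lemma A_continuous:
  assumes "continuous_on U f" "continuous_on U g" "continuous_on U h" "f ` U \<subseteq> S"
  shows "continuous_on U (\<lambda>u. A (f u) (g u) (h u))"
proof -
  have "continuous_on U (\<lambda>u. A (f u) i j)" for i j
    using continuous_on_compose2[OF Cinf_on_continuous[OF smooth] assms(1,4)] .
  then have "continuous_on U (\<lambda>u. \<Sum>i\<in>Basis. \<Sum>j\<in>Basis. (g u \<bullet> i) *\<^sub>R (h u \<bullet> j) *\<^sub>R A (f u) i j)"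
    by (intro continuous_intros assms)
  then show ?thesis
    by (rule continuous_on_eq) (rule A_expand[symmetric], use assms(4) in auto)
qed

lemma A_bounds:
  assumes "compact K" "convex K" "K \<subseteq> S"
  obtains M L Q where "M \<ge> 0" "L \<ge> 0" "Q \<ge> 0"
    "\<And>x a m. x \<in> K \<Longrightarrow> norm (A x a m) \<le> M * norm a * norm m"
    "\<And>x y a m. x \<in> K \<Longrightarrow> y \<in> K \<Longrightarrow> norm (A y a m - A x a m) \<le> L * norm (y - x) * norm a * norm m"
    "\<And>x y a m. x \<in> K \<Longrightarrow> y \<in> K \<Longrightarrow>
      norm (A y a m - A x a m - dd (\<lambda>z. A z a m) (y - x) x) \<le> Q * (norm (y - x))^2 * norm a * norm m"
proof -
  have "\<exists>c\<ge>0. \<forall>x\<in>K. norm (A x i j) \<le> c" for i j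
  proof -
    have "continuous_on K (\<lambda>x. A x i j)"
      using Cinf_on_continuous[OF smooth] assms(3) continuous_on_subset by blast
    then have "bounded ((\<lambda>x. A x i j) ` K)" using assms(1) compact_continuous_image compact_imp_bounded by blast
    then obtain c where "\<forall>x\<in>K. norm (A x i j) \<le> c" by (auto simp: bounded_iff)
    then show ?thesis by (intro exI[of _ "\<bar>c\<bar>"]) force
  qed
  then obtain m1 where m1: "\<And>i j. m1 i j \<ge> 0" "\<And>i j x. x \<in> K \<Longrightarrow> norm (A x i j) \<le> m1 i j" by metis
  define l1 where "l1 i j = (SOME C. C \<ge> 0 \<and> (\<forall>x\<in>K. \<forall>y\<in>K. norm (A y i j - A x i j) \<le> C * norm (y - x)))" for i j
  have l1: "l1 i j \<ge> 0" "x \<in> K \<Longrightarrow> y \<in> K \<Longrightarrow> norm (A y i j - A x i j) \<le> l1 i j * norm (y - x)" for i j x y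
  proof -
    have *: "l1 i j \<ge> 0 \<and> (\<forall>x\<in>K. \<forall>y\<in>K. norm (A y i j - A x i j) \<le> l1 i j * norm (y - x))"
      unfolding l1_def by (rule someI_ex) (rule C1_lipschitz[OF smooth[of i j] assms])
    show "l1 i j \<ge> 0" using * by (rule conjunct1)
    show "x \<in> K \<Longrightarrow> y \<in> K \<Longrightarrow> norm (A y i j - A x i j) \<le> l1 i j * norm (y - x)" using * by blast
  qed
  define q1 where "q1 i j = (SOME C. C \<ge> 0 \<and> (\<forall>x\<in>K. \<forall>y\<in>K.
    norm (A y i j - A x i j - dd (\<lambda>z. A z i j) (y - x) x) \<le> C * (norm (y - x))^2))" for i j
  have q1: "q1 i j \<ge> 0" "x \<in> K \<Longrightarrow> y \<in> K \<Longrightarrow>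
    norm (A y i j - A x i j - dd (\<lambda>z. A z i j) (y - x) x) \<le> q1 i j * (norm (y - x))^2" for i j x y
  proof -
    have *: "q1 i j \<ge> 0 \<and> (\<forall>x\<in>K. \<forall>y\<in>K.
      norm (A y i j - A x i j - dd (\<lambda>z. A z i j) (y - x) x) \<le> q1 i j * (norm (y - x))^2)"
      unfolding q1_def by (rule someI_ex) (rule C2_taylor[OF smooth[of i j] assms])
    show "q1 i j \<ge> 0" using * by (rule conjunct1)
    show "x \<in> K \<Longrightarrow> y \<in> K \<Longrightarrow>
      norm (A y i j - A x i j - dd (\<lambda>z. A z i j) (y - x) x) \<le> q1 i j * (norm (y - x))^2" using * by blast
  qed
  define M where "M = (\<Sum>i\<in>Basis. \<Sum>j\<in>Basis. m1 i j)"
  define L where "L = (\<Sum>i\<in>Basis. \<Sum>j\<in>Basis. l1 i j)"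
  define Q where "Q = (\<Sum>i\<in>Basis. \<Sum>j\<in>Basis. q1 i j)"
  show thesis
  proof (rule that[of M L Q])
    show "M \<ge> 0" "L \<ge> 0" "Q \<ge> 0" by (simp_all add: M_def L_def Q_def sum_nonneg m1 l1 q1)
    show "norm (A x a m) \<le> M * norm a * norm m" if "x \<in> K" for x a m
      unfolding M_def using that assms(3) by (intro bilinear_basis_bound m1 lin1 lin2) auto
    fix x y a m assume xy: "x \<in> K" "y \<in> K"
    then have xyS: "x \<in> S" "y \<in> S" using assms(3) by auto
    show "norm (A y a m - A x a m) \<le> L * norm (y - x) * norm a * norm m"
      unfolding L_def sum_distrib_right
      by (rule bilinear_basis_bound[unfolded sum_distrib_right, where b = "\<lambda>a m. A y a m - A x a m"])
         (use xy in \<open>auto intro!: linear_compose_sub lin1[OF xyS(1)] lin1[OF xyS(2)] lin2[OF xyS(1)] lin2[OF xyS(2)] l1\<close>)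
    show "norm (A y a m - A x a m - dd (\<lambda>z. A z a m) (y - x) x) \<le> Q * (norm (y - x))^2 * norm a * norm m"
      unfolding Q_def sum_distrib_right
      by (rule bilinear_basis_bound[unfolded sum_distrib_right, where b = "\<lambda>a m. A y a m - A x a m - dd (\<lambda>z. A z a m) (y - x) x"])
         (use xy in \<open>auto intro!: linear_compose_sub lin1[OF xyS(1)] lin1[OF xyS(2)] lin2[OF xyS(1)] lin2[OF xyS(2)] q1
           linear_family_dd[OF open_S _ _ xyS(1)] lin1 lin2 smooth\<close>)
  qed
qed

text \<open>Integration along rays from 0 solves the equation in radial directions, as a fixed point
  of m = m0 + I m given by a Neumann series. That this m also has the prescribed derivative in all
  other directions is the estimate \<open>est\<close>, obtained by comparing the rays to two
  neighbouring points.\<close>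

theorem solvable:
  "\<exists>r>0. ball 0 r \<subseteq> S \<and> (\<forall>m0. \<exists>m. m 0 = m0 \<and> Cinf_on (ball 0 r) m \<and>
    (\<forall>x\<in>ball 0 r. (m has_derivative (\<lambda>a. A x a (m x))) (at x)))"
proof -
  obtain R where R: "R > 0" "cball 0 R \<subseteq> S" using open_S zero_S open_contains_cball by blast
  obtain M L Q where M: "M \<ge> 0" "L \<ge> 0" "Q \<ge> 0"
    "\<And>x a m. x \<in> cball 0 R \<Longrightarrow> norm (A x a m) \<le> M * norm a * norm m"
    "\<And>x y a m. x \<in> cball 0 R \<Longrightarrow> y \<in> cball 0 R \<Longrightarrow> norm (A y a m - A x a m) \<le> L * norm (y - x) * norm a * norm m"
    "\<And>x y a m. x \<in> cball 0 R \<Longrightarrow> y \<in> cball 0 R \<Longrightarrow>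
      norm (A y a m - A x a m - dd (\<lambda>z. A z a m) (y - x) x) \<le> Q * (norm (y - x))^2 * norm a * norm m"
    using A_bounds[OF compact_cball convex_cball R(2)] by blast
  \<comment> \<open>M r <= 1/2 makes I halve sup norms and supplies the factor 1/2 of
    \<open>linear_ode_bound\<close> along every ray.\<close>
  define r where "r = min R (1 / (2 * (M + 1)))"
  have r: "r > 0" "r \<le> R" "M * r \<le> 1 / 2"
  proof -
    show "r > 0" "r \<le> R" using R M by (auto simp: r_def)
    have "M * r \<le> M * (1 / (2 * (M + 1)))" using M(1) by (intro mult_left_mono) (auto simp: r_def)
    also have "\<dots> \<le> 1 / 2" using M(1) by (simp add: divide_simps)
    finally show "M * r \<le> 1 / 2" .
  qed
  have sc: "t *\<^sub>R x \<in> cball 0 r" "t *\<^sub>R x \<in> cball 0 R" "t *\<^sub>R x \<in> S"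
    if "x \<in> cball 0 r" "t \<in> {0..1}" for t x
  proof -
    have "norm (t *\<^sub>R x) \<le> norm x" using that(2) by (simp add: mult_left_le_one_le)
    then show "t *\<^sub>R x \<in> cball 0 r" using that(1) by simp
    then show "t *\<^sub>R x \<in> cball 0 R" "t *\<^sub>R x \<in> S" using r(2) R(2) by auto
  qed
  have half: "norm (A (t *\<^sub>R x) x m) \<le> norm m / 2" if "x \<in> cball 0 r" "t \<in> {0..1}" for t x m
  proof -
    have "norm (A (t *\<^sub>R x) x m) \<le> M * norm x * norm m" using M(4)[OF sc(2)[OF that]] .
    also have "\<dots> \<le> M * r * norm m" using that(1) M(1) by (intro mult_right_mono mult_left_mono) auto
    also have "\<dots> \<le> 1 / 2 * norm m" using r(3) by (intro mult_right_mono) auto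
    finally show ?thesis by simp
  qed
  have contA: "continuous_on (cball 0 r \<times> cbox 0 1) (\<lambda>(x, t). A (t *\<^sub>R x) x (m (t *\<^sub>R x)))"
    if "continuous_on (cball 0 r) m" for m :: "'e \<Rightarrow> 'f"
    unfolding split_beta
    by (intro A_continuous continuous_intros continuous_on_compose2[OF that]) (use sc in auto)
  define I where "I m x = integral (cbox 0 1) (\<lambda>t::real. A (t *\<^sub>R x) x (m (t *\<^sub>R x)))" for m :: "'e \<Rightarrow> 'f" and x
  have contI: "continuous_on (cball 0 r) (I m)" if "continuous_on (cball 0 r) m" for m
    unfolding I_def by (rule integral_continuous_on_param[OF contA[OF that]])
  have contA1: "continuous_on (cbox 0 1) (\<lambda>t. A (t *\<^sub>R x) x (m (t *\<^sub>R x)))"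
    if "continuous_on (cball 0 r) m" "x \<in> cball 0 r" for m :: "'e \<Rightarrow> 'f" and x
    by (intro A_continuous continuous_intros continuous_on_compose2[OF that(1)]) (use sc[OF that(2)] in auto)
  have intA: "(\<lambda>t::real. A (t *\<^sub>R x) x (m (t *\<^sub>R x))) integrable_on cbox 0 1"
    if "continuous_on (cball 0 r) m" "x \<in> cball 0 r" for m :: "'e \<Rightarrow> 'f" and x
    by (rule integrable_continuous[OF contA1[OF that]])
  have boundI: "norm (I m x) \<le> c / 2"
    if "continuous_on (cball 0 r) m" "x \<in> cball 0 r" "\<And>z. z \<in> cball 0 r \<Longrightarrow> norm (m z) \<le> c" for m x c
  proof -
    have "norm (I m x) \<le> integral (cbox 0 1) (\<lambda>t::real. c / 2)"
      unfolding I_def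
    proof (rule integral_norm_bound_integral[OF intA[OF that(1,2)]])
      fix t :: real assume "t \<in> cbox 0 1"
      then have "t \<in> {0..1}" by simp
      then show "norm (A (t *\<^sub>R x) x (m (t *\<^sub>R x))) \<le> c / 2"
        using half[OF that(2), of t "m (t *\<^sub>R x)"] that(3)[OF sc(1)[OF that(2)], of t] by simp
    qed (rule integrable_const)
    then show ?thesis by simp
  qed
  show ?thesis
  proof (intro exI[of _ r] conjI allI)
    show "r > 0" "ball 0 r \<subseteq> S" using r R by auto
    fix m0 :: 'f
    \<comment> \<open>Terms of the Neumann series for m = m0 + I m; each is at most half as large as
      its predecessor.\<close>
    define D where "D k = (I ^^ k) (\<lambda>x. m0)" for k
    have D: "continuous_on (cball 0 r) (D k) \<and> (\<forall>x\<in>cball 0 r. norm (D k x) \<le> norm m0 * (1/2)^k)" for k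
    proof (induction k)
      case (Suc k)
      have "D (Suc k) = I (D k)" by (simp add: D_def)
      then show ?case using Suc contI boundI[of "D k" _ "norm m0 * (1/2)^k"] by auto
    qed (simp add: D_def)
    define P where "P n x = (\<Sum>k<n. D k x)" for n x
    define m where "m x = (\<Sum>k. D k x)" for x
    have unif: "uniform_limit (cball 0 r) P m sequentially"
      unfolding P_def m_def
      by (rule Weierstrass_m_test[where M = "\<lambda>k. norm m0 * (1/2)^k"])
         (use D in \<open>auto intro!: summable_mult summable_geometric\<close>)
    have contP: "continuous_on (cball 0 r) (P n)" for n
      unfolding P_def using D by (intro continuous_on_sum) auto
    have contm: "continuous_on (cball 0 r) m"
      by (rule uniform_limit_theorem[OF _ unif]) (auto simp: contP)
    have fixP: "P (Suc n) x = m0 + I (P n) x" if x: "x \<in> cball 0 r" for n x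
    proof -
      have "I (P n) x = (\<Sum>k<n. I (D k) x)"
        unfolding I_def P_def using D sc(3)[OF x]
        by (subst integral_sum[symmetric]) (auto intro!: intA[OF _ x, simplified] integral_cong simp: linear_sum[OF lin2])
      moreover have "D (Suc k) = I (D k)" for k by (simp add: D_def)
      ultimately show ?thesis unfolding P_def by (subst sum.lessThan_Suc_shift) (simp add: D_def)
    qed
    have fixm: "m x = m0 + I m x" if x: "x \<in> cball 0 r" for x
    proof -
      have "(\<lambda>n. I (P n) x) \<longlonglongrightarrow> I m x"
      proof (rule LIMSEQ_I)
        fix e :: real assume e: "e > 0"
        obtain N where N: "\<And>n z. n \<ge> N \<Longrightarrow> z \<in> cball 0 r \<Longrightarrow> norm (P n z - m z) \<le> e"
          using uniform_limitD[OF unif e] unfolding eventually_sequentially dist_norm by (meson less_imp_le)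
        have "norm (I (P n) x - I m x) < e" if n: "n \<ge> N" for n
        proof -
          have "I (P n) x - I m x = I (\<lambda>z. P n z - m z) x"
            unfolding I_def using sc(3)[OF x]
            by (subst integral_diff[symmetric])
               (auto intro!: intA[OF _ x, simplified] integral_cong contP contm simp: linear_diff[OF lin2])
          also have "norm \<dots> \<le> e / 2"
            by (rule boundI[OF _ x N[OF n]]) (auto intro!: continuous_intros contP contm)
          finally show ?thesis using e by simp
        qed
        then show "\<exists>no. \<forall>n\<ge>no. norm (I (P n) x - I m x) < e" by blast
      qed
      then have "(\<lambda>n. P (Suc n) x) \<longlonglongrightarrow> m0 + I m x"
        unfolding fixP[OF x] by (intro tendsto_intros)
      moreover have "(\<lambda>n. P (Suc n) x) \<longlonglongrightarrow> m x"
        using tendsto_uniform_limitI[OF unif x] by (rule LIMSEQ_Suc)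
      ultimately show ?thesis using LIMSEQ_unique by blast
    qed
    \<comment> \<open>A substitution in the fixed point equation at s x turns the integral over the
      unit interval into an integral with upper limit s, which can be differentiated in s.\<close>
    have ray: "((\<lambda>t. m (t *\<^sub>R x)) has_vector_derivative A (t *\<^sub>R x) x (m (t *\<^sub>R x))) (at t within {0..1})"
      if x: "x \<in> cball 0 r" and t: "t \<in> {0..1}" for t x
    proof -
      define F where "F s = A (s *\<^sub>R x) x (m (s *\<^sub>R x))" for s :: real
      have contF: "continuous_on {0..1} F" using contA1[OF contm x] by (simp add: F_def[abs_def])
      have mF: "m (s *\<^sub>R x) = m0 + integral {0..s} F" if s: "s \<in> {0..1}" for s
      proof -
        have sub: "(\<lambda>u. s * u) ` {0..1} \<subseteq> {0..1}" using s by (auto simp: mult_le_one)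
        have sI: "((\<lambda>u. s *\<^sub>R F (s * u)) has_integral integral {s * 0..s * 1} F) {0..1}"
          by (rule has_integral_substitution[OF _ _ sub contF])
             (use s in \<open>auto intro!: derivative_eq_intros\<close>)
        have "A (u *\<^sub>R s *\<^sub>R x) (s *\<^sub>R x) (m (u *\<^sub>R s *\<^sub>R x)) = s *\<^sub>R F (s * u)" if "u \<in> {0..1}" for u
        proof -
          have "s * u \<in> {0..1}" using sub that by blast
          then show ?thesis
            using linear_cmul[OF lin1[OF sc(3)[OF x, of "s * u"]]] by (simp add: F_def mult.commute)
        qed
        then have "((\<lambda>u. A (u *\<^sub>R s *\<^sub>R x) (s *\<^sub>R x) (m (u *\<^sub>R s *\<^sub>R x))) has_integral integral {s * 0..s * 1} F) {0..1}"
          by (intro has_integral_eq[OF _ sI]) simp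
        from integral_unique[OF this] show ?thesis
          unfolding fixm[OF sc(1)[OF x s]] I_def cbox_interval by (simp only: mult_zero_right mult_1_right)
      qed
      have "((\<lambda>s. m0 + integral {0..s} F) has_vector_derivative F t) (at t within {0..1})"
        using integral_has_vector_derivative[OF contF t] by (auto intro!: derivative_eq_intros)
      then have "((\<lambda>s. m (s *\<^sub>R x)) has_vector_derivative F t) (at t within {0..1})"
        by (rule has_vector_derivative_transform[OF t, rotated]) (rule mF)
      then show ?thesis by (simp only: F_def)
    qed
    have m00: "m 0 = m0"
    proof -
      have "I m 0 = 0" using linear_0[OF lin1[OF zero_S]] by (simp add: I_def)
      then show ?thesis using fixm[of 0] r by simp
    qed
    obtain K where K: "\<And>x. x \<in> cball 0 r \<Longrightarrow> norm (m x) \<le> K" "K \<ge> 0"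
      using compact_continuous_image[OF contm compact_cball, THEN compact_imp_bounded]
      unfolding bounded_iff by (metis abs_ge_self abs_ge_zero dual_order.trans imageI)
    define E where "E = 2 * ((L * r + M) * K)"
    define Z where "Z = Q * r * K + L * r * E + L * K + M * E"
    have est: "norm (m y - m x - A x (y - x) (m x)) \<le> 2 * Z * (norm (y - x))^2"
      if x: "x \<in> cball 0 r" and y: "y \<in> cball 0 r" for x y
    proof -
      define w where "w = y - x"
      have wt: "norm (t *\<^sub>R y - t *\<^sub>R x) \<le> norm w" if "t \<in> {0..1}" for t
        using that by (simp add: w_def scaleR_diff_right[symmetric] mult_left_le_one_le)
      have nr: "norm x \<le> r" "norm y \<le> r" using x y by auto
      define e where "e t = m (t *\<^sub>R y) - m (t *\<^sub>R x)" for t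
      have ebound: "norm (e t) \<le> E * norm w" if t: "t \<in> {0..1}" for t
      proof -
        have "norm (e t) \<le> 2 * ((L * r + M) * K * norm w)"
        proof (rule linear_ode_bound[OF _ _ _ _ t, where u = e and L = "\<lambda>t. A (t *\<^sub>R x) x (e t)"
              and c = "\<lambda>t. A (t *\<^sub>R y) y (m (t *\<^sub>R y)) - A (t *\<^sub>R x) x (m (t *\<^sub>R y))"])
          fix t :: real assume t: "t \<in> {0..1}"
          have "(e has_vector_derivative A (t *\<^sub>R y) y (m (t *\<^sub>R y)) - A (t *\<^sub>R x) x (m (t *\<^sub>R x))) (at t within {0..1})"
            unfolding e_def[abs_def] by (intro has_vector_derivative_diff ray x y t)
          then show "(e has_vector_derivative A (t *\<^sub>R x) x (e t) + (A (t *\<^sub>R y) y (m (t *\<^sub>R y)) - A (t *\<^sub>R x) x (m (t *\<^sub>R y)))) (at t within {0..1})"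
            by (simp add: e_def linear_diff[OF lin2[OF sc(3)[OF x t]]])
          show "norm (A (t *\<^sub>R x) x (e t)) \<le> norm (e t) / 2" by (rule half[OF x t])
          have "A (t *\<^sub>R y) y (m (t *\<^sub>R y)) - A (t *\<^sub>R x) x (m (t *\<^sub>R y))
              = (A (t *\<^sub>R y) y (m (t *\<^sub>R y)) - A (t *\<^sub>R x) y (m (t *\<^sub>R y))) + A (t *\<^sub>R x) w (m (t *\<^sub>R y))"
            by (simp add: w_def linear_diff[OF lin1[OF sc(3)[OF x t]]])
          also have "norm \<dots> \<le> L * norm w * r * K + M * norm w * K"
          proof (rule norm_triangle_le[OF add_mono])
            have "norm (A (t *\<^sub>R y) y (m (t *\<^sub>R y)) - A (t *\<^sub>R x) y (m (t *\<^sub>R y)))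
                \<le> L * norm (t *\<^sub>R y - t *\<^sub>R x) * norm y * norm (m (t *\<^sub>R y))"
              by (rule M(5)[OF sc(2)[OF x t] sc(2)[OF y t]])
            also have "\<dots> \<le> L * norm w * r * K"
              using wt[OF t] nr K(1)[OF sc(1)[OF y t]] M(2) r by (intro mult_mono) auto
            finally show "norm (A (t *\<^sub>R y) y (m (t *\<^sub>R y)) - A (t *\<^sub>R x) y (m (t *\<^sub>R y))) \<le> L * norm w * r * K" .
            have "norm (A (t *\<^sub>R x) w (m (t *\<^sub>R y))) \<le> M * norm w * norm (m (t *\<^sub>R y))"
              by (rule M(4)[OF sc(2)[OF x t]])
            also have "\<dots> \<le> M * norm w * K"
              using K(1)[OF sc(1)[OF y t]] M(1) by (intro mult_mono) auto
            finally show "norm (A (t *\<^sub>R x) w (m (t *\<^sub>R y))) \<le> M * norm w * K" .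
          qed
          finally show "norm (A (t *\<^sub>R y) y (m (t *\<^sub>R y)) - A (t *\<^sub>R x) x (m (t *\<^sub>R y))) \<le> (L * r + M) * K * norm w"
            by (simp add: algebra_simps)
        qed (simp add: e_def)
        then show ?thesis by (simp add: E_def)
      qed
      \<comment> \<open>The error of the expected first order expansion of m between t x and t y. It
        solves the linear equation along the ray of x up to a term of order |w|^2, hence h 1, the
        remainder wanted in \<open>est\<close>, is of that order too.\<close>
      define h where "h t = e t - t *\<^sub>R A (t *\<^sub>R x) w (m (t *\<^sub>R x))" for t
      define dA where "dA t a b = dd (\<lambda>z. A z a (m (t *\<^sub>R x))) b (t *\<^sub>R x)" for t a b
      define rem where "rem t = A (t *\<^sub>R y) y (m (t *\<^sub>R y)) - A (t *\<^sub>R x) y (m (t *\<^sub>R x))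
         - t *\<^sub>R dA t x w - A (t *\<^sub>R x) x (e t)" for t
      have "norm (h 1) \<le> 2 * (Z * (norm w)^2)"
      proof (rule linear_ode_bound[where u = h and L = "\<lambda>t. A (t *\<^sub>R x) x (h t)" and c = rem])
        fix t :: real assume t: "t \<in> {0..1}"
        note S' = sc(3)[OF x t]
        have dw: "((\<lambda>t. A (t *\<^sub>R x) w (m (t *\<^sub>R x))) has_vector_derivative
          dA t w x + A (t *\<^sub>R x) w (A (t *\<^sub>R x) x (m (t *\<^sub>R x)))) (at t within {0..1})"
        proof -
          have 1: "((\<lambda>t. A (t *\<^sub>R x) w j) has_vector_derivative dd (\<lambda>z. A z w j) x (t *\<^sub>R x)) (at t within {0..1})" for j
          proof -
            have "((\<lambda>t. A (t *\<^sub>R x) w j) has_derivative (\<lambda>s. dd (\<lambda>z. A z w j) (s *\<^sub>R x) (t *\<^sub>R x))) (at t within {0..1})"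
              by (rule has_derivative_compose[where f = "\<lambda>t. t *\<^sub>R x" and f' = "\<lambda>s. s *\<^sub>R x" and g = "\<lambda>z. A z w j"
                    and g' = "\<lambda>v. dd (\<lambda>z. A z w j) v (t *\<^sub>R x)"])
                 (auto intro!: derivative_eq_intros Cinf_on_has_derivative[OF smooth S'])
            then show ?thesis
              using linear_cmul[OF dd_linear[OF Cinf_on_differentiable[OF smooth S']]]
              by (simp add: has_vector_derivative_def)
          qed
          have "((\<lambda>t. \<Sum>j\<in>Basis. (m (t *\<^sub>R x) \<bullet> j) *\<^sub>R A (t *\<^sub>R x) w j) has_vector_derivative
            (\<Sum>j\<in>Basis. (m (t *\<^sub>R x) \<bullet> j) *\<^sub>R dd (\<lambda>z. A z w j) x (t *\<^sub>R x)
               + (A (t *\<^sub>R x) x (m (t *\<^sub>R x)) \<bullet> j) *\<^sub>R A (t *\<^sub>R x) w j)) (at t within {0..1})"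
            by (intro has_vector_derivative_sum has_vector_derivative_scaleR 1)
               (use ray[OF x t] in \<open>auto simp: has_real_derivative_iff_has_vector_derivative
                 intro: bounded_linear.has_vector_derivative[OF bounded_linear_inner_left]\<close>)
          moreover have "(\<Sum>j\<in>Basis. (m (t *\<^sub>R x) \<bullet> j) *\<^sub>R dd (\<lambda>z. A z w j) x (t *\<^sub>R x)) = dA t w x"
            unfolding dA_def by (rule linear_expand[symmetric, OF linear_family_dd[OF open_S lin2 smooth S']])
          moreover have "A (s *\<^sub>R x) w k = (\<Sum>j\<in>Basis. (k \<bullet> j) *\<^sub>R A (s *\<^sub>R x) w j)" if "s \<in> {0..1}" for s k
            by (rule linear_expand[OF lin2[OF sc(3)[OF x that]]])
          ultimately show ?thesis
            using has_vector_derivative_transform[OF t, of "\<lambda>t. A (t *\<^sub>R x) w (m (t *\<^sub>R x))"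
                "\<lambda>t. \<Sum>j\<in>Basis. (m (t *\<^sub>R x) \<bullet> j) *\<^sub>R A (t *\<^sub>R x) w j"] t
            by (simp add: sum.distrib)
        qed
        have hd: "(h has_vector_derivative (A (t *\<^sub>R y) y (m (t *\<^sub>R y)) - A (t *\<^sub>R x) x (m (t *\<^sub>R x)))
            - (t *\<^sub>R (dA t w x + A (t *\<^sub>R x) w (A (t *\<^sub>R x) x (m (t *\<^sub>R x)))) + 1 *\<^sub>R A (t *\<^sub>R x) w (m (t *\<^sub>R x))))
            (at t within {0..1})"
          unfolding h_def[abs_def] e_def[abs_def]
          by (intro has_vector_derivative_diff has_vector_derivative_scaleR ray x y t dw)
             (auto intro!: derivative_eq_intros)
        \<comment> \<open>Here integrability enters: it exchanges the displacement w with the ray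
          direction x, so that the terms linear in w cancel.\<close>
        have fl: "dA t w x + A (t *\<^sub>R x) w (A (t *\<^sub>R x) x (m (t *\<^sub>R x)))
            = dA t x w + A (t *\<^sub>R x) x (A (t *\<^sub>R x) w (m (t *\<^sub>R x)))"
          unfolding dA_def by (rule flat[OF S'])
        have ah: "A (t *\<^sub>R x) x (h t) = A (t *\<^sub>R x) x (e t) - t *\<^sub>R A (t *\<^sub>R x) x (A (t *\<^sub>R x) w (m (t *\<^sub>R x)))"
          unfolding h_def by (simp add: linear_diff[OF lin2[OF S']] linear_cmul[OF lin2[OF S']])
        have ay: "A (t *\<^sub>R x) y k = A (t *\<^sub>R x) x k + A (t *\<^sub>R x) w k" for k
          by (simp add: w_def linear_diff[OF lin1[OF S']])
        have "(A (t *\<^sub>R y) y (m (t *\<^sub>R y)) - A (t *\<^sub>R x) x (m (t *\<^sub>R x)))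
            - (t *\<^sub>R (dA t w x + A (t *\<^sub>R x) w (A (t *\<^sub>R x) x (m (t *\<^sub>R x)))) + 1 *\<^sub>R A (t *\<^sub>R x) w (m (t *\<^sub>R x)))
            = A (t *\<^sub>R x) x (h t) + rem t"
          unfolding fl ah rem_def ay by (simp add: algebra_simps)
        then show "(h has_vector_derivative A (t *\<^sub>R x) x (h t) + rem t) (at t within {0..1})"
          using hd by (simp only:)
        show "norm (A (t *\<^sub>R x) x (h t)) \<le> norm (h t) / 2" by (rule half[OF x t])
        have y': "A (t *\<^sub>R y) y k = A (t *\<^sub>R y) x k + A (t *\<^sub>R y) w k" for k
          by (simp add: w_def linear_diff[OF lin1[OF sc(3)[OF y t]]])
        have x': "A (t *\<^sub>R x) y k = A (t *\<^sub>R x) x k + A (t *\<^sub>R x) w k" for k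
          by (simp add: w_def linear_diff[OF lin1[OF S']])
        have dAt: "t *\<^sub>R dA t x w = dd (\<lambda>z. A z x (m (t *\<^sub>R x))) (t *\<^sub>R y - t *\<^sub>R x) (t *\<^sub>R x)"
          unfolding dA_def w_def using linear_cmul[OF dd_linear[OF Cinf_on_differentiable[OF smooth S']]]
          by (simp add: scaleR_diff_right[symmetric])
        have me: "m (t *\<^sub>R y) = m (t *\<^sub>R x) + e t" by (simp add: e_def)
        have "rem t = ((A (t *\<^sub>R y) x (m (t *\<^sub>R x)) - A (t *\<^sub>R x) x (m (t *\<^sub>R x)) - t *\<^sub>R dA t x w)
            + (A (t *\<^sub>R y) x (e t) - A (t *\<^sub>R x) x (e t)))
            + ((A (t *\<^sub>R y) w (m (t *\<^sub>R y)) - A (t *\<^sub>R x) w (m (t *\<^sub>R y))) + A (t *\<^sub>R x) w (e t))"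
          unfolding rem_def x' y' by (simp add: me linear_add[OF lin2[OF S']] linear_add[OF lin2[OF sc(3)[OF y t]]] algebra_simps)
        also have "norm \<dots> \<le> (Q * (norm w)^2 * r * K + L * norm w * r * (E * norm w))
            + (L * norm w * norm w * K + M * norm w * (E * norm w))"
        proof (intro norm_triangle_le[OF add_mono])
          note cR = sc(2)[OF x t] sc(2)[OF y t]
          note Kx = K(1)[OF sc(1)[OF x t]] and Ky = K(1)[OF sc(1)[OF y t]]
          have "norm (A (t *\<^sub>R y) x (m (t *\<^sub>R x)) - A (t *\<^sub>R x) x (m (t *\<^sub>R x)) - t *\<^sub>R dA t x w)
              \<le> Q * (norm (t *\<^sub>R y - t *\<^sub>R x))^2 * norm x * norm (m (t *\<^sub>R x))"
            unfolding dAt by (rule M(6)[OF cR])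
          also have "\<dots> \<le> Q * (norm w)^2 * r * K"
            using wt[OF t] nr Kx M(3) r by (intro mult_mono power_mono) auto
          finally show "norm (A (t *\<^sub>R y) x (m (t *\<^sub>R x)) - A (t *\<^sub>R x) x (m (t *\<^sub>R x)) - t *\<^sub>R dA t x w)
              \<le> Q * (norm w)^2 * r * K" .
          have "norm (A (t *\<^sub>R y) x (e t) - A (t *\<^sub>R x) x (e t)) \<le> L * norm (t *\<^sub>R y - t *\<^sub>R x) * norm x * norm (e t)"
            by (rule M(5)[OF cR])
          also have "\<dots> \<le> L * norm w * r * (E * norm w)"
            using wt[OF t] nr ebound[OF t] M(2) r by (intro mult_mono) auto
          finally show "norm (A (t *\<^sub>R y) x (e t) - A (t *\<^sub>R x) x (e t)) \<le> L * norm w * r * (E * norm w)" .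
          have "norm (A (t *\<^sub>R y) w (m (t *\<^sub>R y)) - A (t *\<^sub>R x) w (m (t *\<^sub>R y)))
              \<le> L * norm (t *\<^sub>R y - t *\<^sub>R x) * norm w * norm (m (t *\<^sub>R y))"
            by (rule M(5)[OF cR])
          also have "\<dots> \<le> L * norm w * norm w * K"
            using wt[OF t] Ky M(2) by (intro mult_mono) auto
          finally show "norm (A (t *\<^sub>R y) w (m (t *\<^sub>R y)) - A (t *\<^sub>R x) w (m (t *\<^sub>R y))) \<le> L * norm w * norm w * K" .
          have "norm (A (t *\<^sub>R x) w (e t)) \<le> M * norm w * norm (e t)" by (rule M(4)[OF cR(1)])
          also have "\<dots> \<le> M * norm w * (E * norm w)"
            using ebound[OF t] M(1) by (intro mult_mono) auto
          finally show "norm (A (t *\<^sub>R x) w (e t)) \<le> M * norm w * (E * norm w)" .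
        qed
        finally show "norm (rem t) \<le> Z * (norm w)^2"
          by (simp add: Z_def power2_eq_square algebra_simps)
      qed (simp_all add: h_def e_def)
      then show ?thesis by (simp add: h_def e_def w_def)
    qed
    have der: "(m has_derivative (\<lambda>a. A x a (m x))) (at x)" if "x \<in> ball 0 r" for x
    proof -
      have xS: "x \<in> S" using that r R by auto
      have "(m has_derivative (\<lambda>a. A x a (m x))) (at x within ball 0 r)"
        unfolding has_derivative_within
      proof (intro conjI)
        show "bounded_linear (\<lambda>a. A x a (m x))" using lin1[OF xS] linear_conv_bounded_linear by blast
        have Z0: "Z \<ge> 0" using M r K unfolding Z_def E_def by (intro add_nonneg_nonneg mult_nonneg_nonneg) auto
        show "((\<lambda>y. (1 / norm (y - x)) *\<^sub>R (m y - (m x + A x (y - x) (m x)))) \<longlongrightarrow> 0) (at x within ball 0 r)"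
        proof (rule Lim_null_comparison)
          show "((\<lambda>y. 2 * Z * norm (y - x)) \<longlongrightarrow> 0) (at x within ball 0 r)"
            by (intro tendsto_eq_intros) auto
          show "eventually (\<lambda>y. norm ((1 / norm (y - x)) *\<^sub>R (m y - (m x + A x (y - x) (m x)))) \<le> 2 * Z * norm (y - x)) (at x within ball 0 r)"
          proof (rule eventually_at_topological[THEN iffD2], intro exI[of _ UNIV] conjI ballI impI open_UNIV UNIV_I)
            fix y assume "y \<noteq> x" "y \<in> ball 0 r"
            then have le: "norm (m y - (m x + A x (y - x) (m x))) \<le> 2 * Z * (norm (y - x))^2"
              using est[of x y] that by (simp add: diff_diff_eq)
            have "norm ((1 / norm (y - x)) *\<^sub>R (m y - (m x + A x (y - x) (m x))))
                = norm (m y - (m x + A x (y - x) (m x))) / norm (y - x)" unfolding norm_scaleR by simp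
            also have "\<dots> \<le> 2 * Z * (norm (y - x))^2 / norm (y - x)" by (rule divide_right_mono[OF le]) simp
            also have "\<dots> = 2 * Z * norm (y - x)" using \<open>y \<noteq> x\<close> by (simp add: power2_eq_square)
            finally show "norm ((1 / norm (y - x)) *\<^sub>R (m y - (m x + A x (y - x) (m x)))) \<le> 2 * Z * norm (y - x)" .
          qed
        qed
      qed
      then show ?thesis using at_within_open[OF that open_ball] by (simp only:)
    qed
    have "Cinf_on (ball 0 r) m"
    proof (rule Cinf_on_bootstrap[OF open_ball der])
      fix k v assume "Ck_on k (ball 0 r) m"
      moreover have "ball 0 r \<subseteq> S" using r R by auto
      ultimately show "Ck_on k (ball 0 r) (\<lambda>x. A x v (m x))"
        by (intro Ck_on_linear_apply[OF open_ball _ Ck_on_subset[OF Cinf_onD[OF smooth]]] lin2) auto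
    qed
    then show "\<exists>m. m 0 = m0 \<and> Cinf_on (ball 0 r) m \<and> (\<forall>x\<in>ball 0 r. (m has_derivative (\<lambda>a. A x a (m x))) (at x))"
      using m00 der by blast
  qed
qed

end

text \<open>The weight c is general for the sake of the induction: each differentiation under the
  integral multiplies it by t.\<close>

lemma Cinf_on_ray_integral:
  fixes G :: "'e::euclidean_space \<Rightarrow> 'c::euclidean_space"
  assumes "Cinf_on (ball x r) G" "continuous_on {0..1} c"
  shows "Cinf_on (ball x r) (\<lambda>z. integral (cbox 0 1) (\<lambda>t::real. c t *\<^sub>R G (x + t *\<^sub>R (z - x))))"
proof -
  have inb: "x + t *\<^sub>R (z - x) \<in> ball x r" if "z \<in> ball x r" "t \<in> {0..1}" for t z
  proof -
    have "norm (t *\<^sub>R (z - x)) \<le> norm (z - x)" using that(2) by (simp add: mult_left_le_one_le)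
    then show ?thesis using that(1) by (simp add: dist_norm norm_minus_commute)
  qed
  have "Ck_on k (ball x r) (\<lambda>z. integral (cbox 0 1) (\<lambda>t::real. c t *\<^sub>R G (x + t *\<^sub>R (z - x))))" for k
    using assms
  proof (induction k arbitrary: c G)
    case 0
    have "continuous_on (ball x r \<times> cbox 0 1) (\<lambda>(z, t). c t *\<^sub>R G (x + t *\<^sub>R (z - x)))"
      unfolding split_beta
      by (intro continuous_intros continuous_on_compose2[OF 0(2)] continuous_on_compose2[OF Cinf_on_continuous[OF 0(1)]])
         (use inb in auto)
    from integral_continuous_on_param[OF this] show ?case by simp
  next
    case (Suc k)
    have dG: "(G has_derivative (\<lambda>v. dd G v y)) (at y)" if "y \<in> ball x r" for y
      using Cinf_on_has_derivative[OF Suc.prems(1) that] .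
    define fx where "fx z t = Blinfun (\<lambda>v. c t *\<^sub>R t *\<^sub>R dd G v (x + t *\<^sub>R (z - x)))" for z and t :: real
    have fx: "blinfun_apply (fx z t) = (\<lambda>v. c t *\<^sub>R t *\<^sub>R dd G v (x + t *\<^sub>R (z - x)))"
      if "z \<in> ball x r" "t \<in> cbox 0 1" for z t
      unfolding fx_def using has_derivative_bounded_linear[OF dG[OF inb]] that
      by (intro bounded_linear_Blinfun_apply bounded_linear_scaleR_right[THEN bounded_linear_compose, unfolded o_def]) auto
    have contf: "continuous_on (cbox 0 1) (\<lambda>t. c t *\<^sub>R G (x + t *\<^sub>R (z - x)))" if "z \<in> ball x r" for z
      using Suc.prems(2) inb[OF that]
      by (intro continuous_intros continuous_on_compose2[OF Cinf_on_continuous[OF Suc.prems(1)]]) auto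
    have contfx: "continuous_on (ball x r \<times> cbox 0 1) (\<lambda>(z, t). fx z t)"
    proof (rule continuous_on_blinfun_componentwise)
      fix i :: 'e
      have "continuous_on (ball x r \<times> cbox 0 1) (\<lambda>(z, t). c t *\<^sub>R t *\<^sub>R dd G i (x + t *\<^sub>R (z - x)))"
        unfolding split_beta
        by (intro continuous_intros continuous_on_compose2[OF Suc.prems(2)]
             continuous_on_compose2[OF Cinf_on_continuous[OF Cinf_on_dd[OF Suc.prems(1)]]])
           (use inb in auto)
      then show "continuous_on (ball x r \<times> cbox 0 1) (\<lambda>p. blinfun_apply (case p of (z, t) \<Rightarrow> fx z t) i)"
        by (rule continuous_on_eq) (use fx in auto)
    qed
    show ?case
    proof (rule Ck_on_SucI[OF open_ball])
      fix z assume z: "z \<in> ball x r"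
      have "((\<lambda>z. integral (cbox 0 1) (\<lambda>t. c t *\<^sub>R G (x + t *\<^sub>R (z - x)))) has_derivative
          integral (cbox 0 1) (fx z)) (at z within ball x r)"
      proof (rule leibniz_rule[OF _ _ contfx z convex_ball])
        fix y and t :: real assume yt: "y \<in> ball x r" "t \<in> cbox 0 1"
        have "((\<lambda>y. G (x + t *\<^sub>R (y - x))) has_derivative (\<lambda>v. dd G (t *\<^sub>R v) (x + t *\<^sub>R (y - x)))) (at y within ball x r)"
          by (rule has_derivative_compose[where f = "\<lambda>y. x + t *\<^sub>R (y - x)" and f' = "\<lambda>v. t *\<^sub>R v" and g = G
                and g' = "\<lambda>v. dd G v (x + t *\<^sub>R (y - x))"])
             (use inb[of y t] yt in \<open>auto intro!: derivative_eq_intros dG\<close>)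
        then have "((\<lambda>y. c t *\<^sub>R G (x + t *\<^sub>R (y - x))) has_derivative (\<lambda>v. c t *\<^sub>R dd G (t *\<^sub>R v) (x + t *\<^sub>R (y - x)))) (at y within ball x r)"
          by (rule has_derivative_scaleR_right)
        moreover have "dd G (t *\<^sub>R v) (x + t *\<^sub>R (y - x)) = t *\<^sub>R dd G v (x + t *\<^sub>R (y - x))" for v
          using linear_cmul[OF has_derivative_linear[OF dG[OF inb[of y t]]]] yt by auto
        ultimately show "((\<lambda>y. c t *\<^sub>R G (x + t *\<^sub>R (y - x))) has_derivative fx y t) (at y within ball x r)"
          by (simp only: fx[OF yt])
      qed (rule integrable_continuous[OF contf])
      then show "((\<lambda>z. integral (cbox 0 1) (\<lambda>t. c t *\<^sub>R G (x + t *\<^sub>R (z - x)))) has_derivative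
          integral (cbox 0 1) (fx z)) (at z)"
        unfolding at_within_open[OF z open_ball] .
    next
      fix v
      have base: "Ck_on k (ball x r) (\<lambda>z. integral (cbox 0 1) (\<lambda>t. (c t * t) *\<^sub>R dd G v (x + t *\<^sub>R (z - x))))"
        by (rule Suc.IH[OF Cinf_on_dd[OF Suc.prems(1)]]) (intro continuous_intros Suc.prems)
      have eq: "blinfun_apply (integral (cbox 0 1) (fx z)) v
          = integral (cbox 0 1) (\<lambda>t. (c t * t) *\<^sub>R dd G v (x + t *\<^sub>R (z - x)))" if z: "z \<in> ball x r" for z
      proof -
        have "continuous_on (cbox 0 1) (fx z)"
          by (rule continuous_on_compose2[OF contfx, of _ "\<lambda>t. (z, t)", simplified split_conv])
             (use z in \<open>auto intro!: continuous_intros\<close>)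
        then show ?thesis
          by (subst blinfun_apply_integral[OF integrable_continuous]) (auto intro!: integral_cong simp: fx[OF z])
      qed
      show "Ck_on k (ball x r) (\<lambda>z. blinfun_apply (integral (cbox 0 1) (fx z)) v)"
        by (rule iffD2[OF Ck_on_cong[OF open_ball] base]) (rule eq)
    qed
  qed
  then show ?thesis by (simp add: Cinf_on_def)
qed

text \<open>h b z is the average of the partial derivative in direction b over the segment from x to
  z. Smooth coefficients are the point: a derivation can then be applied to each product.\<close>

lemma hadamard:
  fixes F :: "'e::euclidean_space \<Rightarrow> real"
  assumes F: "Cinf_on (ball x r) F" and r: "r > 0"
  shows "\<exists>h. (\<forall>b. Cinf_on (ball x r) (h b)) \<and> (\<forall>b. h b x = dd F b x) \<and>
    (\<forall>z\<in>ball x r. F z = F x + (\<Sum>b\<in>Basis. ((z - x) \<bullet> b) * h b z))"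
proof -
  define h where "h b z = integral (cbox 0 1) (\<lambda>t::real. 1 *\<^sub>R dd F b (x + t *\<^sub>R (z - x)))" for b z
  have 1: "Cinf_on (ball x r) (h b)" for b
    unfolding h_def by (rule Cinf_on_ray_integral[OF Cinf_on_dd[OF F]]) simp
  have 2: "h b x = dd F b x" for b by (simp add: h_def)
  have "F z = F x + (\<Sum>b\<in>Basis. ((z - x) \<bullet> b) * h b z)" if z: "z \<in> ball x r" for z
  proof -
  have inb: "x + t *\<^sub>R (z - x) \<in> ball x r" if "t \<in> {0..1}" for t
  proof -
    have "norm (t *\<^sub>R (z - x)) \<le> norm (z - x)" using that by (simp add: mult_left_le_one_le)
    then show ?thesis using z by (simp add: dist_norm norm_minus_commute)
  qed
  have cont: "continuous_on {0..1} (\<lambda>t. dd F b (x + t *\<^sub>R (z - x)))" for b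
    using inb by (intro continuous_on_compose2[OF Cinf_on_continuous[OF Cinf_on_dd[OF F]]] continuous_intros) auto
  have exp: "dd F (z - x) y = (\<Sum>b\<in>Basis. ((z - x) \<bullet> b) *\<^sub>R dd F b y)" if "y \<in> ball x r" for y
    using linear_expand[OF dd_linear[OF Cinf_on_differentiable[OF F that]]] .
  have "((\<lambda>t. dd F (z - x) (x + t *\<^sub>R (z - x))) has_integral F (x + 1 *\<^sub>R (z - x)) - F (x + 0 *\<^sub>R (z - x))) {0..1}"
    by (rule fundamental_theorem_of_calculus)
       (use dd_along[OF F inb] in \<open>auto simp: has_real_derivative_iff_has_vector_derivative\<close>)
  then have "F z - F x = integral {0..1} (\<lambda>t. dd F (z - x) (x + t *\<^sub>R (z - x)))"
    by (simp add: integral_unique)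
  also have "\<dots> = integral {0..1} (\<lambda>t. \<Sum>b\<in>Basis. ((z - x) \<bullet> b) * dd F b (x + t *\<^sub>R (z - x)))"
    by (rule integral_cong) (use exp[OF inb] in simp)
  also have "\<dots> = (\<Sum>b\<in>Basis. ((z - x) \<bullet> b) * integral {0..1} (\<lambda>t. dd F b (x + t *\<^sub>R (z - x))))"
    by (subst integral_sum) (auto intro!: integrable_continuous_real continuous_on_mult_left cont)
  finally show ?thesis by (simp add: h_def)
  qed
  then show ?thesis using 1 2 by blast
qed

section \<open>Local parametrizations of a complex manifold\<close>

text \<open>The inverse of a coordinate system of the underlying real manifold. It is broader than
  the inverse of a chart of the atlas, because flat coordinates need not be holomorphic;
  \<open>complex ^ 'n\<close> only serves as a real vector space of dimension 2n.\<close>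

definition param ::
    "('a::topological_space, 'n::finite) atlas \<Rightarrow> (complex ^ 'n) set \<Rightarrow> (complex ^ 'n \<Rightarrow> 'a) \<Rightarrow> bool" where
  "param A B P \<longleftrightarrow> open B \<and> inj_on P B \<and> continuous_on B P \<and> (\<forall>N\<subseteq>B. open N \<longrightarrow> open (P ` N)) \<and>
     (\<forall>W f. open W \<longrightarrow> W \<subseteq> P ` B \<longrightarrow> (smooth_fun_on A W f \<longleftrightarrow> Cinf_on (B \<inter> P -` W) (\<lambda>x. f (P x))))"

lemma smooth_fun_on_subset: "smooth_fun_on A W f \<Longrightarrow> W' \<subseteq> W \<Longrightarrow> smooth_fun_on A W' f"
  unfolding smooth_fun_on_def
  by (auto intro: Cinf_on_subset[OF _ image_mono])

lemma param_open: "param A B P \<Longrightarrow> open B" by (simp add: param_def)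
lemma param_inj: "param A B P \<Longrightarrow> inj_on P B" by (simp add: param_def)
lemma param_cont: "param A B P \<Longrightarrow> continuous_on B P" by (simp add: param_def)
lemma param_open_image: "param A B P \<Longrightarrow> N \<subseteq> B \<Longrightarrow> open N \<Longrightarrow> open (P ` N)" by (simp add: param_def)
lemma param_open_range: "param A B P \<Longrightarrow> open (P ` B)" by (simp add: param_def)

lemma param_inv: "param A B P \<Longrightarrow> x \<in> B \<Longrightarrow> inv_into B P (P x) = x"
  by (simp add: param_inj)

lemma param_open_vimage: "param A B P \<Longrightarrow> open W \<Longrightarrow> open (B \<inter> P -` W)"
  using continuous_on_open_vimage[OF param_open, of A B P P] param_cont[of A B P] by (simp add: Int_commute)

lemma param_smooth:
  assumes "param A B P" "open W" "smooth_fun_on A W f"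
  shows "Cinf_on (B \<inter> P -` W) (\<lambda>x. f (P x))"
proof -
  have "Cinf_on (B \<inter> P -` (W \<inter> P ` B)) (\<lambda>x. f (P x))"
    using assms param_open_range[OF assms(1)] smooth_fun_on_subset[OF assms(3), of "W \<inter> P ` B"]
    unfolding param_def by blast
  moreover have "B \<inter> P -` (W \<inter> P ` B) = B \<inter> P -` W" by auto
  ultimately show ?thesis by simp
qed

lemma param_smoothI:
  assumes "param A B P" "open W" "W \<subseteq> P ` B" "Cinf_on (B \<inter> P -` W) (\<lambda>x. f (P x))"
  shows "smooth_fun_on A W f"
  using assms unfolding param_def by blast

lemma param_smooth_iff:
  "param A B P \<Longrightarrow> open W \<Longrightarrow> W \<subseteq> P ` B \<Longrightarrow> smooth_fun_on A W f \<longleftrightarrow> Cinf_on (B \<inter> P -` W) (\<lambda>x. f (P x))"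
  by (simp add: param_def)

lemma param_compose:
  assumes P: "param A B P" and B': "open B'" "\<kappa> ` B' \<subseteq> B" "inj_on \<kappa> B'" "open (\<kappa> ` B')"
    and \<kappa>: "Cinf_on B' \<kappa>" "Cinf_on (\<kappa> ` B') (inv_into B' \<kappa>)"
  shows "param A B' (\<lambda>x. P (\<kappa> x))"
  unfolding param_def
proof (intro conjI allI impI)
  have opk: "open (\<kappa> ` N)" if "N \<subseteq> B'" "open N" for N
  proof -
    have "\<kappa> ` N = \<kappa> ` B' \<inter> inv_into B' \<kappa> -` N"
      using that B'(3) by (auto simp: inj_on_def f_inv_into_f inv_into_into subset_iff)
    then show ?thesis
      using continuous_on_open_vimage[OF B'(4), of "inv_into B' \<kappa>"] Cinf_on_continuous[OF \<kappa>(2)] that(2) by (simp add: Int_commute)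
  qed
  show "open B'" by fact
  show "inj_on (\<lambda>x. P (\<kappa> x)) B'"
    using comp_inj_on[OF B'(3) inj_on_subset[OF param_inj[OF P] B'(2)]] by (simp add: o_def)
  show "continuous_on B' (\<lambda>x. P (\<kappa> x))"
    by (rule continuous_on_compose2[OF param_cont[OF P] Cinf_on_continuous[OF \<kappa>(1)] B'(2)])
  show "open ((\<lambda>x. P (\<kappa> x)) ` N)" if "N \<subseteq> B'" "open N" for N
  proof -
    have "(\<lambda>x. P (\<kappa> x)) ` N = P ` (\<kappa> ` N)" by (simp add: image_image)
    then show ?thesis using param_open_image[OF P _ opk[OF that]] that B'(2) by auto
  qed
  fix W f assume W: "open W" "W \<subseteq> (\<lambda>x. P (\<kappa> x)) ` B'"
  have eq: "B \<inter> P -` W = \<kappa> ` (B' \<inter> (\<lambda>x. P (\<kappa> x)) -` W)"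
  proof
    show "\<kappa> ` (B' \<inter> (\<lambda>x. P (\<kappa> x)) -` W) \<subseteq> B \<inter> P -` W" using B' by auto
    show "B \<inter> P -` W \<subseteq> \<kappa> ` (B' \<inter> (\<lambda>x. P (\<kappa> x)) -` W)"
    proof
      fix y assume y: "y \<in> B \<inter> P -` W"
      then obtain x where x: "x \<in> B'" "P y = P (\<kappa> x)" using W(2) by auto
      then have "y = \<kappa> x" using param_inj[OF P] y B'(2) by (auto simp: inj_on_def)
      then show "y \<in> \<kappa> ` (B' \<inter> (\<lambda>x. P (\<kappa> x)) -` W)" using x y by auto
    qed
  qed
  have op: "open (B' \<inter> (\<lambda>x. P (\<kappa> x)) -` W)" "open (B \<inter> P -` W)"
    using \<open>continuous_on B' (\<lambda>x. P (\<kappa> x))\<close> W(1) continuous_on_open_vimage[OF B'(1), of "\<lambda>x. P (\<kappa> x)"]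
      param_open_vimage[OF P] by (auto simp: Int_commute)
  have "smooth_fun_on A W f \<longleftrightarrow> Cinf_on (B \<inter> P -` W) (\<lambda>x. f (P x))"
    using W(1) order_trans[OF W(2)[unfolded image_image[symmetric, of P \<kappa>]] image_mono[OF B'(2)]]
    by (intro param_smooth_iff[OF P])
  also have "\<dots> \<longleftrightarrow> Cinf_on (B' \<inter> (\<lambda>x. P (\<kappa> x)) -` W) (\<lambda>x. f (P (\<kappa> x)))"
  proof
    assume "Cinf_on (B \<inter> P -` W) (\<lambda>x. f (P x))"
    then show "Cinf_on (B' \<inter> (\<lambda>x. P (\<kappa> x)) -` W) (\<lambda>x. f (P (\<kappa> x)))"
      by (intro Cinf_on_compose[OF op Cinf_on_subset[OF \<kappa>(1)], where g = "\<lambda>x. f (P x)"]) (auto simp: eq)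
  next
    assume "Cinf_on (B' \<inter> (\<lambda>x. P (\<kappa> x)) -` W) (\<lambda>x. f (P (\<kappa> x)))"
    then have "Cinf_on (B \<inter> P -` W) (\<lambda>y. f (P (\<kappa> (inv_into B' \<kappa> y))))"
      by (intro Cinf_on_compose[OF op(2,1) Cinf_on_subset[OF \<kappa>(2)], where g = "\<lambda>x. f (P (\<kappa> x))"])
         (use B' in \<open>auto simp: eq\<close>)
    then show "Cinf_on (B \<inter> P -` W) (\<lambda>x. f (P x))"
      by (subst Cinf_on_cong[OF op(2), of _ "\<lambda>y. f (P (\<kappa> (inv_into B' \<kappa> y)))"])
         (use B' in \<open>auto simp: eq\<close>)
  qed
  finally show "smooth_fun_on A W f \<longleftrightarrow> Cinf_on (B' \<inter> (\<lambda>x. P (\<kappa> x)) -` W) (\<lambda>x. f (P (\<kappa> x)))" .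
qed

section \<open>Charts of the atlas as parametrizations\<close>

locale atlas_manifold =
  fixes A :: "('a::{t2_space, second_countable_topology}, 'n::finite) atlas"
  assumes atlas: "complex_atlas A"
begin

lemma chart_homeo:
  assumes "(U, \<phi>) \<in> A"
  shows "open U" "open (\<phi> ` U)" "homeomorphism U (\<phi> ` U) \<phi> (inv_into U \<phi>)" "inj_on \<phi> U"
proof -
  show *: "open U" "open (\<phi> ` U)" "homeomorphism U (\<phi> ` U) \<phi> (inv_into U \<phi>)"
    using atlas assms unfolding complex_atlas_def by auto
  show "inj_on \<phi> U" using *(3) unfolding homeomorphism_def by (metis inj_on_inverseI)
qed

lemma chart_transition:
  assumes "(U, \<phi>) \<in> A" "(V, \<psi>) \<in> A"
  shows "Cinf_on (\<phi> ` (U \<inter> V)) (\<lambda>x. \<psi> (inv_into U \<phi> x))"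
proof -
  have "\<forall>(U, \<phi>)\<in>A. \<forall>(V, \<psi>)\<in>A. let \<tau> = (\<lambda>x. \<psi> (inv_into U \<phi> x)) in
        Cinf_on (\<phi> ` (U \<inter> V)) \<tau> \<and>
        (\<forall>x\<in>\<phi> ` (U \<inter> V). \<forall>v.
           frechet_derivative \<tau> (at x) (\<i> *s v) = \<i> *s frechet_derivative \<tau> (at x) v)"
    by (rule atlas[unfolded complex_atlas_def, THEN conjunct2, THEN conjunct2])
  from bspec[OF this assms(1), unfolded split_conv, THEN bspec, OF assms(2)] show ?thesis
    by (simp add: Let_def)
qed

lemma chart_open_image:
  assumes "(U, \<phi>) \<in> A" "open N"
  shows "open (\<phi> ` (N \<inter> U))"
proof -
  note h = chart_homeo[OF assms(1)]
  have "openin (top_of_set U) (N \<inter> U)" using assms(2) by (auto simp: openin_open)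
  then have "openin (top_of_set (\<phi> ` U)) (\<phi> ` (N \<inter> U))" by (rule homeomorphism_imp_open_map[OF h(3)])
  then show ?thesis using h(2) openin_open_eq by blast
qed

text \<open>\<open>smooth_fun_on\<close> tests a function in every chart; since transition maps are
  smooth, the test in one chart decides on the domain of that chart.\<close>

lemma chart_param:
  assumes U: "(U, \<phi>) \<in> A"
  shows "param A (\<phi> ` U) (inv_into U \<phi>)"
  unfolding param_def
proof (intro conjI allI impI)
  note h = chart_homeo[OF U]
  have inv: "\<And>x. x \<in> U \<Longrightarrow> inv_into U \<phi> (\<phi> x) = x" using h(4) by simp
  show "open (\<phi> ` U)" by (rule h)
  show "inj_on (inv_into U \<phi>) (\<phi> ` U)" by (rule inj_on_inv_into) simp
  show cont: "continuous_on (\<phi> ` U) (inv_into U \<phi>)" using h(3) by (simp add: homeomorphism_def)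
  show "open (inv_into U \<phi> ` N)" if "N \<subseteq> \<phi> ` U" "open N" for N
  proof -
    have "inv_into U \<phi> ` N = U \<inter> \<phi> -` N"
      using that(1) inv by (auto simp: inv_into_into f_inv_into_f image_iff subset_iff) (metis inv)
    moreover have "continuous_on U \<phi>" using h(3) by (simp add: homeomorphism_def)
    ultimately show ?thesis using continuous_on_open_vimage[OF h(1), of \<phi>] that(2) by (simp add: Int_commute)
  qed
  fix W f assume W: "open W" "W \<subseteq> inv_into U \<phi> ` \<phi> ` U"
  have WU: "W \<subseteq> U" using W(2) inv by auto
  have eq: "\<phi> ` U \<inter> inv_into U \<phi> -` W = \<phi> ` (W \<inter> U)" using inv by auto
  show "smooth_fun_on A W f \<longleftrightarrow> Cinf_on (\<phi> ` U \<inter> inv_into U \<phi> -` W) (\<lambda>x. f (inv_into U \<phi> x))"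
  proof
    assume "smooth_fun_on A W f"
    then show "Cinf_on (\<phi> ` U \<inter> inv_into U \<phi> -` W) (\<lambda>x. f (inv_into U \<phi> x))"
      using U unfolding eq smooth_fun_on_def by auto
  next
    assume f: "Cinf_on (\<phi> ` U \<inter> inv_into U \<phi> -` W) (\<lambda>x. f (inv_into U \<phi> x))"
    have "Cinf_on (\<psi> ` (W \<inter> V)) (\<lambda>x. f (inv_into V \<psi> x))" if V: "(V, \<psi>) \<in> A" for V \<psi>
    proof -
      have \<tau>: "Cinf_on (\<psi> ` (V \<inter> U)) (\<lambda>x. \<phi> (inv_into V \<psi> x))"
        by (rule chart_transition[OF V U])
      have invV: "\<And>x. x \<in> V \<Longrightarrow> inv_into V \<psi> (\<psi> x) = x" using chart_homeo(4)[OF V] by simp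
      have "Cinf_on (\<psi> ` (W \<inter> V)) (\<lambda>x. f (inv_into U \<phi> (\<phi> (inv_into V \<psi> x))))"
        by (rule Cinf_on_compose[OF chart_open_image[OF V W(1)] chart_open_image[OF U W(1)] Cinf_on_subset[OF \<tau>]
              f[unfolded eq]])
           (use WU invV in auto)
      then show ?thesis
        by (subst Cinf_on_cong[OF chart_open_image[OF V W(1)], of _ "\<lambda>x. f (inv_into U \<phi> (\<phi> (inv_into V \<psi> x)))"])
           (use WU invV inv in auto)
    qed
    then show "smooth_fun_on A W f" unfolding smooth_fun_on_def by auto
  qed
qed

lemma param_exists: "\<exists>B P x. param A B P \<and> x \<in> B \<and> P x = p"
proof -
  have "p \<in> (\<Union>(U, \<phi>)\<in>A. U)" using atlas[unfolded complex_atlas_def, THEN conjunct1] by simp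
  then obtain U \<phi> where U: "(U, \<phi>) \<in> A" "p \<in> U" by auto
  then show ?thesis
    using chart_param[OF U(1)] chart_homeo(4)[OF U(1)] by (metis imageI inv_into_f_f)
qed

end

section \<open>Tangent vectors and vector fields in a parametrization\<close>

text \<open>The differential of P at x applied to w, as a derivation. The value 0 on functions that
  are not smooth matches the normalization in \<open>tangent_space\<close>.\<close>

definition push_vec ::
    "('a::topological_space, 'n::finite) atlas \<Rightarrow> (complex ^ 'n \<Rightarrow> 'a) \<Rightarrow> complex ^ 'n \<Rightarrow> complex ^ 'n \<Rightarrow> 'a tvec" where
  "push_vec A P x w = (\<lambda>f. if smooth_fun_at A (P x) f then dd (\<lambda>z. f (P z)) w x else 0)"

text \<open>Inverse of the differential of P: a tangent vector is evaluated on the coordinate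
  functions.\<close>

definition coords :: "(complex ^ 'n::finite) set \<Rightarrow> (complex ^ 'n \<Rightarrow> 'a) \<Rightarrow> 'a tvec \<Rightarrow> complex ^ 'n" where
  "coords B P v = (\<Sum>b\<in>Basis. v (\<lambda>q. inv_into B P q \<bullet> b) *\<^sub>R b)"

lemma coords_inner: "b \<in> Basis \<Longrightarrow> coords B P v \<bullet> b = v (\<lambda>q. inv_into B P q \<bullet> b)"
  by (simp add: coords_def inner_sum_left inner_Basis if_distrib sum.delta cong: if_cong)

lemma smooth_fun_at_param:
  assumes P: "param A B P" and x: "x \<in> B"
  shows "smooth_fun_at A (P x) f \<longleftrightarrow> (\<exists>N. open N \<and> x \<in> N \<and> N \<subseteq> B \<and> Cinf_on N (\<lambda>z. f (P z)))"
proof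
  assume "smooth_fun_at A (P x) f"
  then obtain W where "open W" "P x \<in> W" "smooth_fun_on A W f" unfolding smooth_fun_at_def by auto
  then show "\<exists>N. open N \<and> x \<in> N \<and> N \<subseteq> B \<and> Cinf_on N (\<lambda>z. f (P z))"
    using x param_smooth[OF P] param_open_vimage[OF P] by (intro exI[of _ "B \<inter> P -` W"]) auto
next
  assume "\<exists>N. open N \<and> x \<in> N \<and> N \<subseteq> B \<and> Cinf_on N (\<lambda>z. f (P z))"
  then obtain N where N: "open N" "x \<in> N" "N \<subseteq> B" "Cinf_on N (\<lambda>z. f (P z))" by auto
  have "B \<inter> P -` P ` N = N" using N(3) param_inj[OF P] by (auto simp: inj_on_def)
  then have "smooth_fun_on A (P ` N) f"
    using N by (intro param_smoothI[OF P param_open_image[OF P]]) auto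
  then show "smooth_fun_at A (P x) f"
    using N param_open_image[OF P N(3,1)] unfolding smooth_fun_at_def by blast
qed

lemma smooth_fun_at_pair:
  assumes P: "param A B P" and x: "x \<in> B" and "smooth_fun_at A (P x) f" "smooth_fun_at A (P x) g"
  obtains N where "open N" "x \<in> N" "N \<subseteq> B" "Cinf_on N (\<lambda>z. f (P z))" "Cinf_on N (\<lambda>z. g (P z))"
proof -
  obtain N1 where N1: "open N1" "x \<in> N1" "N1 \<subseteq> B" "Cinf_on N1 (\<lambda>z. f (P z))"
    using assms(3) smooth_fun_at_param[OF P x] by blast
  obtain N2 where N2: "open N2" "x \<in> N2" "N2 \<subseteq> B" "Cinf_on N2 (\<lambda>z. g (P z))"
    using assms(4) smooth_fun_at_param[OF P x] by blast
  show thesis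
    by (rule that[of "N1 \<inter> N2"]) (use N1 N2 in \<open>auto intro: Cinf_on_subset\<close>)
qed

lemma push_vec_tangent:
  assumes P: "param A B P" and x: "x \<in> B"
  shows "push_vec A P x w \<in> tangent_space A (P x)"
proof -
  let ?s = "smooth_fun_at A (P x)"
  have 1: "push_vec A P x w (f + g) = push_vec A P x w f + push_vec A P x w g \<and>
    push_vec A P x w (f * g) = push_vec A P x w f * g (P x) + f (P x) * push_vec A P x w g \<and>
    ((\<forall>\<^sub>F q in nhds (P x). f q = g q) \<longrightarrow> push_vec A P x w f = push_vec A P x w g)"
    if fg: "?s f" "?s g" for f g
  proof -
    obtain N where N: "open N" "x \<in> N" "N \<subseteq> B" "Cinf_on N (\<lambda>z. f (P z))" "Cinf_on N (\<lambda>z. g (P z))"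
      using smooth_fun_at_pair[OF P x fg] by blast
    note df = Cinf_on_has_derivative[OF N(4,2)] and dg = Cinf_on_has_derivative[OF N(5,2)]
    have "?s (f + g)" "?s (f * g)"
      using N Cinf_on_add[OF N(1,4,5)] Cinf_on_mult[OF N(1,4,5)]
      by (auto simp: smooth_fun_at_param[OF P x] plus_fun_def times_fun_def)
    moreover have "dd (\<lambda>z. f (P z) + g (P z)) w x = dd (\<lambda>z. f (P z)) w x + dd (\<lambda>z. g (P z)) w x"
      by (rule dd_eqI) (rule has_derivative_add[OF df dg])
    moreover have "dd (\<lambda>z. f (P z) * g (P z)) w x = f (P x) * dd (\<lambda>z. g (P z)) w x + dd (\<lambda>z. f (P z)) w x * g (P x)"
      by (rule dd_eqI) (rule has_derivative_mult[OF df dg])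
    moreover have "dd (\<lambda>z. f (P z)) w x = dd (\<lambda>z. g (P z)) w x" if ev: "\<forall>\<^sub>F q in nhds (P x). f q = g q"
    proof -
      obtain W where "open W" "P x \<in> W" "\<And>q. q \<in> W \<Longrightarrow> f q = g q"
        using ev by (auto simp: eventually_nhds)
      then show ?thesis
        using x by (intro dd_cong[OF param_open_vimage[OF P]]) auto
    qed
    ultimately show ?thesis using fg by (simp add: push_vec_def plus_fun_def times_fun_def)
  qed
  have 2: "push_vec A P x w (\<lambda>q. c * f q) = c * push_vec A P x w f" if f: "?s f" for c f
  proof -
    obtain N where N: "open N" "x \<in> N" "N \<subseteq> B" "Cinf_on N (\<lambda>z. f (P z))"
      using f smooth_fun_at_param[OF P x] by blast
    have "?s (\<lambda>q. c * f q)"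
      using N Cinf_on_mult[OF N(1) Cinf_on_const N(4)] by (auto simp: smooth_fun_at_param[OF P x])
    moreover have "dd (\<lambda>z. c * f (P z)) w x = c * dd (\<lambda>z. f (P z)) w x"
      by (rule dd_eqI) (rule has_derivative_mult_right[OF Cinf_on_has_derivative[OF N(4,2)]])
    ultimately show ?thesis using f by (simp add: push_vec_def)
  qed
  have 3: "\<forall>f. \<not> ?s f \<longrightarrow> push_vec A P x w f = 0" by (simp add: push_vec_def)
  show ?thesis
    unfolding tangent_space_def
    by (rule CollectI, rule conjI, intro allI impI, rule 1, assumption+, rule conjI, intro allI impI, rule 2, assumption, rule 3)
qed

lemma push_vec_linear:
  assumes P: "param A B P" and x: "x \<in> B"
  shows "push_vec A P x (v + w) = push_vec A P x v + push_vec A P x w"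
    "push_vec A P x (c *\<^sub>R w) = c *\<^sub>T push_vec A P x w"
proof -
  have lin: "linear (\<lambda>w. dd (\<lambda>z. f (P z)) w x)" if "smooth_fun_at A (P x) f" for f
    using that unfolding smooth_fun_at_param[OF P x]
    by (auto intro: dd_linear Cinf_on_differentiable)
  show "push_vec A P x (v + w) = push_vec A P x v + push_vec A P x w"
    by (auto simp: push_vec_def fun_eq_iff linear_add[OF lin])
  show "push_vec A P x (c *\<^sub>R w) = c *\<^sub>T push_vec A P x w"
    by (auto simp: push_vec_def fun_eq_iff linear_cmul[OF lin])
qed

lemma push_vec_zero: "param A B P \<Longrightarrow> x \<in> B \<Longrightarrow> push_vec A P x 0 = 0"
  using push_vec_linear(2)[of A B P x 0 0] by (simp add: zero_fun_def)

lemma coordinate_smooth: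
  assumes P: "param A B P"
  shows "smooth_fun_on A (P ` B) (\<lambda>q. inv_into B P q \<bullet> b)"
proof (rule param_smoothI[OF P param_open_range[OF P]])
  have "Cinf_on B (\<lambda>x. x \<bullet> b)" by (rule Cinf_on_inner[OF param_open[OF P] Cinf_on_id Cinf_on_const])
  moreover have "B \<inter> P -` P ` B = B" by auto
  ultimately show "Cinf_on (B \<inter> P -` P ` B) (\<lambda>x. inv_into B P (P x) \<bullet> b)"
    by (subst Cinf_on_cong[of _ _ "\<lambda>x. x \<bullet> b"]) (auto simp: param_inv[OF P] param_open[OF P])
qed simp

lemma coordinate_smooth_at:
  assumes P: "param A B P" and x: "x \<in> B"
  shows "smooth_fun_at A (P x) (\<lambda>q. inv_into B P q \<bullet> b)"
  using coordinate_smooth[OF P] param_open_range[OF P] x unfolding smooth_fun_at_def by blast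

lemma push_vec_coordinate:
  assumes P: "param A B P" and x: "x \<in> B"
  shows "push_vec A P x w (\<lambda>q. inv_into B P q \<bullet> b) = w \<bullet> b"
proof -
  have "dd (\<lambda>z. inv_into B P (P z) \<bullet> b) w x = dd (\<lambda>z. z \<bullet> b) w x"
    by (rule dd_cong[OF param_open[OF P] x]) (simp add: param_inv[OF P])
  also have "\<dots> = w \<bullet> b" by (rule dd_eqI) (auto intro!: derivative_eq_intros)
  finally show ?thesis by (simp add: push_vec_def coordinate_smooth_at[OF P x])
qed

lemma coords_push_vec: "param A B P \<Longrightarrow> x \<in> B \<Longrightarrow> coords B P (push_vec A P x w) = w"
  by (simp add: coords_def push_vec_coordinate euclidean_representation)

lemma push_vec_inject: "param A B P \<Longrightarrow> x \<in> B \<Longrightarrow> push_vec A P x v = push_vec A P x w \<longleftrightarrow> v = w"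
  using coords_push_vec by metis

text \<open>Every derivation comes from a coordinate vector. By Hadamard's lemma a smooth f is near
  P x a constant plus products of a coordinate function vanishing at P x with a smooth function, and
  the Leibniz rule keeps only the derivative of the first factor.\<close>

lemma push_vec_coords:
  fixes A :: "('a::topological_space, 'n::finite) atlas"
  assumes P: "param A B P" and x: "x \<in> B" and v: "v \<in> tangent_space A (P x)"
  shows "push_vec A P x (coords B P v) = v"
proof
  fix f
  let ?s = "smooth_fun_at A (P x)"
  let ?co = "\<lambda>b q. inv_into B P q \<bullet> b"
  have T: "\<forall>f g. ?s f \<longrightarrow> ?s g \<longrightarrow> v (\<lambda>q. f q + g q) = v f + v g \<and> v (\<lambda>q. f q * g q) = v f * g (P x) + f (P x) * v g \<and>
      ((\<forall>\<^sub>F q in nhds (P x). f q = g q) \<longrightarrow> v f = v g)"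
    and T': "\<forall>c f. ?s f \<longrightarrow> v (\<lambda>q. c * f q) = c * v f"
    using v unfolding tangent_space_def plus_fun_def times_fun_def mem_Collect_eq by (rule conjunct1, blast)
  have add: "v (\<lambda>q. f q + g q) = v f + v g" and mult: "v (\<lambda>q. f q * g q) = v f * g (P x) + f (P x) * v g"
    and germ: "(\<forall>\<^sub>F q in nhds (P x). f q = g q) \<Longrightarrow> v f = v g" and scale: "v (\<lambda>q. c * f q) = c * v f"
    if "?s f" "?s g" for f g c
    using T[rule_format, OF that] T'[rule_format, OF that(1)] by auto
  have s_add: "?s (\<lambda>q. f q + g q)" and s_mult: "?s (\<lambda>q. f q * g q)" if fg: "?s f" "?s g" for f g
  proof -
    obtain N where N: "open N" "x \<in> N" "N \<subseteq> B" "Cinf_on N (\<lambda>z. f (P z))" "Cinf_on N (\<lambda>z. g (P z))"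
      using smooth_fun_at_pair[OF P x fg] by blast
    show "?s (\<lambda>q. f q + g q)" "?s (\<lambda>q. f q * g q)"
      using N Cinf_on_add[OF N(1,4,5)] Cinf_on_mult[OF N(1,4,5)] by (auto simp: smooth_fun_at_param[OF P x])
  qed
  have s_const: "?s (\<lambda>q. c)" for c
    unfolding smooth_fun_at_param[OF P x] using x param_open[OF P] Cinf_on_const by blast
  have v_const: "v (\<lambda>q. c) = 0" for c
  proof -
    have "v (\<lambda>q. 1 :: real) = 0" using mult[OF s_const[of 1] s_const[of 1]] by simp
    then show ?thesis using scale[OF s_const[of 1] s_const[of 1], of c] by simp
  qed
  have sum: "?s (\<lambda>q. \<Sum>b\<in>K. F b q) \<and> v (\<lambda>q. \<Sum>b\<in>K. F b q) = (\<Sum>b\<in>K. v (F b))"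
    if "finite K" "\<And>b. b \<in> K \<Longrightarrow> ?s (F b)" for F :: "complex ^ 'n \<Rightarrow> 'a \<Rightarrow> real" and K
    using that
  proof (induction K)
    case (insert b K)
    then show ?case using s_add[of "F b" "\<lambda>q. \<Sum>b\<in>K. F b q"] add[of "F b" "\<lambda>q. \<Sum>b\<in>K. F b q"] by simp
  qed (simp add: s_const v_const)
  show "push_vec A P x (coords B P v) f = v f"
  proof (cases "?s f")
    case False
    then show ?thesis using v by (simp add: push_vec_def tangent_space_def)
  next
    case f: True
    obtain N where N: "open N" "x \<in> N" "N \<subseteq> B" "Cinf_on N (\<lambda>z. f (P z))"
      using f smooth_fun_at_param[OF P x] by blast
    obtain r where r: "r > 0" "ball x r \<subseteq> N" using N(1,2) openE by blast
    obtain h where h0: "(\<forall>b. Cinf_on (ball x r) (h b)) \<and> (\<forall>b. h b x = dd (\<lambda>z. f (P z)) b x) \<and>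
      (\<forall>z\<in>ball x r. f (P z) = f (P x) + (\<Sum>b\<in>Basis. ((z - x) \<bullet> b) * h b z))"
      using hadamard[OF Cinf_on_subset[OF N(4) r(2)] r(1)] by (rule exE)
    have h: "Cinf_on (ball x r) (h b)" "h b x = dd (\<lambda>z. f (P z)) b x" for b
      using h0 by auto
    have h3: "f (P z) = f (P x) + (\<Sum>b\<in>Basis. ((z - x) \<bullet> b) * h b z)" if "z \<in> ball x r" for z
      using h0 that by blast
    define H where "H b q = h b (inv_into B P q)" for b q
    define G where "G b q = (?co b q + - (x \<bullet> b)) * H b q" for b q
    have rB: "ball x r \<subseteq> B" using r N by auto
    have sH: "?s (H b)" for b
      unfolding smooth_fun_at_param[OF P x]
    proof (intro exI[of _ "ball x r"] conjI)
      show "Cinf_on (ball x r) (\<lambda>z. H b (P z))"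
        using h(1)[of b] rB by (subst Cinf_on_cong[of _ _ "h b"]) (auto simp: H_def param_inv[OF P] subset_iff)
    qed (use r rB in auto)
    have sco: "?s (\<lambda>q. ?co b q + - (x \<bullet> b))" for b
      using s_add[OF coordinate_smooth_at[OF P x, of b] s_const] .
    have sG: "?s (G b)" for b unfolding G_def using s_mult[OF sco sH] .
    have vG: "v (G b) = v (?co b) * h b x" for b
    proof -
      have "v (G b) = v (\<lambda>q. ?co b q + - (x \<bullet> b)) * H b (P x) + (?co b (P x) + - (x \<bullet> b)) * v (H b)"
        unfolding G_def using mult[OF sco sH] .
      also have "v (\<lambda>q. ?co b q + - (x \<bullet> b)) = v (?co b)"
        using add[OF coordinate_smooth_at[OF P x, of b] s_const[of "- (x \<bullet> b)"]] by (simp add: v_const)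
      finally show ?thesis by (simp add: H_def param_inv[OF P x])
    qed
    have "\<forall>\<^sub>F q in nhds (P x). f q = f (P x) + (\<Sum>b\<in>Basis. G b q)"
      unfolding eventually_nhds
    proof (intro exI[of _ "P ` ball x r"] conjI ballI)
      show "open (P ` ball x r)" using param_open_image[OF P rB] by simp
      fix q assume "q \<in> P ` ball x r"
      then obtain z where z: "z \<in> ball x r" "q = P z" by auto
      then show "f q = f (P x) + (\<Sum>b\<in>Basis. G b q)"
        using h3[OF z(1)] rB by (auto simp: G_def H_def param_inv[OF P] inner_diff_left)
    qed (use r in auto)
    moreover have "?s (\<lambda>q. f (P x) + (\<Sum>b\<in>Basis. G b q))"
      using s_add[OF s_const] sum[of Basis G] sG by simp
    ultimately have "v f = v (\<lambda>q. f (P x) + (\<Sum>b\<in>Basis. G b q))" by (intro germ[OF f])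
    also have "\<dots> = (\<Sum>b\<in>Basis. v (?co b) * h b x)"
      using add[OF s_const, of "\<lambda>q. \<Sum>b\<in>Basis. G b q" "f (P x)"] sum[of Basis G] sG by (simp add: v_const vG)
    also have "\<dots> = (\<Sum>b\<in>Basis. (coords B P v \<bullet> b) *\<^sub>R dd (\<lambda>z. f (P z)) b x)"
      by (simp add: coords_inner h(2))
    also have "\<dots> = dd (\<lambda>z. f (P z)) (coords B P v) x"
      by (rule linear_expand[symmetric, OF dd_linear[OF Cinf_on_differentiable[OF N(4,2)]]])
    finally show ?thesis using f by (simp add: push_vec_def)
  qed
qed

lemma push_vec_field:
  assumes P: "param A B P" and W: "open W" "W \<subseteq> P ` B" and \<xi>: "Cinf_on (B \<inter> P -` W) \<xi>"
  shows "vector_field_on A W (\<lambda>q. push_vec A P (inv_into B P q) (\<xi> (inv_into B P q)))"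
  unfolding vector_field_on_def
proof (intro conjI ballI allI impI)
  fix q assume "q \<in> W"
  then obtain x where x: "x \<in> B" "q = P x" using W by auto
  then show "push_vec A P (inv_into B P q) (\<xi> (inv_into B P q)) \<in> tangent_space A q"
    using push_vec_tangent[OF P x(1)] by (simp add: param_inv[OF P])
next
  fix W' f assume W': "open W'" "W' \<subseteq> W" "smooth_fun_on A W' f"
  let ?N = "B \<inter> P -` W'"
  have N: "open ?N" "Cinf_on ?N (\<lambda>x. f (P x))"
    using param_open_vimage[OF P W'(1)] param_smooth[OF P W'(1,3)] by auto
  have "Cinf_on ?N (\<lambda>x. dd (\<lambda>z. f (P z)) (\<xi> x) x)"
    by (rule Cinf_on_linear_apply[OF N(1) dd_linear[OF Cinf_on_differentiable[OF N(2)]] Cinf_on_dd[OF N(2)]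
          Cinf_on_subset[OF \<xi>]]) (use W' in auto)
  moreover have "push_vec A P (inv_into B P (P x)) (\<xi> (inv_into B P (P x))) f = dd (\<lambda>z. f (P z)) (\<xi> x) x"
    if "x \<in> ?N" for x
  proof -
    have "smooth_fun_at A (P x) f" using that W' unfolding smooth_fun_at_def by blast
    then show ?thesis using that by (simp add: push_vec_def param_inv[OF P])
  qed
  ultimately have "Cinf_on ?N (\<lambda>x. push_vec A P (inv_into B P (P x)) (\<xi> (inv_into B P (P x))) f)"
    by (subst Cinf_on_cong[OF N(1)])
  then show "smooth_fun_on A W' (\<lambda>q. push_vec A P (inv_into B P q) (\<xi> (inv_into B P q)) f)"
    using W' W by (intro param_smoothI[OF P W'(1)]) auto
qed

lemma vector_field_coords_smooth:
  fixes A :: "('a::topological_space, 'n::finite) atlas"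
  assumes P: "param A B P" and W: "open W" and X: "vector_field_on A W X"
  shows "Cinf_on (B \<inter> P -` W) (\<lambda>x. coords B P (X (P x)))"
proof (rule Cinf_on_componentwise[OF param_open_vimage[OF P W]])
  fix b :: "complex ^ 'n" assume b: "b \<in> Basis"
  have "open (W \<inter> P ` B)" using W param_open_range[OF P] by auto
  moreover have "smooth_fun_on A (W \<inter> P ` B) (\<lambda>p. X p (\<lambda>q. inv_into B P q \<bullet> b))"
    using X[unfolded vector_field_on_def, THEN conjunct2, rule_format, OF \<open>open (W \<inter> P ` B)\<close> Int_lower1
        smooth_fun_on_subset[OF coordinate_smooth[OF P] Int_lower2]] .
  ultimately have "Cinf_on (B \<inter> P -` (W \<inter> P ` B)) (\<lambda>x. X (P x) (\<lambda>q. inv_into B P q \<bullet> b))"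
    using param_smooth[OF P] by blast
  then show "Cinf_on (B \<inter> P -` W) (\<lambda>x. coords B P (X (P x)) \<bullet> b)"
    unfolding coords_inner[OF b] by (rule Cinf_on_subset) auto
qed

lemma vector_field_on_subset: "vector_field_on A W X \<Longrightarrow> W' \<subseteq> W \<Longrightarrow> vector_field_on A W' X"
  unfolding vector_field_on_def by (auto dest: order_trans)

lemma vector_field_tangent: "vector_field_on A W X \<Longrightarrow> p \<in> W \<Longrightarrow> X p \<in> tangent_space A p"
  by (simp add: vector_field_on_def)

lemma Ck_on_linear_comp:
  assumes "open S" "bounded_linear L" "Ck_on k S f"
  shows "Ck_on k S (\<lambda>x. L (f x))"
  using assms(3)
proof (induction k arbitrary: f)
  case 0
  then show ?case using bounded_linear.continuous_on[OF assms(2)] by simp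
next
  case (Suc k)
  show ?case
  proof (rule Ck_on_SucI[OF assms(1)])
    show "((\<lambda>x. L (f x)) has_derivative (\<lambda>v. L (dd f v x))) (at x)" if "x \<in> S" for x
      by (rule bounded_linear.has_derivative[OF assms(2) Ck_on_has_derivative[OF Suc.prems that]])
  qed (use Suc in auto)
qed

lemma Cinf_on_linear_comp: "open S \<Longrightarrow> bounded_linear L \<Longrightarrow> Cinf_on S f \<Longrightarrow> Cinf_on S (\<lambda>x. L (f x))"
  by (simp add: Cinf_on_def Ck_on_linear_comp)

lemma Cinf_on_Pair:
  fixes f :: "'b::real_normed_vector \<Rightarrow> 'c::real_normed_vector" and g :: "'b \<Rightarrow> 'd::real_normed_vector"
  assumes "open S" "Cinf_on S f" "Cinf_on S g"
  shows "Cinf_on S (\<lambda>x. (f x, g x))"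
proof -
  have "Cinf_on S (\<lambda>x. (f x, 0 :: 'd) + (0 :: 'c, g x))"
    by (intro Cinf_on_add[OF assms(1)] Cinf_on_linear_comp[OF assms(1) _ assms(2), of "\<lambda>x. (x, 0)"]
        Cinf_on_linear_comp[OF assms(1) _ assms(3), of "\<lambda>x. (0, x)"] bounded_linear_Pair
        bounded_linear_ident bounded_linear_zero)
  then show ?thesis by simp
qed

section \<open>Connections in a parametrization\<close>

lemma smooth_fun_on_const: "smooth_fun_on A U (\<lambda>p. c)"
  by (auto simp: smooth_fun_on_def Cinf_on_const)

lemma connectionD:
  assumes "connection A D" "open U" "vector_field_on A U Y"
  shows "vector_field_on A U Z \<Longrightarrow> vector_field_on A U (\<lambda>p. D p (Z p) Y)"
    and "p \<in> U \<Longrightarrow> v \<in> tangent_space A p \<Longrightarrow> D p v Y \<in> tangent_space A p"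
    and "p \<in> U \<Longrightarrow> v \<in> tangent_space A p \<Longrightarrow> w \<in> tangent_space A p \<Longrightarrow> D p (v + w) Y = D p v Y + D p w Y"
    and "p \<in> U \<Longrightarrow> v \<in> tangent_space A p \<Longrightarrow> D p (c *\<^sub>T v) Y = c *\<^sub>T D p v Y"
    and "p \<in> U \<Longrightarrow> v \<in> tangent_space A p \<Longrightarrow> vector_field_on A U Z \<Longrightarrow> D p v (Y + Z) = D p v Y + D p v Z"
    and "p \<in> U \<Longrightarrow> v \<in> tangent_space A p \<Longrightarrow> smooth_fun_on A U h \<Longrightarrow>
      D p v (\<lambda>q. h q *\<^sub>T Y q) = v h *\<^sub>T Y p + h p *\<^sub>T D p v Y"
    and "p \<in> U \<Longrightarrow> v \<in> tangent_space A p \<Longrightarrow> vector_field_on A U Z \<Longrightarrow> (\<And>q. q \<in> U \<Longrightarrow> Y q = Z q) \<Longrightarrow>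
      D p v Y = D p v Z"
proof -
  have all: "vector_field_on A U (\<lambda>p. D p (Z p) Y) \<and>
        (\<forall>p\<in>U. \<forall>v\<in>tangent_space A p. \<forall>w\<in>tangent_space A p. \<forall>c.
           D p v Y \<in> tangent_space A p \<and>
           D p (v + w) Y = D p v Y + D p w Y \<and>
           D p (c *\<^sub>T v) Y = c *\<^sub>T D p v Y \<and>
           D p v (Y + Z) = D p v Y + D p v Z \<and>
           D p v (\<lambda>q. h q *\<^sub>T Y q) = v h *\<^sub>T Y p + h p *\<^sub>T D p v Y \<and>
           ((\<forall>q\<in>U. Y q = Z q) \<longrightarrow> D p v Y = D p v Z))"
    if "vector_field_on A U Z" "smooth_fun_on A U h" for Z h
    using assms(1)[unfolded connection_def, rule_format, OF assms(2,3) that] by blast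
  note Y = all[OF assms(3) smooth_fun_on_const[of A U 0]]
  show "vector_field_on A U Z \<Longrightarrow> vector_field_on A U (\<lambda>p. D p (Z p) Y)"
    using all[OF _ smooth_fun_on_const[of A U 0], of Z] by blast
  show "p \<in> U \<Longrightarrow> v \<in> tangent_space A p \<Longrightarrow> D p v Y \<in> tangent_space A p" using Y by blast
  show "p \<in> U \<Longrightarrow> v \<in> tangent_space A p \<Longrightarrow> w \<in> tangent_space A p \<Longrightarrow> D p (v + w) Y = D p v Y + D p w Y"
    using Y by blast
  show "p \<in> U \<Longrightarrow> v \<in> tangent_space A p \<Longrightarrow> D p (c *\<^sub>T v) Y = c *\<^sub>T D p v Y" using Y by blast
  show "p \<in> U \<Longrightarrow> v \<in> tangent_space A p \<Longrightarrow> vector_field_on A U Z \<Longrightarrow> D p v (Y + Z) = D p v Y + D p v Z"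
    using all[OF _ smooth_fun_on_const[of A U 0], of Z] by blast
  show "p \<in> U \<Longrightarrow> v \<in> tangent_space A p \<Longrightarrow> smooth_fun_on A U h \<Longrightarrow>
      D p v (\<lambda>q. h q *\<^sub>T Y q) = v h *\<^sub>T Y p + h p *\<^sub>T D p v Y"
    using all[OF assms(3), of h] by blast
  show "p \<in> U \<Longrightarrow> v \<in> tangent_space A p \<Longrightarrow> vector_field_on A U Z \<Longrightarrow> (\<And>q. q \<in> U \<Longrightarrow> Y q = Z q) \<Longrightarrow>
      D p v Y = D p v Z"
    using all[OF _ smooth_fun_on_const[of A U 0], of Z] by blast
qed

text \<open>A coordinate vector field of P: its components are the constant w.\<close>

definition cfield ::
    "('a::topological_space, 'n::finite) atlas \<Rightarrow> (complex ^ 'n) set \<Rightarrow> (complex ^ 'n \<Rightarrow> 'a) \<Rightarrow> complex ^ 'n \<Rightarrow> 'a \<Rightarrow> 'a tvec" where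
  "cfield A B P w = (\<lambda>q. push_vec A P (inv_into B P q) w)"

definition christoffel ::
    "('a::topological_space, 'n::finite) atlas \<Rightarrow> 'a connection \<Rightarrow> (complex ^ 'n) set \<Rightarrow> (complex ^ 'n \<Rightarrow> 'a) \<Rightarrow>
     complex ^ 'n \<Rightarrow> complex ^ 'n \<Rightarrow> complex ^ 'n \<Rightarrow> complex ^ 'n" where
  "christoffel A D B P x a w = coords B P (D (P x) (push_vec A P x a) (cfield A B P w))"

lemma coords_add: "coords B P (v + w) = coords B P v + coords B P w"
  by (simp add: coords_def sum.distrib scaleR_add_left)
lemma coords_tscale: "coords B P (c *\<^sub>T v) = c *\<^sub>R coords B P v"
  by (simp add: coords_def scaleR_sum_right)
lemma coords_zero: "coords B P 0 = 0"
  by (simp add: coords_def)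
lemma push_vec_sub:
  assumes "param A B P" "x \<in> B"
  shows "push_vec A P x (v - w) = push_vec A P x v - push_vec A P x w"
  using push_vec_linear(1)[OF assms, of "v - w" w] by simp

lemma push_vec_compose:
  assumes P: "param A B P" and \<kappa>: "\<kappa> differentiable (at z)" "\<kappa> z \<in> B"
  shows "push_vec A (\<lambda>x. P (\<kappa> x)) z w = push_vec A P (\<kappa> z) (dd \<kappa> w z)"
proof
  fix f
  show "push_vec A (\<lambda>x. P (\<kappa> x)) z w f = push_vec A P (\<kappa> z) (dd \<kappa> w z) f"
  proof (cases "smooth_fun_at A (P (\<kappa> z)) f")
    case True
    then obtain N where N: "\<kappa> z \<in> N" "Cinf_on N (\<lambda>z. f (P z))"
      unfolding smooth_fun_at_param[OF P \<kappa>(2)] by blast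
    have "((\<lambda>x. f (P (\<kappa> x))) has_derivative (\<lambda>w. dd (\<lambda>z. f (P z)) (dd \<kappa> w z) (\<kappa> z))) (at z)"
      using has_derivative_compose[OF \<kappa>(1)[unfolded frechet_derivative_works] Cinf_on_has_derivative[OF N(2,1)]] .
    then show ?thesis using True by (simp add: push_vec_def dd_eqI)
  qed (simp add: push_vec_def)
qed

lemma push_vec_cong:
  assumes "open N" "x \<in> N" "\<And>z. z \<in> N \<Longrightarrow> P z = P' z"
  shows "push_vec A P x w = push_vec A P' x w"
proof
  fix f :: "_ \<Rightarrow> real"
  have "dd (\<lambda>z. f (P z)) w x = dd (\<lambda>z. f (P' z)) w x"
    by (rule dd_cong[OF assms(1,2)]) (simp add: assms(3))
  then show "push_vec A P x w f = push_vec A P' x w f" using assms by (simp add: push_vec_def)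
qed

lemma cfield_vector_field: "param A B P \<Longrightarrow> vector_field_on A (P ` B) (cfield A B P w)"
  unfolding cfield_def by (rule push_vec_field[OF _ param_open_range]) (auto simp: Cinf_on_const)

lemma cfield_at: "param A B P \<Longrightarrow> x \<in> B \<Longrightarrow> cfield A B P w (P x) = push_vec A P x w"
  by (simp add: cfield_def param_inv)

locale connection_param =
  fixes A :: "('a::topological_space, 'n::finite) atlas" and D :: "'a connection"
    and B :: "(complex ^ 'n) set" and P :: "complex ^ 'n \<Rightarrow> 'a"
  assumes conn: "connection A D" and par: "param A B P"
begin

abbreviation pv where "pv \<equiv> push_vec A P"
abbreviation \<Gamma> where "\<Gamma> \<equiv> christoffel A D B P"
abbreviation X where "X \<equiv> cfield A B P"

lemmas pv_tangent = push_vec_tangent[OF par]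
lemmas oR = param_open_range[OF par]
lemmas Xvf = cfield_vector_field[OF par]

lemma D_X: "x \<in> B \<Longrightarrow> D (P x) (pv x a) (X w) = pv x (\<Gamma> x a w)"
  unfolding christoffel_def
  by (rule push_vec_coords[symmetric, OF par]) (auto intro!: connectionD(2)[OF conn oR Xvf] pv_tangent)

lemma \<Gamma>_linear1: assumes x: "x \<in> B" shows "linear (\<lambda>a. \<Gamma> x a w)"
proof (rule linearI)
  fix a b c
  show "\<Gamma> x (a + b) w = \<Gamma> x a w + \<Gamma> x b w"
    unfolding christoffel_def push_vec_linear(1)[OF par x]
    by (subst connectionD(3)[OF conn oR Xvf]) (use x in \<open>auto simp: pv_tangent coords_add\<close>)
  show "\<Gamma> x (c *\<^sub>R a) w = c *\<^sub>R \<Gamma> x a w"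
    unfolding christoffel_def push_vec_linear(2)[OF par x]
    by (subst connectionD(4)[OF conn oR Xvf]) (use x in \<open>auto simp: pv_tangent coords_tscale\<close>)
qed

lemma vector_field_cong:
  assumes "open W" "W \<subseteq> P ` B" "vector_field_on A W Y" "\<And>q. q \<in> W \<Longrightarrow> Y q = Z q"
  shows "vector_field_on A W Z"
  unfolding vector_field_on_def
proof (intro conjI ballI allI impI)
  show "Z p \<in> tangent_space A p" if "p \<in> W" for p
    using vector_field_tangent[OF assms(3) that] assms(4)[OF that] by simp
  fix W' f assume W': "open W'" "W' \<subseteq> W" "smooth_fun_on A W' f"
  have "smooth_fun_on A W' (\<lambda>p. Y p f)"
    using assms(3) W' unfolding vector_field_on_def by simp
  then have "Cinf_on (B \<inter> P -` W') (\<lambda>x. Y (P x) f)" by (rule param_smooth[OF par W'(1)])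
  then have "Cinf_on (B \<inter> P -` W') (\<lambda>x. Z (P x) f)"
    by (subst Cinf_on_cong[OF param_open_vimage[OF par W'(1)], of _ "\<lambda>x. Y (P x) f"])
       (use assms(4) W'(2) in auto)
  then show "smooth_fun_on A W' (\<lambda>p. Z p f)"
    using W' assms(2) by (intro param_smoothI[OF par]) auto
qed

lemma push_field:
  assumes "open W" "W \<subseteq> P ` B" "Cinf_on (B \<inter> P -` W) \<xi>" "\<And>x. x \<in> B \<Longrightarrow> P x \<in> W \<Longrightarrow> Z (P x) = pv x (\<xi> x)"
  shows "vector_field_on A W Z"
  by (rule vector_field_cong[OF assms(1,2) push_vec_field[OF par assms(1-3)]])
     (use assms(2,4) in \<open>auto simp: param_inv[OF par] image_subset_iff\<close>)

lemma pv_tscale: "x \<in> B \<Longrightarrow> c *\<^sub>T pv x w = pv x (c *\<^sub>R w)"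
  by (simp add: push_vec_linear(2)[OF par])

lemma D_zero: assumes "open W" "vector_field_on A W 0" "p \<in> W" "v \<in> tangent_space A p" shows "D p v 0 = 0"
  using connectionD(5)[OF conn assms(1,2,3,4,2)] by (simp only: add_0_right) simp

text \<open>The connection axioms handle one sum or one product at a time, so Y is rebuilt from
  functions times coordinate fields by induction over the index set. The right side carries the
  basis expansion of \<Gamma> because linearity of \<Gamma> in its last argument is itself deduced
  from this lemma.\<close>

lemma D_expand_basis:
  assumes W: "open W" "W \<subseteq> P ` B" and Y: "vector_field_on A W Y" and x: "x \<in> B" "P x \<in> W"
    and \<eta>: "\<And>z. \<eta> z = coords B P (Y (P z))"
  shows "D (P x) (pv x a) Y = pv x (dd \<eta> a x + (\<Sum>b\<in>Basis. (\<eta> x \<bullet> b) *\<^sub>R \<Gamma> x a b))"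
proof -
  let ?N = "B \<inter> P -` W"
  have oN: "open ?N" by (rule param_open_vimage[OF par W(1)])
  have \<eta>s: "Cinf_on ?N \<eta>"
    using vector_field_coords_smooth[OF par W(1) Y] by (simp add: \<eta>[abs_def])
  have hd: "(\<eta> has_derivative (\<lambda>v. dd \<eta> v x)) (at x)" by (rule Cinf_on_has_derivative[OF \<eta>s]) (use x in auto)
  define h where "h b q = \<eta> (inv_into B P q) \<bullet> b" for b q
  define YS where "YS K = (\<Sum>b\<in>K. (\<lambda>q. h b q *\<^sub>T X b q))" for K
  have YSx: "YS K (P z) = pv z (\<Sum>b\<in>K. (\<eta> z \<bullet> b) *\<^sub>R b)" if z: "z \<in> B" and K: "finite K" for K z
    using K
  proof (induction K)
    case (insert b K)
    have "YS (insert b K) (P z) = h b (P z) *\<^sub>T X b (P z) + YS K (P z)"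
      using insert by (simp add: YS_def)
    then show ?case
      using insert by (simp add: h_def param_inv[OF par z] cfield_at[OF par z] pv_tscale[OF z] push_vec_linear(1)[OF par z])
  qed (simp add: YS_def push_vec_zero[OF par z])
  have sm: "Cinf_on ?N (\<lambda>z. \<Sum>b\<in>K. (\<eta> z \<bullet> b) *\<^sub>R b)" for K
    by (intro Cinf_on_sum oN Cinf_on_scaleR[OF oN] Cinf_on_inner[OF oN] \<eta>s Cinf_on_const)
  have YSvf: "vector_field_on A W (YS K)" if "finite K" for K
    by (rule push_field[OF W sm YSx[OF _ that]])
  have hs: "smooth_fun_on A W (h b)" for b
  proof (rule param_smoothI[OF par W])
    have "Cinf_on ?N (\<lambda>z. \<eta> z \<bullet> b)" by (rule Cinf_on_inner[OF oN \<eta>s Cinf_on_const])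
    then show "Cinf_on ?N (\<lambda>z. h b (P z))"
      by (subst Cinf_on_cong[OF oN, of _ "\<lambda>z. \<eta> z \<bullet> b"]) (auto simp: h_def param_inv[OF par])
  qed
  have pvh: "pv x a (h b) = dd \<eta> a x \<bullet> b" for b
  proof -
    have "dd (\<lambda>z. h b (P z)) a x = dd (\<lambda>z. \<eta> z \<bullet> b) a x"
      by (rule dd_cong[OF param_open[OF par] x(1)]) (simp add: h_def param_inv[OF par])
    also have "\<dots> = dd \<eta> a x \<bullet> b"
      by (rule dd_eqI) (rule has_derivative_inner_left[OF hd])
    finally show ?thesis
      using W(1) x hs unfolding push_vec_def smooth_fun_at_def by auto
  qed
  have XW: "vector_field_on A W (X b)" for b using vector_field_on_subset[OF Xvf W(2)] .
  note vt = pv_tangent[OF x(1), of a]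
  have DS: "D (P x) (pv x a) (YS K) = pv x (\<Sum>b\<in>K. (dd \<eta> a x \<bullet> b) *\<^sub>R b + (\<eta> x \<bullet> b) *\<^sub>R \<Gamma> x a b)"
    if "finite K" for K
    using that
  proof (induction K)
    case empty
    have e: "YS {} = 0" by (simp add: YS_def)
    show ?case
      unfolding e sum.empty push_vec_zero[OF par x(1)]
      by (rule D_zero[OF W(1) _ x(2) vt]) (use YSvf[of "{}"] in \<open>simp only: e finite.emptyI\<close>)
  next
    case (insert b K)
    have vb: "vector_field_on A W (\<lambda>q. h b q *\<^sub>T X b q)"
      by (rule push_field[OF W, where \<xi> = "\<lambda>z. (\<eta> z \<bullet> b) *\<^sub>R b"])
         (auto simp: h_def param_inv[OF par] cfield_at[OF par] pv_tscale intro!: Cinf_on_scaleR[OF oN] Cinf_on_inner[OF oN] \<eta>s Cinf_on_const)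
    have "YS (insert b K) = (\<lambda>q. h b q *\<^sub>T X b q) + YS K" using insert by (simp add: YS_def)
    then have "D (P x) (pv x a) (YS (insert b K)) = D (P x) (pv x a) (\<lambda>q. h b q *\<^sub>T X b q) + D (P x) (pv x a) (YS K)"
      using connectionD(5)[OF conn W(1) vb x(2) vt YSvf[OF insert(1)]] by simp
    also have "D (P x) (pv x a) (\<lambda>q. h b q *\<^sub>T X b q) = pv x a (h b) *\<^sub>T X b (P x) + h b (P x) *\<^sub>T D (P x) (pv x a) (X b)"
      by (rule connectionD(6)[OF conn W(1) XW x(2) vt hs])
    also have "\<dots> = pv x ((dd \<eta> a x \<bullet> b) *\<^sub>R b) + pv x ((\<eta> x \<bullet> b) *\<^sub>R \<Gamma> x a b)"
      by (simp add: pvh h_def param_inv[OF par x(1)] D_X[OF x(1)] cfield_at[OF par x(1)] pv_tscale[OF x(1)])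
    finally show ?case using insert by (simp add: push_vec_linear(1)[OF par x(1)])
  qed
  have "D (P x) (pv x a) Y = D (P x) (pv x a) (YS Basis)"
  proof (rule connectionD(7)[OF conn W(1) Y x(2) vt YSvf])
    fix q assume q: "q \<in> W"
    then obtain z where z: "z \<in> B" "q = P z" using W(2) by auto
    have "Y q = pv z (\<eta> z)"
      unfolding \<eta> using push_vec_coords[OF par z(1)] vector_field_tangent[OF Y] q z(2) by simp
    then show "Y q = YS Basis q" using YSx[OF z(1), of Basis] z(2) by (simp add: euclidean_representation)
  qed simp
  then show ?thesis using DS[of Basis] by (simp add: sum.distrib euclidean_representation)
qed

lemma coords_X: "x \<in> B \<Longrightarrow> coords B P (X w (P x)) = w"
  by (simp add: cfield_at[OF par] coords_push_vec[OF par])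

lemma \<Gamma>_basis: assumes x: "x \<in> B" shows "\<Gamma> x a w = (\<Sum>b\<in>Basis. (w \<bullet> b) *\<^sub>R \<Gamma> x a b)"
proof -
  have "dd (\<lambda>z. coords B P (X w (P z))) a x = dd (\<lambda>z. w) a x"
    by (rule dd_cong[OF param_open[OF par] x]) (rule coords_X)
  then have "D (P x) (pv x a) (X w) = pv x (\<Sum>b\<in>Basis. (w \<bullet> b) *\<^sub>R \<Gamma> x a b)"
    using D_expand_basis[OF oR order_refl Xvf[of w] x imageI[OF x] refl, of a] by (simp add: coords_X[OF x])
  then show ?thesis unfolding D_X[OF x] push_vec_inject[OF par x] .
qed

lemma \<Gamma>_linear2: assumes x: "x \<in> B" shows "linear (\<Gamma> x a)"
proof (rule linearI)
  show "\<Gamma> x a (v + w) = \<Gamma> x a v + \<Gamma> x a w" for v w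
    unfolding \<Gamma>_basis[OF x, of a "v + w"] \<Gamma>_basis[OF x, of a v] \<Gamma>_basis[OF x, of a w]
    by (simp add: inner_add_left scaleR_add_left sum.distrib)
  show "\<Gamma> x a (c *\<^sub>R w) = c *\<^sub>R \<Gamma> x a w" for c w
    unfolding \<Gamma>_basis[OF x, of a "c *\<^sub>R w"] \<Gamma>_basis[OF x, of a w] by (simp add: scaleR_sum_right)
qed

lemma D_expand:
  assumes "open W" "W \<subseteq> P ` B" and Y: "vector_field_on A W Y" and x: "x \<in> B" "P x \<in> W"
    and \<eta>: "\<And>z. z \<in> B \<Longrightarrow> P z \<in> W \<Longrightarrow> Y (P z) = pv z (\<eta> z)"
  shows "D (P x) (pv x a) Y = pv x (dd \<eta> a x + \<Gamma> x a (\<eta> x))"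
proof -
  have c: "coords B P (Y (P z)) = \<eta> z" if "z \<in> B \<inter> P -` W" for z
    using \<eta>[of z] that by (simp add: coords_push_vec[OF par])
  have "dd (\<lambda>z. coords B P (Y (P z))) a x = dd \<eta> a x"
    by (rule dd_cong[OF param_open_vimage[OF par assms(1)] _ c]) (use x in auto)
  then show ?thesis
    using D_expand_basis[OF assms(1-5) refl, of a] c[of x] x by (simp add: \<Gamma>_basis[OF x(1), of a "\<eta> x"])
qed

lemma \<Gamma>_smooth: "Cinf_on B (\<lambda>x. \<Gamma> x a w)"
proof -
  have "vector_field_on A (P ` B) (\<lambda>p. D p (X a p) (X w))" by (rule connectionD(1)[OF conn oR Xvf Xvf])
  from vector_field_coords_smooth[OF par oR this]
  have "Cinf_on B (\<lambda>x. coords B P (D (P x) (X a (P x)) (X w)))"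
    by (rule Cinf_on_subset) auto
  then show ?thesis
    by (subst Cinf_on_cong[OF param_open[OF par], of _ "\<lambda>x. coords B P (D (P x) (X a (P x)) (X w))"])
       (auto simp: christoffel_def cfield_at[OF par])
qed

text \<open>Near x coordinate fields act as partial derivatives, and these commute.\<close>

lemma lie_bracket_X: assumes x: "x \<in> B" shows "lie_bracket A (X a) (X b) (P x) = 0"
proof
  fix f
  have "X a (P x) (\<lambda>q. X b q f) = X b (P x) (\<lambda>q. X a q f)" if f: "smooth_fun_at A (P x) f"
  proof -
    obtain N where N: "open N" "x \<in> N" "N \<subseteq> B" "Cinf_on N (\<lambda>z. f (P z))"
      using f smooth_fun_at_param[OF par x] by blast
    have 1: "X c (P z) f = dd (\<lambda>z. f (P z)) c z" if "z \<in> N" for z c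
    proof -
      have "z \<in> B" using that N by auto
      moreover have "smooth_fun_at A (P z) f" using that N smooth_fun_at_param[OF par \<open>z \<in> B\<close>] by blast
      ultimately show ?thesis by (simp add: cfield_at[OF par] push_vec_def)
    qed
    have 2: "X a (P x) (\<lambda>q. X b q f) = dd (dd (\<lambda>z. f (P z)) b) a x" for a b
    proof -
      have "Cinf_on N (\<lambda>z. X b (P z) f)"
        by (subst Cinf_on_cong[OF N(1) 1]) (auto intro: Cinf_on_dd[OF N(4)])
      then have "smooth_fun_at A (P x) (\<lambda>q. X b q f)"
        unfolding smooth_fun_at_param[OF par x] using N by blast
      then have "X a (P x) (\<lambda>q. X b q f) = dd (\<lambda>z. X b (P z) f) a x"
        by (simp add: cfield_at[OF par x] push_vec_def)
      also have "\<dots> = dd (dd (\<lambda>z. f (P z)) b) a x" by (rule dd_cong[OF N(1,2) 1])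
      finally show ?thesis .
    qed
    show ?thesis unfolding 2 by (rule dd_commute[OF N(1,4,2)])
  qed
  then show "lie_bracket A (X a) (X b) (P x) f = 0 f" by (simp add: lie_bracket_def)
qed

lemma \<Gamma>_symmetric:
  assumes "torsion_free A D" and x: "x \<in> B"
  shows "\<Gamma> x a b = \<Gamma> x b a"
proof -
  have "D (P x) (X a (P x)) (X b) - D (P x) (X b (P x)) (X a) = lie_bracket A (X a) (X b) (P x)"
    using assms(1)[unfolded torsion_free_def, rule_format, OF oR Xvf Xvf imageI[OF x]] .
  then show ?thesis
    by (simp add: lie_bracket_X[OF x] cfield_at[OF par x] D_X[OF x] push_vec_inject[OF par x])
qed

text \<open>Vanishing curvature on coordinate fields, whose brackets are 0. It provides the
  integrability condition of the linear systems for parallel frames and coframes.\<close>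

lemma \<Gamma>_flat:
  assumes "curvature_vanishes A D" and x: "x \<in> B"
  shows "dd (\<lambda>z. \<Gamma> z b w) a x + \<Gamma> x a (\<Gamma> x b w) = dd (\<lambda>z. \<Gamma> z a w) b x + \<Gamma> x b (\<Gamma> x a w)"
proof -
  have 1: "D (P x) (X a (P x)) (\<lambda>q. D q (X b q) (X w)) = pv x (dd (\<lambda>z. \<Gamma> z b w) a x + \<Gamma> x a (\<Gamma> x b w))" for a b
    unfolding cfield_at[OF par x]
    by (rule D_expand[OF oR order_refl connectionD(1)[OF conn oR Xvf Xvf] x imageI[OF x]])
       (simp add: cfield_at[OF par] D_X)
  have 2: "D (P x) (lie_bracket A (X a) (X b) (P x)) (X w) = 0"
    using connectionD(4)[OF conn oR Xvf imageI[OF x] pv_tangent[OF x], of 0 0 w]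
    unfolding lie_bracket_X[OF x] by (simp add: zero_fun_def)
  have "curvature A D (X a) (X b) (X w) (P x) = 0"
    using assms(1)[unfolded curvature_vanishes_def, rule_format, OF oR Xvf Xvf Xvf imageI[OF x]] .
  then show ?thesis
    unfolding curvature_def 1 2 by (simp add: push_vec_inject[OF par x])
qed

end

section \<open>Flat parametrizations\<close>

text \<open>Affine coordinates for D: all Christoffel symbols vanish.\<close>

definition flat_param ::
    "('a::topological_space, 'n::finite) atlas \<Rightarrow> 'a connection \<Rightarrow> (complex ^ 'n) set \<Rightarrow> (complex ^ 'n \<Rightarrow> 'a) \<Rightarrow> bool" where
  "flat_param A D B P \<longleftrightarrow> param A B P \<and> (\<forall>x\<in>B. \<forall>a w. D (P x) (push_vec A P x a) (cfield A B P w) = 0)"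

lemma flat_paramD: "flat_param A D B P \<Longrightarrow> param A B P"
  by (simp add: flat_param_def)

lemma flat_param_expand:
  assumes D: "connection A D" and P: "flat_param A D B P" and W: "open W" "W \<subseteq> P ` B"
    and Y: "vector_field_on A W Y" and x: "x \<in> B" "P x \<in> W"
    and \<eta>: "\<And>z. z \<in> B \<Longrightarrow> P z \<in> W \<Longrightarrow> Y (P z) = push_vec A P z (\<eta> z)"
  shows "D (P x) (push_vec A P x a) Y = push_vec A P x (dd \<eta> a x)"
proof -
  interpret connection_param A D B P using D flat_paramD[OF P] by unfold_locales
  have "\<Gamma> x a (\<eta> x) = 0" using P x(1) by (simp add: christoffel_def flat_param_def coords_zero)
  then show ?thesis using D_expand[OF W Y x \<eta>, of a] by simp
qed

text \<open>An affine change of coordinates multiplies components by the constant map L, so fields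
  with constant components keep constant components and remain parallel.\<close>

lemma flat_param_compose_affine:
  assumes D: "connection A D" and P: "flat_param A D B P"
    and L: "linear L" "linear L'" "\<And>x. L (L' x) = x" "\<And>x. L' (L x) = x"
    and B': "open B'" "\<And>x. x \<in> B' \<Longrightarrow> y0 + L (x - x0) \<in> B"
  shows "flat_param A D B' (\<lambda>x. P (y0 + L (x - x0)))"
proof -
  let ?k = "\<lambda>x. y0 + L (x - x0)"
  note par = flat_paramD[OF P]
  have bl: "bounded_linear L" "bounded_linear L'" using L linear_conv_bounded_linear by blast+
  have Lder: "(?k has_derivative L) (at x)" for x
    by (auto intro!: derivative_eq_intros bounded_linear.has_derivative[OF bl(1)])
  have dk: "dd ?k w x = L w" for w x using dd_eqI[OF Lder] .
  have inj: "inj_on ?k B'"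
  proof (rule inj_onI)
    fix x y assume "y0 + L (x - x0) = y0 + L (y - x0)"
    then have "L' (L (x - x0)) = L' (L (y - x0))" by simp
    then show "x = y" by (simp add: L(4))
  qed
  have smk: "Cinf_on S ?k" if "open S" for S
    by (intro Cinf_on_add[OF that] Cinf_on_const Cinf_on_linear_comp[OF that bl(1)] Cinf_on_diff[OF that] Cinf_on_id)
  have img: "?k ` B' = (\<lambda>y. x0 + L' (y - y0)) -` B'"
  proof
    show "?k ` B' \<subseteq> (\<lambda>y. x0 + L' (y - y0)) -` B'" using L(4) by auto
    show "(\<lambda>y. x0 + L' (y - y0)) -` B' \<subseteq> ?k ` B'"
    proof
      fix y assume "y \<in> (\<lambda>y. x0 + L' (y - y0)) -` B'"
      then show "y \<in> ?k ` B'" using L(3) by (intro image_eqI[of _ _ "x0 + L' (y - y0)"]) auto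
    qed
  qed
  have opk: "open (?k ` B')"
    unfolding img by (intro open_vimage B' continuous_intros bounded_linear.continuous_on[OF bl(2)])
  have inv: "inv_into B' ?k y = x0 + L' (y - y0)" if "y \<in> ?k ` B'" for y
  proof -
    obtain x where x: "x \<in> B'" "y = ?k x" using \<open>y \<in> ?k ` B'\<close> by auto
    show ?thesis unfolding x(2) inv_into_f_f[OF inj x(1)] by (simp add: L(4))
  qed
  have par': "param A B' (\<lambda>x. P (?k x))"
  proof (rule param_compose[OF par B'(1) _ inj opk smk[OF B'(1)]])
    show "?k ` B' \<subseteq> B" using B' by auto
    have "Cinf_on (?k ` B') (\<lambda>y. x0 + L' (y - y0))"
      by (intro Cinf_on_add[OF opk] Cinf_on_const Cinf_on_linear_comp[OF opk bl(2)] Cinf_on_diff[OF opk] Cinf_on_id)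
    then show "Cinf_on (?k ` B') (inv_into B' ?k)"
      by (subst Cinf_on_cong[OF opk inv])
  qed
  have pv: "push_vec A (\<lambda>x. P (?k x)) x w = push_vec A P (?k x) (L w)" if "x \<in> B'" for x w
    using push_vec_compose[OF par, of ?k x w] Lder B'(2)[OF that] by (auto simp: dk differentiable_def)
  show ?thesis
    unfolding flat_param_def
  proof (intro conjI par' ballI allI)
    fix x a w assume x: "x \<in> B'"
    let ?W = "(\<lambda>x. P (?k x)) ` B'"
    have "D (P (?k x)) (push_vec A P (?k x) (L a)) (cfield A B' (\<lambda>x. P (?k x)) w) = push_vec A P (?k x) (dd (\<lambda>z. L w) (L a) (?k x))"
    proof (rule flat_param_expand[OF D P param_open_range[OF par'] _ cfield_vector_field[OF par']])
      fix z assume z: "z \<in> B" "P z \<in> ?W"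
      then obtain x' where x': "x' \<in> B'" "P z = P (?k x')" by auto
      then have "z = ?k x'" using param_inj[OF par] z(1) B'(2) by (meson inj_onD)
      then show "cfield A B' (\<lambda>x. P (?k x)) w (P z) = push_vec A P z (L w)"
        using cfield_at[OF par' x'(1), of w] pv[OF x'(1)] by simp
    qed (use x B'(2) in auto)
    then show "D (P (?k x)) (push_vec A (\<lambda>x. P (?k x)) x a) (cfield A B' (\<lambda>x. P (?k x)) w) = 0"
      using push_vec_zero[OF par B'(2)[OF x]] by (simp add: pv[OF x])
  qed
qed

lemma flat_param_restrict:
  assumes "connection A D" "flat_param A D B P" "open B'" "B' \<subseteq> B"
  shows "flat_param A D B' P"
  using flat_param_compose_affine[OF assms(1,2), of "\<lambda>x. x" "\<lambda>x. x" B' 0 0] assms(3,4)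
  by (auto simp: linear_id[unfolded id_def])

lemma has_derivative_zero_on_convex:
  assumes "convex S" "open S" "\<And>x. x \<in> S \<Longrightarrow> (f has_derivative (\<lambda>v. 0)) (at x)" "x \<in> S" "y \<in> S"
  shows "f x = f y"
proof -
  have "\<exists>c. \<forall>x\<in>S. f x = c"
    by (rule has_derivative_zero_constant[OF assms(1)]) (use assms(3) has_derivative_at_withinI in blast)
  then show ?thesis using assms(4,5) by metis
qed

text \<open>In the coordinates of P' the parallel field \<open>cfield A B P w\<close> has components
  \<open>dd h w\<close>. Since covariant derivatives in flat coordinates are ordinary derivatives,
  these components are locally constant.\<close>

lemma transition_second_derivative:
  assumes D: "connection A D" and P: "flat_param A D B P" and P': "flat_param A D B' P'"
    and sub: "P ` B \<subseteq> P' ` B'"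
  defines "h \<equiv> \<lambda>x. inv_into B' P' (P x)"
  shows "Cinf_on B h" "\<And>x. x \<in> B \<Longrightarrow> h x \<in> B' \<and> P x = P' (h x)"
    "\<And>x w. x \<in> B \<Longrightarrow> push_vec A P x w = push_vec A P' (h x) (dd h w x)"
    "\<And>x w. x \<in> B \<Longrightarrow> (dd h w has_derivative (\<lambda>v. 0)) (at x)"
proof -
  note par = flat_paramD[OF P] and par' = flat_paramD[OF P']
  note oB = param_open[OF par]
  show hs: "Cinf_on B h"
  proof (rule Cinf_on_componentwise[OF oB])
    fix b :: "complex ^ 'b"
    have "smooth_fun_on A (P ` B) (\<lambda>q. inv_into B' P' q \<bullet> b)"
      by (rule smooth_fun_on_subset[OF coordinate_smooth[OF par'] sub])
    from param_smooth[OF par param_open_range[OF par] this]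
    show "Cinf_on B (\<lambda>x. h x \<bullet> b)" unfolding h_def by (rule Cinf_on_subset) auto
  qed
  have h: "h x \<in> B'" "P x = P' (h x)" if "x \<in> B" for x
    using that sub unfolding h_def by (auto simp: inv_into_into f_inv_into_f image_subset_iff)
  then show "\<And>x. x \<in> B \<Longrightarrow> h x \<in> B' \<and> P x = P' (h x)" by blast
  show pv: "push_vec A P x w = push_vec A P' (h x) (dd h w x)" if x: "x \<in> B" for x w
  proof -
    have "push_vec A P x w = push_vec A (\<lambda>x. P' (h x)) x w"
      by (rule push_vec_cong[OF oB x]) (rule h(2))
    also have "\<dots> = push_vec A P' (h x) (dd h w x)"
      by (rule push_vec_compose[OF par' Cinf_on_differentiable[OF hs x] h(1)[OF x]])
    finally show ?thesis .
  qed
  fix x w assume x: "x \<in> B"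
  let ?W = "P ` B" and ?N = "B' \<inter> P' -` P ` B"
  define \<eta> where "\<eta> z = dd h w (inv_into B P (P' z))" for z
  have vf: "vector_field_on A ?W (cfield A B P w)" by (rule cfield_vector_field[OF par])
  have \<eta>: "cfield A B P w (P' z) = push_vec A P' z (\<eta> z)" if z: "z \<in> B'" "P' z \<in> ?W" for z
  proof -
    obtain x' where x': "x' \<in> B" "P' z = P x'" using z(2) by auto
    then have "h x' = z" unfolding h_def by (metis param_inv[OF par' z(1)])
    then show ?thesis
      using cfield_at[OF par x'(1), of w] pv[OF x'(1), of w] by (simp add: \<eta>_def x'(2) param_inv[OF par x'(1)])
  qed
  have \<eta>s: "Cinf_on ?N \<eta>"
  proof -
    have "Cinf_on ?N (\<lambda>z. coords B' P' (cfield A B P w (P' z)))"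
      by (rule vector_field_coords_smooth[OF par' param_open_range[OF par] vf])
    then show ?thesis
      by (subst Cinf_on_cong[OF param_open_vimage[OF par' param_open_range[OF par]], of _ "\<lambda>z. coords B' P' (cfield A B P w (P' z))"])
         (auto simp: \<eta> coords_push_vec[OF par'])
  qed
  have dh: "(dd h w has_derivative (\<lambda>v. dd (dd h w) v x)) (at x)"
    by (rule Cinf_on_has_derivative[OF Cinf_on_dd[OF hs] x])
  have "(\<lambda>v. dd (dd h w) v x) = (\<lambda>v. 0)"
  proof
    fix v
    have "P' (h x) \<in> ?W" using h(2)[OF x] x by (metis imageI)
    then have hx: "h x \<in> ?N" using h(1)[OF x] by simp
    have "push_vec A P' (h x) (dd \<eta> (dd h v x) (h x)) = D (P' (h x)) (push_vec A P' (h x) (dd h v x)) (cfield A B P w)"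
      by (rule flat_param_expand[OF D P' param_open_range[OF par] sub vf h(1)[OF x] _ \<eta>, symmetric]) (use hx in auto)
    also have "\<dots> = D (P x) (push_vec A P x v) (cfield A B P w)" using h(2)[OF x] pv[OF x] by simp
    also have "\<dots> = 0" using P x by (simp add: flat_param_def)
    finally have z: "dd \<eta> (dd h v x) (h x) = 0"
      using push_vec_zero[OF par' h(1)[OF x]] push_vec_inject[OF par' h(1)[OF x]] by metis
    have "((\<lambda>z. \<eta> (h z)) has_derivative (\<lambda>v. dd \<eta> (dd h v x) (h x))) (at x)"
      by (rule has_derivative_compose[OF Cinf_on_has_derivative[OF hs x] Cinf_on_has_derivative[OF \<eta>s hx]])
    moreover have "dd (dd h w) v x = dd (\<lambda>z. \<eta> (h z)) v x"
    proof (rule dd_cong[OF oB x])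
      fix z assume z: "z \<in> B"
      have "inv_into B P (P' (h z)) = z" using h(2)[OF z] param_inv[OF par z] by simp
      then show "dd h w z = \<eta> (h z)" by (simp add: \<eta>_def)
    qed
    ultimately show "dd (dd h w) v x = 0" using z dd_eqI by metis
  qed
  then show "(dd h w has_derivative (\<lambda>v. 0)) (at x)" using dh by (simp only:)
qed

text \<open>Convexity makes the derivative of the transition one linear map L and integrates it. L
  is injective because \<open>push_vec\<close> is, and then bijective by dimension.\<close>

lemma transition_affine:
  assumes D: "connection A D" and P: "flat_param A D B P" and P': "flat_param A D B' P'"
    and sub: "P ` B \<subseteq> P' ` B'" and B: "convex B" "x0 \<in> B"
  shows "\<exists>L L'. linear L \<and> linear L' \<and> (\<forall>x. L (L' x) = x) \<and> (\<forall>x. L' (L x) = x) \<and>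
    (\<forall>x\<in>B. inv_into B' P' (P x) = inv_into B' P' (P x0) + L (x - x0)) \<and>
    (\<forall>x\<in>B. inv_into B' P' (P x) \<in> B' \<and> P x = P' (inv_into B' P' (P x))) \<and>
    (\<forall>x\<in>B. \<forall>w. push_vec A P x w = push_vec A P' (inv_into B' P' (P x)) (L w))"
proof -
  define h where "h x = inv_into B' P' (P x)" for x
  note t = transition_second_derivative[OF D P P' sub, folded h_def]
  note oB = param_open[OF flat_paramD[OF P]]
  define L where "L w = dd h w x0" for w
  have dL: "dd h w x = L w" if "x \<in> B" for x w
    unfolding L_def by (rule has_derivative_zero_on_convex[OF B(1) oB t(4) that B(2)])
  have linL: "linear L"
    unfolding L_def by (rule dd_linear[OF Cinf_on_differentiable[OF t(1) B(2)]])
  have "inj L"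
  proof (rule linear_injective_0[THEN iffD2, OF linL, rule_format])
    fix w assume "L w = 0"
    then have "push_vec A P x0 w = push_vec A P x0 0"
      using t(3)[OF B(2)] dL[OF B(2)] linear_0[OF linL] by simp
    then show "w = 0" using push_vec_inject[OF flat_paramD[OF P] B(2)] by blast
  qed
  then obtain L' where L': "linear L'" "\<And>x. L' (L x) = x" "\<And>x. L (L' x) = x"
    using linear_injective_isomorphism[OF linL] by blast
  have bl: "bounded_linear L" using linL linear_conv_bounded_linear by blast
  have aff: "h x = h x0 + L (x - x0)" if x: "x \<in> B" for x
  proof -
    have "((\<lambda>z. h z - L z) has_derivative (\<lambda>v. dd h v z - L v)) (at z)" if "z \<in> B" for z
      using that bl by (intro has_derivative_diff Cinf_on_has_derivative[OF t(1)] bounded_linear_imp_has_derivative)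
    then have "((\<lambda>z. h z - L z) has_derivative (\<lambda>v. 0)) (at z)" if "z \<in> B" for z
      using that dL[OF that] by fastforce
    then have "h x - L x = h x0 - L x0"
      by (rule has_derivative_zero_on_convex[OF B(1) oB _ x B(2)])
    then have "h x = h x0 - L x0 + L x" by (metis diff_add_cancel)
    then show ?thesis unfolding linear_diff[OF linL, of x x0] by simp
  qed
  have "\<forall>x\<in>B. \<forall>w. push_vec A P x w = push_vec A P' (h x) (L w)" using t(3) dL by simp
  then show ?thesis
    using linL L' aff t(2) unfolding h_def[symmetric] by (intro exI[of _ L] exI[of _ L']) blast
qed

lemma (in atlas_manifold) centered_param_exists: "\<exists>B P. param A B P \<and> 0 \<in> B \<and> P 0 = p"
proof -
  obtain B P x0 where P: "param A B P" "x0 \<in> B" "P x0 = p" using param_exists by blast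
  let ?B = "(+) (- x0) ` B"
  have oB: "open ?B" using open_translation[OF param_open[OF P(1)]] by blast
  have im: "(\<lambda>x. x0 + x) ` ?B = B" by (auto simp: image_image)
  have inj: "inj_on (\<lambda>x. x0 + x) ?B" by (auto simp: inj_on_def)
  have inv: "inv_into ?B (\<lambda>x. x0 + x) y = y - x0" if "y \<in> B" for y
    by (rule inv_into_f_eq[OF inj]) (use that in \<open>auto simp: image_iff\<close>)
  have oB': "open B" by (rule param_open[OF P(1)])
  have "param A ?B (\<lambda>x. P (x0 + x))"
  proof (rule param_compose[OF P(1) oB _ inj])
    show "Cinf_on ?B (\<lambda>x. x0 + x)" by (intro Cinf_on_add[OF oB] Cinf_on_const Cinf_on_id)
    have "Cinf_on B (\<lambda>y. y - x0)" by (intro Cinf_on_diff[OF oB'] Cinf_on_const Cinf_on_id)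
    then show "Cinf_on ((\<lambda>x. x0 + x) ` ?B) (inv_into ?B (\<lambda>x. x0 + x))"
      unfolding im by (subst Cinf_on_cong[OF oB' inv])
  qed (use im oB' in auto)
  moreover have "0 \<in> ?B" using P(2) by (auto simp: image_iff)
  ultimately show ?thesis using P(3) by (intro exI[of _ ?B] exI[of _ "\<lambda>x. P (x0 + x)"]) auto
qed

text \<open>Parallel coframes and frames solve flat linear systems; a parallel coframe is closed, and its primitive
  is carried along in the first component of \<open>A1\<close>.\<close>

theorem (in atlas_manifold) flat_param_exists:
  assumes D: "connection A D" "torsion_free A D" "curvature_vanishes A D"
  shows "\<exists>P r. r > 0 \<and> flat_param A D (ball 0 r) P \<and> P 0 = p"
proof -
  obtain B P1 where P1: "param A B P1" "0 \<in> B" "P1 0 = p" using centered_param_exists by blast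
  interpret connection_param A D B P1 using D(1) P1(1) by unfold_locales
  note oB = param_open[OF P1(1)]
  define A1 :: "complex ^ 'n \<Rightarrow> complex ^ 'n \<Rightarrow> real \<times> (complex ^ 'n) \<Rightarrow> real \<times> (complex ^ 'n)"
    where "A1 x a m = (snd m \<bullet> a, \<Sum>c\<in>Basis. (snd m \<bullet> \<Gamma> x a c) *\<^sub>R c)" for x a m
  \<comment> \<open>The equation of parallel vector fields. Its solutions N turn out to be the
    inverse of the coframe matrix, so no smoothness of matrix inversion has to be shown.\<close>
  define A2 where "A2 x a m = - \<Gamma> x a m" for x a m
  have adj: "(\<Sum>c\<in>Basis. (\<theta> \<bullet> \<Gamma> x a c) *\<^sub>R c) \<bullet> w = \<theta> \<bullet> \<Gamma> x a w" if x: "x \<in> B" for x a w \<theta>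
  proof -
    have "\<theta> \<bullet> \<Gamma> x a w = (\<Sum>c\<in>Basis. (w \<bullet> c) * (\<theta> \<bullet> \<Gamma> x a c))"
      by (subst \<Gamma>_basis[OF x]) (simp add: inner_sum_right)
    then show ?thesis by (simp add: inner_sum_right inner_commute[of _ w] mult.commute)
  qed
  have dG: "((\<lambda>z. \<Gamma> z a c) has_derivative (\<lambda>v. dd (\<lambda>z. \<Gamma> z a c) v x)) (at x)" if "x \<in> B" for x a c
    by (rule Cinf_on_has_derivative[OF \<Gamma>_smooth that])
  interpret S1: flat_linear_system B A1
  proof (rule flat_linear_system.intro)
    show "open B" "0 \<in> B" by fact+
    fix x assume x: "x \<in> B"
    show "linear (\<lambda>a. A1 x a m)" for m
      unfolding A1_def
      by (rule linearI) (simp_all add: linear_add[OF \<Gamma>_linear1[OF x]] linear_cmul[OF \<Gamma>_linear1[OF x]]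
          inner_add_right scaleR_add_left sum.distrib scaleR_sum_right)
    show "linear (A1 x a)" for a
      unfolding A1_def
      by (rule linearI) (simp_all add: inner_add_left scaleR_add_left sum.distrib scaleR_sum_right)
    have dA: "dd (\<lambda>z. A1 z a m) b x = (0, \<Sum>c\<in>Basis. (snd m \<bullet> dd (\<lambda>z. \<Gamma> z a c) b x) *\<^sub>R c)" for a b m
      unfolding A1_def
      by (rule dd_eqI)
         (intro has_derivative_Pair has_derivative_const has_derivative_sum has_derivative_scaleR_left
            has_derivative_inner_right dG[OF x])
    \<comment> \<open>The first component, closedness of the coframe, is symmetry of \<Gamma>, that
      is, absence of torsion; the second is absence of curvature.\<close>
    show "dd (\<lambda>z. A1 z a m) b x + A1 x a (A1 x b m) = dd (\<lambda>z. A1 z b m) a x + A1 x b (A1 x a m)" for a b m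
    proof -
      have AA: "A1 x a (A1 x b m) = (snd m \<bullet> \<Gamma> x b a, \<Sum>c\<in>Basis. (snd m \<bullet> \<Gamma> x b (\<Gamma> x a c)) *\<^sub>R c)" for a b
        by (simp add: A1_def adj[OF x])
      have "snd m \<bullet> dd (\<lambda>z. \<Gamma> z a c) b x + snd m \<bullet> \<Gamma> x b (\<Gamma> x a c)
          = snd m \<bullet> dd (\<lambda>z. \<Gamma> z b c) a x + snd m \<bullet> \<Gamma> x a (\<Gamma> x b c)" for c
        using \<Gamma>_flat[OF D(3) x, of a c b] by (simp add: inner_add_right[symmetric])
      then show ?thesis
        unfolding dA AA using \<Gamma>_symmetric[OF D(2) x, of a b]
        by (simp add: sum.distrib[symmetric] scaleR_add_left[symmetric])
    qed
  next
    fix a m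
    show "Cinf_on B (\<lambda>x. A1 x a m)"
      unfolding A1_def
      by (intro Cinf_on_Pair oB Cinf_on_const Cinf_on_sum[OF oB] Cinf_on_scaleR[OF oB] Cinf_on_inner[OF oB] \<Gamma>_smooth)
  qed
  interpret S2: flat_linear_system B A2
  proof (rule flat_linear_system.intro)
    show "open B" "0 \<in> B" by fact+
    fix x assume x: "x \<in> B"
    show "linear (\<lambda>a. A2 x a m)" "linear (A2 x a)" for a m
      unfolding A2_def by (intro linear_compose_neg \<Gamma>_linear1[OF x] \<Gamma>_linear2[OF x])+
    have dA: "dd (\<lambda>z. A2 z a m) b x = - dd (\<lambda>z. \<Gamma> z a m) b x" for a b m
      unfolding A2_def by (rule dd_eqI) (intro has_derivative_minus dG[OF x])
    show "dd (\<lambda>z. A2 z a m) b x + A2 x a (A2 x b m) = dd (\<lambda>z. A2 z b m) a x + A2 x b (A2 x a m)" for a b m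
      unfolding dA using \<Gamma>_flat[OF D(3) x, of a m b]
      by (simp add: A2_def linear_neg[OF \<Gamma>_linear2[OF x]] algebra_simps)
  next
    fix a m
    show "Cinf_on B (\<lambda>x. A2 x a m)" unfolding A2_def by (rule Cinf_on_minus[OF oB \<Gamma>_smooth])
  qed
  obtain r1 where r1: "r1 > 0" "ball 0 r1 \<subseteq> B" and sol1: "\<forall>m0. \<exists>m. m 0 = m0 \<and> Cinf_on (ball 0 r1) m \<and>
      (\<forall>x\<in>ball 0 r1. (m has_derivative (\<lambda>a. A1 x a (m x))) (at x))"
    using S1.solvable by blast
  obtain r2 where r2: "r2 > 0" "ball 0 r2 \<subseteq> B" and sol2: "\<forall>m0. \<exists>m. m 0 = m0 \<and> Cinf_on (ball 0 r2) m \<and>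
      (\<forall>x\<in>ball 0 r2. (m has_derivative (\<lambda>a. A2 x a (m x))) (at x))"
    using S2.solvable by blast
  obtain Y0 where Y0: "\<forall>m0. Y0 m0 0 = m0 \<and> Cinf_on (ball 0 r1) (Y0 m0) \<and>
      (\<forall>x\<in>ball 0 r1. (Y0 m0 has_derivative (\<lambda>a. A1 x a (Y0 m0 x))) (at x))"
    using choice[OF sol1] by blast
  define Y where "Y c = Y0 (0, c)" for c
  have Y: "\<forall>c. Y c 0 = (0, c) \<and> Cinf_on (ball 0 r1) (Y c) \<and>
      (\<forall>x\<in>ball 0 r1. (Y c has_derivative (\<lambda>a. A1 x a (Y c x))) (at x))"
    using Y0 unfolding Y_def by blast
  obtain N where N: "\<forall>w. N w 0 = w \<and> Cinf_on (ball 0 r2) (N w) \<and>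
      (\<forall>x\<in>ball 0 r2. (N w has_derivative (\<lambda>a. A2 x a (N w x))) (at x))"
    using choice[OF sol2] by blast
  define r where "r = min r1 r2"
  have r: "r > 0" "ball 0 r \<subseteq> B" "ball 0 r \<subseteq> ball (0 :: complex ^ 'n) r1" "ball 0 r \<subseteq> ball (0 :: complex ^ 'n) r2"
    using r1 r2 by (auto simp: r_def)
  define \<theta> where "\<theta> c x = snd (Y c x)" for c x
  define y where "y x = (\<Sum>c\<in>Basis. fst (Y c x) *\<^sub>R c)" for x
  define M where "M x a = (\<Sum>c\<in>Basis. (\<theta> c x \<bullet> a) *\<^sub>R c)" for x a
  have dY: "(Y c has_derivative (\<lambda>a. A1 x a (Y c x))) (at x)" if "x \<in> ball 0 r" for c x
    using Y that r(3) by blast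
  have dN: "(N w has_derivative (\<lambda>a. - \<Gamma> x a (N w x))) (at x)" if "x \<in> ball 0 r" for w x
    using N that r(4) unfolding A2_def by blast
  have d\<theta>: "(\<theta> c has_derivative (\<lambda>a. \<Sum>b\<in>Basis. (\<theta> c x \<bullet> \<Gamma> x a b) *\<^sub>R b)) (at x)" if "x \<in> ball 0 r" for c x
    using has_derivative_snd[OF dY[OF that, of c]] by (simp add: \<theta>_def[abs_def] A1_def)
  have dy: "(y has_derivative M x) (at x)" if "x \<in> ball 0 r" for x
  proof -
    have "((\<lambda>x. fst (Y c x)) has_derivative (\<lambda>a. \<theta> c x \<bullet> a)) (at x)" for c
      using has_derivative_fst[OF dY[OF that, of c]] by (simp add: \<theta>_def A1_def)
    then show ?thesis
      unfolding y_def[abs_def] M_def[abs_def] by (intro has_derivative_sum has_derivative_scaleR_left)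
  qed
  \<comment> \<open>The pairing of a parallel covector with a parallel vector has derivative 0, so
    it keeps its value at 0.\<close>
  have MN: "M x (N w x) = w" if x: "x \<in> ball 0 r" for x w
  proof -
    have "((\<lambda>x. \<theta> c x \<bullet> N w x) has_derivative (\<lambda>v. 0)) (at z)" if z: "z \<in> ball 0 r" for z c
    proof -
      have zB: "z \<in> B" using z r(2) by auto
      have "((\<lambda>x. \<theta> c x \<bullet> N w x) has_derivative
          (\<lambda>a. \<theta> c z \<bullet> - \<Gamma> z a (N w z) + (\<Sum>b\<in>Basis. (\<theta> c z \<bullet> \<Gamma> z a b) *\<^sub>R b) \<bullet> N w z)) (at z)"
        by (rule has_derivative_inner[OF d\<theta>[OF z] dN[OF z]])
      then show ?thesis by (simp add: adj[OF zB])
    qed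
    then have "\<theta> c x \<bullet> N w x = \<theta> c 0 \<bullet> N w 0" for c
      by (rule has_derivative_zero_on_convex[OF convex_ball open_ball _ x]) (use r(1) in auto)
    then have "\<theta> c x \<bullet> N w x = w \<bullet> c" for c
      using Y N by (simp add: \<theta>_def inner_commute)
    then show ?thesis by (simp add: M_def euclidean_representation)
  qed
  have blM: "bounded_linear (M x)" if "x \<in> ball 0 r" for x
    using has_derivative_bounded_linear[OF dy[OF that]] .
  have bijM: "bij (M x)" if x: "x \<in> ball 0 r" for x
  proof -
    have "surj (M x)" by (rule surjI[of "M x" "\<lambda>w. N w x"]) (rule MN[OF x])
    then show ?thesis
      using blM[OF x] linear_surjective_imp_injective[of "M x"] linear_conv_bounded_linear by (auto simp: bij_def)
  qed
  have invM: "inv (M x) w = N w x" if x: "x \<in> ball 0 r" for x w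
    using inv_f_eq[OF bij_is_inj[OF bijM[OF x]] MN[OF x]] .
  have y0: "y 0 = 0" using Y by (simp add: y_def)
  have smY: "Cinf_on (ball 0 r) (Y c)" for c
    by (rule Cinf_on_subset[OF _ r(3)]) (use Y in blast)
  have sm\<theta>: "Cinf_on (ball 0 r) (\<theta> c)" for c
    unfolding \<theta>_def by (rule Cinf_on_linear_comp[OF open_ball bounded_linear_snd smY])
  have smy: "Cinf_on (ball 0 r) y"
    unfolding y_def
    by (intro Cinf_on_sum[OF open_ball] Cinf_on_scaleR[OF open_ball] Cinf_on_const
        Cinf_on_linear_comp[OF open_ball bounded_linear_fst smY])
  have smN: "Cinf_on (ball 0 r) (N w)" for w
    by (rule Cinf_on_subset[OF _ r(4)]) (use N in blast)
  have contM: "continuous_on (ball 0 r) (\<lambda>x. Blinfun (M x))"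
  proof (rule continuous_on_blinfun_componentwise)
    fix i :: "complex ^ 'n"
    have "continuous_on (ball 0 r) (\<lambda>x. M x i)"
      unfolding M_def by (intro continuous_intros Cinf_on_continuous[OF sm\<theta>])
    then show "continuous_on (ball 0 r) (\<lambda>x. blinfun_apply (Blinfun (M x)) i)"
      by (rule continuous_on_eq) (simp add: bounded_linear_Blinfun_apply[OF blM])
  qed
  have "M 0 a = a" for a
    using Y by (simp add: M_def \<theta>_def inner_commute[of _ a] euclidean_representation)
  then have idM: "id_blinfun o\<^sub>L Blinfun (M 0) = id_blinfun"
    using r(1) by (intro blinfun_eqI) (simp add: bounded_linear_Blinfun_apply[OF blM])
  have dyM: "(y has_derivative blinfun_apply (Blinfun (M x))) (at x)" if "x \<in> ball 0 r" for x
    using dy[OF that] by (simp only: bounded_linear_Blinfun_apply[OF blM[OF that]])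
  have zb: "0 \<in> ball (0 :: complex ^ 'n) r" using r(1) by simp
  obtain U V g g' where g: "open U" "U \<subseteq> ball 0 r" "0 \<in> U" "open V" "y 0 \<in> V" "homeomorphism U V y g"
    "\<And>z. z \<in> V \<Longrightarrow> (g has_derivative (g' z)) (at z)" "\<And>z. z \<in> V \<Longrightarrow> g' z = inv (blinfun_apply (Blinfun (M (g z))))"
    by (rule inverse_function_theorem[OF open_ball dyM contM zb idM]) (assumption, blast)
  obtain s where s: "s > 0" "ball 0 s \<subseteq> V" using g(4,5) y0 openE by metis
  let ?B = "ball (0 :: complex ^ 'n) s"
  have gU: "g z \<in> U" "y (g z) = z" if "z \<in> ?B" for z
    using that s(2) g(6) unfolding homeomorphism_def by auto
  have gr: "g z \<in> ball 0 r" "g z \<in> B" if "z \<in> ?B" for z using gU(1)[OF that] g(2) r(2) by auto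
  have dg: "(g has_derivative (\<lambda>w. N w (g z))) (at z)" if z: "z \<in> ?B" for z
  proof -
    have "g' z = (\<lambda>w. N w (g z))"
      unfolding g(8)[OF subsetD[OF s(2) z]] bounded_linear_Blinfun_apply[OF blM[OF gr(1)[OF z]]]
      by (rule ext) (rule invM[OF gr(1)[OF z]])
    then show ?thesis using g(7)[OF subsetD[OF s(2) z]] by (simp only:)
  qed
  \<comment> \<open>The inverse function theorem gives only a differentiable inverse g. Its
    derivative is N at g z, with N smooth, so g inherits all orders.\<close>
  have smg: "Cinf_on ?B g"
  proof (rule Cinf_on_bootstrap[OF open_ball dg])
    fix k v assume "Ck_on k ?B g"
    then show "Ck_on k ?B (\<lambda>x. N v (g x))"
      by (rule Ck_on_compose[OF open_ball open_ball _ Cinf_onD[OF smN]]) (use gr in auto)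
  qed
  have injg: "inj_on g ?B" using gU(2) by (metis inj_onI)
  have img: "g ` ?B = U \<inter> y -` ?B"
  proof
    show "g ` ?B \<subseteq> U \<inter> y -` ?B" using gU by auto
    show "U \<inter> y -` ?B \<subseteq> g ` ?B"
      using g(6) unfolding homeomorphism_def by (auto simp: image_iff) (metis mem_ball_0)
  qed
  have opg: "open (g ` ?B)"
    unfolding img using continuous_on_open_vimage[OF g(1), of y] g(6)
    by (auto simp: homeomorphism_def Int_commute)
  define P where "P x = P1 (g x)" for x
  have invg: "inv_into ?B g x = y x" if "x \<in> g ` ?B" for x
    using that injg gU(2) by auto
  have par: "param A ?B P"
    unfolding P_def
  proof (rule param_compose[OF P1(1) open_ball _ injg opg smg])
    show "g ` ?B \<subseteq> B" using gr by auto
    have "Cinf_on (g ` ?B) y" using smy by (rule Cinf_on_subset) (use gr in auto)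
    then show "Cinf_on (g ` ?B) (inv_into ?B g)" by (subst Cinf_on_cong[OF opg invg])
  qed
  have pv: "push_vec A P z w = push_vec A P1 (g z) (N w (g z))" if z: "z \<in> ?B" for z w
    using push_vec_compose[OF P1(1), of g z w] gr(2)[OF z] dg[OF z] dd_eqI[OF dg[OF z]]
    unfolding P_def[abs_def] differentiable_def by auto
  have "flat_param A D ?B P"
    unfolding flat_param_def
  proof (intro conjI par ballI allI)
    fix x a w assume x: "x \<in> ?B"
    have "D (P1 (g x)) (push_vec A P1 (g x) (N a (g x))) (cfield A ?B P w)
        = push_vec A P1 (g x) (dd (N w) (N a (g x)) (g x) + \<Gamma> (g x) (N a (g x)) (N w (g x)))"
    proof (rule D_expand[OF param_open_range[OF par] _ cfield_vector_field[OF par]])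
      show "P ` ?B \<subseteq> P1 ` B" unfolding P_def using gr by auto
      fix z assume z: "z \<in> B" "P1 z \<in> P ` ?B"
      then obtain x' where x': "x' \<in> ?B" "P1 z = P1 (g x')" unfolding P_def by auto
      then have "z = g x'" using param_inj[OF P1(1)] z(1) gr(2)[OF x'(1)] by (meson inj_onD)
      then show "cfield A ?B P w (P1 z) = push_vec A P1 z (N w z)"
        using cfield_at[OF par x'(1), of w] pv[OF x'(1)] by (simp add: P_def)
    qed (use x gr in \<open>auto simp: P_def\<close>)
    also have "dd (N w) (N a (g x)) (g x) = - \<Gamma> (g x) (N a (g x)) (N w (g x))"
      by (rule dd_eqI[OF dN[OF gr(1)[OF x]]])
    finally show "D (P x) (push_vec A P x a) (cfield A ?B P w) = 0"
      unfolding pv[OF x] P_def[of x] by (simp only: add.left_inverse push_vec_zero[OF P1(1) gr(2)[OF x]])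
  qed
  moreover have "P 0 = p"
  proof -
    have "g 0 = 0" using g(3,6) y0 unfolding homeomorphism_def by metis
    then show ?thesis using P1(3) by (simp add: P_def)
  qed
  ultimately show ?thesis using s(1) by blast
qed

section \<open>The developing map\<close>

definition locally_flat ::
    "('a::topological_space, 'n::finite) atlas \<Rightarrow> 'a connection \<Rightarrow> (complex ^ 'n) set \<Rightarrow> (complex ^ 'n \<Rightarrow> 'a) \<Rightarrow> bool" where
  "locally_flat A D W F \<longleftrightarrow> open W \<and> (\<forall>x\<in>W. \<exists>r>0. ball x r \<subseteq> W \<and> flat_param A D (ball x r) F)"

lemma param_cong:
  assumes P: "param A B P" and eq: "\<And>x. x \<in> B \<Longrightarrow> P x = P' x"
  shows "param A B P'"
  unfolding param_def
proof (intro conjI allI impI)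
  show "open B" by (rule param_open[OF P])
  show "inj_on P' B" using param_inj[OF P] eq by (simp add: inj_on_def)
  show "continuous_on B P'" using param_cont[OF P] eq by (rule continuous_on_eq)
  show "open (P' ` N)" if "N \<subseteq> B" "open N" for N
  proof -
    have "P' ` N = P ` N" using that eq by (intro image_cong) auto
    then show ?thesis using param_open_image[OF P that] by simp
  qed
  fix W f assume W: "open W" "W \<subseteq> P' ` B"
  have 1: "W \<subseteq> P ` B" using W(2) eq by auto
  have 2: "B \<inter> P' -` W = B \<inter> P -` W" using eq by auto
  have "smooth_fun_on A W f \<longleftrightarrow> Cinf_on (B \<inter> P -` W) (\<lambda>x. f (P x))" by (rule param_smooth_iff[OF P W(1) 1])
  also have "\<dots> \<longleftrightarrow> Cinf_on (B \<inter> P -` W) (\<lambda>x. f (P' x))"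
    by (rule Cinf_on_cong[OF param_open_vimage[OF P W(1)]]) (simp add: eq)
  finally show "smooth_fun_on A W f \<longleftrightarrow> Cinf_on (B \<inter> P' -` W) (\<lambda>x. f (P' x))" unfolding 2 .
qed

lemma flat_param_cong:
  assumes D: "connection A D" and P: "flat_param A D B P" and eq: "\<And>x. x \<in> B \<Longrightarrow> P x = P' x"
  shows "flat_param A D B P'"
  unfolding flat_param_def
proof (intro conjI ballI allI)
  note par = flat_paramD[OF P]
  show par': "param A B P'" by (rule param_cong[OF par eq])
  have pv: "push_vec A P x w = push_vec A P' x w" if "x \<in> B" for x w
    by (rule push_vec_cong[OF param_open[OF par] that eq])
  fix x a w assume x: "x \<in> B"
  have im: "P' ` B = P ` B" using eq by (intro image_cong) auto
  have "D (P x) (push_vec A P x a) (cfield A B P w) = D (P x) (push_vec A P x a) (cfield A B P' w)"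
  proof (rule connectionD(7)[OF D param_open_range[OF par] cfield_vector_field[OF par] imageI[OF x] push_vec_tangent[OF par x]
        cfield_vector_field[OF par', unfolded im]])
    fix q assume "q \<in> P ` B"
    then obtain z where z: "z \<in> B" "q = P z" by auto
    show "cfield A B P w q = cfield A B P' w q"
      using cfield_at[OF par z(1), of w] cfield_at[OF par' z(1), of w] pv[OF z(1)] eq[OF z(1)] z(2) by simp
  qed
  moreover have "D (P x) (push_vec A P x a) (cfield A B P w) = 0" using P x unfolding flat_param_def by blast
  ultimately show "D (P' x) (push_vec A P' x a) (cfield A B P' w) = 0"
    using eq[OF x] pv[OF x] by simp
qed

lemma param_inv_continuous:
  assumes P: "param A B P"
  shows "continuous_on (P ` B) (inv_into B P)"
  unfolding continuous_on_open_vimage[OF param_open_range[OF P]]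
proof (intro allI impI)
  fix N :: "(complex, 'b) vec set" assume "open N"
  have "inv_into B P -` N \<inter> P ` B = P ` (N \<inter> B)"
    using param_inj[OF P] by (auto simp: image_iff)
  then show "open (inv_into B P -` N \<inter> P ` B)"
    using param_open_image[OF P, of "N \<inter> B"] param_open[OF P] \<open>open N\<close> by auto
qed

lemma linear_id_near_zero:
  fixes L :: "'e::real_normed_vector \<Rightarrow> 'e"
  assumes "linear L" "e > 0" "\<And>v. norm v < e \<Longrightarrow> L v = v"
  shows "L v = v"
proof -
  define c where "c = e / 2 / (norm v + 1)"
  have p: "norm v + 1 > 0" by (simp add: add_nonneg_pos)
  have c: "c > 0" using assms(2) p by (simp add: c_def)
  have "norm (c *\<^sub>R v) \<le> c * (norm v + 1)" using c by simp
  also have "\<dots> = e / 2" unfolding c_def using p by (intro nonzero_eq_divide_eq[THEN iffD1]) auto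
  finally have "norm (c *\<^sub>R v) < e" using assms(2) by linarith
  then have "c *\<^sub>R L v = c *\<^sub>R v" using assms(3) linear_cmul[OF assms(1)] by metis
  then show ?thesis using c by simp
qed

section \<open>Identity principle and continuation of locally flat maps\<close>

locale flat_manifold = atlas_manifold A
  for A :: "('a::{t2_space, second_countable_topology}, 'n::finite) atlas" +
  fixes D :: "'a connection"
  assumes conn: "connection A D" and tor: "torsion_free A D" and curv: "curvature_vanishes A D"
begin

lemma locally_flat_subset:
  assumes "locally_flat A D W F" "open W'" "W' \<subseteq> W"
  shows "locally_flat A D W' F"
  unfolding locally_flat_def
proof (intro conjI ballI assms(2))
  fix x assume x: "x \<in> W'"
  then obtain r where r: "r > 0" "flat_param A D (ball x r) F" using assms unfolding locally_flat_def by blast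
  obtain s where s: "s > 0" "ball x s \<subseteq> W'" using assms(2) x openE by blast
  have "flat_param A D (ball x (min r s)) F" by (rule flat_param_restrict[OF conn r(2)]) auto
  then show "\<exists>r>0. ball x r \<subseteq> W' \<and> flat_param A D (ball x r) F"
    using r s by (intro exI[of _ "min r s"]) auto
qed

lemma flat_param_locally_flat:
  assumes "flat_param A D B F"
  shows "locally_flat A D B F"
  unfolding locally_flat_def
proof (intro conjI ballI)
  show oB: "open B" using assms flat_paramD param_open by blast
  fix x assume "x \<in> B"
  then obtain r where "r > 0" "ball x r \<subseteq> B" using oB openE by blast
  then show "\<exists>r>0. ball x r \<subseteq> B \<and> flat_param A D (ball x r) F"
    using flat_param_restrict[OF conn assms open_ball] by blast
qed

lemma locally_flat_continuous: "locally_flat A D W F \<Longrightarrow> continuous_on W F"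
proof -
  assume F: "locally_flat A D W F"
  have "isCont F x" if x: "x \<in> W" for x
  proof -
    obtain r where r: "r > 0" "flat_param A D (ball x r) F" using F x unfolding locally_flat_def by blast
    then show ?thesis
      using param_cont[OF flat_paramD[OF r(2)]] continuous_on_eq_continuous_at[OF open_ball, of x r F] by simp
  qed
  then show ?thesis by (simp add: continuous_at_imp_continuous_on)
qed

lemma locally_flat_glue:
  assumes "open W" "\<And>x. x \<in> W \<Longrightarrow> \<exists>N G. open N \<and> x \<in> N \<and> N \<subseteq> W \<and> locally_flat A D N G \<and> (\<forall>z\<in>N. G z = F z)"
  shows "locally_flat A D W F"
  unfolding locally_flat_def
proof (intro conjI ballI assms(1))
  fix x assume "x \<in> W"
  then obtain N G where N: "open N" "x \<in> N" "N \<subseteq> W" "locally_flat A D N G" "\<forall>z\<in>N. G z = F z"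
    using assms(2) by blast
  then obtain r where r: "r > 0" "ball x r \<subseteq> N" "flat_param A D (ball x r) G" unfolding locally_flat_def by blast
  have "flat_param A D (ball x r) F" by (rule flat_param_cong[OF conn r(3)]) (use r N in auto)
  then show "\<exists>r>0. ball x r \<subseteq> W \<and> flat_param A D (ball x r) F" using r N by blast
qed

text \<open>Choose s so that G maps \<open>ball x s\<close> into the range of F. There G read in the
  coordinates of F is affine, and an affine map that is the identity on some small ball is the
  identity everywhere.\<close>

lemma flat_agree_propagate:
  assumes F: "flat_param A D (ball x r) F" "flat_param A D (ball x r) G" and r: "r > 0" and eq: "F x = G x"
  shows "\<exists>s>0. s \<le> r \<and> (\<forall>z\<in>ball x s. \<forall>e>0. (\<forall>y\<in>ball z e. F y = G y) \<longrightarrow> (\<forall>y\<in>ball x s. F y = G y))"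
proof -
  note pF = flat_paramD[OF F(1)] and pG = flat_paramD[OF F(2)]
  have "open (ball x r \<inter> G -` F ` ball x r)" by (rule param_open_vimage[OF pG param_open_range[OF pF]])
  moreover have "x \<in> ball x r \<inter> G -` F ` ball x r" using r eq by (auto intro!: image_eqI[of _ _ x])
  ultimately obtain s where s: "s > 0" "ball x s \<subseteq> ball x r \<inter> G -` F ` ball x r" using openE by blast
  have sr: "s \<le> r"
    using s ball_subset_ball_iff[of x s x r] by auto
  have Gs: "flat_param A D (ball x s) G" by (rule flat_param_restrict[OF conn F(2)]) (use s in auto)
  have "F y = G y" if z: "z \<in> ball x s" and e: "e > 0" "\<forall>y\<in>ball z e. F y = G y" and y: "y \<in> ball x s" for z e y
  proof -
    let ?h = "\<lambda>y. inv_into (ball x r) F (G y)"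
    have sub: "G ` ball x s \<subseteq> F ` ball x r" using s(2) by auto
    from transition_affine[OF conn Gs F(1) sub convex_ball z]
    obtain L where L1: "linear L" and L5: "\<forall>y\<in>ball x s. ?h y = ?h z + L (y - z)"
      and L6: "\<forall>y\<in>ball x s. ?h y \<in> ball x r \<and> G y = F (?h y)"
      by (elim exE conjE)
    obtain e' where e': "e' > 0" "ball z e' \<subseteq> ball x s" using z openE[OF open_ball] by blast
    define d where "d = min e e'"
    have hy: "?h y = y" if "y \<in> ball z d" for y
    proof -
      have yb: "y \<in> ball z e" "y \<in> ball z e'" using that by (auto simp: d_def)
      have "G y = F y" using e(2) yb(1) by simp
      moreover have "y \<in> ball x r" using subsetD[OF s(2) subsetD[OF e'(2) yb(2)]] by simp
      ultimately have "G y = F y" "y \<in> ball x r" by auto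
      then show ?thesis using param_inv[OF pF] by simp
    qed
    have "L v = v" for v
    proof (rule linear_id_near_zero[OF L1])
      show "d > 0" using e e' by (simp add: d_def)
      fix v :: "complex ^ 'n" assume v: "norm v < d"
      then have zv: "z + v \<in> ball z d" by (simp add: dist_norm)
      then have "z + v \<in> ball x s" using e'(2) by (auto simp: d_def)
      from bspec[OF L5 this] show "L v = v" using hy[OF zv] hy[of z] \<open>d > 0\<close> by simp
    qed
    then have "?h y = y" using bspec[OF L5 y] hy[of z] e e' by (simp add: d_def)
    then show ?thesis using bspec[OF L6 y] by simp
  qed
  then show ?thesis using s(1) sr by blast
qed

text \<open>E collects the points near which F and G coincide. Its complement in W is open: by
  \<open>flat_agree_propagate\<close> at points where the values agree, by the Hausdorff property
  where they differ.\<close>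

theorem locally_flat_unique:
  assumes F: "locally_flat A D W F" "locally_flat A D W G" and W: "connected W"
    and N: "open N" "N \<subseteq> W" "N \<noteq> {}" "\<And>z. z \<in> N \<Longrightarrow> F z = G z" and z: "z \<in> W"
  shows "F z = G z"
proof -
  have oW: "open W" using F(1) by (simp add: locally_flat_def)
  define E where "E = {x \<in> W. \<exists>e>0. \<forall>y\<in>ball x e. F y = G y}"
  have "open E"
    unfolding open_contains_ball
  proof
    fix x assume "x \<in> E"
    then obtain e where e: "x \<in> W" "e > 0" "\<forall>y\<in>ball x e. F y = G y" by (auto simp: E_def)
    obtain d where d: "d > 0" "ball x d \<subseteq> W" using oW e(1) openE by blast
    have "ball x (min d e) \<subseteq> E"
    proof
      fix y assume y: "y \<in> ball x (min d e)"
      obtain k where "k > 0" "ball y k \<subseteq> ball x (min d e)" using y openE[OF open_ball] by blast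
      then show "y \<in> E" using y d e(3) by (auto simp: E_def subset_iff)
    qed
    then show "\<exists>e>0. ball x e \<subseteq> E" using d(1) e(2) by (intro exI[of _ "min d e"]) auto
  qed
  moreover have "open (W - E)"
    unfolding open_contains_ball
  proof
    fix x assume x: "x \<in> W - E"
    obtain r1 where r1: "r1 > 0" "ball x r1 \<subseteq> W" "flat_param A D (ball x r1) F"
      using F(1) x unfolding locally_flat_def by blast
    obtain r2 where r2: "r2 > 0" "ball x r2 \<subseteq> W" "flat_param A D (ball x r2) G"
      using F(2) x unfolding locally_flat_def by blast
    define r where "r = min r1 r2"
    have r: "r > 0" "ball x r \<subseteq> W" using r1 r2 by (auto simp: r_def)
    have fl: "flat_param A D (ball x r) F" "flat_param A D (ball x r) G"
      by (rule flat_param_restrict[OF conn r1(3)] flat_param_restrict[OF conn r2(3)]; auto simp: r_def)+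
    show "\<exists>e>0. ball x e \<subseteq> W - E"
    proof (cases "F x = G x")
      case True
      then obtain s where s: "s > 0" "s \<le> r"
        "\<forall>z\<in>ball x s. \<forall>e>0. (\<forall>y\<in>ball z e. F y = G y) \<longrightarrow> (\<forall>y\<in>ball x s. F y = G y)"
        using flat_agree_propagate[OF fl r(1)] by blast
      have "ball x s \<subseteq> W - E"
      proof
        fix y assume y: "y \<in> ball x s"
        have "y \<notin> E"
        proof
          assume "y \<in> E"
          then obtain e where "e > 0" "\<forall>v\<in>ball y e. F v = G v" by (auto simp: E_def)
          then have "\<forall>v\<in>ball x s. F v = G v" using s(3) y by blast
          then show False using x s(1) by (auto simp: E_def)
        qed
        then show "y \<in> W - E" using y s(2) r(2) by auto
      qed
      then show ?thesis using s(1) by blast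
    next
      case False
      from hausdorff[OF this] obtain U V where UV: "open U" "open V" "F x \<in> U" "G x \<in> V" "U \<inter> V = {}"
        by (elim exE conjE)
      have "open ((ball x r \<inter> F -` U) \<inter> (ball x r \<inter> G -` V))"
        by (rule open_Int[OF param_open_vimage[OF flat_paramD[OF fl(1)] UV(1)] param_open_vimage[OF flat_paramD[OF fl(2)] UV(2)]])
      moreover have "x \<in> (ball x r \<inter> F -` U) \<inter> (ball x r \<inter> G -` V)" using UV r by auto
      ultimately obtain s where s: "s > 0" "ball x s \<subseteq> (ball x r \<inter> F -` U) \<inter> (ball x r \<inter> G -` V)"
        using openE by blast
      have "ball x s \<subseteq> W - E"
      proof
        fix y assume y: "y \<in> ball x s"
        then have "F y \<in> U" "G y \<in> V" using s(2) by auto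
        then have "F y \<noteq> G y" using UV(5) by (metis disjoint_iff)
        moreover have "F y = G y" if yE: "y \<in> E"
        proof -
          obtain e where "e > 0" "\<forall>v\<in>ball y e. F v = G v" using yE by (auto simp: E_def)
          then show ?thesis using centre_in_ball by blast
        qed
        ultimately have "y \<notin> E" by blast
        then show "y \<in> W - E" using y s(2) r(2) by auto
      qed
      then show ?thesis using s(1) by blast
    qed
  qed
  moreover have "W \<subseteq> E \<union> (W - E)" "E \<inter> (W - E) \<inter> W = {}" by auto
  ultimately have "E \<inter> W = {} \<or> (W - E) \<inter> W = {}" using connectedD[OF W] by blast
  moreover have "E \<inter> W \<noteq> {}"
  proof -
    obtain x where x: "x \<in> N" using N(3) by blast
    then obtain e where "e > 0" "ball x e \<subseteq> N" using N(1) openE by blast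
    then have "x \<in> E" using x N(2,4) by (auto simp: E_def)
    then show ?thesis using x N(2) by blast
  qed
  ultimately have "z \<in> E" using z by blast
  then show ?thesis by (auto simp: E_def)
qed

text \<open>If balls around two points of a sphere meet, they also meet inside the sphere: the point
  dividing the segment in the ratio a : b lies in both balls, and spheres are strictly convex. This
  lets extensions across the boundary be compared where both equal the original map.\<close>

lemma segment_point_in_balls:
  fixes x y :: "'e::real_inner"
  assumes "norm x = r" "norm y = r" "z \<in> ball x a" "z \<in> ball y b"
  shows "\<exists>m. m \<in> ball x a \<and> m \<in> ball y b \<and> (x = y \<or> norm m < r)"
proof (cases "x = y")
  case True
  then show ?thesis using assms by blast
next
  case False
  have ab: "a > 0" "b > 0" using assms(3,4) by (auto intro: le_less_trans[OF zero_le_dist])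
  define u where "u = a / (a + b)"
  have u: "0 < u" "u < 1" "1 - u = b / (a + b)" using ab by (auto simp: u_def field_simps)
  have d: "norm (y - x) < a + b"
    using assms(3,4) dist_triangle[of y x z] by (simp add: dist_norm norm_minus_commute)
  define m where "m = x + u *\<^sub>R (y - x)"
  have mx: "m - x = u *\<^sub>R (y - x)" and my: "y - m = (1 - u) *\<^sub>R (y - x)" by (simp_all add: m_def algebra_simps)
  have "norm (m - x) < a"
  proof -
    have "norm (m - x) = u * norm (y - x)" using u by (simp add: mx)
    also have "\<dots> < u * (a + b)" using u d by (intro mult_strict_left_mono)
    finally show ?thesis using ab by (simp add: u_def)
  qed
  moreover have "norm (y - m) < b"
  proof -
    have "norm (y - m) = (1 - u) * norm (y - x)" using u(1,2) by (simp add: my)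
    also have "\<dots> < (1 - u) * (a + b)" using u d by (intro mult_strict_left_mono) auto
    also have "\<dots> = b" unfolding u(3) using ab by simp
    finally show ?thesis .
  qed
  moreover have "norm m < r"
  proof -
    have xx: "x \<bullet> x = r^2" "y \<bullet> y = r^2" using assms(1,2) by (simp_all add: power2_norm_eq_inner[symmetric])
    have "0 < (x - y) \<bullet> (x - y)" using False by simp
    then have xy: "x \<bullet> y < r^2" by (simp add: inner_diff_left inner_diff_right inner_commute[of y x] xx)
    have "m \<bullet> m = (1 - u)^2 * r^2 + 2 * (u * (1 - u)) * (x \<bullet> y) + u^2 * r^2"
    proof -
      have me: "m = (1 - u) *\<^sub>R x + u *\<^sub>R y" by (simp add: m_def algebra_simps)
      show ?thesis unfolding me
        by (simp add: inner_add_left inner_add_right inner_commute[of y x] xx power2_eq_square algebra_simps)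
    qed
    also have "\<dots> < (1 - u)^2 * r^2 + 2 * (u * (1 - u)) * r^2 + u^2 * r^2"
      using mult_strict_left_mono[OF xy, of "2 * (u * (1 - u))"] u(1,2) by simp
    also have "\<dots> = r^2" by (simp add: power2_eq_square algebra_simps)
    finally have "(norm m)^2 < r^2" by (simp add: power2_norm_eq_inner)
    moreover have "r \<ge> 0" using assms(1) by auto
    ultimately show ?thesis by (rule power2_less_imp_less)
  qed
  ultimately show ?thesis by (intro exI[of _ m]) (simp add: dist_norm norm_minus_commute)
qed

text \<open>Let P be flat coordinates around the limit p and h the map F read in them. Near the end
  of the ray h is affine with a single linear part L, and t tending to 1 fixes the constant: h (t x)
  = L (t x - x). Hence P (L (z - x)) continues F.\<close>

lemma extend_at_boundary_point:
  assumes F: "locally_flat A D (ball 0 r) F" and r: "r > 0" and x: "norm x = r"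
    and lim: "((\<lambda>t. F (t *\<^sub>R x)) \<longlongrightarrow> p) (at_left 1)"
  shows "\<exists>e>0. \<exists>G. locally_flat A D (ball x e) G \<and> (\<forall>z\<in>ball x e \<inter> ball 0 r. G z = F z)"
proof -
  obtain P s where P: "s > 0" "flat_param A D (ball 0 s) P" "P 0 = p"
    using flat_param_exists[OF conn tor curv] by blast
  note par = flat_paramD[OF P(2)]
  let ?R = "P ` ball 0 s"
  have pR: "p \<in> ?R" using P by (auto intro!: image_eqI[of _ _ 0])
  have oR: "open ?R" by (rule param_open_range[OF par])
  obtain t0 where t0: "t0 < 1" "\<And>t. t0 < t \<Longrightarrow> t < 1 \<Longrightarrow> F (t *\<^sub>R x) \<in> ?R"
    using topological_tendstoD[OF lim oR pR] unfolding eventually_at_left_field by blast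
  define t1 where "t1 = max t0 0"
  have t1: "0 \<le> t1" "t1 < 1" "\<And>t. t1 < t \<Longrightarrow> t < 1 \<Longrightarrow> F (t *\<^sub>R x) \<in> ?R"
    using t0 by (auto simp: t1_def)
  define h where "h z = inv_into (ball 0 s) P (F z)" for z
  define Oz where "Oz = ball 0 r \<inter> F -` ?R"
  have oO: "open Oz"
    unfolding Oz_def using continuous_on_open_vimage[OF open_ball, of 0 r F] locally_flat_continuous[OF F] oR
    by (simp add: Int_commute)
  have tO: "t *\<^sub>R x \<in> Oz" if "t1 < t" "t < 1" for t
  proof -
    have "norm (t *\<^sub>R x) < r" using that t1(1) r x by simp
    then show ?thesis using t1(3)[OF that] by (simp add: Oz_def)
  qed
  have loc: "\<exists>e>0. ball z e \<subseteq> Oz \<and> flat_param A D (ball z e) F" if "z \<in> Oz" for z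
    using locally_flat_subset[OF F oO] that unfolding locally_flat_def Oz_def by blast
  have hz: "h z \<in> ball 0 s" "F z = P (h z)" if "z \<in> Oz" for z
  proof -
    have "F z \<in> ?R" using that by (simp add: Oz_def)
    from inv_into_into[OF this] f_inv_into_f[OF this, symmetric] show "h z \<in> ball 0 s" "F z = P (h z)"
      unfolding h_def by auto
  qed
  have hD: "Cinf_on (ball z e) h" "(dd h w has_derivative (\<lambda>v. 0)) (at z)"
    if "ball z e \<subseteq> Oz" "flat_param A D (ball z e) F" "e > 0" for z e w
  proof -
    have sub: "F ` ball z e \<subseteq> ?R" using that(1) unfolding Oz_def by auto
    note t = transition_second_derivative[OF conn that(2) P(2) sub, folded h_def]
    show "Cinf_on (ball z e) h" by (rule t(1))
    show "(dd h w has_derivative (\<lambda>v. 0)) (at z)" by (rule t(4)) (simp add: that(3))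
  qed
  have d2: "((\<lambda>t. dd h w (t *\<^sub>R x)) has_derivative (\<lambda>v. 0)) (at t)" if tt: "t1 < t" "t < 1" for t w
  proof -
    obtain e where "e > 0" "ball (t *\<^sub>R x) e \<subseteq> Oz" "flat_param A D (ball (t *\<^sub>R x) e) F" using loc[OF tO[OF tt]] by blast
    then have hd: "(dd h w has_derivative (\<lambda>v. 0)) (at (t *\<^sub>R x))" by (intro hD(2))
    show ?thesis
      by (rule has_derivative_compose[of "\<lambda>t. t *\<^sub>R x" "\<lambda>s. s *\<^sub>R x" t UNIV "dd h w", OF _ hd])
         (auto intro!: derivative_eq_intros)
  qed
  define tm where "tm = (t1 + 1) / 2"
  have tm: "tm \<in> {t1<..<1}" using t1 by (simp add: tm_def)
  define L where "L w = dd h w (tm *\<^sub>R x)" for w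
  have dL: "dd h w (t *\<^sub>R x) = L w" if "t \<in> {t1<..<1}" for t w
    unfolding L_def
    by (rule has_derivative_zero_on_convex[of "{t1<..<1}" "\<lambda>t. dd h w (t *\<^sub>R x)"]) (use d2 that tm in auto)
  have aff: "\<exists>e>0. ball (t *\<^sub>R x) e \<subseteq> Oz \<and> linear L \<and> (\<exists>L'. linear L' \<and> (\<forall>x. L (L' x) = x) \<and> (\<forall>x. L' (L x) = x)) \<and>
      (\<forall>z\<in>ball (t *\<^sub>R x) e. h z = h (t *\<^sub>R x) + L (z - t *\<^sub>R x))" if t: "t \<in> {t1<..<1}" for t
  proof -
    obtain e where e: "e > 0" "ball (t *\<^sub>R x) e \<subseteq> Oz" "flat_param A D (ball (t *\<^sub>R x) e) F" using loc[OF tO[of t]] t by auto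
    have sub: "F ` ball (t *\<^sub>R x) e \<subseteq> ?R" using e(2) unfolding Oz_def by auto
    have ctr: "t *\<^sub>R x \<in> ball (t *\<^sub>R x) e" using e(1) by simp
    from transition_affine[OF conn e(3) P(2) sub convex_ball ctr, folded h_def]
    obtain M M' where M: "linear M" "linear M'" "\<forall>x. M (M' x) = x" "\<forall>x. M' (M x) = x"
      "\<forall>y\<in>ball (t *\<^sub>R x) e. h y = h (t *\<^sub>R x) + M (y - t *\<^sub>R x)"
      by (elim exE conjE)
    have blM: "bounded_linear M" using M(1) linear_conv_bounded_linear by blast
    have "((\<lambda>y. h (t *\<^sub>R x) + M (y - t *\<^sub>R x)) has_derivative (\<lambda>v. 0 + M (v - 0))) (at (t *\<^sub>R x))"
      by (intro has_derivative_add has_derivative_const bounded_linear.has_derivative[OF blM] has_derivative_diff has_derivative_ident)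
    then have "((\<lambda>y. h (t *\<^sub>R x) + M (y - t *\<^sub>R x)) has_derivative M) (at (t *\<^sub>R x))" by simp
    then have "dd (\<lambda>y. h (t *\<^sub>R x) + M (y - t *\<^sub>R x)) w (t *\<^sub>R x) = M w" for w by (rule dd_eqI)
    moreover have "dd h w (t *\<^sub>R x) = dd (\<lambda>y. h (t *\<^sub>R x) + M (y - t *\<^sub>R x)) w (t *\<^sub>R x)" for w
      by (rule dd_cong[OF open_ball ctr bspec[OF M(5)]])
    ultimately have LM: "L = M" using dL[OF t] by (intro ext) metis
    show ?thesis unfolding LM
      by (intro exI[of _ e] exI[of _ M'] conjI e(1,2) M)
  qed
  obtain L' where linL: "linear L" "linear L'" "\<And>x. L (L' x) = x" "\<And>x. L' (L x) = x"
    using aff[OF tm] by blast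
  have hray: "h (t *\<^sub>R x) = L (t *\<^sub>R x - x)" if t: "t \<in> {t1<..<1}" for t
  proof -
    define c where "c u = h (u *\<^sub>R x) - u *\<^sub>R L x" for u
    have dc: "(c has_derivative (\<lambda>v. 0)) (at u)" if u: "u \<in> {t1<..<1}" for u
    proof -
      obtain e where e: "e > 0" "ball (u *\<^sub>R x) e \<subseteq> Oz" "flat_param A D (ball (u *\<^sub>R x) e) F" using loc[OF tO[of u]] u by auto
      have hd: "(h has_derivative (\<lambda>v. dd h v (u *\<^sub>R x))) (at (u *\<^sub>R x))"
        by (rule Cinf_on_has_derivative[OF hD(1)[OF e(2,3,1)]]) (simp add: e(1))
      have "((\<lambda>u. h (u *\<^sub>R x)) has_derivative (\<lambda>s. dd h (s *\<^sub>R x) (u *\<^sub>R x))) (at u)"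
        by (rule has_derivative_compose[of "\<lambda>u. u *\<^sub>R x" "\<lambda>s. s *\<^sub>R x" u UNIV h, OF _ hd])
           (auto intro!: derivative_eq_intros)
      moreover have "dd h (s *\<^sub>R x) (u *\<^sub>R x) = s *\<^sub>R L x" for s
        using dL[OF u, of "s *\<^sub>R x"] linear_cmul[OF linL(1)] by simp
      ultimately have "((\<lambda>u. h (u *\<^sub>R x)) has_derivative (\<lambda>s. s *\<^sub>R L x)) (at u)" by simp
      then have "(c has_derivative (\<lambda>s. s *\<^sub>R L x - s *\<^sub>R L x)) (at u)"
        unfolding c_def[abs_def] by (rule has_derivative_diff) (auto intro!: derivative_eq_intros)
      then show ?thesis by simp
    qed
    have cc: "c u = c t" if "u \<in> {t1<..<1}" for u
      by (rule has_derivative_zero_on_convex[of "{t1<..<1}" c]) (use dc that t in auto)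
    have hl: "((\<lambda>u. h (u *\<^sub>R x)) \<longlongrightarrow> inv_into (ball 0 s) P p) (at_left 1)"
      unfolding h_def
      by (rule isCont_tendsto_compose[OF _ lim])
         (use param_inv_continuous[OF par] continuous_on_eq_continuous_at[OF oR] pR in blast)
    have "inv_into (ball 0 s) P p = 0" using param_inv[OF par, of 0] P by auto
    then have cl: "(c \<longlongrightarrow> 0 - 1 *\<^sub>R L x) (at_left 1)"
      unfolding c_def[abs_def] using hl by (intro tendsto_intros) auto
    have ev: "\<forall>\<^sub>F u in at_left 1. c u = c t"
      unfolding eventually_at_left_field using cc t1(2) by (intro exI[of _ t1]) auto
    have "c t = 0 - 1 *\<^sub>R L x"
      by (rule tendsto_unique[OF trivial_limit_at_left_real tendsto_const Lim_transform_eventually[OF cl ev]])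
    then show ?thesis by (simp add: c_def linear_diff[OF linL(1)] linear_cmul[OF linL(1)] algebra_simps)
  qed
  have blL: "bounded_linear L" using linL(1) linear_conv_bounded_linear by blast
  obtain K where K: "K > 0" "\<And>v. norm (L v) \<le> norm v * K" using bounded_linear.pos_bounded[OF blL] by blast
  define e where "e = s / K"
  have e: "e > 0" using P(1) K(1) by (simp add: e_def)
  define G where "G z = P (0 + L (z - x))" for z
  have Gfl: "flat_param A D (ball x e) G"
    unfolding G_def
  proof (rule flat_param_compose_affine[OF conn P(2) linL open_ball])
    fix z assume "z \<in> ball x e"
    then have "norm (z - x) * K < e * K" using K(1) by (simp add: dist_norm norm_minus_commute)
    then show "0 + L (z - x) \<in> ball 0 s" using K by (simp add: e_def) (meson le_less_trans)
  qed
  have Gl: "locally_flat A D (ball x e) G" by (rule flat_param_locally_flat[OF Gfl])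
  have "G z = F z" if z: "z \<in> ball x e \<inter> ball 0 r" for z
  proof -
    \<comment> \<open>So close to 1 that t x lies in \<open>ball x e\<close>. Around t x both maps
      are given by the same affine formula, and uniqueness spreads the agreement over the convex
      intersection of the two balls.\<close>
    define t where "t = max tm (1 - e / (2 * r))"
    have t: "t \<in> {t1<..<1}" using tm e r by (auto simp: t_def)
    have "norm (t *\<^sub>R x - x) < e"
    proof -
      have "t *\<^sub>R x - x = (t - 1) *\<^sub>R x" by (simp add: algebra_simps)
      then have "norm (t *\<^sub>R x - x) = (1 - t) * r" using t x by simp
      also have "\<dots> \<le> e / (2 * r) * r" using r by (intro mult_right_mono) (auto simp: t_def)
      also have "\<dots> < e" using r e by simp
      finally show ?thesis .
    qed
    then have tx: "t *\<^sub>R x \<in> ball x e" by (simp add: dist_norm norm_minus_commute)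
    obtain d where d: "d > 0" "ball (t *\<^sub>R x) d \<subseteq> Oz" "\<forall>z\<in>ball (t *\<^sub>R x) d. h z = h (t *\<^sub>R x) + L (z - t *\<^sub>R x)"
      using aff[OF t] by blast
    let ?N = "ball (t *\<^sub>R x) d \<inter> ball x e"
    show ?thesis
    proof (rule locally_flat_unique[of "ball x e \<inter> ball 0 r" G F ?N])
      show "locally_flat A D (ball x e \<inter> ball 0 r) G" "locally_flat A D (ball x e \<inter> ball 0 r) F"
        by (rule locally_flat_subset[OF Gl] locally_flat_subset[OF F]; auto)+
      show "connected (ball x e \<inter> ball 0 r)" by (intro convex_connected convex_Int convex_ball)
      show "open ?N" by auto
      show "?N \<subseteq> ball x e \<inter> ball 0 r" using d(2) by (auto simp: Oz_def)
      show "?N \<noteq> {}" using tx d(1) by (metis IntI centre_in_ball empty_iff)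
      show "z \<in> ball x e \<inter> ball 0 r" by fact
      fix y assume y: "y \<in> ?N"
      have "h y = L (y - x)" using d(3) y hray[OF t] by (simp add: linear_add[OF linL(1), symmetric])
      moreover have "F y = P (h y)" using hz(2) y d(2) by auto
      ultimately show "G y = F y" by (simp add: G_def)
    qed
  qed
  then show ?thesis using e Gl by blast
qed

end

context flat_manifold
begin

text \<open>Local continuations at the boundary points agree on overlaps, since a nonempty overlap
  reaches into the open ball, where they equal F. Compactness of the closed ball turns the glued
  neighbourhood into a ball of larger radius.\<close>

lemma extend_ball:
  assumes F: "locally_flat A D (ball 0 r) F" and r: "r > 0"
    and lim: "\<And>x. norm x = r \<Longrightarrow> \<exists>p. ((\<lambda>t. F (t *\<^sub>R x)) \<longlongrightarrow> p) (at_left 1)"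
  shows "\<exists>s>r. \<exists>F'. locally_flat A D (ball 0 s) F' \<and> (\<forall>z\<in>ball 0 r. F' z = F z)"
proof -
  have "\<forall>x. norm x = r \<longrightarrow> (\<exists>e G. e > 0 \<and> locally_flat A D (ball x e) G \<and> (\<forall>z\<in>ball x e \<inter> ball 0 r. G z = F z))"
    using extend_at_boundary_point[OF F r] lim by metis
  then obtain e G where G: "\<And>x. norm x = r \<Longrightarrow> e x > 0" "\<And>x. norm x = r \<Longrightarrow> locally_flat A D (ball x (e x)) (G x)"
    "\<And>x z. norm x = r \<Longrightarrow> z \<in> ball x (e x) \<Longrightarrow> z \<in> ball 0 r \<Longrightarrow> G x z = F z"
    by (metis IntI)
  have agree: "G x z = G y z"
    if xy: "norm x = r" "norm y = r" "z \<in> ball x (e x)" "z \<in> ball y (e y)" for x y z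
  proof (cases "x = y")
    case False
    obtain m where m: "m \<in> ball x (e x)" "m \<in> ball y (e y)" "norm m < r"
      using segment_point_in_balls[OF xy] False by blast
    let ?W = "ball x (e x) \<inter> ball y (e y)"
    show ?thesis
    proof (rule locally_flat_unique[of ?W "G x" "G y" "?W \<inter> ball 0 r"])
      show "locally_flat A D ?W (G x)" by (rule locally_flat_subset[OF G(2)[OF xy(1)]]) auto
      show "locally_flat A D ?W (G y)" by (rule locally_flat_subset[OF G(2)[OF xy(2)]]) auto
      show "connected ?W" by (intro convex_connected convex_Int convex_ball)
      show "G x v = G y v" if "v \<in> ?W \<inter> ball 0 r" for v
        using that G(3)[OF xy(1), of v] G(3)[OF xy(2), of v] by simp
      show "?W \<inter> ball 0 r \<noteq> {}" using m by (metis IntI empty_iff mem_ball_0)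
    qed (use xy in auto)
  qed simp
  define sel where "sel z = (SOME x. norm x = r \<and> z \<in> ball x (e x))" for z
  define F' where "F' z = (if norm z < r then F z else G (sel z) z)" for z
  have F'F: "F' z = F z" if "z \<in> ball 0 r" for z using that by (simp add: F'_def)
  have F'G: "F' z = G x z" if x: "norm x = r" "z \<in> ball x (e x)" for x z
  proof (cases "norm z < r")
    case True
    then show ?thesis using G(3)[OF x] by (simp add: F'_def)
  next
    case False
    have "norm (sel z) = r \<and> z \<in> ball (sel z) (e (sel z))"
      unfolding sel_def by (rule someI[of _ x]) (use x in blast)
    then show ?thesis using agree[OF _ x(1) _ x(2)] False by (simp add: F'_def)
  qed
  define W where "W = ball 0 r \<union> (\<Union>x\<in>{x. norm x = r}. ball x (e x))"
  have oW: "open W" unfolding W_def by (intro open_Un open_UN open_ball ballI)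
  have "cball 0 r \<subseteq> W"
    using G(1) unfolding W_def by (fastforce simp: less_eq_real_def)
  then obtain d where d: "d > 0" "(\<Union>x\<in>cball 0 r. ball x d) \<subseteq> W"
    using compact_subset_open_imp_ball_epsilon_subset[OF compact_cball oW] by blast
  have "ball 0 (r + d) \<subseteq> W"
  proof
    fix z :: "complex ^ 'n" assume z: "z \<in> ball 0 (r + d)"
    show "z \<in> W"
    proof (cases "norm z \<le> r")
      case True
      then show ?thesis using d by (intro subsetD[OF d(2)]) (auto intro!: bexI[of _ z])
    next
      case False
      define y where "y = (r / norm z) *\<^sub>R z"
      have "z \<noteq> 0" using False r by force
      then have "norm y = r" using r by (simp add: y_def)
      moreover have "norm (z - y) < d"
      proof -
        have "z - y = (1 - r / norm z) *\<^sub>R z" by (simp add: y_def algebra_simps)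
        then have "norm (z - y) = \<bar>1 - r / norm z\<bar> * norm z" by simp
        also have "\<dots> = norm z - r"
        proof -
          have "norm z > 0" using False r by linarith
          then show ?thesis using False r by (simp add: abs_if field_simps)
        qed
        finally show ?thesis using z by simp
      qed
      ultimately show ?thesis
        using d by (intro subsetD[OF d(2)]) (auto intro!: bexI[of _ y] simp: dist_norm norm_minus_commute)
    qed
  qed
  moreover have FW: "locally_flat A D W F'"
  proof (rule locally_flat_glue[OF oW])
    fix x assume "x \<in> W"
    then consider "x \<in> ball 0 r" | y where "norm y = r" "x \<in> ball y (e y)" by (auto simp: W_def)
    then show "\<exists>N G. open N \<and> x \<in> N \<and> N \<subseteq> W \<and> locally_flat A D N G \<and> (\<forall>z\<in>N. G z = F' z)"
    proof cases
      case 1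
      then show ?thesis using F F'F by (intro exI[of _ "ball 0 r"] exI[of _ F]) (auto simp: W_def)
    next
      case 2
      then show ?thesis using G(2) F'G by (intro exI[of _ "ball y (e y)"] exI[of _ "G y"]) (auto simp: W_def)
    qed
  qed
  ultimately have "locally_flat A D (ball 0 (r + d)) F'" using locally_flat_subset[OF FW open_ball] by simp
  then show ?thesis using d(1) F'F by (intro exI[of _ "r + d"]) auto
qed

text \<open>A continuity argument in the radius. Extensions of the germ of F0 coincide on common
  balls, so they unite on the ball whose radius rs is the supremum; if rs < R,
  \<open>extend_ball\<close> would go beyond it.\<close>

theorem developing_map:
  assumes F0: "locally_flat A D (ball 0 r0) F0" and r0: "r0 > 0"
    and ext: "\<And>r F x. 0 < r \<Longrightarrow> r < R \<Longrightarrow> locally_flat A D (ball 0 r) F \<Longrightarrow>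
      \<exists>e>0. \<forall>z\<in>ball 0 e. F z = F0 z \<Longrightarrow> norm x = r \<Longrightarrow> \<exists>p. ((\<lambda>t. F (t *\<^sub>R x)) \<longlongrightarrow> p) (at_left 1)"
  shows "\<exists>F. locally_flat A D (ball 0 R) F \<and> (\<exists>e>0. \<forall>z\<in>ball 0 e. F z = F0 z)"
proof (rule ccontr)
  assume no: "\<not> ?thesis"
  define good where "good r F \<longleftrightarrow> locally_flat A D (ball 0 r) F \<and> (\<exists>e>0. \<forall>z\<in>ball 0 e. F z = F0 z)" for r F
  have restr: "good s F" if "good r F" "s \<le> r" for r s F
    using that locally_flat_subset[OF _ open_ball subset_ball[OF that(2)]] unfolding good_def by blast
  have noR: "\<not> good r F" if "r \<ge> R" for r F
    using restr[of r F R] that no by (auto simp: good_def)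
  have g0: "good r0 F0" using F0 by (auto simp: good_def intro!: exI[of _ "1 :: real"])
  define S where "S = {r. \<exists>F. good r F}"
  have bdd: "bdd_above S" unfolding bdd_above_def
  proof (intro exI[of _ R] ballI)
    fix r assume "r \<in> S"
    then show "r \<le> R" using noR[of r] by (auto simp: S_def intro: leI)
  qed
  define rs where "rs = Sup S"
  have S0: "r0 \<in> S" using g0 by (auto simp: S_def)
  have rs0: "rs \<ge> r0" "rs > 0" using cSup_upper[OF S0 bdd] r0 by (auto simp: rs_def)
  define Fr where "Fr r = (SOME F. good r F)" for r
  have Fr: "good r (Fr r)" if "r \<in> S" for r
    using that someI_ex[of "good r"] unfolding Fr_def S_def by blast
  have same: "Fr r z = Fr s z" if rs: "r \<in> S" "s \<in> S" "norm z < r" "norm z < s" for r s z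
  proof -
    let ?W = "ball (0 :: complex ^ 'n) (min r s)"
    obtain e1 where e1: "e1 > 0" "\<forall>z\<in>ball 0 e1. Fr r z = F0 z" using Fr[OF rs(1)] by (auto simp: good_def)
    obtain e2 where e2: "e2 > 0" "\<forall>z\<in>ball 0 e2. Fr s z = F0 z" using Fr[OF rs(2)] by (auto simp: good_def)
    have pos: "0 < min r s" using rs(3,4) norm_ge_zero[of z] by linarith
    show ?thesis
    proof (rule locally_flat_unique[of ?W "Fr r" "Fr s" "ball 0 (min (min r s) (min e1 e2))"])
      show "locally_flat A D ?W (Fr r)" "locally_flat A D ?W (Fr s)"
        using restr[OF Fr[OF rs(1)], of "min r s"] restr[OF Fr[OF rs(2)], of "min r s"] by (auto simp: good_def)
      show "connected ?W" by (intro convex_connected convex_ball)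
      show "ball (0 :: complex ^ 'n) (min (min r s) (min e1 e2)) \<noteq> {}" using pos e1(1) e2(1) by (simp add: not_le)
      show "Fr r v = Fr s v" if "v \<in> ball 0 (min (min r s) (min e1 e2))" for v using that e1 e2 by simp
    qed (use rs in auto)
  qed
  define sel where "sel z = (SOME r. r \<in> S \<and> norm z < r)" for z :: "complex ^ 'n"
  have sel: "sel z \<in> S \<and> norm z < sel z" if zrs: "norm z < rs" for z
  proof -
    obtain r where "r \<in> S" "norm z < r" using less_cSupD[of S "norm z"] zrs S0 by (auto simp: rs_def)
    then show ?thesis unfolding sel_def by (intro someI[of "\<lambda>r. r \<in> S \<and> norm z < r"]) blast
  qed
  define F where "F z = Fr (sel z) z" for z
  have FFr: "F z = Fr r z" if "r \<in> S" "norm z < r" for r z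
  proof -
    have "norm z < rs" using cSup_upper[OF that(1) bdd] that(2) by (simp add: rs_def)
    then show ?thesis using same[of "sel z" r z] sel[of z] that by (simp add: F_def)
  qed
  have "locally_flat A D (ball 0 rs) F"
  proof (rule locally_flat_glue[OF open_ball])
    fix x :: "complex ^ 'n" assume "x \<in> ball 0 rs"
    then obtain r where r: "r \<in> S" "norm x < r" using less_cSupD[of S "norm x"] S0 by (auto simp: rs_def)
    have "r \<le> rs" using cSup_upper[OF r(1) bdd] by (simp add: rs_def)
    then show "\<exists>N G. open N \<and> x \<in> N \<and> N \<subseteq> ball 0 rs \<and> locally_flat A D N G \<and> (\<forall>z\<in>N. G z = F z)"
      using r Fr[OF r(1)] FFr[OF r(1)] by (intro exI[of _ "ball 0 r"] exI[of _ "Fr r"]) (auto simp: good_def)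
  qed
  moreover have agr: "\<exists>e>0. \<forall>z\<in>ball 0 e. F z = F0 z"
  proof -
    obtain e where e: "e > 0" "\<forall>z\<in>ball 0 e. Fr r0 z = F0 z" using Fr[OF S0] by (auto simp: good_def)
    then show ?thesis using FFr[OF S0] r0 by (intro exI[of _ "min e r0"]) auto
  qed
  ultimately have grs: "good rs F" by (simp add: good_def)
  then have "rs < R" using noR by (meson linorder_not_less)
  have F: "locally_flat A D (ball 0 rs) F" using grs by (simp add: good_def)
  obtain s F' where s: "s > rs" "locally_flat A D (ball 0 s) F'" "\<forall>z\<in>ball 0 rs. F' z = F z"
    using extend_ball[OF F rs0(2) ext[OF rs0(2) \<open>rs < R\<close> F agr]] by blast
  obtain e where e: "e > 0" "\<forall>z\<in>ball 0 e. F z = F0 z" using agr by blast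
  have "good s F'"
    unfolding good_def using s e rs0 by (intro conjI exI[of _ "min e rs"]) auto
  then have "s \<in> S" by (auto simp: S_def)
  then show False using cSup_upper[OF _ bdd, of s] s(1) by (simp add: rs_def)
qed

end

section \<open>Curves and the Riemannian distance\<close>

text \<open>Unlike \<open>velocity\<close>, which is total through \<open>deriv\<close>, this
  asserts that the curve really is differentiable at t.\<close>

definition has_velocity ::
    "('a::topological_space, 'n::finite) atlas \<Rightarrow> (real \<Rightarrow> 'a) \<Rightarrow> real \<Rightarrow> 'a tvec \<Rightarrow> bool" where
  "has_velocity A \<gamma> t v \<longleftrightarrow> v \<in> tangent_space A (\<gamma> t) \<and>
     (\<forall>f. smooth_fun_at A (\<gamma> t) f \<longrightarrow> ((\<lambda>s. f (\<gamma> s)) has_real_derivative v f) (at t))"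

lemma velocity_eq: "has_velocity A \<gamma> t v \<Longrightarrow> velocity A \<gamma> t = v"
proof
  assume v: "has_velocity A \<gamma> t v"
  fix f
  show "velocity A \<gamma> t f = v f"
  proof (cases "smooth_fun_at A (\<gamma> t) f")
    case True
    then show ?thesis using v by (simp add: velocity_def has_velocity_def DERIV_imp_deriv)
  next
    case False
    moreover have "\<forall>f. \<not> smooth_fun_at A (\<gamma> t) f \<longrightarrow> v f = 0"
      using v unfolding has_velocity_def tangent_space_def by blast
    ultimately show ?thesis by (simp add: velocity_def)
  qed
qed

text \<open>A pointwise speed bound over the unit interval in place of a length integral. It bounds
  \<open>riemannian_dist\<close> by l and adds up under concatenation without any integration; l > 0
  provides the split point used there.\<close>

definition reach ::
    "('a::topological_space, 'n::finite) atlas \<Rightarrow> ('a \<Rightarrow> 'a tvec \<Rightarrow> 'a tvec \<Rightarrow> real) \<Rightarrow> 'a \<Rightarrow> 'a \<Rightarrow> real \<Rightarrow> bool" where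
  "reach A g p q l \<longleftrightarrow> 0 < l \<and> (\<exists>\<gamma> S. piecewise_C1_curve A \<gamma> \<and> \<gamma> 0 = p \<and> \<gamma> 1 = q \<and> finite S \<and>
     (\<forall>t\<in>{0..1} - S. \<exists>v. has_velocity A \<gamma> t v \<and> sqrt (g (\<gamma> t) v v) \<le> l))"

lemma reach_dist:
  assumes "reach A g p q l"
  shows "riemannian_dist A g p q \<le> ennreal l"
proof -
  obtain \<gamma> S where \<gamma>: "piecewise_C1_curve A \<gamma>" "\<gamma> 0 = p" "\<gamma> 1 = q" "finite S"
    "\<forall>t\<in>{0..1} - S. \<exists>v. has_velocity A \<gamma> t v \<and> sqrt (g (\<gamma> t) v v) \<le> l"
    using assms unfolding reach_def by blast
  have "riemannian_dist A g p q \<le> curve_length A g \<gamma>"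
    unfolding riemannian_dist_def by (rule INF_lower) (use \<gamma> in auto)
  also have "\<dots> \<le> (\<integral>\<^sup>+t. ennreal l * indicator {0..1 :: real} t \<partial>lborel)"
    unfolding curve_length_def
  proof (rule nn_integral_mono_AE)
    have "AE t in lborel. t \<notin> S"
      using \<gamma>(4) by (intro AE_not_in) (simp add: finite_imp_null_set_lborel)
    then show "AE t in lborel. ennreal (sqrt (g (\<gamma> t) (velocity A \<gamma> t) (velocity A \<gamma> t))) * indicator {0..1} t
        \<le> ennreal l * indicator {0..1} t"
    proof eventually_elim
      case (elim t)
      show ?case
      proof (cases "t \<in> {0..1}")
        case True
        then show ?thesis using \<gamma>(5) elim velocity_eq by (fastforce intro: ennreal_leI)
      qed simp
    qed
  qed
  also have "\<dots> = ennreal l" by (simp add: nn_integral_cmult_indicator)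
  finally show ?thesis .
qed

section \<open>Reparametrized, concatenated and reversed curves\<close>

lemma has_velocity_affine:
  assumes v: "has_velocity A \<gamma> (c * t + d) v" and N: "open N" "t \<in> N" "\<And>s. s \<in> N \<Longrightarrow> \<gamma>' s = \<gamma> (c * s + d)"
    and T: "c *\<^sub>T v \<in> tangent_space A (\<gamma> (c * t + d))"
  shows "has_velocity A \<gamma>' t (c *\<^sub>T v)"
  unfolding has_velocity_def
proof (intro conjI allI impI)
  show "c *\<^sub>T v \<in> tangent_space A (\<gamma>' t)" using T N by simp
  fix f assume "smooth_fun_at A (\<gamma>' t) f"
  then have f: "((\<lambda>s. f (\<gamma> s)) has_real_derivative v f) (at (c * t + d))"
    using v N by (simp add: has_velocity_def)
  have "((\<lambda>s. f (\<gamma> (c * s + d))) has_real_derivative v f * c) (at t)"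
    by (rule DERIV_chain2[where f = "\<lambda>s. f (\<gamma> s)" and g = "\<lambda>s. c * s + d", OF f]) (auto intro!: derivative_eq_intros)
  then have "((\<lambda>s. f (\<gamma>' s)) has_real_derivative v f * c) (at t)"
    by (rule has_field_derivative_transform_within_open[OF _ N(1,2)]) (simp add: N(3))
  then show "((\<lambda>s. f (\<gamma>' s)) has_real_derivative c * v f) (at t)" by (simp add: mult.commute)
qed

text \<open>The speed may be unbounded near S, so its integral is taken with values up to infinity.
  If it is infinite nothing is to be shown; otherwise the fundamental theorem with finitely many
  exceptions applies.\<close>

lemma speed_integral:
  fixes \<psi> :: "real \<Rightarrow> 'e::euclidean_space"
  assumes S: "finite S" and ab: "a \<le> b" and der: "\<And>x. x \<in> {a..b} - S \<Longrightarrow> (\<psi> has_vector_derivative D x) (at x)"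
    and contD: "continuous_on ({a..b} - S) D" and cont: "continuous_on {a..b} \<psi>"
  shows "ennreal (norm (\<psi> b - \<psi> a)) \<le> (\<integral>\<^sup>+x. ennreal (indicator ({a..b} - S) x * norm (D x)) \<partial>lborel)"
proof -
  define n where "n x = indicator ({a..b} - S) x *\<^sub>R norm (D x)" for x :: real
  have "{a..b} - S \<in> sets borel" by (intro sets.Diff) (auto intro: borel_closed finite_imp_closed[OF S])
  then have nm: "n \<in> borel_measurable borel"
    unfolding n_def by (intro borel_measurable_continuous_on_indicator continuous_on_norm contD)
  have n0: "n x \<ge> 0" for x by (simp add: n_def)
  show ?thesis
  proof (cases "(\<integral>\<^sup>+x. ennreal (n x) \<partial>lborel) = \<infinity>")
    case True
    then show ?thesis by (simp add: n_def)
  next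
    case False
    then obtain R where R: "(\<integral>\<^sup>+x. ennreal (n x) \<partial>lborel) = ennreal R" "R \<ge> 0"
      by (cases "\<integral>\<^sup>+x. ennreal (n x) \<partial>lborel" rule: ennreal_cases) auto
    have hn: "(n has_integral R) UNIV" by (rule nn_integral_has_integral[OF nm n0 R])
    have "(D has_integral (\<psi> b - \<psi> a)) {a..b}"
      by (rule fundamental_theorem_of_calculus_strong[OF S ab der cont])
    then have "((\<lambda>x. if x \<in> {a..b} then D x else 0) has_integral (\<psi> b - \<psi> a)) UNIV"
      by (simp only: has_integral_restrict_UNIV)
    then have hD: "((\<lambda>x. indicator ({a..b} - S) x *\<^sub>R D x) has_integral (\<psi> b - \<psi> a)) UNIV"
      by (rule has_integral_spike_finite[OF S, rotated]) (auto simp: indicator_def)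
    have "norm (\<psi> b - \<psi> a) \<le> R"
    proof -
      have "norm (integral UNIV (\<lambda>x. indicator ({a..b} - S) x *\<^sub>R D x)) \<le> integral UNIV n"
        using hD hn by (intro integral_norm_bound_integral) (auto simp: n_def has_integral_integrable indicator_def)
      then show ?thesis using hD hn by (simp add: integral_unique)
    qed
    then show ?thesis using R by (simp add: n_def ennreal_leI)
  qed
qed

lemma piecewise_C1_cong:
  fixes f :: "real \<Rightarrow> 'e::real_normed_vector"
  assumes "f piecewise_C1_differentiable_on {a..b}" and eq: "\<And>t. t \<in> {a..b} \<Longrightarrow> f t = h t"
  shows "h piecewise_C1_differentiable_on {a..b}"
proof -
  obtain S D where S: "continuous_on {a..b} f" "finite S"
    "\<forall>x\<in>{a..b} - S. (f has_vector_derivative D x) (at x)" "continuous_on ({a..b} - S) D"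
    using assms(1) unfolding piecewise_C1_differentiable_on_def C1_differentiable_on_def by blast
  \<comment> \<open>At the end points a two-sided derivative would depend on values of h outside the
    interval, hence they are added to the exceptional set.\<close>
  have "(h has_vector_derivative D x) (at x)" if "x \<in> {a..b} - (S \<union> {a, b})" for x
  proof (rule has_vector_derivative_transform_within_open)
    show "(f has_vector_derivative D x) (at x)" using S(3) that by blast
    show "open {a<..<b}" "x \<in> {a<..<b}" using that by auto
  qed (use eq in auto)
  moreover have "continuous_on ({a..b} - (S \<union> {a, b})) D" using S(4) by (rule continuous_on_subset) auto
  moreover have "continuous_on {a..b} h" using S(1) eq by (rule continuous_on_eq)
  ultimately show ?thesis
    unfolding piecewise_C1_differentiable_on_def C1_differentiable_on_def
    using S(2) by (intro conjI exI[of _ "S \<union> {a, b}"] exI[of _ D]) auto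
qed

lemma piecewise_C1_curve_cases:
  assumes "piecewise_C1_curve A \<gamma>1" "piecewise_C1_curve A \<gamma>2" "\<gamma>1 1 = \<gamma>2 0" and s: "0 < s" "s < 1"
  defines "\<gamma> \<equiv> \<lambda>t. if t \<le> s then \<gamma>1 (1 / s * t + 0) else \<gamma>2 (1 / (1 - s) * t + - s / (1 - s))"
  shows "piecewise_C1_curve A \<gamma>"
  unfolding piecewise_C1_curve_def
proof (intro conjI allI impI ballI)
  let ?f = "\<lambda>t. 1 / s * t + 0" and ?h = "\<lambda>t. 1 / (1 - s) * t + - s / (1 - s)"
  have f1: "?f s = 1" and h0: "?h s = 0" using s by (auto simp: field_simps)
  have hs: "?h t = (t - s) / (1 - s)" for t by (simp add: diff_divide_distrib)
  have fin: "?f t \<in> {0..1}" if "0 \<le> t" "t \<le> s" for t using that s by auto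
  have hin: "?h t \<in> {0..1}" if "s \<le> t" "t \<le> 1" for t
    unfolding hs using that s by (simp add: divide_le_eq_1)
  have c1: "continuous_on {0..1} \<gamma>1" and c2: "continuous_on {0..1} \<gamma>2"
    using assms(1,2) by (auto simp: piecewise_C1_curve_def)
  have "continuous_on ({0..s} \<union> {s..1}) \<gamma>"
    unfolding \<gamma>_def
  proof (rule continuous_on_cases)
    show "continuous_on {0..s} (\<lambda>t. \<gamma>1 (?f t))"
      using fin by (intro continuous_on_compose2[OF c1] continuous_intros) auto
    show "continuous_on {s..1} (\<lambda>t. \<gamma>2 (?h t))"
      using hin s by (intro continuous_on_compose2[OF c2] continuous_intros) auto
    show "\<forall>t. t \<in> {0..s} \<and> \<not> t \<le> s \<or> t \<in> {s..1} \<and> t \<le> s \<longrightarrow> \<gamma>1 (?f t) = \<gamma>2 (?h t)"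
    proof (intro allI impI)
      fix t assume "t \<in> {0..s} \<and> \<not> t \<le> s \<or> t \<in> {s..1} \<and> t \<le> s"
      then have "t = s" by auto
      then show "\<gamma>1 (?f t) = \<gamma>2 (?h t)" using f1 h0 assms(3) by (simp only:)
    qed
  qed auto
  then show "continuous_on {0..1} \<gamma>"
    using s by (metis ivl_disj_un_two_touch(4) less_imp_le)
  fix x assume x: "x \<in> A"
  obtain U \<phi> where [simp]: "x = (U, \<phi>)" by (cases x)
  have p1: "(\<lambda>t. \<phi> (\<gamma>1 (?f t))) piecewise_C1_differentiable_on {a..b}"
    if ab: "0 \<le> a" "b \<le> s" "a \<le> b" "\<And>t. t \<in> {a..b} \<Longrightarrow> \<gamma>1 (?f t) \<in> U" for a b
  proof -
    have im: "?f ` {a..b} = {?f a..?f b}"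
      using ab s image_affinity_atLeastAtMost[of "1/s" 0 a b] by auto
    have "\<gamma>1 ` {?f a..?f b} \<subseteq> U" unfolding im[symmetric] using ab(4) by auto
    then have "(\<lambda>t. \<phi> (\<gamma>1 t)) piecewise_C1_differentiable_on {?f a..?f b}"
      using assms(1) x fin[of a] fin[of b] ab unfolding piecewise_C1_curve_def by fastforce
    then show ?thesis
      using piecewise_C1_differentiable_affine[of "\<lambda>t. \<phi> (\<gamma>1 t)" "1/s" 0 "{a..b}"] im by (simp add: o_def)
  qed
  have p2: "(\<lambda>t. \<phi> (\<gamma>2 (?h t))) piecewise_C1_differentiable_on {a..b}"
    if ab: "s \<le> a" "b \<le> 1" "a \<le> b" "\<And>t. t \<in> {a..b} \<Longrightarrow> \<gamma>2 (?h t) \<in> U" for a b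
  proof -
    have im: "?h ` {a..b} = {?h a..?h b}"
      using ab s image_affinity_atLeastAtMost[of "1/(1-s)" "- s / (1 - s)" a b] by auto
    have "\<gamma>2 ` {?h a..?h b} \<subseteq> U" unfolding im[symmetric] using ab(4) by auto
    then have "(\<lambda>t. \<phi> (\<gamma>2 t)) piecewise_C1_differentiable_on {?h a..?h b}"
      using assms(2) x hin[of a] hin[of b] ab unfolding piecewise_C1_curve_def by fastforce
    then show ?thesis
      using piecewise_C1_differentiable_affine[of "\<lambda>t. \<phi> (\<gamma>2 t)" "1/(1-s)" "- s / (1 - s)" "{a..b}"] im by (simp add: o_def)
  qed
  show "case x of (U, \<phi>) \<Rightarrow> \<forall>a b. 0 \<le> a \<longrightarrow> b \<le> 1 \<longrightarrow> \<gamma> ` {a..b} \<subseteq> U \<longrightarrow>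
        (\<lambda>t. \<phi> (\<gamma> t)) piecewise_C1_differentiable_on {a..b}"
    unfolding \<open>x = _\<close> split_conv
  proof (intro allI impI)
    fix a b assume ab: "0 \<le> a" "b \<le> 1" "\<gamma> ` {a..b} \<subseteq> U"
    have eq: "(\<lambda>t. \<phi> (\<gamma> t)) = (\<lambda>t. if t \<le> s then \<phi> (\<gamma>1 (?f t)) else \<phi> (\<gamma>2 (?h t)))"
      by (auto simp: \<gamma>_def)
    have U1: "\<gamma>1 (?f t) \<in> U" if "t \<in> {a..b}" "t \<le> s" for t
    proof -
      have "\<gamma> t \<in> U" using ab(3) that(1) by blast
      then show ?thesis using that(2) by (simp add: \<gamma>_def)
    qed
    have U2: "\<gamma>2 (?h t) \<in> U" if "t \<in> {a..b}" "s \<le> t" for t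
    proof (cases "t = s")
      case True
      have "\<gamma> t \<in> U" using ab(3) that(1) by blast
      then have "\<gamma>1 1 \<in> U" using True f1 by (simp add: \<gamma>_def)
      then show ?thesis unfolding True h0 using assms(3) by simp
    next
      case False
      have "\<gamma> t \<in> U" using ab(3) that(1) by blast
      then show ?thesis using that(2) False by (simp add: \<gamma>_def)
    qed
    consider "b < a" | "a \<le> b" "b \<le> s" | "a \<le> b" "s \<le> a" | "a \<le> s" "s \<le> b" by linarith
    then show "(\<lambda>t. \<phi> (\<gamma> t)) piecewise_C1_differentiable_on {a..b}"
    proof cases
      case 1
      then show ?thesis by (auto simp: piecewise_C1_differentiable_on_def)
    next
      case 2
      show ?thesis unfolding eq
        by (rule piecewise_C1_cong[OF p1[of a b]]) (use 2 ab U1 in auto)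
    next
      case 3
      have "\<gamma>1 (?f s) = \<gamma>2 (?h s)" unfolding f1 h0 using assms(3) .
      then have "\<phi> (\<gamma>2 (?h t)) = (if t \<le> s then \<phi> (\<gamma>1 (?f t)) else \<phi> (\<gamma>2 (?h t)))" if "t \<in> {a..b}" for t
        using that 3 by (cases "t = s") auto
      then show ?thesis unfolding eq
        by (intro piecewise_C1_cong[OF p2[of a b]]) (use 3 ab U2 in auto)
    next
      case 4
      show ?thesis
        unfolding eq
      proof (rule piecewise_C1_differentiable_cases)
        show "(\<lambda>t. \<phi> (\<gamma>1 (?f t))) piecewise_C1_differentiable_on {a..s}" using 4 ab U1 by (intro p1) auto
        show "(\<lambda>t. \<phi> (\<gamma>2 (?h t))) piecewise_C1_differentiable_on {s..b}" using 4 ab U2 by (intro p2) auto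
        show "\<phi> (\<gamma>1 (?f s)) = \<phi> (\<gamma>2 (?h s))" unfolding f1 h0 using assms(3) by simp
      qed (use 4 in auto)
    qed
  qed
qed

lemma reach_trans:
  assumes tan: "\<And>p v c. v \<in> tangent_space A p \<Longrightarrow> c *\<^sub>T v \<in> tangent_space A p"
    and g: "\<And>p v c. v \<in> tangent_space A p \<Longrightarrow> g p (c *\<^sub>T v) (c *\<^sub>T v) = c^2 * g p v v"
    and pq: "reach A g p q a" and qr: "reach A g q r b"
  shows "reach A g p r (a + b)"
proof -
  obtain \<gamma>1 S1 where 1: "0 < a" "piecewise_C1_curve A \<gamma>1" "\<gamma>1 0 = p" "\<gamma>1 1 = q" "finite S1"
    "\<forall>t\<in>{0..1} - S1. \<exists>v. has_velocity A \<gamma>1 t v \<and> sqrt (g (\<gamma>1 t) v v) \<le> a"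
    using pq unfolding reach_def by blast
  obtain \<gamma>2 S2 where 2: "0 < b" "piecewise_C1_curve A \<gamma>2" "\<gamma>2 0 = q" "\<gamma>2 1 = r" "finite S2"
    "\<forall>t\<in>{0..1} - S2. \<exists>v. has_velocity A \<gamma>2 t v \<and> sqrt (g (\<gamma>2 t) v v) \<le> b"
    using qr unfolding reach_def by blast
  \<comment> \<open>Time is divided in proportion to the two bounds, so that both rescaled halves
    have speed at most a + b.\<close>
  define s where "s = a / (a + b)"
  have s: "0 < s" "s < 1" using 1(1) 2(1) by (auto simp: s_def)
  have s': "1 / s * a = a + b" "1 / (1 - s) * b = a + b" using 1(1) 2(1) by (auto simp: s_def field_simps)
  let ?f = "\<lambda>t. 1 / s * t + 0" and ?h = "\<lambda>t. 1 / (1 - s) * t + - s / (1 - s)"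
  define \<gamma> where "\<gamma> t = (if t \<le> s then \<gamma>1 (?f t) else \<gamma>2 (?h t))" for t
  have C: "piecewise_C1_curve A \<gamma>"
    unfolding \<gamma>_def[abs_def] by (rule piecewise_C1_curve_cases[OF 1(2) 2(2) _ s]) (simp add: 1 2)
  have hs: "?h t = (t - s) / (1 - s)" for t by (simp add: diff_divide_distrib)
  have "\<gamma> 0 = p" using s 1(3) by (simp add: \<gamma>_def)
  moreover have "\<gamma> 1 = r"
  proof -
    have "?h 1 = 1" unfolding hs using s by simp
    then show ?thesis using s 2(4) by (simp only: \<gamma>_def) simp
  qed
  moreover define S where "S = {s} \<union> ?f -` S1 \<union> ?h -` S2"
  have "finite S"
    unfolding S_def using s 1(5) 2(5)
    by (intro finite_UnI finite_vimageI) (auto simp: inj_on_def divide_simps)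
  moreover have "\<exists>v. has_velocity A \<gamma> t v \<and> sqrt (g (\<gamma> t) v v) \<le> a + b" if t: "t \<in> {0..1} - S" for t
  proof (cases "t < s")
    case True
    have "?f t \<in> {0..1} - S1" using t True s by (auto simp: S_def)
    then obtain v where v: "has_velocity A \<gamma>1 (?f t) v" "sqrt (g (\<gamma>1 (?f t)) v v) \<le> a" using 1(6) by blast
    have vt: "v \<in> tangent_space A (\<gamma>1 (?f t))" using v(1) by (simp add: has_velocity_def)
    have "has_velocity A \<gamma> t ((1 / s) *\<^sub>T v)"
      by (rule has_velocity_affine[OF v(1), of "{..<s}", OF _ _ _ tan[OF vt]]) (use True in \<open>auto simp: \<gamma>_def\<close>)
    moreover have "sqrt (g (\<gamma> t) ((1 / s) *\<^sub>T v) ((1 / s) *\<^sub>T v)) = 1 / s * sqrt (g (\<gamma>1 (?f t)) v v)"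
      using True s g[OF vt, of "1 / s"] by (simp add: \<gamma>_def real_sqrt_mult)
    moreover have "1 / s * sqrt (g (\<gamma>1 (?f t)) v v) \<le> 1 / s * a" using v(2) s by (intro mult_left_mono) auto
    ultimately show ?thesis unfolding s'(1) by auto
  next
    case False
    then have ts: "t > s" using t by (auto simp: S_def)
    have "?h t \<in> {0..1}" unfolding hs using ts t s by (simp add: divide_le_eq_1)
    then have "?h t \<in> {0..1} - S2" using t by (auto simp: S_def)
    then obtain v where v: "has_velocity A \<gamma>2 (?h t) v" "sqrt (g (\<gamma>2 (?h t)) v v) \<le> b" using 2(6) by blast
    have vt: "v \<in> tangent_space A (\<gamma>2 (?h t))" using v(1) by (simp add: has_velocity_def)
    have gt: "\<gamma> t = \<gamma>2 (?h t)" using ts by (simp add: \<gamma>_def)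
    have "has_velocity A \<gamma> t ((1 / (1 - s)) *\<^sub>T v)"
      by (rule has_velocity_affine[OF v(1), of "{s<..}", OF _ _ _ tan[OF vt]]) (use ts in \<open>auto simp: \<gamma>_def\<close>)
    moreover have "sqrt (g (\<gamma> t) ((1 / (1 - s)) *\<^sub>T v) ((1 / (1 - s)) *\<^sub>T v)) = 1 / (1 - s) * sqrt (g (\<gamma>2 (?h t)) v v)"
      unfolding gt g[OF vt, of "1 / (1 - s)"] using s by (simp add: real_sqrt_mult real_sqrt_divide)
    moreover have "1 / (1 - s) * sqrt (g (\<gamma>2 (?h t)) v v) \<le> 1 / (1 - s) * b" using v(2) s by (intro mult_left_mono) auto
    ultimately show ?thesis unfolding s'(2) by auto
  qed
  ultimately show ?thesis
    unfolding reach_def using C 1(1) 2(1) by (intro conjI exI[of _ \<gamma>] exI[of _ S]) auto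
qed

lemma reach_sym:
  assumes tan: "\<And>p v c. v \<in> tangent_space A p \<Longrightarrow> c *\<^sub>T v \<in> tangent_space A p"
    and g: "\<And>p v c. v \<in> tangent_space A p \<Longrightarrow> g p (c *\<^sub>T v) (c *\<^sub>T v) = c^2 * g p v v"
    and pq: "reach A g p q l"
  shows "reach A g q p l"
proof -
  obtain \<gamma>1 S1 where 1: "0 < l" "piecewise_C1_curve A \<gamma>1" "\<gamma>1 0 = p" "\<gamma>1 1 = q" "finite S1"
    "\<forall>t\<in>{0..1} - S1. \<exists>v. has_velocity A \<gamma>1 t v \<and> sqrt (g (\<gamma>1 t) v v) \<le> l"
    using pq unfolding reach_def by blast
  define \<gamma> where "\<gamma> t = \<gamma>1 (- 1 * t + 1)" for t
  have C: "piecewise_C1_curve A \<gamma>"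
    unfolding piecewise_C1_curve_def
  proof (intro conjI ballI)
    have "continuous_on {0..1} \<gamma>1" using 1(2) by (simp add: piecewise_C1_curve_def)
    then show "continuous_on {0..1} \<gamma>"
      unfolding \<gamma>_def by (rule continuous_on_compose2) (auto intro!: continuous_intros)
    fix x assume x: "x \<in> A"
    obtain U \<phi> where [simp]: "x = (U, \<phi>)" by (cases x)
    have "(\<lambda>t. \<phi> (\<gamma> t)) piecewise_C1_differentiable_on {a..b}" if ab: "0 \<le> a" "b \<le> 1" "\<gamma> ` {a..b} \<subseteq> U" for a b
    proof (cases "a \<le> b")
      case True
      have im: "(\<lambda>t. - 1 * t + 1) ` {a..b} = {1 - b..1 - a}"
        using image_affinity_atLeastAtMost[of "-1" 1 a b] True by auto
      have "\<gamma>1 ` {1 - b..1 - a} \<subseteq> U" using ab(3) unfolding im[symmetric] image_image \<gamma>_def .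
      then have "(\<lambda>t. \<phi> (\<gamma>1 t)) piecewise_C1_differentiable_on {1 - b..1 - a}"
        using 1(2) x ab unfolding piecewise_C1_curve_def by fastforce
      then show ?thesis
        using piecewise_C1_differentiable_affine[of "\<lambda>t. \<phi> (\<gamma>1 t)" "-1" 1 "{a..b}"] im by (simp add: o_def \<gamma>_def)
    qed (auto simp: piecewise_C1_differentiable_on_def)
    then show "case x of (U, \<phi>) \<Rightarrow> \<forall>a b. 0 \<le> a \<longrightarrow> b \<le> 1 \<longrightarrow> \<gamma> ` {a..b} \<subseteq> U \<longrightarrow>
        (\<lambda>t. \<phi> (\<gamma> t)) piecewise_C1_differentiable_on {a..b}" by simp
  qed
  define S where "S = (\<lambda>t. - 1 * t + 1 :: real) -` S1"
  have "finite S" unfolding S_def using 1(5) by (intro finite_vimageI) (auto simp: inj_on_def)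
  moreover have "\<exists>v. has_velocity A \<gamma> t v \<and> sqrt (g (\<gamma> t) v v) \<le> l" if t: "t \<in> {0..1} - S" for t
  proof -
    have "- 1 * t + 1 \<in> {0..1} - S1" using t by (auto simp: S_def)
    then obtain v where v: "has_velocity A \<gamma>1 (- 1 * t + 1) v" "sqrt (g (\<gamma>1 (- 1 * t + 1)) v v) \<le> l" using 1(6) by blast
    have vt: "v \<in> tangent_space A (\<gamma>1 (- 1 * t + 1))" using v(1) by (simp add: has_velocity_def)
    have "has_velocity A \<gamma> t (- 1 *\<^sub>T v)"
      by (rule has_velocity_affine[OF v(1), of UNIV, OF _ _ _ tan[OF vt]]) (auto simp: \<gamma>_def)
    moreover have "sqrt (g (\<gamma> t) (- 1 *\<^sub>T v) (- 1 *\<^sub>T v)) \<le> l"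
      unfolding \<gamma>_def g[OF vt, of "- 1"] using v(2) by simp
    ultimately show ?thesis by blast
  qed
  ultimately show ?thesis
    unfolding reach_def using C 1 by (intro conjI exI[of _ \<gamma>] exI[of _ S]) (auto simp: \<gamma>_def)
qed

lemma bilinear_family_continuous:
  fixes G :: "'e::euclidean_space \<Rightarrow> 'e \<Rightarrow> 'e \<Rightarrow> real"
  assumes "\<And>y a. y \<in> B \<Longrightarrow> linear (G y a)" "\<And>y b. y \<in> B \<Longrightarrow> linear (\<lambda>a. G y a b)"
    and "\<And>a b. continuous_on B (\<lambda>y. G y a b)"
  shows "continuous_on (B \<times> UNIV) (\<lambda>(y, a). G y a a)"
proof -
  have "continuous_on (B \<times> UNIV) (\<lambda>p. \<Sum>i\<in>Basis. \<Sum>j\<in>Basis. (snd p \<bullet> i) * ((snd p \<bullet> j) * G (fst p) i j))"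
    by (intro continuous_intros continuous_on_compose2[OF assms(3)]) auto
  moreover have "(\<Sum>i\<in>Basis. \<Sum>j\<in>Basis. (snd p \<bullet> i) * ((snd p \<bullet> j) * G (fst p) i j)) = (case p of (y, a) \<Rightarrow> G y a a)"
    if "p \<in> B \<times> UNIV" for p
  proof -
    obtain y a where p: "p = (y, a)" "y \<in> B" using \<open>p \<in> B \<times> UNIV\<close> by auto
    have "G y a a = (\<Sum>i\<in>Basis. (a \<bullet> i) * G y i a)"
      using linear_expand[OF assms(2)[OF p(2)], of a a] by simp
    also have "\<dots> = (\<Sum>i\<in>Basis. (a \<bullet> i) * (\<Sum>j\<in>Basis. (a \<bullet> j) * G y i j))"
      by (intro sum.cong refl arg_cong2[of _ _ _ _ "(*)"]) (use linear_expand[OF assms(1)[OF p(2)], of _ a] in simp)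
    finally show ?thesis by (simp add: p(1) sum_distrib_left)
  qed
  ultimately show ?thesis by (rule continuous_on_eq)
qed

section \<open>Riemannian metrics in a parametrization\<close>

lemma (in atlas_manifold) tangent_scale:
  assumes v: "v \<in> tangent_space A p"
  shows "c *\<^sub>T v \<in> tangent_space A p"
proof -
  obtain B P x where P: "param A B P" "x \<in> B" "P x = p" using param_exists by blast
  have "c *\<^sub>T v = push_vec A P x (c *\<^sub>R coords B P v)"
    using push_vec_coords[OF P(1,2)] v P(3) push_vec_linear(2)[OF P(1,2)] by metis
  then show ?thesis using push_vec_tangent[OF P(1,2)] P(3) by metis
qed

locale riemannian_manifold = atlas_manifold A
  for A :: "('a::{t2_space, second_countable_topology}, 'n::finite) atlas" +
  fixes g :: "'a \<Rightarrow> 'a tvec \<Rightarrow> 'a tvec \<Rightarrow> real"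
  assumes metric: "riemannian_metric A g"
begin

lemma bilinear: "bilinear_form_field A g"
  using metric[unfolded riemannian_metric_def] by (elim conjE)

lemma g_bilinear:
  assumes "u \<in> tangent_space A p" "v \<in> tangent_space A p" "w \<in> tangent_space A p"
  shows "g p (u + v) w = g p u w + g p v w" "g p w (u + v) = g p w u + g p w v"
    "g p (c *\<^sub>T v) w = c * g p v w" "g p w (c *\<^sub>T v) = c * g p w v"
  using bilinear[unfolded bilinear_form_field_def, THEN conjunct1, THEN spec, THEN bspec, OF assms(1),
      THEN bspec, OF assms(2), THEN bspec, OF assms(3), THEN spec, of c]
  by auto

lemma g_sym: "v \<in> tangent_space A p \<Longrightarrow> w \<in> tangent_space A p \<Longrightarrow> g p v w = g p w v"
  using metric[unfolded riemannian_metric_def, THEN conjunct2, THEN conjunct1] by simp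

lemma g_pos: "v \<in> tangent_space A p \<Longrightarrow> v \<noteq> 0 \<Longrightarrow> g p v v > 0"
  using metric[unfolded riemannian_metric_def, THEN conjunct2, THEN conjunct2] by simp

lemma g_scale: assumes "v \<in> tangent_space A p" shows "g p (c *\<^sub>T v) (c *\<^sub>T v) = c^2 * g p v v"
  using g_bilinear(3)[OF assms assms tangent_scale[OF assms]] g_bilinear(4)[OF assms assms assms]
  by (simp add: power2_eq_square)

lemma reach_add: "reach A g p q a \<Longrightarrow> reach A g q r b \<Longrightarrow> reach A g p r (a + b)"
  by (rule reach_trans[of A g]) (rule tangent_scale g_scale, assumption)+

lemma reach_reverse: "reach A g p q a \<Longrightarrow> reach A g q p a"
  by (rule reach_sym[of A g]) (rule tangent_scale g_scale, assumption)+

text \<open>The pullback of the metric by P. It uses no inverse of P and therefore also makes sense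
  for developing maps.\<close>

definition pull :: "(complex ^ 'n \<Rightarrow> 'a) \<Rightarrow> complex ^ 'n \<Rightarrow> complex ^ 'n \<Rightarrow> complex ^ 'n \<Rightarrow> real" where
  "pull P y a b = g (P y) (push_vec A P y a) (push_vec A P y b)"

context
  fixes B P assumes par: "param A B P"
begin

lemma pull_sym: "y \<in> B \<Longrightarrow> pull P y a b = pull P y b a"
  unfolding pull_def by (intro g_sym push_vec_tangent[OF par])

lemma pull_linear: assumes y: "y \<in> B" shows "linear (pull P y a)"
  unfolding pull_def
  by (rule linearI) (simp_all add: push_vec_linear[OF par y] g_bilinear(2,4)[OF push_vec_tangent[OF par y] push_vec_tangent[OF par y] push_vec_tangent[OF par y]])

lemma pull_linear1: assumes y: "y \<in> B" shows "linear (\<lambda>a. pull P y a b)"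
  using pull_linear[OF y, of b] pull_sym[OF y, of _ b] by presburger

lemma pull_pos: assumes y: "y \<in> B" and a: "a \<noteq> 0" shows "pull P y a a > 0"
  unfolding pull_def
proof (rule g_pos[OF push_vec_tangent[OF par y]])
  show "push_vec A P y a \<noteq> 0"
    using push_vec_inject[OF par y, of a 0] push_vec_zero[OF par y] a by metis
qed

lemma pull_smooth: "Cinf_on B (\<lambda>y. pull P y a b)"
proof -
  have "smooth_fun_on A (P ` B) (\<lambda>p. g p (cfield A B P a p) (cfield A B P b p))"
    by (rule bilinear[unfolded bilinear_form_field_def, THEN conjunct2, rule_format,
          OF param_open_range[OF par] cfield_vector_field[OF par] cfield_vector_field[OF par]])
  from param_smooth[OF par param_open_range[OF par] this]
  have "Cinf_on B (\<lambda>x. g (P x) (cfield A B P a (P x)) (cfield A B P b (P x)))" by (rule Cinf_on_subset) auto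
  then show ?thesis
    by (subst Cinf_on_cong[OF param_open[OF par], of _ "\<lambda>x. g (P x) (cfield A B P a (P x)) (cfield A B P b (P x))"])
       (auto simp: pull_def cfield_at[OF par])
qed

lemma pull_lower_bound:
  assumes K: "compact K" "K \<subseteq> B"
  shows "\<exists>c>0. \<forall>y\<in>K. \<forall>a. c * (norm a)^2 \<le> pull P y a a"
proof (cases "K = {}")
  case False
  have cont: "continuous_on (K \<times> sphere 0 1) (\<lambda>(y, a). pull P y a a)"
    by (rule continuous_on_subset[OF bilinear_family_continuous[OF pull_linear pull_linear1 Cinf_on_continuous[OF pull_smooth]]])
       (use K in auto)
  have "compact (K \<times> sphere (0 :: complex ^ 'n) 1)" using K(1) by (intro compact_Times compact_sphere)
  moreover obtain e0 :: "complex ^ 'n" where "e0 \<in> Basis" using nonempty_Basis by blast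
  then have "K \<times> sphere (0 :: complex ^ 'n) 1 \<noteq> {}" using False by (auto simp: norm_Basis intro!: exI[of _ e0])
  ultimately obtain y0 a0 where m: "y0 \<in> K" "norm a0 = 1"
    "\<And>y a. y \<in> K \<Longrightarrow> norm a = 1 \<Longrightarrow> pull P y0 a0 a0 \<le> pull P y a a"
    using continuous_attains_inf[OF _ _ cont] by fastforce
  have "a0 \<noteq> 0" using m(2) by auto
  then have pos: "pull P y0 a0 a0 > 0" using m(1) K(2) by (intro pull_pos) auto
  have "pull P y0 a0 a0 * (norm a)^2 \<le> pull P y a a" if y: "y \<in> K" for y a
  proof (cases "a = 0")
    case True
    then show ?thesis using linear_0[OF pull_linear, of y] y K(2) by auto
  next
    case False
    have yB: "y \<in> B" using y K(2) by auto
    define u where "u = (1 / norm a) *\<^sub>R a"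
    have u: "norm u = 1" "a = norm a *\<^sub>R u" using False by (auto simp: u_def)
    have "pull P y a a = (norm a)^2 * pull P y u u"
      using linear_cmul[OF pull_linear[OF yB], of _ "norm a" u] linear_cmul[OF pull_linear1[OF yB], of "norm a" u]
      by (subst (1 2) u(2)) (simp add: power2_eq_square)
    then show ?thesis using mult_left_mono[OF m(3)[OF y u(1)], of "(norm a)^2"] by (simp add: mult.commute)
  qed
  then show ?thesis using pos by blast
qed (auto intro: exI[of _ 1])

end

lemma pull_cong:
  assumes "open N" "x \<in> N" "\<And>z. z \<in> N \<Longrightarrow> P z = P' z"
  shows "pull P x a b = pull P' x a b"
  using push_vec_cong[OF assms(1,2), of P P' A] assms(2,3) by (simp add: pull_def)

lemma chart_coordinate_smooth:
  assumes "(U, \<phi>) \<in> A"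
  shows "smooth_fun_on A U (\<lambda>q. \<phi> q \<bullet> b)"
  unfolding smooth_fun_on_def
proof (intro ballI, clarify)
  fix V \<psi> assume V: "(V, \<psi>) \<in> A"
  have "Cinf_on (\<psi> ` (V \<inter> U)) (\<lambda>x. \<phi> (inv_into V \<psi> x))" by (rule chart_transition[OF V assms])
  moreover have "open (\<psi> ` (U \<inter> V))" by (rule chart_open_image[OF V chart_homeo(1)[OF assms]])
  ultimately show "Cinf_on (\<psi> ` (U \<inter> V)) (\<lambda>x. \<phi> (inv_into V \<psi> x) \<bullet> b)"
    by (intro Cinf_on_inner Cinf_on_const) (simp_all add: Int_commute)
qed

text \<open>The curve is the image of a straight segment. As F need not be injective on W, its chart
  expressions are shown smooth locally, in balls where F is a parametrization.\<close>

lemma reach_segment: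
  assumes W: "open W" "\<And>z. z \<in> W \<Longrightarrow> \<exists>r>0. ball z r \<subseteq> W \<and> param A (ball z r) F"
    and seg: "\<And>t. t \<in> {0..1} \<Longrightarrow> x + t *\<^sub>R w \<in> W"
    and l: "l > 0" "\<And>t. t \<in> {0..1} \<Longrightarrow> sqrt (pull F (x + t *\<^sub>R w) w w) \<le> l"
  shows "reach A g (F x) (F (x + w)) l"
proof -
  have contF: "continuous_on W F"
  proof (rule continuous_at_imp_continuous_on, rule ballI)
    fix z assume "z \<in> W"
    then obtain r where r: "r > 0" "param A (ball z r) F" using W(2) by blast
    then show "isCont F z"
      using param_cont[OF r(2)] continuous_on_eq_continuous_at[OF open_ball, of z r F] by simp
  qed
  define \<gamma> where "\<gamma> t = F (x + t *\<^sub>R w)" for t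
  have vel: "has_velocity A \<gamma> t (push_vec A F (x + t *\<^sub>R w) w)" if t: "t \<in> {0..1}" for t
  proof -
    let ?z = "x + t *\<^sub>R w"
    obtain r where r: "r > 0" "param A (ball ?z r) F" using W(2)[OF seg[OF t]] by blast
    have zr: "?z \<in> ball ?z r" using r(1) by simp
    show ?thesis
      unfolding has_velocity_def
    proof (intro conjI allI impI)
      show "push_vec A F ?z w \<in> tangent_space A (\<gamma> t)" unfolding \<gamma>_def by (rule push_vec_tangent[OF r(2) zr])
      fix f assume f: "smooth_fun_at A (\<gamma> t) f"
      then obtain N where N: "?z \<in> N" "Cinf_on N (\<lambda>z. f (F z))"
        unfolding \<gamma>_def smooth_fun_at_param[OF r(2) zr] by blast
      show "((\<lambda>s. f (\<gamma> s)) has_real_derivative push_vec A F ?z w f) (at t)"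
        using dd_along[OF N(2,1)] f unfolding \<gamma>_def push_vec_def by simp
    qed
  qed
  have "piecewise_C1_curve A \<gamma>"
    unfolding piecewise_C1_curve_def
  proof (intro conjI ballI)
    show "continuous_on {0..1} \<gamma>"
      unfolding \<gamma>_def using seg by (intro continuous_on_compose2[OF contF] continuous_intros) auto
    fix c assume c: "c \<in> A"
    obtain U \<phi> where [simp]: "c = (U, \<phi>)" by (cases c)
    have U: "(U, \<phi>) \<in> A" using c by simp
    let ?Z = "W \<inter> F -` U"
    have oZ: "open ?Z"
      using continuous_on_open_vimage[OF W(1), of F] contF chart_homeo(1)[OF U] by (simp add: Int_commute)
    have sm: "Cinf_on ?Z (\<lambda>z. \<phi> (F z))"
    proof (rule Cinf_on_componentwise[OF oZ], rule Cinf_on_local[OF oZ])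
      fix b z assume z: "z \<in> ?Z"
      then obtain r where r: "r > 0" "ball z r \<subseteq> W" "param A (ball z r) F" using W(2) by blast
      have "Cinf_on (ball z r \<inter> F -` U) (\<lambda>z. \<phi> (F z) \<bullet> b)"
        by (rule param_smooth[OF r(3) chart_homeo(1)[OF U] chart_coordinate_smooth[OF U]])
      then have "Cinf_on (ball z r \<inter> ?Z) (\<lambda>z. \<phi> (F z) \<bullet> b)" by (rule Cinf_on_subset) auto
      then show "\<exists>T. open T \<and> z \<in> T \<and> Cinf_on (T \<inter> ?Z) (\<lambda>z. \<phi> (F z) \<bullet> b)"
        using r(1) by (intro exI[of _ "ball z r"]) auto
    qed
    have "(\<lambda>t. \<phi> (\<gamma> t)) piecewise_C1_differentiable_on {a..b}" if ab: "0 \<le> a" "b \<le> 1" "\<gamma> ` {a..b} \<subseteq> U" for a b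
    proof (rule C1_differentiable_imp_piecewise)
      have inZ: "x + t *\<^sub>R w \<in> ?Z" if "t \<in> {a..b}" for t
        using seg[of t] that ab by (auto simp: \<gamma>_def)
      define Dv where "Dv t = dd (\<lambda>z. \<phi> (F z)) w (x + t *\<^sub>R w)" for t
      have "((\<lambda>t. \<phi> (\<gamma> t)) has_vector_derivative Dv t) (at t)" if t: "t \<in> {a..b}" for t
      proof -
        note hd = Cinf_on_has_derivative[OF sm inZ[OF t]]
        have "((\<lambda>t. \<phi> (F (x + t *\<^sub>R w))) has_derivative (\<lambda>s. dd (\<lambda>z. \<phi> (F z)) (s *\<^sub>R w) (x + t *\<^sub>R w))) (at t)"
          by (rule has_derivative_compose[where f = "\<lambda>t. x + t *\<^sub>R w" and f' = "\<lambda>s. s *\<^sub>R w" and g = "\<lambda>z. \<phi> (F z)", OF _ hd])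
             (auto intro!: derivative_eq_intros)
        then show ?thesis
          unfolding has_vector_derivative_def \<gamma>_def Dv_def linear_cmul[OF has_derivative_linear[OF hd]] .
      qed
      moreover have "continuous_on {a..b} Dv"
        unfolding Dv_def using inZ
        by (intro continuous_on_compose2[OF Cinf_on_continuous[OF Cinf_on_dd[OF sm]]] continuous_intros) auto
      ultimately show "(\<lambda>t. \<phi> (\<gamma> t)) C1_differentiable_on {a..b}" unfolding C1_differentiable_on_def by blast
    qed
    then show "case c of (U, \<phi>) \<Rightarrow> \<forall>a b. 0 \<le> a \<longrightarrow> b \<le> 1 \<longrightarrow> \<gamma> ` {a..b} \<subseteq> U \<longrightarrow>
        (\<lambda>t. \<phi> (\<gamma> t)) piecewise_C1_differentiable_on {a..b}" by simp
  qed
  moreover have "\<forall>t\<in>{0..1} - {}. \<exists>v. has_velocity A \<gamma> t v \<and> sqrt (g (\<gamma> t) v v) \<le> l"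
    using vel l(2) unfolding pull_def \<gamma>_def by blast
  ultimately show ?thesis
    unfolding reach_def using l(1) by (intro conjI exI[of _ \<gamma>] exI[of _ "{}"]) (auto simp: \<gamma>_def)
qed

text \<open>Turns convergence in distance into convergence in the topology. A curve from outside W
  to l must cross a coordinate ball on which the metric is at least m times the Euclidean one, which
  costs length at least sqrt m times the radius.\<close>

lemma dist_neighbourhood:
  assumes W: "open W" "l \<in> W"
  shows "\<exists>e>0. \<forall>x. riemannian_dist A g x l < ennreal e \<longrightarrow> x \<in> W"
proof -
  have "l \<in> (\<Union>(U, \<phi>)\<in>A. U)" using atlas[unfolded complex_atlas_def, THEN conjunct1] by simp
  then obtain U \<phi> where U: "(U, \<phi>) \<in> A" "l \<in> U" by auto
  define P where "P = inv_into U \<phi>"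
  have par: "param A (\<phi> ` U) P" unfolding P_def by (rule chart_param[OF U(1)])
  have inv: "P (\<phi> q) = q" if "q \<in> U" for q using chart_homeo(4)[OF U(1)] that by (simp add: P_def)
  have oW: "open (\<phi> ` (W \<inter> U))" by (rule chart_open_image[OF U(1) W(1)])
  obtain r where r: "r > 0" "cball (\<phi> l) r \<subseteq> \<phi> ` (W \<inter> U)"
    using oW W(2) U(2) open_contains_cball[of "\<phi> ` (W \<inter> U)"] by blast
  have rU: "cball (\<phi> l) r \<subseteq> \<phi> ` U" using r(2) by auto
  obtain m where m: "m > 0" "\<forall>y\<in>cball (\<phi> l) r. \<forall>a. m * (norm a)^2 \<le> pull P y a a"
    using pull_lower_bound[OF par compact_cball rU] by blast
  define c where "c = sqrt m"
  have c: "c > 0" using m(1) by (simp add: c_def)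
  have PW: "P y \<in> W \<inter> U" if "y \<in> cball (\<phi> l) r" for y
  proof -
    from that have "y \<in> \<phi> ` (W \<inter> U)" using r(2) by (rule subsetD[rotated])
    then obtain q where "q \<in> W \<inter> U" "y = \<phi> q" by (elim imageE)
    then show ?thesis using inv by auto
  qed
  have "x \<in> W" if d: "riemannian_dist A g x l < ennreal (c * r)" for x
  proof (rule ccontr)
    assume "x \<notin> W"
    obtain \<gamma> where \<gamma>: "piecewise_C1_curve A \<gamma>" "\<gamma> 0 = x" "\<gamma> 1 = l" "curve_length A g \<gamma> < ennreal (c * r)"
      using d unfolding riemannian_dist_def INF_less_iff by blast
    have cont: "continuous_on {0..1} \<gamma>" using \<gamma>(1) by (simp add: piecewise_C1_curve_def)
    let ?Bo = "P ` ball (\<phi> l) r" and ?Bc = "P ` cball (\<phi> l) r"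
    have sub: "ball (\<phi> l) r \<subseteq> \<phi> ` U" using rU by auto
    have oBo: "open ?Bo" by (rule param_open_image[OF par sub open_ball])
    have cBc: "closed ?Bc"
      by (intro compact_imp_closed compact_continuous_image compact_cball continuous_on_subset[OF param_cont[OF par] rU])
    define Z where "Z = {0..1} \<inter> \<gamma> -` (- ?Bo)"
    have cZ: "closed Z" unfolding Z_def using oBo by (intro continuous_closed_preimage cont) auto
    have "0 \<in> Z" using PW \<open>x \<notin> W\<close> \<gamma>(2) by (auto simp: Z_def)
    have bZ: "bdd_above Z" by (auto simp: Z_def bdd_above_def)
    \<comment> \<open>The last time at which the curve is outside the open coordinate ball;
      afterwards a single chart describes it.\<close>
    define a where "a = Sup Z"
    have aZ: "a \<in> Z" unfolding a_def using closed_contains_Sup[OF _ bZ cZ] \<open>0 \<in> Z\<close> by blast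
    have l1: "l \<in> ?Bo" using r(1) inv[OF U(2)] by (auto intro!: image_eqI[of _ _ "\<phi> l"])
    have a1: "0 \<le> a" "a < 1"
    proof -
      show "0 \<le> a" using aZ by (simp add: Z_def)
      have "a \<noteq> 1" using aZ l1 \<gamma>(3) by (auto simp: Z_def)
      then show "a < 1" using aZ by (simp add: Z_def)
    qed
    have after: "\<gamma> t \<in> ?Bo" if "a < t" "t \<le> 1" for t
    proof (rule ccontr)
      assume "\<gamma> t \<notin> ?Bo"
      then have "t \<in> Z" using that a1 by (simp add: Z_def)
      then show False using cSup_upper[OF _ bZ, of t] that by (simp add: a_def)
    qed
    have "closure {a<..1} \<subseteq> {a..1} \<inter> \<gamma> -` ?Bc"
    proof (rule closure_minimal)
      show "{a<..1} \<subseteq> {a..1} \<inter> \<gamma> -` ?Bc" using after by fastforce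
      show "closed ({a..1} \<inter> \<gamma> -` ?Bc)"
        by (intro continuous_closed_preimage cBc continuous_on_subset[OF cont]) (use a1 in auto)
    qed
    then have inBc: "\<gamma> t \<in> ?Bc" if "t \<in> {a..1}" for t
      using that a1 closure_greaterThanAtMost[OF a1(2)] by auto
    have inU: "\<gamma> t \<in> U" if "t \<in> {a..1}" for t using inBc[OF that] PW by auto
    define \<psi> where "\<psi> t = \<phi> (\<gamma> t)" for t
    have \<psi>c: "\<psi> t \<in> cball (\<phi> l) r" "P (\<psi> t) = \<gamma> t" if t: "t \<in> {a..1}" for t
    proof -
      obtain y where y: "y \<in> cball (\<phi> l) r" "\<gamma> t = P y" using inBc[OF t] by blast
      have "\<phi> (P y) = y" using rU y(1) inv by auto
      then show "\<psi> t \<in> cball (\<phi> l) r" using y by (simp add: \<psi>_def)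
      show "P (\<psi> t) = \<gamma> t" using inv[OF inU[OF t]] by (simp add: \<psi>_def)
    qed
    have "(\<lambda>t. \<phi> (\<gamma> t)) piecewise_C1_differentiable_on {a..1}"
      using \<gamma>(1) U(1) a1(1) inU unfolding piecewise_C1_curve_def by fastforce
    then obtain S Dv where S: "continuous_on {a..1} \<psi>" "finite S"
      "\<forall>t\<in>{a..1} - S. (\<psi> has_vector_derivative Dv t) (at t)" "continuous_on ({a..1} - S) Dv"
      unfolding \<psi>_def[abs_def] piecewise_C1_differentiable_on_def C1_differentiable_on_def by blast
    have speed: "c * norm (Dv t) \<le> sqrt (g (\<gamma> t) (velocity A \<gamma> t) (velocity A \<gamma> t))"
      if t: "t \<in> {a<..<1} - S" for t
    proof -
      have tc: "t \<in> {a..1}" using t by auto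
      have yU: "\<psi> t \<in> \<phi> ` U" using \<psi>c(1)[OF tc] rU by blast
      have hd: "(\<psi> has_derivative (\<lambda>s. s *\<^sub>R Dv t)) (at t)"
        using S(3) t by (auto simp: has_vector_derivative_def)
      have "has_velocity A \<gamma> t (push_vec A P (\<psi> t) (Dv t))"
        unfolding has_velocity_def
      proof (intro conjI allI impI)
        show "push_vec A P (\<psi> t) (Dv t) \<in> tangent_space A (\<gamma> t)"
          using push_vec_tangent[OF par yU] \<psi>c(2)[OF tc] by simp
        fix f assume "smooth_fun_at A (\<gamma> t) f"
        then have f: "smooth_fun_at A (P (\<psi> t)) f" using \<psi>c(2)[OF tc] by simp
        then obtain N where N: "\<psi> t \<in> N" "Cinf_on N (\<lambda>z. f (P z))"
          unfolding smooth_fun_at_param[OF par yU] by blast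
        note hf = Cinf_on_has_derivative[OF N(2,1)]
        have "((\<lambda>s. f (P (\<psi> s))) has_derivative (\<lambda>s. dd (\<lambda>z. f (P z)) (s *\<^sub>R Dv t) (\<psi> t))) (at t)"
          by (rule has_derivative_compose[OF hd hf])
        then have "((\<lambda>s. f (P (\<psi> s))) has_real_derivative dd (\<lambda>z. f (P z)) (Dv t) (\<psi> t)) (at t)"
          unfolding has_field_derivative_def linear_cmul[OF has_derivative_linear[OF hf]] by (simp add: mult_commute_abs)
        then have "((\<lambda>s. f (\<gamma> s)) has_real_derivative dd (\<lambda>z. f (P z)) (Dv t) (\<psi> t)) (at t)"
          by (rule has_field_derivative_transform_within_open[of _ _ _ "{a<..<1}"]) (use t \<psi>c(2) in auto)
        then show "((\<lambda>s. f (\<gamma> s)) has_real_derivative push_vec A P (\<psi> t) (Dv t) f) (at t)"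
          using f by (simp add: push_vec_def)
      qed
      then have "velocity A \<gamma> t = push_vec A P (\<psi> t) (Dv t)" by (rule velocity_eq)
      then have "g (\<gamma> t) (velocity A \<gamma> t) (velocity A \<gamma> t) = pull P (\<psi> t) (Dv t) (Dv t)"
        using \<psi>c(2)[OF tc] by (simp add: pull_def)
      moreover have "sqrt (m * (norm (Dv t))^2) \<le> sqrt (pull P (\<psi> t) (Dv t) (Dv t))"
        using m(2) \<psi>c(1)[OF tc] by (intro real_sqrt_le_mono) blast
      ultimately show ?thesis by (simp add: c_def real_sqrt_mult)
    qed
    have "r \<le> norm (\<psi> 1 - \<psi> a)"
    proof -
      have "\<psi> a \<notin> ball (\<phi> l) r"
      proof
        assume "\<psi> a \<in> ball (\<phi> l) r"
        then have "P (\<psi> a) \<in> ?Bo" by blast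
        then show False using aZ \<psi>c(2)[of a] a1 by (simp add: Z_def)
      qed
      then show ?thesis using \<gamma>(3) by (simp add: \<psi>_def dist_norm)
    qed
    then have "ennreal (c * r) \<le> ennreal c * ennreal (norm (\<psi> 1 - \<psi> a))"
      using c by (simp add: ennreal_mult[symmetric] ennreal_leI)
    also have "\<dots> \<le> ennreal c * (\<integral>\<^sup>+t. ennreal (indicator ({a..1} - S) t * norm (Dv t)) \<partial>lborel)"
      by (intro mult_left_mono speed_integral[OF S(2)]) (use a1 S in auto)
    also have "\<dots> = (\<integral>\<^sup>+t. ennreal c * ennreal (indicator ({a..1} - S) t * norm (Dv t)) \<partial>lborel)"
    proof (rule nn_integral_cmult[symmetric])
      have "{a..1} - S \<in> sets borel" by (intro sets.Diff) (auto intro: borel_closed finite_imp_closed[OF S(2)])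
      then have "(\<lambda>t. indicator ({a..1} - S) t *\<^sub>R norm (Dv t)) \<in> borel_measurable borel"
        by (intro borel_measurable_continuous_on_indicator continuous_on_norm S)
      then show "(\<lambda>t. ennreal (indicator ({a..1} - S) t * norm (Dv t))) \<in> borel_measurable lborel" by simp
    qed
    also have "\<dots> \<le> curve_length A g \<gamma>"
      unfolding curve_length_def
    proof (rule nn_integral_mono_AE)
      have "AE t in lborel. t \<notin> {a, 1}"
        by (intro AE_not_in finite_imp_null_set_lborel) simp
      then show "AE t in lborel. ennreal c * ennreal (indicator ({a..1} - S) t * norm (Dv t))
        \<le> ennreal (sqrt (g (\<gamma> t) (velocity A \<gamma> t) (velocity A \<gamma> t))) * indicator {0..1} t"
      proof eventually_elim
        case (elim t)
        show ?case
        proof (cases "t \<in> {a..1} - S")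
          case True
          then have "t \<in> {a<..<1} - S" using elim by auto
          from speed[OF this] show ?thesis
            using True c a1 by (simp add: ennreal_mult[symmetric] ennreal_leI)
        qed simp
      qed
    qed
    finally show False using \<gamma>(4) by simp
  qed
  then show ?thesis using c r(1) by (intro exI[of _ "c * r"]) auto
qed

end

section \<open>Special Kaehler structures in flat coordinates\<close>

context atlas_manifold
begin

lemma tangent_local:
  assumes v: "v \<in> tangent_space A p" and f: "smooth_fun_at A p f" "smooth_fun_at A p h"
    and eq: "open U" "p \<in> U" "\<And>q. q \<in> U \<Longrightarrow> f q = h q"
  shows "v f = v h"
proof -
  have "\<forall>\<^sub>F q in nhds p. f q = h q" unfolding eventually_nhds using eq by blast
  then show ?thesis
    by (rule v[unfolded tangent_space_def mem_Collect_eq, THEN conjunct1, rule_format, OF f,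
          THEN conjunct2, THEN conjunct2, THEN mp])
qed

lemma tangent_add: assumes v: "v \<in> tangent_space A p" "w \<in> tangent_space A p" shows "v + w \<in> tangent_space A p"
proof -
  obtain B P x where P: "param A B P" "x \<in> B" "P x = p" using param_exists by blast
  have "v + w = push_vec A P x (coords B P v + coords B P w)"
    using push_vec_coords[OF P(1,2)] v P(3) push_vec_linear(1)[OF P(1,2)] by metis
  then show ?thesis using push_vec_tangent[OF P(1,2)] P(3) by metis
qed

text \<open>\<open>chart_differential\<close> lists real and imaginary parts, which are the
  components with respect to the real basis of \<open>complex ^ 'n\<close>. This connects
  \<open>complex_structure\<close> with \<open>coords\<close>.\<close>

lemma chart_differential_coords:
  assumes U: "(U, \<phi>) \<in> A" and p: "p \<in> U" and v: "v \<in> tangent_space A p"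
  shows "chart_differential \<phi> v = coords (\<phi> ` U) (inv_into U \<phi>) v"
proof -
  let ?P = "inv_into U \<phi>" and ?B = "\<phi> ` U"
  have par: "param A ?B ?P" by (rule chart_param[OF U])
  have inv: "?P (\<phi> q) = q" if "q \<in> U" for q using chart_homeo(4)[OF U] that by simp
  have P\<phi>: "inv_into ?B ?P q = \<phi> q" if "q \<in> U" for q
    using param_inv[OF par, of "\<phi> q"] inv[OF that] that by auto
  have eq: "v (\<lambda>q. inv_into ?B ?P q \<bullet> b) = v (\<lambda>q. \<phi> q \<bullet> b)" for b
  proof (rule tangent_local[OF v _ _ chart_homeo(1)[OF U] p])
    show "smooth_fun_at A p (\<lambda>q. inv_into ?B ?P q \<bullet> b)"
      using coordinate_smooth_at[OF par, of "\<phi> p" b] inv[OF p] p by auto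
    then obtain W where W: "open W" "p \<in> W" "smooth_fun_on A W (\<lambda>q. inv_into ?B ?P q \<bullet> b)"
      unfolding smooth_fun_at_def by blast
    have WU: "open (W \<inter> U)" using W(1) chart_homeo(1)[OF U] by auto
    have sub: "W \<inter> U \<subseteq> ?P ` ?B" using inv by force
    have "Cinf_on (?B \<inter> ?P -` (W \<inter> U)) (\<lambda>x. inv_into ?B ?P (?P x) \<bullet> b)"
      by (rule param_smooth[OF par WU smooth_fun_on_subset[OF W(3)]]) auto
    then have "Cinf_on (?B \<inter> ?P -` (W \<inter> U)) (\<lambda>x. \<phi> (?P x) \<bullet> b)"
      by (subst Cinf_on_cong[OF param_open_vimage[OF par WU], of _ "\<lambda>x. inv_into ?B ?P (?P x) \<bullet> b"])
         (use P\<phi> in auto)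
    then have "smooth_fun_on A (W \<inter> U) (\<lambda>q. \<phi> q \<bullet> b)" by (rule param_smoothI[OF par WU sub])
    then show "smooth_fun_at A p (\<lambda>q. \<phi> q \<bullet> b)" unfolding smooth_fun_at_def using WU W(2) p by blast
  qed (simp add: P\<phi>)
  have cv: "coords ?B ?P v \<bullet> axis k c = v (\<lambda>q. \<phi> q \<bullet> axis k c)" if "c \<in> Basis" for k and c :: complex
    using coords_inner[of "axis k c" ?B ?P v] that eq by (auto simp: axis_in_Basis_iff)
  show ?thesis
  proof (rule vec_eq_iff[THEN iffD2], rule allI)
    fix k
    have "Re (coords ?B ?P v $ k) = v (\<lambda>q. Re (\<phi> q $ k))" "Im (coords ?B ?P v $ k) = v (\<lambda>q. Im (\<phi> q $ k))"
      using cv[of 1 k] cv[of \<i> k] by (simp_all add: inner_axis Basis_complex_def inner_complex_def)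
    then show "chart_differential \<phi> v $ k = coords ?B ?P v $ k"
      by (simp add: chart_differential_def complex_eq_iff)
  qed
qed

end

section \<open>The complex structure as a smooth endomorphism field\<close>

locale complex_manifold = atlas_manifold A
  for A :: "('a::{t2_space, second_countable_topology}, 'n::finite) atlas" +
  fixes I :: "'a \<Rightarrow> 'a tvec \<Rightarrow> 'a tvec"
  assumes I: "complex_structure A I"
begin

lemma I_tangent: "v \<in> tangent_space A p \<Longrightarrow> I p v \<in> tangent_space A p"
  using I[unfolded complex_structure_def] by blast

lemma chart_exists: "\<exists>U \<phi>. (U, \<phi>) \<in> A \<and> p \<in> U"
proof -
  have "p \<in> (\<Union>(U, \<phi>)\<in>A. U)" using atlas[unfolded complex_atlas_def, THEN conjunct1] by simp
  then show ?thesis by auto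
qed

lemma I_chart:
  assumes U: "(U, \<phi>) \<in> A" and p: "p \<in> U" and v: "v \<in> tangent_space A p"
  shows "I p v = push_vec A (inv_into U \<phi>) (\<phi> p) (\<i> *s coords (\<phi> ` U) (inv_into U \<phi>) v)"
proof -
  have "chart_differential \<phi> (I p v) = \<i> *s chart_differential \<phi> v"
    using I[unfolded complex_structure_def, rule_format, OF v] U p by blast
  then have c: "coords (\<phi> ` U) (inv_into U \<phi>) (I p v) = \<i> *s coords (\<phi> ` U) (inv_into U \<phi>) v"
    using chart_differential_coords[OF U p v] chart_differential_coords[OF U p I_tangent[OF v]] by simp
  have "inv_into U \<phi> (\<phi> p) = p" using chart_homeo(4)[OF U] p by simp
  then have "push_vec A (inv_into U \<phi>) (\<phi> p) (coords (\<phi> ` U) (inv_into U \<phi>) (I p v)) = I p v"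
    using push_vec_coords[OF chart_param[OF U], of "\<phi> p"] I_tangent[OF v] p by simp
  then show ?thesis unfolding c by simp
qed

lemma linear_i: "linear (\<lambda>x :: complex ^ 'm. \<i> *s x)"
  by (rule linearI) (simp_all add: vec_eq_iff algebra_simps)

lemma I_linear:
  assumes v: "v \<in> tangent_space A p"
  shows "w \<in> tangent_space A p \<Longrightarrow> I p (v + w) = I p v + I p w" "I p (c *\<^sub>T v) = c *\<^sub>T I p v"
    "I p (I p v) = (- 1) *\<^sub>T v"
proof -
  obtain U \<phi> where U: "(U, \<phi>) \<in> A" "p \<in> U" using chart_exists by blast
  let ?P = "inv_into U \<phi>" and ?B = "\<phi> ` U"
  note par = chart_param[OF U(1)]
  have x: "\<phi> p \<in> ?B" using U(2) by simp
  have inv: "?P (\<phi> p) = p" using chart_homeo(4)[OF U(1)] U(2) by simp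
  note l = linear_add[OF linear_i] linear_cmul[OF linear_i]
  show "I p (v + w) = I p v + I p w" if "w \<in> tangent_space A p"
    unfolding I_chart[OF U v] I_chart[OF U that] I_chart[OF U tangent_add[OF v that]] coords_add l
    by (rule push_vec_linear(1)[OF par x])
  show "I p (c *\<^sub>T v) = c *\<^sub>T I p v"
    unfolding I_chart[OF U v] I_chart[OF U tangent_scale[OF v]] coords_tscale l
    by (rule push_vec_linear(2)[OF par x])
  have "coords ?B ?P (I p v) = \<i> *s coords ?B ?P v"
    unfolding I_chart[OF U v] by (rule coords_push_vec[OF par x])
  then have "I p (I p v) = push_vec A ?P (\<phi> p) ((- 1) *\<^sub>R coords ?B ?P v)"
    unfolding I_chart[OF U I_tangent[OF v]] by (intro arg_cong[of _ _ "push_vec A ?P (\<phi> p)"]) (simp add: vec_eq_iff)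
  also have "\<dots> = (- 1) *\<^sub>T v"
    unfolding push_vec_linear(2)[OF par x] using push_vec_coords[OF par x] v inv by simp
  finally show "I p (I p v) = (- 1) *\<^sub>T v" .
qed

text \<open>In every holomorphic chart I is multiplication by the constant \<i>, a fixed linear map
  on components, so it preserves smoothness of fields.\<close>

lemma I_field:
  assumes W: "open W" and X: "vector_field_on A W X"
  shows "vector_field_on A W (\<lambda>q. I q (X q))"
  unfolding vector_field_on_def
proof (intro conjI ballI allI impI)
  fix p assume "p \<in> W" then show "I p (X p) \<in> tangent_space A p" using X by (intro I_tangent) (auto dest: vector_field_tangent)
next
  fix W' f assume W': "open W'" "W' \<subseteq> W" "smooth_fun_on A W' f"
  show "smooth_fun_on A W' (\<lambda>p. I p (X p) f)"
    unfolding smooth_fun_on_def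
  proof (intro ballI, clarify)
    fix U \<phi> assume U: "(U, \<phi>) \<in> A"
    let ?P = "inv_into U \<phi>" and ?B = "\<phi> ` U" and ?V = "W' \<inter> U"
    note par = chart_param[OF U]
    have inv: "?P (\<phi> q) = q" if "q \<in> U" for q using chart_homeo(4)[OF U] that by simp
    have V: "open ?V" using W'(1) chart_homeo(1)[OF U] by auto
    have VP: "?V \<subseteq> ?P ` ?B" using inv by force
    have P\<phi>: "inv_into ?B ?P q = \<phi> q" if "q \<in> U" for q
      using param_inv[OF par, of "\<phi> q"] inv[OF that] that by auto
    have oS: "open (?B \<inter> ?P -` ?V)" by (rule param_open_vimage[OF par V])
    have XV: "vector_field_on A ?V X" by (rule vector_field_on_subset[OF X]) (use W'(2) in auto)
    have "Cinf_on (?B \<inter> ?P -` ?V) (\<lambda>x. \<i> *s coords ?B ?P (X (?P x)))"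
      by (rule Cinf_on_linear_comp[OF oS _ vector_field_coords_smooth[OF par V XV]])
         (use linear_i linear_conv_bounded_linear in blast)
    then have "vector_field_on A ?V (\<lambda>q. push_vec A ?P (inv_into ?B ?P q) (\<i> *s coords ?B ?P (X (?P (inv_into ?B ?P q)))))"
      by (rule push_vec_field[OF par V VP])
    then have "smooth_fun_on A ?V (\<lambda>q. push_vec A ?P (inv_into ?B ?P q) (\<i> *s coords ?B ?P (X (?P (inv_into ?B ?P q)))) f)"
      using V smooth_fun_on_subset[OF W'(3), of ?V] unfolding vector_field_on_def by simp
    from param_smooth[OF par V this]
    have 1: "Cinf_on (?B \<inter> ?P -` ?V)
      (\<lambda>x. push_vec A ?P (inv_into ?B ?P (?P x)) (\<i> *s coords ?B ?P (X (?P (inv_into ?B ?P (?P x))))) f)" .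
    have 2: "I (?P x) (X (?P x)) f = push_vec A ?P (inv_into ?B ?P (?P x)) (\<i> *s coords ?B ?P (X (?P (inv_into ?B ?P (?P x))))) f"
      if "x \<in> ?B \<inter> ?P -` ?V" for x
    proof -
      have x: "?P x \<in> U" "?P x \<in> W" "x \<in> ?B" using that W'(2) by auto
      have \<phi>P: "\<phi> (?P x) = x" using x(3) by (rule f_inv_into_f)
      show ?thesis
        using I_chart[OF U x(1) vector_field_tangent[OF X x(2)]] P\<phi>[OF x(1)] by (simp add: \<phi>P)
    qed
    have "Cinf_on (?B \<inter> ?P -` ?V) (\<lambda>x. I (?P x) (X (?P x)) f)"
      by (subst Cinf_on_cong[OF oS 2]) (assumption, rule 1)
    moreover have "\<phi> ` (W' \<inter> U) \<subseteq> ?B \<inter> ?P -` ?V" using inv by auto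
    ultimately show "Cinf_on (\<phi> ` (W' \<inter> U)) (\<lambda>x. I (?P x) (X (?P x)) f)" by (rule Cinf_on_subset)
  qed
qed

end

locale special_kaehler = complex_manifold A I
  for A :: "('a::{t2_space, second_countable_topology}, 'n::finite) atlas" and I +
  fixes om :: "'a \<Rightarrow> 'a tvec \<Rightarrow> 'a tvec \<Rightarrow> real" and nabla :: "'a connection"
  assumes om_bilinear: "bilinear_form_field A om"
    and kaehler_metric: "riemannian_metric A (kaehler_metric I om)"
    and nabla: "connection A nabla" "torsion_free A nabla" "curvature_vanishes A nabla"
    and om_parallel: "parallel_form A nabla om"
    and I_closed: "\<And>U X Y p. open U \<Longrightarrow> vector_field_on A U X \<Longrightarrow> vector_field_on A U Y \<Longrightarrow> p \<in> U \<Longrightarrow>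
      cov_deriv_endo nabla I X Y p = cov_deriv_endo nabla I Y X p"
begin

sublocale riemannian_manifold A "kaehler_metric I om"
  by unfold_locales (rule kaehler_metric)

sublocale flat_manifold A nabla
  by unfold_locales (rule nabla)+

lemma om_linear:
  assumes "u \<in> tangent_space A p" "v \<in> tangent_space A p" "w \<in> tangent_space A p"
  shows "om p (u + v) w = om p u w + om p v w" "om p w (u + v) = om p w u + om p w v"
    "om p (c *\<^sub>T v) w = c * om p v w" "om p w (c *\<^sub>T v) = c * om p w v"
  using om_bilinear[unfolded bilinear_form_field_def, THEN conjunct1, THEN spec, THEN bspec, OF assms(1),
      THEN bspec, OF assms(2), THEN bspec, OF assms(3), THEN spec, of c]
  by auto

text \<open>In flat coordinates covariant derivatives are ordinary ones: a parallel form has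
  constant coefficients, and the condition on the exterior derivative of I says that the derivative
  of J is symmetric. Through g = om(., J .) the latter exchanges the first and last argument of the
  derivative of g; symmetry of g then gives total symmetry.\<close>

lemma flat_model_param:
  assumes P: "flat_param A nabla B P" and B: "convex B" "y0 \<in> B"
  shows "flat_model B (pull P) (\<lambda>a b. om (P y0) (push_vec A P y0 a) (push_vec A P y0 b))
    (\<lambda>y b. coords B P (I (P y) (push_vec A P y b)))"
proof -
  note par = flat_paramD[OF P]
  let ?pv = "push_vec A P" and ?X = "cfield A B P"
  define J where "J y b = coords B P (I (P y) (?pv y b))" for y b
  note pt = push_vec_tangent[OF par]
  note oR = param_open_range[OF par]
  note vX = cfield_vector_field[OF par]
  have pJ: "?pv y (J y b) = I (P y) (?pv y b)" if y: "y \<in> B" for y b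
    unfolding J_def by (rule push_vec_coords[OF par y I_tangent[OF pt[OF y]]])
  have I0: "I p 0 = 0" for p
  proof -
    obtain B P x where P: "param A B P" "x \<in> B" "P x = p" using param_exists by blast
    have "(0 :: 'a tvec) \<in> tangent_space A p"
      using push_vec_tangent[OF P(1,2), of 0] push_vec_zero[OF P(1,2)] P(3) by simp
    from I_linear(2)[OF this, of 0] show ?thesis by (simp add: zero_fun_def)
  qed
  have lJ: "linear (J y)" if y: "y \<in> B" for y
    by (rule linearI) (simp_all add: J_def push_vec_linear[OF par y] I_linear[OF pt[OF y]] pt[OF y] coords_add coords_tscale)
  have JJ: "J y (J y b) = - b" if y: "y \<in> B" for y b
  proof -
    have "?pv y (J y (J y b)) = ?pv y ((- 1) *\<^sub>R b)"
      unfolding pJ[OF y] I_linear(3)[OF pt[OF y]] push_vec_linear(2)[OF par y] ..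
    then show ?thesis unfolding push_vec_inject[OF par y] by simp
  qed
  have vI: "vector_field_on A (P ` B) (\<lambda>q. I q (?X b q))" for b by (rule I_field[OF oR vX])
  have sJ: "Cinf_on B (\<lambda>y. J y b)" for b
  proof -
    have "Cinf_on (B \<inter> P -` (P ` B)) (\<lambda>y. coords B P (I (P y) (?X b (P y))))"
      by (rule vector_field_coords_smooth[OF par oR vI])
    then have "Cinf_on B (\<lambda>y. coords B P (I (P y) (?X b (P y))))" by (rule Cinf_on_subset) auto
    then show ?thesis
      by (subst Cinf_on_cong[OF param_open[OF par], of _ "\<lambda>y. coords B P (I (P y) (?X b (P y)))"])
         (simp add: J_def cfield_at[OF par])
  qed
  have flat: "nabla (P y) (?pv y a) (?X b) = 0" if "y \<in> B" for y a b
    using P that by (simp add: flat_param_def)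
  have dJ: "dd (\<lambda>z. J z b) a y = dd (\<lambda>z. J z a) b y" if y: "y \<in> B" for a b y
  proof -
    have "cov_deriv_endo nabla I (?X a) (?X b) (P y) = ?pv y (dd (\<lambda>z. J z b) a y)" for a b
    proof -
      have "nabla (P y) (?pv y a) (\<lambda>q. I q (?X b q)) = ?pv y (dd (\<lambda>z. J z b) a y)"
        by (rule flat_param_expand[OF nabla(1) P oR order_refl vI y imageI[OF y]])
           (simp add: cfield_at[OF par] pJ)
      then show ?thesis unfolding cov_deriv_endo_def cfield_at[OF par y] flat[OF y] I0 by simp
    qed
    then have "?pv y (dd (\<lambda>z. J z b) a y) = ?pv y (dd (\<lambda>z. J z a) b y)"
      using I_closed[OF oR vX[of a] vX[of b] imageI[OF y]] by simp
    then show ?thesis unfolding push_vec_inject[OF par y] .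
  qed
  define o0 where "o0 y a b = om (P y) (?pv y a) (?pv y b)" for y a b
  have so: "smooth_fun_on A (P ` B) (\<lambda>q. om q (?X a q) (?X b q))" for a b
    by (rule om_bilinear[unfolded bilinear_form_field_def, THEN conjunct2, rule_format, OF oR vX vX])
  have so': "Cinf_on B (\<lambda>y. om (P y) (?X a (P y)) (?X b (P y)))" for a b
    by (rule Cinf_on_subset[OF param_smooth[OF par oR so]]) auto
  have o_eq: "om (P y) (?X a (P y)) (?X b (P y)) = o0 y a b" if "y \<in> B" for a b y
    using that by (simp add: o0_def cfield_at[OF par])
  have so2: "Cinf_on B (\<lambda>y. o0 y a b)" for a b
    by (rule Cinf_on_cong[OF param_open[OF par] o_eq, THEN iffD1, OF _ so'])
  have om0: "om (P y) 0 (?pv y b) = 0" "om (P y) (?pv y b) 0 = 0" if "y \<in> B" for y b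
    using om_linear(3,4)[OF pt[OF that, of b] pt[OF that, of b] pt[OF that, of b], of 0] by (simp_all add: zero_fun_def)
  have "dd (\<lambda>z. o0 z a b) c y = 0" if y: "y \<in> B" for a b c y
  proof -
    have "cov_deriv_form nabla om (?X c) (?X a) (?X b) (P y) = 0"
      using om_parallel[unfolded parallel_form_def, rule_format, OF oR vX vX vX imageI[OF y]] .
    then have 1: "?pv y c (\<lambda>q. om q (?X a q) (?X b q)) = 0"
      unfolding cov_deriv_form_def cfield_at[OF par y] flat[OF y] using om0[OF y] by simp
    have "smooth_fun_at A (P y) (\<lambda>q. om q (?X a q) (?X b q))"
      unfolding smooth_fun_at_def using so oR y by blast
    then have "dd (\<lambda>z. om (P z) (?X a (P z)) (?X b (P z))) c y = 0"
      using 1 by (simp add: push_vec_def)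
    then show ?thesis using dd_cong[OF param_open[OF par] y o_eq] by simp
  qed
  then have "((\<lambda>z. o0 z a b) has_derivative (\<lambda>v. 0)) (at y)" if "y \<in> B" for a b y
    using Cinf_on_has_derivative[OF so2 that, of a b] that by simp
  then have o_const: "o0 y a b = o0 y0 a b" if "y \<in> B" for y a b
    using has_derivative_zero_on_convex[OF B(1) param_open[OF par] _ that B(2), of "\<lambda>z. o0 z a b"] by blast
  have lo: "linear (o0 y0 a)" for a
    by (rule linearI) (simp_all add: o0_def push_vec_linear[OF par B(2)] om_linear[OF pt[OF B(2)] pt[OF B(2)] pt[OF B(2)]])
  have G: "pull P y a b = o0 y0 a (J y b)" if y: "y \<in> B" for y a b
    unfolding o_const[OF y, symmetric] by (simp add: pull_def kaehler_metric_def o0_def pJ[OF y])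
  have dG: "dd (\<lambda>z. pull P z b c) a y = o0 y0 b (dd (\<lambda>z. J z c) a y)" if y: "y \<in> B" for a b c y
  proof -
    have "((\<lambda>z. o0 y0 b (J z c)) has_derivative (\<lambda>v. o0 y0 b (dd (\<lambda>z. J z c) v y))) (at y)"
      by (intro bounded_linear.has_derivative[OF _ Cinf_on_has_derivative[OF sJ y]])
         (use lo linear_conv_bounded_linear in blast)
    from dd_eqI[OF this] show ?thesis using dd_cong[OF param_open[OF par] y G] by simp
  qed
  have swap13: "dd (\<lambda>z. pull P z b c) a y = dd (\<lambda>z. pull P z b a) c y" if "y \<in> B" for a b c y
    unfolding dG[OF that] dJ[OF that, of c a] ..
  have swap23: "dd (\<lambda>z. pull P z b c) a y = dd (\<lambda>z. pull P z c b) a y" if "y \<in> B" for a b c y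
    by (rule dd_cong[OF param_open[OF par] that]) (rule pull_sym[OF par])
  have tot: "dd (\<lambda>z. pull P z b c) a y = dd (\<lambda>z. pull P z a c) b y" if "y \<in> B" for a b c y
    using swap23[OF that, of b c a] swap13[OF that, of c b a] swap23[OF that, of c a b] by simp
  have "flat_model B (pull P) (o0 y0) J"
  proof (intro flat_model.intro cubic_model.intro flat_model_axioms.intro)
    show "open B" by (rule param_open[OF par])
    show "pull P y a b = o0 y0 a (J y b)" if "y \<in> B" for y a b by (rule G[OF that])
    show "o0 y0 a (- b) = - o0 y0 a b" for a b by (rule linear_neg[OF lo])
    show "linear (pull P y a)" if "y \<in> B" for y a by (rule pull_linear[OF par that])
    show "pull P y a b = pull P y b a" if "y \<in> B" for y a b by (rule pull_sym[OF par that])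
    show "pull P y a a > 0" if "y \<in> B" "a \<noteq> 0" for y a by (rule pull_pos[OF par that])
    show "Cinf_on B (\<lambda>y. pull P y a b)" for a b by (rule pull_smooth[OF par])
    show "linear (J y)" if "y \<in> B" for y by (rule lJ[OF that])
    show "J y (J y b) = - b" if "y \<in> B" for y b by (rule JJ[OF that])
    show "dd (\<lambda>z. pull P z b c) a y = dd (\<lambda>z. pull P z a c) b y" if "y \<in> B" for y a b c by (rule tot[OF that])
  qed
  then show ?thesis unfolding o0_def[abs_def] J_def[abs_def] .
qed

text \<open>The clauses about g alone are local and survive without injectivity of F. The clauses on
  J stay confined to small balls, where \<open>coords\<close> can be formed.\<close>

lemma cubic_model_locally_flat:
  assumes F: "locally_flat A nabla W F"
  shows "cubic_model W (pull F)"
proof -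
  have W: "open W" using F by (simp add: locally_flat_def)
  have loc: "\<exists>r>0. ball y r \<subseteq> W \<and> cubic_model (ball y r) (pull F)" if "y \<in> W" for y
  proof -
    obtain r where r: "r > 0" "ball y r \<subseteq> W" "flat_param A nabla (ball y r) F"
      using F[unfolded locally_flat_def, THEN conjunct2, THEN bspec, OF \<open>y \<in> W\<close>] by (elim exE conjE)
    have "y \<in> ball y r" using r(1) by simp
    from flat_model.axioms(1)[OF flat_model_param[OF r(3) convex_ball this]] show ?thesis
      using r(1,2) by (intro exI[of _ r] conjI)
  qed
  show ?thesis
  proof (rule cubic_model.intro[OF W])
    fix y a b c assume "y \<in> W"
    then obtain r where r: "r > 0" "ball y r \<subseteq> W" "cubic_model (ball y r) (pull F)" using loc by blast
    interpret cubic_model "ball y r" "pull F" by (rule r(3))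
    have y: "y \<in> ball y r" using r(1) by simp
    show "linear (pull F y a)" by (rule lin[OF y])
    show "pull F y a b = pull F y b a" by (rule sym[OF y])
    show "a \<noteq> 0 \<Longrightarrow> pull F y a a > 0" by (rule pos[OF y])
    show "dd (\<lambda>z. pull F z b c) a y = dd (\<lambda>z. pull F z a c) b y" by (rule tot[OF y])
  next
    fix a b
    show "Cinf_on W (\<lambda>y. pull F y a b)"
    proof (rule Cinf_on_local[OF W])
      fix y assume "y \<in> W"
      then obtain r where r: "r > 0" "ball y r \<subseteq> W" "cubic_model (ball y r) (pull F)" using loc by blast
      have "Cinf_on (ball y r \<inter> W) (\<lambda>y. pull F y a b)"
        by (rule Cinf_on_subset[OF cubic_model.smooth[OF r(3)]]) auto
      then show "\<exists>T. open T \<and> y \<in> T \<and> Cinf_on (T \<inter> W) (\<lambda>y. pull F y a b)"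
        using r(1) by (intro exI[of _ "ball y r"]) auto
    qed
  qed
qed

end

lemma special_kaehler_manifoldD:
  assumes "special_kaehler_manifold A I om nabla"
  shows "special_kaehler A I om nabla"
proof -
  have k: "complex_atlas A" "complex_structure A I" "closed_two_form A om" "riemannian_metric A (kaehler_metric I om)"
    and s: "connection A nabla" "curvature_vanishes A nabla" "torsion_free A nabla" "parallel_form A nabla om"
      "\<forall>U X Y. open U \<longrightarrow> vector_field_on A U X \<longrightarrow> vector_field_on A U Y \<longrightarrow>
        (\<forall>p\<in>U. cov_deriv_endo nabla I X Y p = cov_deriv_endo nabla I Y X p)"
    using assms unfolding special_kaehler_manifold_def kaehler_manifold_def special_kaehler_structure_def
    by - (elim conjE, assumption)+
  show ?thesis
  proof (intro special_kaehler.intro complex_manifold.intro atlas_manifold.intro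
      complex_manifold_axioms.intro special_kaehler_axioms.intro k s(1-4))
    show "bilinear_form_field A om" using k(3) unfolding closed_two_form_def two_form_def by (elim conjE)
  qed (use s(5) in simp)
qed

section \<open>Growth of the cubic form\<close>

text \<open>f t exp(-k t) decreases and f t exp(k t) increases.\<close>

lemma gronwall_bounds:
  fixes f f' :: "real \<Rightarrow> real"
  assumes d: "\<And>t. 0 \<le> t \<Longrightarrow> t \<le> \<tau> \<Longrightarrow> (f has_real_derivative f' t) (at t)"
    and b: "\<And>t. 0 \<le> t \<Longrightarrow> t \<le> \<tau> \<Longrightarrow> \<bar>f' t\<bar> \<le> k * f t" and \<tau>: "0 \<le> \<tau>"
  shows "f \<tau> \<le> f 0 * exp (k * \<tau>)" "f 0 \<le> f \<tau> * exp (k * \<tau>)"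
proof -
  have "f \<tau> * exp (- k * \<tau>) \<le> f 0 * exp (- k * 0)"
  proof (rule DERIV_nonpos_imp_nonincreasing[OF \<tau>])
    fix t assume t: "0 \<le> t" "t \<le> \<tau>"
    have "((\<lambda>t. f t * exp (- k * t)) has_real_derivative (f' t - k * f t) * exp (- k * t)) (at t)"
      by (auto intro!: derivative_eq_intros d[OF t] simp: algebra_simps)
    moreover have "(f' t - k * f t) * exp (- k * t) \<le> 0"
      using b[OF t] by (intro mult_nonpos_nonneg) auto
    ultimately show "\<exists>y. ((\<lambda>t. f t * exp (- k * t)) has_real_derivative y) (at t) \<and> y \<le> 0" by blast
  qed
  then have "f \<tau> * exp (- k * \<tau>) * exp (k * \<tau>) \<le> f 0 * exp (k * \<tau>)" by (intro mult_right_mono) auto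
  then show "f \<tau> \<le> f 0 * exp (k * \<tau>)" by (simp add: mult.assoc exp_add[symmetric])
  have "f 0 * exp (k * 0) \<le> f \<tau> * exp (k * \<tau>)"
  proof (rule DERIV_nonneg_imp_nondecreasing[OF \<tau>])
    fix t assume t: "0 \<le> t" "t \<le> \<tau>"
    have "((\<lambda>t. f t * exp (k * t)) has_real_derivative (f' t + k * f t) * exp (k * t)) (at t)"
      by (auto intro!: derivative_eq_intros d[OF t] simp: algebra_simps)
    moreover have "0 \<le> (f' t + k * f t) * exp (k * t)"
      using b[OF t] by (intro mult_nonneg_nonneg) auto
    ultimately show "\<exists>y. ((\<lambda>t. f t * exp (k * t)) has_real_derivative y) (at t) \<and> 0 \<le> y" by blast
  qed
  then show "f 0 \<le> f \<tau> * exp (k * \<tau>)" by simp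
qed

text \<open>2/3 is a rational lower bound of ln 2; the exponents in \<open>ray_control\<close> are
  kept below it.\<close>

lemma exp_le_two: assumes "x \<le> 2 / 3" shows "exp x \<le> (2 :: real)"
proof -
  have "exp x \<le> exp (ln 2)" using assms ln2_ge_two_thirds by (subst exp_le_cancel_iff) linarith
  then show ?thesis by simp
qed

text \<open>An orthonormal set of maximal size spans, since otherwise the normalized rest of some
  vector could be added. The index set K is left open: frames are needed over \<open>Basis\<close>
  as well as over a finite type that indexes matrices.\<close>

theorem orthonormal_frame:
  fixes G :: "'e::euclidean_space \<Rightarrow> 'e \<Rightarrow> real"
  assumes lin: "\<And>a. linear (G a)" and sym: "\<And>a b. G a b = G b a" and pos: "\<And>a. a \<noteq> 0 \<Longrightarrow> G a a > 0"
    and K: "finite K" "card K = DIM('e)"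
  shows "\<exists>e. (\<forall>i\<in>K. \<forall>j\<in>K. G (e i) (e j) = (if i = j then 1 else 0)) \<and> (\<forall>x. x = (\<Sum>i\<in>K. G x (e i) *\<^sub>R e i))"
proof -
  define orth where "orth S \<longleftrightarrow> finite S \<and> (\<forall>a\<in>S. \<forall>b\<in>S. G a b = (if a = b then 1 else 0))" for S
  have coeff: "G x s = c s" if S: "orth S" "x = (\<Sum>t\<in>S. c t *\<^sub>R t)" "s \<in> S" for S x s and c :: "'e \<Rightarrow> real"
  proof -
    have "G s x = (\<Sum>t\<in>S. c t * G s t)" unfolding S(2) by (simp add: linear_sum[OF lin] linear_cmul[OF lin])
    also have "\<dots> = (\<Sum>t\<in>S. if s = t then c t else 0)" using S(1,3) by (intro sum.cong) (auto simp: orth_def)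
    also have "\<dots> = c s" using S(1,3) by (simp add: orth_def sum.delta')
    finally show ?thesis by (simp add: sym)
  qed
  have ind: "independent S" if S: "orth S" for S
  proof (rule independent_if_scalars_zero)
    show "finite S" using S by (simp add: orth_def)
    fix f x assume "(\<Sum>x\<in>S. f x *\<^sub>R x) = 0" "x \<in> S"
    then show "f x = 0" using coeff[OF S _ , of 0 f x] sym[of 0 x] linear_0[OF lin, of x] by simp
  qed
  have bound: "card S \<le> DIM('e)" if "orth S" for S using independent_bound[OF ind[OF that]] by simp
  have "orth {}" by (simp add: orth_def)
  then have "\<exists>S. orth S \<and> (\<forall>S'. orth S' \<longrightarrow> card S' \<le> card S)"
    by (rule ex_has_greatest_nat[where b = "DIM('e) + 1"]) (use bound in \<open>simp add: less_Suc_eq_le\<close>)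
  then obtain S where S: "orth S" "\<And>S'. orth S' \<Longrightarrow> card S' \<le> card S" by (elim exE conjE) simp
  have fin: "finite S" using S(1) by (simp add: orth_def)
  have exp: "x = (\<Sum>s\<in>S. G x s *\<^sub>R s)" for x
  proof (rule ccontr)
    assume ne: "x \<noteq> (\<Sum>s\<in>S. G x s *\<^sub>R s)"
    define p where "p = x - (\<Sum>s\<in>S. G x s *\<^sub>R s)"
    have "p \<noteq> 0" using ne by (simp add: p_def)
    then have Gp: "G p p > 0" by (rule pos)
    have ps: "G s p = 0" if s: "s \<in> S" for s
      unfolding p_def linear_diff[OF lin] using coeff[OF S(1) refl s, of "G x"] sym[of s x] sym[of s "\<Sum>s\<in>S. G x s *\<^sub>R s"] by simp
    define u where "u = (1 / sqrt (G p p)) *\<^sub>R p"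
    have us: "G s u = 0" "G u s = 0" if "s \<in> S" for s
      using ps[OF that] sym[of u s] by (simp_all add: u_def linear_cmul[OF lin])
    have uu: "G u u = 1"
    proof -
      have "G u u = (1 / sqrt (G p p)) * ((1 / sqrt (G p p)) * G p p)"
        unfolding u_def linear_cmul[OF lin] sym[of "(1 / sqrt (G p p)) *\<^sub>R p" p] by simp
      also have "\<dots> = 1" using Gp by (simp add: field_simps)
      finally show ?thesis .
    qed
    have "u \<notin> S" using us[of u] uu by auto
    moreover have "orth (insert u S)" using S(1) us uu unfolding orth_def by auto
    ultimately show False using S(2)[of "insert u S"] fin by simp
  qed
  have "span S = UNIV"
  proof -
    have "x \<in> span S" for x by (subst exp[of x]) (intro span_sum span_scale span_base)
    then show ?thesis by blast
  qed
  then have "card S = DIM('e)" using dim_eq_card[OF _ ind[OF S(1)], of UNIV] by (simp add: dim_UNIV)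
  then obtain e where e: "bij_betw e K S" using finite_same_card_bij[OF K(1) fin] K(2) by metis
  have "x = (\<Sum>i\<in>K. G x (e i) *\<^sub>R e i)" for x
    using exp[of x] sum.reindex_bij_betw[OF e, of "\<lambda>s. G x s *\<^sub>R s"] by simp
  moreover have "G (e i) (e j) = (if i = j then 1 else 0)" if "i \<in> K" "j \<in> K" for i j
    using S(1) e that unfolding orth_def bij_betw_def inj_on_def by auto
  ultimately show ?thesis by blast
qed

section \<open>Estimates from the values of the cubic form on unit vectors\<close>

context cubic_model
begin

lemma g_scale: "y \<in> B \<Longrightarrow> g y (c *\<^sub>R a) (c *\<^sub>R a) = c^2 * g y a a"
  by (simp add: linear_cmul[OF lin] linear_cmul[OF lin_left] power2_eq_square)

lemma T_scale: "y \<in> B \<Longrightarrow> T y (c *\<^sub>R a) (c *\<^sub>R a) (c *\<^sub>R a) = c^3 * T y a a a"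
  by (simp add: linear_cmul[OF T_lin1] linear_cmul[OF T_lin2] linear_cmul[OF T_lin3] power3_eq_cube)

lemma g_nonneg: "y \<in> B \<Longrightarrow> 0 \<le> g y a a"
  using pos[of y a] linear_0[OF lin, of y a] by (cases "a = 0") auto

lemma T_homogeneous:
  assumes y: "y \<in> B" and T: "\<And>w. g y w w = 1 \<Longrightarrow> T y w w w \<le> M"
  shows "T y a a a \<le> M * (g y a a * sqrt (g y a a))"
proof (cases "a = 0")
  case True
  then show ?thesis using linear_0[OF T_lin3[OF y], of a a] linear_0[OF lin[OF y], of a] by simp
next
  case False
  define s where "s = sqrt (g y a a)"
  have s: "s > 0" "s^2 = g y a a" using pos[OF y False] by (simp_all add: s_def)
  define u where "u = (1 / s) *\<^sub>R a"
  have a: "a = s *\<^sub>R u" using s by (simp add: u_def)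
  have "g y u u = 1" using s pos[OF y False] by (simp add: u_def g_scale[OF y] power_divide)
  then have "s^3 * T y u u u \<le> s^3 * M" using T s by (intro mult_left_mono) auto
  moreover have "T y a a a = s^3 * T y u u u" by (subst (1 2 3) a) (rule T_scale[OF y])
  ultimately show ?thesis
    by (simp add: s(2)[symmetric] s_def[symmetric] mult.commute power3_eq_cube power2_eq_square)
      (use s in \<open>simp add: mult_ac abs_of_pos\<close>)
qed

text \<open>Polarization: \<open>6 T(b, a, a) = T(b + a) + T(b - a) - 2 T(b)\<close> on the diagonal.\<close>

lemma T_polarization:
  assumes y: "y \<in> B" and T: "\<And>w. g y w w = 1 \<Longrightarrow> T y w w w \<le> M"
    and a: "g y a a = 1" and b: "g y b b = 1"
  shows "\<bar>T y b a a\<bar> \<le> 3 * M"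
proof -
  have M: "M \<ge> 0"
  proof -
    have "T y (- a) (- a) (- a) = - T y a a a" "g y (- a) (- a) = 1"
      using T_scale[OF y, of "-1" a] g_scale[OF y, of "-1" a] a by simp_all
    then show ?thesis using T[of a] T[of "- a"] a by simp
  qed
  have ub: "T y w w w \<le> M * 8" if "g y w w \<le> 4" for w
  proof -
    have "sqrt (g y w w) \<le> 2" using real_sqrt_le_mono[OF that] by simp
    then have "g y w w * sqrt (g y w w) \<le> 4 * 2"
      using that g_nonneg[OF y, of w] by (intro mult_mono) auto
    then have "M * (g y w w * sqrt (g y w w)) \<le> M * 8" using M by (intro mult_left_mono) auto
    then show ?thesis using T_homogeneous[OF y T, of w] by simp
  qed
  have neg: "T y (- w) (- w) (- w) = - T y w w w" "g y (- w) (- w) = g y w w" for w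
    using T_scale[OF y, of "-1" w] g_scale[OF y, of "-1" w] by simp_all
  have abs: "\<bar>T y w w w\<bar> \<le> M * 8" if "g y w w \<le> 4" for w
    using ub[OF that] ub[of "- w"] that neg[of w] by simp
  have gp: "g y (b + a) (b + a) = 2 + 2 * g y b a" "g y (b - a) (b - a) = 2 - 2 * g y b a"
    using g_diag[OF y, of 1 b 1 a] g_diag[OF y, of 1 b "-1" a] a b by simp_all
  \<comment> \<open>Hence b + a and b - a have squared length at most 4 and cubic values at most 8 M
    in absolute value; polarization gives (8 + 8 + 2) M / 6 = 3 M.\<close>
  have "\<bar>g y b a\<bar> \<le> 1" using gp g_nonneg[OF y, of "b + a"] g_nonneg[OF y, of "b - a"] by linarith
  then have "\<bar>T y (b + a) (b + a) (b + a)\<bar> \<le> M * 8" "\<bar>T y (b - a) (b - a) (b - a)\<bar> \<le> M * 8"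
    using gp by (intro abs; simp)+
  moreover have "\<bar>T y b b b\<bar> \<le> M" using T[of b] T[of "- b"] neg[of b] b by simp
  moreover have "6 * T y b a a = T y (b + a) (b + a) (b + a) + T y (b - a) (b - a) (b - a) - 2 * T y b b b"
    using T_diag[OF y, of 1 b 1 a] T_diag[OF y, of 1 b "-1" a] by simp
  ultimately show ?thesis by linarith
qed

lemma T_bound:
  assumes y: "y \<in> B" and T: "\<And>w. g y w w = 1 \<Longrightarrow> T y w w w \<le> M"
  shows "\<bar>T y b a a\<bar> \<le> 3 * M * sqrt (g y b b) * g y a a"
proof (cases "a = 0 \<or> b = 0")
  case True
  then show ?thesis
    using linear_0[OF T_lin3[OF y], of b a] linear_0[OF T_lin1[OF y], of a a] linear_0[OF lin[OF y], of a] linear_0[OF lin[OF y], of b]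
    by auto
next
  case False
  define s r where "s = sqrt (g y a a)" and "r = sqrt (g y b b)"
  have s: "s > 0" "s^2 = g y a a" "r > 0" "r^2 = g y b b" using pos[OF y] False by (simp_all add: s_def r_def less_imp_le)
  define u v where "u = (1 / s) *\<^sub>R a" and "v = (1 / r) *\<^sub>R b"
  have a: "a = s *\<^sub>R u" "b = r *\<^sub>R v" using s by (simp_all add: u_def v_def)
  have "g y u u = 1" "g y v v = 1"
    using s pos[OF y, of a] pos[OF y, of b] False by (simp_all add: u_def v_def g_scale[OF y] power_divide)
  then have "\<bar>T y v u u\<bar> \<le> 3 * M" using T_polarization[OF y T] by blast
  then have "r * s^2 * \<bar>T y v u u\<bar> \<le> r * s^2 * (3 * M)" using s(1,3) by (intro mult_left_mono) auto
  moreover have "T y (r *\<^sub>R v) (s *\<^sub>R u) (s *\<^sub>R u) = r * s^2 * T y v u u"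
    by (simp add: linear_cmul[OF T_lin1[OF y]] linear_cmul[OF T_lin2[OF y]] linear_cmul[OF T_lin3[OF y]] power2_eq_square)
  then have "\<bar>T y b a a\<bar> = r * s^2 * \<bar>T y v u u\<bar>" unfolding a[symmetric] using s(1,3) by (simp add: abs_mult)
  ultimately have "\<bar>T y b a a\<bar> \<le> 3 * M * r * s^2" by (simp only: mult_ac)
  then show ?thesis unfolding s(2) r_def .
qed

lemma g_along:
  assumes "t *\<^sub>R x \<in> B"
  shows "((\<lambda>s. g (s *\<^sub>R x) a b) has_real_derivative T (t *\<^sub>R x) x a b) (at t)"
  using dd_along[OF smooth, of 0 t x a b UNIV] assms by (simp add: T_def)

text \<open>\<open>H\<close> bounds \<open>T\<close> only at the end of rays on which g stays below
  the weak factor 4. Under that bound the growth exponent is 4 \<mu> |x| <= 1/4, and Gronwall's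
  inequality improves 4 to 2, so the weak bound can never be lost. In other directions the exponent
  is then 9 \<mu> |x| <= 9/16, still below 2/3.\<close>

lemma ray_control:
  assumes R: "ball 0 r \<subseteq> B" and L: "\<mu> > 0" "r \<le> 1 / (16 * \<mu>)" and g0: "\<And>a b. g 0 a b = a \<bullet> b"
    and H: "\<And>y w. y \<in> ball 0 r \<Longrightarrow> (\<And>t. 0 \<le> t \<Longrightarrow> t \<le> 1 \<Longrightarrow> g (t *\<^sub>R y) y y \<le> 4 * (norm y)^2) \<Longrightarrow>
      g y w w = 1 \<Longrightarrow> T y w w w \<le> 2 * \<mu>"
    and x: "x \<in> ball 0 r"
  shows "g x x x \<le> 2 * (norm x)^2" "g x a a \<le> 2 * (norm a)^2" "(norm a)^2 \<le> 2 * g x a a"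
    "g x w w = 1 \<Longrightarrow> T x w w w \<le> 2 * \<mu>"
proof -
  have "x = 0 \<Longrightarrow> r > 0" using x by auto
  have r: "r > 0" using x by (auto intro: le_less_trans[OF norm_ge_zero])
  have xr: "\<mu> * norm x \<le> 1 / 16"
  proof -
    have "norm x \<le> 1 / (16 * \<mu>)" using x L by simp
    then show ?thesis using L(1) by (simp add: field_simps)
  qed
  have inb: "t *\<^sub>R x \<in> ball 0 r" if "0 \<le> t" "t \<le> 1" for t
  proof -
    have "\<bar>t\<bar> * norm x \<le> norm x" using that by (intro mult_left_le_one_le) auto
    then show ?thesis using x by simp
  qed
  have inB: "t *\<^sub>R x \<in> B" if "0 \<le> t" "t \<le> 1" for t using inb[OF that] R by blast
  have nn: "norm (v :: 'e)^2 = v \<bullet> v" for v by (simp add: power2_norm_eq_inner)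
  define \<phi> where "\<phi> t = g (t *\<^sub>R x) x x" for t
  have \<phi>d: "(\<phi> has_real_derivative T (t *\<^sub>R x) x x x) (at t)" if "0 \<le> t" "t \<le> 1" for t
    unfolding \<phi>_def by (rule g_along[OF inB[OF that]])
  have tr: "T (t *\<^sub>R x) w w w \<le> 2 * \<mu>"
    if t: "0 \<le> t" "t \<le> 1" and ph: "\<And>s. 0 \<le> s \<Longrightarrow> s \<le> t \<Longrightarrow> \<phi> s \<le> 4 * (norm x)^2"
      and w: "g (t *\<^sub>R x) w w = 1" for t w
  proof (rule H[OF inb[OF t] _ w])
    fix s :: real assume s: "0 \<le> s" "s \<le> 1"
    have st: "s * t \<le> t" "s * t \<le> 1" using s t mult_left_le_one_le[of t s] by auto
    have "g (s *\<^sub>R t *\<^sub>R x) (t *\<^sub>R x) (t *\<^sub>R x) = t^2 * \<phi> (s * t)"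
      using g_scale[OF inB[of "s * t"], of t x] st s t by (simp add: \<phi>_def)
    also have "\<dots> \<le> t^2 * (4 * (norm x)^2)" using ph[of "s * t"] st s t by (intro mult_left_mono) auto
    finally show "g (s *\<^sub>R t *\<^sub>R x) (t *\<^sub>R x) (t *\<^sub>R x) \<le> 4 * (norm (t *\<^sub>R x))^2"
      by (simp add: power_mult_distrib mult_ac)
  qed
  have improve: "\<phi> \<tau> \<le> 2 * (norm x)^2"
    if \<tau>: "0 \<le> \<tau>" "\<tau> \<le> 1" and ph: "\<And>s. 0 \<le> s \<Longrightarrow> s \<le> \<tau> \<Longrightarrow> \<phi> s \<le> 4 * (norm x)^2" for \<tau>
  proof -
    have "\<phi> \<tau> \<le> \<phi> 0 * exp (1/4 * \<tau>)"
    proof (rule gronwall_bounds(1)[OF \<phi>d])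
      fix t assume t: "0 \<le> t" "t \<le> \<tau>"
      then have t1: "t \<le> 1" using \<tau> by simp
      note tB = inB[OF t(1) t1]
      have tr': "T (t *\<^sub>R x) w w w \<le> 2 * \<mu>" if "g (t *\<^sub>R x) w w = 1" for w
        by (rule tr[OF t(1) t1 _ that]) (use ph t in auto)
      have "sqrt (\<phi> t) \<le> sqrt (4 * (norm x)^2)" using ph[OF t] by (rule real_sqrt_le_mono)
      then have s: "sqrt (\<phi> t) \<le> 2 * norm x" by (simp add: real_sqrt_mult)
      have p0: "0 \<le> \<phi> t" unfolding \<phi>_def by (rule g_nonneg[OF tB])
      have "T (t *\<^sub>R x) x x x \<le> 2 * \<mu> * (\<phi> t * sqrt (\<phi> t))"
        using T_homogeneous[OF tB tr', of x] by (simp add: \<phi>_def)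
      moreover have "- T (t *\<^sub>R x) x x x \<le> 2 * \<mu> * (\<phi> t * sqrt (\<phi> t))"
        using T_homogeneous[OF tB tr', of "- x"] T_scale[OF tB, of "-1" x] g_scale[OF tB, of "-1" x] by (simp add: \<phi>_def)
      ultimately have "\<bar>T (t *\<^sub>R x) x x x\<bar> \<le> 2 * \<mu> * (\<phi> t * sqrt (\<phi> t))" by simp
      also have "\<dots> \<le> 2 * \<mu> * (\<phi> t * (2 * norm x))"
        using s p0 L(1) by (intro mult_left_mono) auto
      also have "\<dots> = (4 * (\<mu> * norm x)) * \<phi> t" by simp
      also have "\<dots> \<le> 1/4 * \<phi> t" using xr p0 by (intro mult_right_mono) auto
      finally show "\<bar>T (t *\<^sub>R x) x x x\<bar> \<le> 1/4 * \<phi> t" .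
    qed (use \<tau> in auto)
    also have "\<dots> \<le> (norm x)^2 * 2"
      using \<tau> by (intro mult_mono exp_le_two) (auto simp: \<phi>_def g0 nn)
    finally show ?thesis by simp
  qed
  have ctrl: "\<phi> t \<le> 4 * (norm x)^2" if t: "0 \<le> t" "t \<le> 1" for t
  proof (cases "x = 0")
    case True
    then show ?thesis using linear_0[OF lin[OF inB[OF t]], of 0] by (simp add: \<phi>_def)
  next
    case False
    show ?thesis
    proof (rule ccontr)
      assume neg: "\<not> \<phi> t \<le> 4 * (norm x)^2"
      \<comment> \<open>Its infimum is the first time at which the factor 4 is reached. Up to then
        \<open>improve\<close> applies and yields the factor 2, a contradiction for x \<noteq>
        0.\<close>
      define Z where "Z = {0..t} \<inter> \<phi> -` {4 * (norm x)^2..}"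
      have c\<phi>: "continuous_on {0..t} \<phi>"
        by (rule continuous_at_imp_continuous_on) (use \<phi>d t DERIV_isCont in force)
      have "closed Z" unfolding Z_def by (intro continuous_closed_preimage c\<phi>) auto
      moreover have "t \<in> Z" using neg t by (simp add: Z_def)
      moreover have bZ: "bdd_below Z" by (auto simp: Z_def bdd_below_def)
      ultimately have IZ: "Inf Z \<in> Z" using closed_contains_Inf[of Z] by blast
      define \<tau> where "\<tau> = Inf Z"
      have \<tau>: "0 \<le> \<tau>" "\<tau> \<le> t" "4 * (norm x)^2 \<le> \<phi> \<tau>" using IZ by (auto simp: Z_def \<tau>_def)
      have less: "\<phi> s < 4 * (norm x)^2" if "0 \<le> s" "s < \<tau>" for s
      proof (rule ccontr)
        assume "\<not> \<phi> s < 4 * (norm x)^2"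
        then have "s \<in> Z" using that \<tau> by (simp add: Z_def)
        then show False using cInf_lower[OF _ bZ, of s] that by (simp add: \<tau>_def)
      qed
      have "\<phi> \<tau> \<le> 4 * (norm x)^2"
      proof (cases "\<tau> = 0")
        case True then show ?thesis by (simp add: \<phi>_def g0 nn)
      next
        case False
        have "(\<phi> \<longlongrightarrow> \<phi> \<tau>) (at_left \<tau>)"
          using DERIV_isCont[OF \<phi>d[of \<tau>]] \<tau> t by (auto simp: isCont_def filterlim_at_split)
        moreover have "eventually (\<lambda>s. \<phi> s \<le> 4 * (norm x)^2) (at_left \<tau>)"
          unfolding eventually_at_left_field using False \<tau>(1) less
          by (intro exI[of _ 0]) (auto intro: less_imp_le)
        ultimately show ?thesis by (rule tendsto_upperbound) simp
      qed
      then have "\<phi> s \<le> 4 * (norm x)^2" if "0 \<le> s" "s \<le> \<tau>" for s using less[of s] that by (cases "s = \<tau>") auto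
      from improve[OF \<tau>(1) _ this] have "\<phi> \<tau> \<le> 2 * (norm x)^2" using \<tau> t by auto
      moreover have "(norm x)^2 > 0" using False by simp
      ultimately show False using \<tau>(3) by linarith
    qed
  qed
  have ctrl2: "\<phi> t \<le> 2 * (norm x)^2" if "0 \<le> t" "t \<le> 1" for t
    by (rule improve[OF that]) (use ctrl that in auto)
  show "g x x x \<le> 2 * (norm x)^2" using ctrl2[of 1] by (simp add: \<phi>_def)
  have tr1: "T (t *\<^sub>R x) w w w \<le> 2 * \<mu>" if "0 \<le> t" "t \<le> 1" "g (t *\<^sub>R x) w w = 1" for t w
    by (rule tr[OF that(1,2) _ that(3)]) (use ctrl that in auto)
  show "g x w w = 1 \<Longrightarrow> T x w w w \<le> 2 * \<mu>" using tr1[of 1 w] by simp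
  define k where "k = (2 / 3 :: real)"
  have dbd: "\<bar>T (t *\<^sub>R x) x a a\<bar> \<le> k * g (t *\<^sub>R x) a a" if t: "0 \<le> t" "t \<le> 1" for t
  proof -
    note tB = inB[OF t]
    have "(3/2 * norm x)^2 = 9/4 * (norm x)^2" by (simp add: power_mult_distrib power_divide)
    then have "\<phi> t \<le> (3/2 * norm x)^2" using ctrl2[OF t] zero_le_power2[of "norm x"] by linarith
    then have "sqrt (\<phi> t) \<le> sqrt ((3/2 * norm x)^2)" by (rule real_sqrt_le_mono)
    then have s: "sqrt (\<phi> t) \<le> 3/2 * norm x" by simp
    have "\<bar>T (t *\<^sub>R x) x a a\<bar> \<le> 3 * (2 * \<mu>) * sqrt (\<phi> t) * g (t *\<^sub>R x) a a"
      using T_bound[OF tB tr1[OF t], of x a] by (simp add: \<phi>_def)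
    also have "\<dots> \<le> 3 * (2 * \<mu>) * (3/2 * norm x) * g (t *\<^sub>R x) a a"
      using s L(1) g_nonneg[OF tB] by (intro mult_right_mono mult_left_mono) auto
    also have "\<dots> = (9 * (\<mu> * norm x)) * g (t *\<^sub>R x) a a" by simp
    also have "\<dots> \<le> k * g (t *\<^sub>R x) a a"
      using xr g_nonneg[OF tB] by (intro mult_right_mono) (auto simp: k_def)
    finally show ?thesis .
  qed
  have d: "((\<lambda>t. g (t *\<^sub>R x) a a) has_real_derivative T (t *\<^sub>R x) x a a) (at t)" if "0 \<le> t" "t \<le> 1" for t
    by (rule g_along[OF inB[OF that]])
  have e: "exp (k * 1) \<le> 2" by (rule exp_le_two) (simp add: k_def)
  have ga: "0 \<le> g x a a" using g_nonneg[OF inB[of 1], of a] by simp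
  have "g x a a \<le> (a \<bullet> a) * exp (k * 1)" "a \<bullet> a \<le> g x a a * exp (k * 1)"
    using gronwall_bounds[of 1 "\<lambda>t. g (t *\<^sub>R x) a a", OF d dbd] g0 by auto
  moreover have "(a \<bullet> a) * exp (k * 1) \<le> (a \<bullet> a) * 2" "g x a a * exp (k * 1) \<le> g x a a * 2"
    using e ga by (intro mult_left_mono; simp)+
  ultimately show "g x a a \<le> 2 * (norm a)^2" "(norm a)^2 \<le> 2 * g x a a" unfolding nn by linarith+
qed

lemma cubic_continuous: "continuous_on (B \<times> UNIV) (\<lambda>(y, w). T y w w w)"
proof -
  have "continuous_on (B \<times> UNIV) (\<lambda>p. \<Sum>i\<in>Basis. (snd p \<bullet> i) * (case p of (y, w) \<Rightarrow> T y i w w))"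
    by (intro continuous_on_sum continuous_on_mult continuous_on_inner continuous_on_snd continuous_on_const continuous_on_id
          bilinear_family_continuous T_lin3 T_lin2 Cinf_on_continuous[OF T_smooth])
  moreover have "(\<Sum>i\<in>Basis. (snd p \<bullet> i) * (case p of (y, w) \<Rightarrow> T y i w w)) = (case p of (y, w) \<Rightarrow> T y w w w)"
    if p: "p \<in> B \<times> UNIV" for p
  proof -
    obtain y w where pw: "p = (y, w)" "y \<in> B" using p by auto
    show ?thesis using linear_expand[OF T_lin1[OF pw(2)], of w w w] by (simp add: pw(1))
  qed
  ultimately show ?thesis by (rule continuous_on_eq)
qed

lemma metric_continuous: "continuous_on (B \<times> UNIV) (\<lambda>(y, w). g y w w)"
  by (intro bilinear_family_continuous lin lin_left Cinf_on_continuous[OF smooth])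

text \<open>The maximum of \<open>T\<^sub>y(w, w, w) - \<kappa> |y|\<^sup>2\<close> over \<open>|y| \<le> \<rho>\<close> and unit vectors \<open>w\<close> cannot lie in the interior.\<close>

theorem cubic_growth:
  fixes \<mu> :: real
  assumes L: "\<mu> > 0" and R: "cball 0 (1 / (32 * \<mu>)) \<subseteq> B"
    and ctrl: "\<And>y a. norm y \<le> 1 / (32 * \<mu>) \<Longrightarrow> (norm a)^2 \<le> 2 * g y a a"
    and w0: "g 0 w0 w0 = 1" "T 0 w0 w0 w0 = \<mu>"
    and fm: "\<And>y. y \<in> B \<Longrightarrow> \<exists>r>0. \<exists>om J. flat_model (ball y r) g om J"
    and card: "CARD('k::finite) = DIM('e)"
  shows "\<exists>y w. norm y \<le> 1 / (32 * \<mu>) \<and> g y w w = 1 \<and> (1 + 1 / (8192 * DIM('e))) * \<mu> \<le> T y w w w"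
proof -
  define m where "m = real DIM('e)"
  have m: "m \<ge> 1" using DIM_positive[where 'a = 'e] by (simp add: m_def)
  \<comment> \<open>Small enough for the interior case: with squared frame lengths at most 2, the
    interior bound would give 3/4 l^3 <= 4 m \<kappa> = \<mu>^3 / 2 although l >= \<mu>. On the
    boundary |y| = \<rho> the penalty \<kappa> \<rho>^2 = \<mu> / (8192 m) becomes the gain in the
    conclusion.\<close>
  define \<kappa> where "\<kappa> = \<mu>^3 / (8 * m)"
  have \<kappa>: "\<kappa> > 0" using L m by (simp add: \<kappa>_def)
  define \<rho> where "\<rho> = 1 / (32 * \<mu>)"
  have \<rho>: "\<rho> > 0" using L by (simp add: \<rho>_def)
  have \<kappa>\<rho>: "\<kappa> * \<rho>^2 = 1 / (8192 * m) * \<mu>" using L m by (simp add: \<kappa>_def \<rho>_def field_simps power2_eq_square power3_eq_cube)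
  \<comment> \<open>All unit vectors over the ball: by \<open>ctrl\<close> their squared Euclidean
    norm is at most 2, so the radius 2 loses none and makes K compact.\<close>
  define K where "K = (cball 0 \<rho> \<times> cball 0 (2 :: real)) \<inter> (\<lambda>(y, w). g y w w) -` {1}"
  have sub: "cball 0 \<rho> \<times> cball 0 2 \<subseteq> B \<times> (UNIV :: 'e set)" using R by (auto simp: \<rho>_def)
  have small: "norm w \<le> 2" if y: "norm y \<le> \<rho>" and w: "g y w w = 1" for y w
    by (rule power2_le_imp_le) (use ctrl[of y w] y w in \<open>auto simp: \<rho>_def\<close>)
  have "closed K" unfolding K_def
    by (intro continuous_closed_preimage continuous_on_subset[OF metric_continuous sub] closed_Times closed_cball) auto
  then have cK: "compact K"
    using compact_Int_closed[OF compact_Times[OF compact_cball compact_cball], of K 0 \<rho> 0 2]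
    by (simp add: K_def Int_absorb1 inf.left_commute Int_commute)
  have "(0, w0) \<in> K" using small[of 0 w0] w0 \<rho> by (auto simp: K_def)
  define \<Phi> where "\<Phi> p = (case p of (y, w) \<Rightarrow> T y w w w) - \<kappa> * (fst p \<bullet> fst p)" for p
  have c\<Phi>: "continuous_on K \<Phi>" unfolding \<Phi>_def
    by (intro continuous_intros continuous_on_subset[OF cubic_continuous]) (use sub in \<open>auto simp: K_def\<close>)
  obtain p where p: "p \<in> K" "\<And>q. q \<in> K \<Longrightarrow> \<Phi> q \<le> \<Phi> p"
    using continuous_attains_sup[OF cK _ c\<Phi>] \<open>(0, w0) \<in> K\<close> by blast
  obtain y v where yv: "p = (y, v)" by (cases p)
  have y: "norm y \<le> \<rho>" "g y v v = 1" using p(1) by (auto simp: K_def yv)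
  have mx: "T z w w w - \<kappa> * (z \<bullet> z) \<le> T y v v v - \<kappa> * (y \<bullet> y)" if "norm z \<le> \<rho>" "g z w w = 1" for z w
    using p(2)[of "(z, w)"] that small[OF that] by (auto simp: K_def \<Phi>_def yv)
  have yB: "y \<in> B" using y(1) R by (auto simp: \<rho>_def)
  define l where "l = T y v v v"
  have l: "l \<ge> \<mu> + \<kappa> * (y \<bullet> y)" using mx[of 0 w0] w0 \<rho> by (simp add: l_def)
  have ll: "l \<ge> \<mu>" using l \<kappa> by (meson add_increasing2 inner_ge_zero less_imp_le mult_nonneg_nonneg order_trans le_add_same_cancel1)
  have "norm y = \<rho>"
  proof (rule ccontr)
    assume "norm y \<noteq> \<rho>"
    then have yr: "norm y < \<rho>" using y(1) by simp
    obtain r1 om J where r1: "r1 > 0" "flat_model (ball y r1) g om J" using fm[OF yB] by (elim exE conjE)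
    define r where "r = min r1 (\<rho> - norm y)"
    have r: "r > 0" "ball y r \<subseteq> ball y r1" using r1(1) yr by (auto simp: r_def)
    have rr: "norm z \<le> \<rho>" if "z \<in> ball y r" for z
      using that norm_triangle_ineq2[of z y] by (auto simp: r_def dist_norm norm_minus_commute)
    obtain e :: "'k \<Rightarrow> 'e" where e: "\<And>i j. g y (e i) (e j) = (if i = j then 1 else 0)"
      "\<And>x. x = (\<Sum>i\<in>UNIV. g y x (e i) *\<^sub>R e i)"
    proof -
      have "\<exists>e :: 'k \<Rightarrow> 'e. (\<forall>i\<in>UNIV. \<forall>j\<in>UNIV. g y (e i) (e j) = (if i = j then 1 else 0)) \<and>
          (\<forall>x. x = (\<Sum>i\<in>UNIV. g y x (e i) *\<^sub>R e i))"
        by (rule orthonormal_frame) (auto simp: lin[OF yB] pos[OF yB] card intro: sym[OF yB])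
      then show thesis using that by (metis UNIV_I)
    qed
    interpret fl: flat_model "ball y r1" g om J by (rule r1(2))
    have "3 / 4 * l ^ 3 \<le> 2 * \<kappa> * (\<Sum>i\<in>UNIV. e i \<bullet> e i)"
      unfolding l_def
    proof (rule fl.interior_maximum_bound[OF _ y(2) r _ _ _ e])
      show "y \<in> ball y r1" using r1(1) by simp
      show "0 < T y v v v" using ll L by (simp add: l_def)
      show "0 \<le> \<kappa>" using \<kappa> by simp
      fix z w assume z: "z \<in> ball y r"
      have zB: "z \<in> B" using rr[OF z] R by (auto simp: \<rho>_def)
      show "T z w w w \<le> (T y v v v + \<kappa> * (z \<bullet> z - y \<bullet> y)) * (g z w w * sqrt (g z w w))"
        by (rule T_homogeneous[OF zB]) (use mx[OF rr[OF z]] in \<open>simp add: algebra_simps\<close>)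
    qed
    also have "\<dots> \<le> 2 * \<kappa> * (\<Sum>i\<in>(UNIV :: 'k set). 2)"
    proof (intro mult_left_mono sum_mono)
      show "e i \<bullet> e i \<le> 2" for i using ctrl[of y "e i"] y(1) e(1)[of i i] by (simp add: \<rho>_def power2_norm_eq_inner)
    qed (use \<kappa> in simp)
    also have "\<dots> = \<mu>^3 / 2" using m by (simp add: card m_def[symmetric] \<kappa>_def)
    also have "\<dots> < 3 / 4 * \<mu>^3" using L by simp
    also have "\<dots> \<le> 3 / 4 * l^3" using ll L by (simp add: power_mono)
    finally show False by simp
  qed
  then have "y \<bullet> y = \<rho>^2" by (simp add: power2_norm_eq_inner[symmetric])
  then have "(1 + 1 / (8192 * m)) * \<mu> \<le> l" using l \<kappa>\<rho> by (simp add: algebra_simps)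
  then show ?thesis using y unfolding l_def \<rho>_def m_def by (intro exI[of _ y] exI[of _ v]) simp
qed

end

section \<open>The values of the cubic form on unit vectors\<close>

context riemannian_manifold
begin

lemma pull_affine:
  assumes par: "param A B P" and L: "linear L" and x: "y0 + L (x - x0) \<in> B"
  shows "pull (\<lambda>x. P (y0 + L (x - x0))) x a b = pull P (y0 + L (x - x0)) (L a) (L b)"
proof -
  let ?k = "\<lambda>x. y0 + L (x - x0)"
  have bl: "bounded_linear L" using L linear_conv_bounded_linear by blast
  have Lder: "(?k has_derivative L) (at x)" for x
    by (auto intro!: derivative_eq_intros bounded_linear.has_derivative[OF bl])
  have "push_vec A (\<lambda>x. P (?k x)) x w = push_vec A P (?k x) (L w)" for w
    using push_vec_compose[where \<kappa> = ?k and w = w, OF par _ x] Lder dd_eqI[OF Lder] by (auto simp: differentiable_def)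
  then show ?thesis by (simp add: pull_def)
qed

lemma reach_mono: "reach A g p q l \<Longrightarrow> l \<le> l' \<Longrightarrow> reach A g p q l'"
proof -
  assume l: "reach A g p q l" "l \<le> l'"
  obtain \<gamma> S where \<gamma>: "0 < l" "piecewise_C1_curve A \<gamma>" "\<gamma> 0 = p" "\<gamma> 1 = q" "finite S"
    and v: "\<forall>t\<in>{0..1} - S. \<exists>v. has_velocity A \<gamma> t v \<and> sqrt (g (\<gamma> t) v v) \<le> l"
    using l(1) unfolding reach_def by (elim exE conjE)
  have "\<forall>t\<in>{0..1} - S. \<exists>v. has_velocity A \<gamma> t v \<and> sqrt (g (\<gamma> t) v v) \<le> l'"
    using v l(2) by (meson order_trans)
  then show "reach A g p q l'" unfolding reach_def using \<gamma> l(2) by (intro conjI exI[of _ \<gamma>] exI[of _ S]) auto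
qed

end

context special_kaehler
begin

abbreviation G where "G \<equiv> kaehler_metric I om"

abbreviation cub where "cub P \<equiv> cubic_model.T (pull P)"

lemma cub_def:
  assumes "locally_flat A nabla W P"
  shows "cub P y a b c = dd (\<lambda>z. pull P z b c) a y"
  using cubic_model.T_def[OF cubic_model_locally_flat[OF assms]] .

lemma reach_locally_flat:
  assumes F: "locally_flat A nabla W F"
    and seg: "\<And>t. t \<in> {0..1} \<Longrightarrow> x + t *\<^sub>R w \<in> W"
    and l: "l > 0" "\<And>t. t \<in> {0..1} \<Longrightarrow> sqrt (pull F (x + t *\<^sub>R w) w w) \<le> l"
  shows "reach A G (F x) (F (x + w)) l"
proof (rule reach_segment[OF _ _ seg l])
  show "open W" using F by (simp add: locally_flat_def)
  fix z assume "z \<in> W"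
  then obtain r where "r > 0" "ball z r \<subseteq> W" "flat_param A nabla (ball z r) F"
    using F unfolding locally_flat_def by (elim conjE) (drule bspec, assumption, elim exE conjE)
  then show "\<exists>r>0. ball z r \<subseteq> W \<and> param A (ball z r) F" by (intro exI[of _ r] conjI flat_paramD)
qed

lemma cub_cong:
  assumes "locally_flat A nabla W F" "locally_flat A nabla W' F'" and N: "open N" "x \<in> N" "\<And>z. z \<in> N \<Longrightarrow> F z = F' z"
  shows "cub F x a b c = cub F' x a b c"
  unfolding cub_def[OF assms(1)] cub_def[OF assms(2)]
  by (rule dd_cong[OF N(1,2)]) (rule pull_cong[OF N(1) _ N(3)])

lemma cub_affine:
  assumes P: "flat_param A nabla B P"
    and L: "linear L" "linear L'" "\<And>x. L (L' x) = x" "\<And>x. L' (L x) = x"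
    and B': "open B'" "\<And>x. x \<in> B' \<Longrightarrow> y0 + L (x - x0) \<in> B" and x: "x \<in> B'"
  shows "cub (\<lambda>x. P (y0 + L (x - x0))) x a b c = cub P (y0 + L (x - x0)) (L a) (L b) (L c)"
proof -
  let ?k = "\<lambda>x. y0 + L (x - x0)"
  note lf = flat_param_locally_flat[OF P]
  have lf': "locally_flat A nabla B' (\<lambda>x. P (?k x))"
    by (rule flat_param_locally_flat[OF flat_param_compose_affine[OF nabla(1) P L B']])
  have bl: "bounded_linear L" using L linear_conv_bounded_linear by blast
  have Lder: "(?k has_derivative L) (at x)"
    by (auto intro!: derivative_eq_intros bounded_linear.has_derivative[OF bl])
  have "dd (\<lambda>z. pull (\<lambda>x. P (?k x)) z b c) a x = dd (\<lambda>z. pull P (?k z) (L b) (L c)) a x"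
    by (rule dd_cong[OF B'(1) x]) (rule pull_affine[OF flat_paramD[OF P] L(1) B'(2)])
  also have "\<dots> = dd (\<lambda>z. pull P z (L b) (L c)) (L a) (?k x)"
  proof (rule dd_eqI)
    show "((\<lambda>z. pull P (?k z) (L b) (L c)) has_derivative (\<lambda>v. dd (\<lambda>z. pull P z (L b) (L c)) (L v) (?k x))) (at x)"
      by (rule has_derivative_compose[where f = ?k and f' = L and g = "\<lambda>z. pull P z (L b) (L c)",
            OF Lder Cinf_on_has_derivative[OF pull_smooth[OF flat_paramD[OF P]] B'(2)[OF x]]])
  qed
  finally show ?thesis using cub_def[OF lf, of "?k x" "L a" "L b" "L c"] cub_def[OF lf', of x a b c] by simp
qed

text \<open>The cubic form is only available in flat coordinates, so its values at a point are
  introduced through some centred flat parametrization; \<open>cubic_value_in_param\<close> removes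
  the dependence on it.\<close>

definition cubic_value :: "real \<Rightarrow> 'a \<Rightarrow> bool" where
  "cubic_value \<mu> q \<longleftrightarrow> (\<exists>P r w. r > 0 \<and> flat_param A nabla (ball 0 r) P \<and> P 0 = q \<and> pull P 0 w w = 1 \<and> cub P 0 w w w = \<mu>)"

lemma cubic_valueI:
  assumes F: "locally_flat A nabla W F" and y: "y \<in> W" and w: "pull F y w w = 1"
  shows "cubic_value (cub F y w w w) (F y)"
proof -
  obtain r where r: "r > 0" "ball y r \<subseteq> W" "flat_param A nabla (ball y r) F"
    using F y unfolding locally_flat_def by (elim conjE) (drule bspec, assumption, elim exE conjE)
  let ?P = "\<lambda>x. F (y + (x - 0))"
  have B: "\<And>x. x \<in> ball 0 r \<Longrightarrow> y + (x - 0) \<in> ball y r" by (simp add: dist_norm)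
  have 0: "(0 :: complex ^ 'n) \<in> ball 0 r" using r(1) by simp
  have fp: "flat_param A nabla (ball 0 r) ?P"
    by (rule flat_param_compose_affine[OF nabla(1) r(3) _ _ _ _ open_ball, of "\<lambda>x. x" "\<lambda>x. x"])
       (use B in \<open>simp_all add: linear_id[unfolded id_def]\<close>)
  have "pull ?P 0 w w = 1"
    using pull_affine[OF flat_paramD[OF r(3)] linear_id[unfolded id_def] B[OF 0], of w w] w by simp
  moreover have "cub ?P 0 w w w = cub F (y + (0 - 0)) w w w"
    by (rule cub_affine[OF r(3) _ _ _ _ open_ball _ 0, of "\<lambda>x. x" "\<lambda>x. x"])
       (use B in \<open>simp_all add: linear_id[unfolded id_def]\<close>)
  ultimately show ?thesis
    unfolding cubic_value_def using r(1) fp by (intro exI[of _ ?P] exI[of _ r] exI[of _ w]) simp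
qed

text \<open>Two flat parametrizations differ by an affine map near the point, and under affine
  changes the coordinate derivative of the metric transforms like a tensor.\<close>

lemma cubic_value_in_param:
  assumes P: "flat_param A nabla B P" and y: "y \<in> B" and v: "cubic_value \<mu> (P y)"
  shows "\<exists>w. pull P y w w = 1 \<and> cub P y w w w = \<mu>"
proof -
  obtain P' r w where P': "r > 0" "flat_param A nabla (ball 0 r) P'" "P' 0 = P y" "pull P' 0 w w = 1" "cub P' 0 w w w = \<mu>"
    using v unfolding cubic_value_def by (elim exE conjE)
  note par = flat_paramD[OF P] and par' = flat_paramD[OF P'(2)]
  have "open (ball 0 r \<inter> P' -` (P ` B))" by (rule param_open_vimage[OF par' param_open_range[OF par]])
  moreover have "0 \<in> ball 0 r \<inter> P' -` (P ` B)" using P'(1,3) y by auto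
  ultimately obtain s where s: "s > 0" "ball 0 s \<subseteq> ball 0 r \<inter> P' -` (P ` B)"
    by (rule openE)
  have fs: "flat_param A nabla (ball 0 s) P'" by (rule flat_param_restrict[OF nabla(1) P'(2) open_ball]) (use s in auto)
  have 0: "(0 :: complex ^ 'n) \<in> ball 0 s" using s(1) by simp
  have sub: "P' ` ball 0 s \<subseteq> P ` B" using s(2) by auto
  obtain L L' where L: "linear L" "linear L'" "\<forall>x. L (L' x) = x" "\<forall>x. L' (L x) = x"
    "\<forall>x\<in>ball 0 s. inv_into B P (P' x) = inv_into B P (P' 0) + L (x - 0)"
    "\<forall>x\<in>ball 0 s. inv_into B P (P' x) \<in> B \<and> P' x = P (inv_into B P (P' x))"
    using transition_affine[OF nabla(1) fs P sub convex_ball 0] by (elim exE conjE)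
  have i0: "inv_into B P (P' 0) = y" unfolding P'(3) by (rule param_inv[OF par y])
  have k: "y + L (x - 0) \<in> B \<and> P' x = P (y + L (x - 0))" if "x \<in> ball 0 s" for x
    using L(5)[rule_format, OF that] L(6)[rule_format, OF that] by (simp add: i0)
  let ?Q = "\<lambda>x. P (y + L (x - 0))"
  have inB: "\<And>x. x \<in> ball 0 s \<Longrightarrow> y + L (x - 0) \<in> B" using k by blast
  have Q: "flat_param A nabla (ball 0 s) ?Q"
    by (rule flat_param_compose_affine[OF nabla(1) P L(1,2) L(3)[rule_format] L(4)[rule_format] open_ball inB])
  have eq: "P' z = ?Q z" if "z \<in> ball 0 s" for z using k[OF that] by simp
  have L0: "y + L (0 - 0) = y" using linear_0[OF L(1)] by simp
  have "pull P y (L w) (L w) = 1"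
    using pull_cong[where P = P' and P' = ?Q and a = w and b = w, OF open_ball 0 eq]
      pull_affine[where a = w and b = w, OF par L(1) inB[OF 0]] P'(4) by (simp only: L0)
  moreover have "cub P y (L w) (L w) (L w) = \<mu>"
    using cub_cong[where F = P' and F' = ?Q and a = w and b = w and c = w,
        OF flat_param_locally_flat[OF fs] flat_param_locally_flat[OF Q] open_ball 0 eq]
      cub_affine[where a = w and b = w and c = w, OF P L(1,2) L(3)[rule_format] L(4)[rule_format] open_ball inB 0] P'(5) by (simp only: L0)
  ultimately show ?thesis by blast
qed

text \<open>A linear change of flat coordinates that sends the standard basis to an orthonormal
  frame makes the metric at the centre Euclidean, as \<open>ray_control\<close> presupposes.\<close>

lemma cubic_value_normalized:
  assumes v: "cubic_value \<mu> q"
  shows "\<exists>P r w. r > 0 \<and> flat_param A nabla (ball 0 r) P \<and> P 0 = q \<and> pull P 0 w w = 1 \<and> cub P 0 w w w = \<mu> \<and>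
    (\<forall>a b. pull P 0 a b = a \<bullet> b)"
proof -
  obtain P r w where P: "r > 0" "flat_param A nabla (ball 0 r) P" "P 0 = q" "pull P 0 w w = 1" "cub P 0 w w w = \<mu>"
    using v unfolding cubic_value_def by (elim exE conjE)
  note par = flat_paramD[OF P(2)]
  have 0: "(0 :: complex ^ 'n) \<in> ball 0 r" using P(1) by simp
  let ?G = "pull P 0"
  have lin: "linear (?G a)" and lin1: "linear (\<lambda>a. ?G a b)" for a b
    by (rule pull_linear[OF par 0], rule pull_linear1[OF par 0])
  have "\<exists>e. (\<forall>i\<in>(Basis :: (complex ^ 'n) set). \<forall>j\<in>Basis. ?G (e i) (e j) = (if i = j then 1 else 0)) \<and>
      (\<forall>x. x = (\<Sum>i\<in>Basis. ?G x (e i) *\<^sub>R e i))"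
  proof (rule orthonormal_frame[of ?G, OF lin _ _ finite_Basis])
    show "pull P 0 a b = pull P 0 b a" for a b by (rule pull_sym[OF par 0])
    show "0 < pull P 0 a a" if "a \<noteq> 0" for a by (rule pull_pos[OF par 0 that])
  qed simp
  then obtain e where e: "\<forall>i\<in>(Basis :: (complex ^ 'n) set). \<forall>j\<in>Basis. ?G (e i) (e j) = (if i = j then 1 else 0)"
    "\<forall>x. x = (\<Sum>i\<in>Basis. ?G x (e i) *\<^sub>R e i)"
    by (elim exE conjE)
  define L where "L a = (\<Sum>i\<in>Basis. (a \<bullet> i) *\<^sub>R e i)" for a
  define L' where "L' x = (\<Sum>i\<in>Basis. ?G x (e i) *\<^sub>R i)" for x
  have L: "linear L" unfolding L_def by (rule linearI) (simp_all add: inner_add_left scaleR_add_left sum.distrib scaleR_sum_right)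
  have L': "linear L'" unfolding L'_def
    by (rule linearI) (simp_all add: linear_add[OF lin1] linear_cmul[OF lin1] scaleR_add_left sum.distrib scaleR_sum_right)
  have Ge: "?G (L a) (e j) = a \<bullet> j" if j: "j \<in> Basis" for a j
  proof -
    have "?G (L a) (e j) = (\<Sum>i\<in>Basis. (a \<bullet> i) * ?G (e i) (e j))"
      unfolding L_def by (simp add: linear_sum[OF lin1] linear_cmul[OF lin1])
    also have "\<dots> = (\<Sum>i\<in>Basis. if i = j then a \<bullet> i else 0)" using e(1) j by (intro sum.cong) auto
    finally show ?thesis using j by simp
  qed
  have LL': "L (L' x) = x" for x
  proof -
    have "L' x \<bullet> i = ?G x (e i)" if "i \<in> Basis" for i
      unfolding L'_def using inner_sum_left_Basis[OF that, of "\<lambda>i. ?G x (e i)"] by simp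
    then have "L (L' x) = (\<Sum>i\<in>Basis. ?G x (e i) *\<^sub>R e i)" unfolding L_def by simp
    then show ?thesis using e(2)[rule_format, of x] by simp
  qed
  have L'L: "L' (L x) = x" for x unfolding L'_def by (simp add: Ge euclidean_representation)
  have iso: "?G (L a) (L b) = a \<bullet> b" for a b
  proof -
    have "?G (L a) (L b) = (\<Sum>i\<in>Basis. (b \<bullet> i) * ?G (L a) (e i))"
      by (subst (2) L_def) (simp add: linear_sum[OF lin] linear_cmul[OF lin])
    also have "\<dots> = (\<Sum>i\<in>Basis. (a \<bullet> i) * (b \<bullet> i))" by (intro sum.cong) (auto simp: Ge)
    finally show ?thesis by (simp add: euclidean_inner[of a b])
  qed
  have bl: "bounded_linear L" using L linear_conv_bounded_linear by blast
  have "open (L -` ball 0 r)" by (intro open_vimage open_ball linear_continuous_on bl)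
  moreover have "0 \<in> L -` ball 0 r" using linear_0[OF L] P(1) by simp
  ultimately obtain s where s: "s > 0" "ball 0 s \<subseteq> L -` ball 0 r" by (rule openE)
  have inB: "\<And>x. x \<in> ball 0 s \<Longrightarrow> 0 + L (x - 0) \<in> ball 0 r" using s(2) by auto
  let ?Q = "\<lambda>x. P (0 + L (x - 0))"
  have 0: "(0 :: complex ^ 'n) \<in> ball 0 s" using s(1) by simp
  have L0: "0 + L (0 - 0) = 0" using linear_0[OF L] by simp
  have "flat_param A nabla (ball 0 s) ?Q"
    by (rule flat_param_compose_affine[OF nabla(1) P(2) L L' LL' L'L open_ball inB])
  moreover have pq: "pull ?Q 0 a b = a \<bullet> b" for a b
    using pull_affine[where a = a and b = b, OF par L inB[OF 0]] iso by (simp only: L0)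
  moreover have "pull ?Q 0 (L' w) (L' w) = 1" using pq iso[of "L' w" "L' w"] P(4) by (simp only: LL')
  moreover have "cub ?Q 0 (L' w) (L' w) (L' w) = \<mu>"
    using cub_affine[where a = "L' w" and b = "L' w" and c = "L' w", OF P(2) L L' LL' L'L open_ball inB 0] P(5) by (simp only: L0 LL')
  moreover have "?Q 0 = q" using P(3) by (simp only: L0)
  ultimately show ?thesis using s(1) by (intro exI[of _ ?Q] exI[of _ s] exI[of _ "L' w"]) simp
qed

end

section \<open>Growth along a complete special Kaehler manifold\<close>

locale complete_special_kaehler = special_kaehler A I om nabla
  for A :: "('a::{t2_space, second_countable_topology}, 'n::finite) atlas" and I om nabla +
  assumes complete: "complete_metric A (kaehler_metric I om)"
begin

text \<open>Completeness provides a limit with respect to the distance, and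
  \<open>dist_neighbourhood\<close> makes it a limit in the topology of the manifold.\<close>

lemma convergent_sequence:
  assumes "\<And>e. e > 0 \<Longrightarrow> \<exists>N. \<forall>m\<ge>N. \<forall>n\<ge>N. reach A G (x m) (x n) e"
  shows "\<exists>l. x \<longlonglongrightarrow> l"
proof -
  have "\<exists>N. \<forall>m\<ge>N. \<forall>n\<ge>N. riemannian_dist A G (x m) (x n) < e" if e: "e > 0" for e :: ennreal
  proof -
    obtain d :: real where d: "d > 0" "ennreal d < e"
    proof (cases e)
      case (real r)
      then have "r > 0" using e by (simp add: ennreal_less_zero_iff)
      then show thesis using that[of "r / 2"] real by (simp add: ennreal_lessI)
    next
      case top
      then show thesis using that[of 1] by simp
    qed
    obtain N where "\<forall>m\<ge>N. \<forall>n\<ge>N. reach A G (x m) (x n) d" using assms[OF d(1)] by blast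
    then have "\<forall>m\<ge>N. \<forall>n\<ge>N. riemannian_dist A G (x m) (x n) < e"
      using reach_dist d(2) by (meson order_le_less_trans)
    then show ?thesis by blast
  qed
  then obtain l where l: "(\<lambda>n. riemannian_dist A G (x n) l) \<longlonglongrightarrow> 0"
    using complete unfolding complete_metric_def by blast
  have "x \<longlonglongrightarrow> l"
  proof (rule topological_tendstoI)
    fix S assume "open S" "l \<in> S"
    then obtain e where e: "e > 0" "\<forall>x. riemannian_dist A G x l < ennreal e \<longrightarrow> x \<in> S"
      using dist_neighbourhood by blast
    have "\<forall>\<^sub>F n in sequentially. riemannian_dist A G (x n) l < ennreal e"
      by (rule order_tendstoD(2)[OF l]) (use e in simp)
    then show "\<forall>\<^sub>F n in sequentially. x n \<in> S" by eventually_elim (use e in blast)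
  qed
  then show ?thesis by blast
qed

text \<open>Interleaving two sequences shows that all of them have the same limit.\<close>

lemma ray_limit:
  assumes F: "locally_flat A nabla (ball 0 r) F" and x: "norm x = r"
    and K: "K > 0" "\<And>t. 0 \<le> t \<Longrightarrow> t < 1 \<Longrightarrow> sqrt (pull F (t *\<^sub>R x) x x) \<le> K"
  shows "\<exists>p. ((\<lambda>t. F (t *\<^sub>R x)) \<longlongrightarrow> p) (at_left 1)"
proof (cases "r > 0")
  case False
  then have "norm x \<le> 0" using x by simp
  then have "x = 0" by simp
  then show ?thesis by (intro exI[of _ "F 0"]) simp
next
  case r: True
  have inb: "t *\<^sub>R x \<in> ball 0 r" if "0 \<le> t" "t < 1" for t using that x r by simp
  have reach: "reach A G (F (s *\<^sub>R x)) (F (t *\<^sub>R x)) (K * \<eta>)"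
    if st: "0 \<le> s" "s < 1" "0 \<le> t" "t < 1" and \<eta>: "\<bar>t - s\<bar> \<le> \<eta>" "\<eta> > 0" for s t \<eta>
  proof -
    let ?w = "(t - s) *\<^sub>R x"
    have u: "0 \<le> s + \<tau> * (t - s) \<and> s + \<tau> * (t - s) < 1" if "\<tau> \<in> {0..1}" for \<tau>
    proof -
      have "s + \<tau> * (t - s) = (1 - \<tau>) * s + \<tau> * t" by (simp add: algebra_simps)
      moreover have "0 \<le> (1 - \<tau>) * s + \<tau> * t" using that st by simp
      moreover have "(1 - \<tau>) * s + \<tau> * t < 1" using that st by (intro convex_bound_lt) auto
      ultimately show ?thesis by simp
    qed
    have pt: "s *\<^sub>R x + \<tau> *\<^sub>R ?w = (s + \<tau> * (t - s)) *\<^sub>R x" for \<tau> by (simp add: algebra_simps)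
    interpret cubic_model "ball 0 r" "pull F" by (rule cubic_model_locally_flat[OF F])
    have "reach A G (F (s *\<^sub>R x)) (F (s *\<^sub>R x + ?w)) (K * \<eta>)"
    proof (rule reach_locally_flat[OF F])
      show "s *\<^sub>R x + \<tau> *\<^sub>R ?w \<in> ball 0 r" if "\<tau> \<in> {0..1}" for \<tau> unfolding pt by (rule inb) (use u[OF that] in auto)
      show "K * \<eta> > 0" using K \<eta> by simp
      fix \<tau> :: real assume \<tau>: "\<tau> \<in> {0..1}"
      let ?z = "(s + \<tau> * (t - s)) *\<^sub>R x"
      have "sqrt (pull F ?z ?w ?w) = \<bar>t - s\<bar> * sqrt (pull F ?z x x)"
        using g_scale[OF inb, of "s + \<tau> * (t - s)" "t - s" x] u[OF \<tau>] by (simp add: real_sqrt_mult)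
      also have "\<dots> \<le> \<eta> * K" using \<eta> K u[OF \<tau>] g_nonneg[OF inb, of "s + \<tau> * (t - s)" x] by (intro mult_mono) auto
      finally show "sqrt (pull F (s *\<^sub>R x + \<tau> *\<^sub>R ?w) ?w ?w) \<le> K * \<eta>" unfolding pt by (simp add: mult.commute)
    qed
    then show ?thesis by (simp add: algebra_simps)
  qed
  have conv: "\<exists>l. (\<lambda>n. F (S n *\<^sub>R x)) \<longlonglongrightarrow> l"
    if S: "\<And>n. 0 \<le> S n" "\<And>n. S n < 1" "S \<longlonglongrightarrow> 1" for S :: "nat \<Rightarrow> real"
  proof (rule convergent_sequence)
    fix e :: real assume e: "e > 0"
    have "Cauchy S" by (rule LIMSEQ_imp_Cauchy[OF S(3)])
    then obtain N where N: "\<forall>m\<ge>N. \<forall>n\<ge>N. dist (S m) (S n) < e / K" using e K(1) unfolding Cauchy_def by (meson divide_pos_pos)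
    have "reach A G (F (S m *\<^sub>R x)) (F (S n *\<^sub>R x)) (K * (e / K))" if "m \<ge> N" "n \<ge> N" for m n
      by (rule reach) (use S N that e K in \<open>auto simp: dist_real_def abs_minus_commute intro: less_imp_le\<close>)
    then show "\<exists>N. \<forall>m\<ge>N. \<forall>n\<ge>N. reach A G (F (S m *\<^sub>R x)) (F (S n *\<^sub>R x)) e" using K(1) by auto
  qed
  define t0 where "t0 n = 1 - inverse (real (Suc n))" for n
  have t0: "0 \<le> t0 n" "t0 n < 1" for n by (simp_all add: t0_def field_simps)
  have t01: "t0 \<longlonglongrightarrow> 1" unfolding t0_def[abs_def] using tendsto_diff[OF tendsto_const LIMSEQ_inverse_real_of_nat, of 1] by simp
  obtain l where l: "(\<lambda>n. F (t0 n *\<^sub>R x)) \<longlonglongrightarrow> l" using conv[OF t0 t01] by blast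
  have "((\<lambda>t. F (t *\<^sub>R x)) \<longlongrightarrow> l) (at_left 1)"
  proof (rule tendsto_at_left_sequentially[of 0])
    show "(0 :: real) < 1" by simp
    fix S :: "nat \<Rightarrow> real" assume S: "\<And>n. S n < 1" "\<And>n. 0 < S n" "S \<longlonglongrightarrow> 1"
    define u where "u n = (if even n then t0 (n div 2) else S (n div 2))" for n
    have u: "0 \<le> u n" "u n < 1" for n using t0 S(1) S(2)[of "n div 2"] by (simp_all add: u_def)
    have "u \<longlonglongrightarrow> 1"
    proof (rule LIMSEQ_I)
      fix e :: real assume e: "e > 0"
      obtain N1 N2 where N: "\<forall>n\<ge>N1. norm (t0 n - 1) < e" "\<forall>n\<ge>N2. norm (S n - 1) < e"
        using LIMSEQ_D[OF t01 e] LIMSEQ_D[OF S(3) e] by blast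
      have "norm (u n - 1) < e" if "n \<ge> 2 * max N1 N2" for n
      proof -
        have "n div 2 \<ge> N1" "n div 2 \<ge> N2" using that by linarith+
        then show ?thesis using N by (simp add: u_def)
      qed
      then show "\<exists>no. \<forall>n\<ge>no. norm (u n - 1) < e" by blast
    qed
    then obtain l' where l': "(\<lambda>n. F (u n *\<^sub>R x)) \<longlonglongrightarrow> l'" using conv[of u] u by blast
    have "(\<lambda>n. F (t0 n *\<^sub>R x)) \<longlonglongrightarrow> l'"
      using LIMSEQ_subseq_LIMSEQ[OF l', of "\<lambda>n. 2 * n"] by (simp add: o_def u_def strict_mono_def)
    then have "l' = l" using LIMSEQ_unique l by blast
    moreover have "(\<lambda>n. F (S n *\<^sub>R x)) \<longlonglongrightarrow> l'"
      using LIMSEQ_subseq_LIMSEQ[OF l', of "\<lambda>n. 2 * n + 1"] by (simp add: o_def u_def strict_mono_def)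
    ultimately show "(\<lambda>n. F (S n *\<^sub>R x)) \<longlonglongrightarrow> l" by simp
  qed
  then show ?thesis by blast
qed

text \<open>If the claim fails, all values reachable within 1/\<mu> are below 2 \<mu>. This bound
  feeds \<open>ray_control\<close> on every partial development, so rays have bounded speed;
  completeness gives their limits, and \<open>developing_map\<close> continues up to radius R. On
  the resulting ball \<open>cubic_growth\<close> produces the value that was excluded.\<close>

theorem cubic_value_step:
  fixes \<mu> :: real
  assumes v: "cubic_value \<mu> q" and \<mu>: "\<mu> > 0"
  shows "\<exists>q' \<mu>'. cubic_value \<mu>' q' \<and> (1 + 1 / (8192 * real DIM(complex ^ 'n))) * \<mu> \<le> \<mu>' \<and> reach A G q q' (1 / \<mu>)"
proof (rule ccontr)
  define m where "m = real DIM(complex ^ 'n)"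
  assume "\<not> ?thesis"
  then have NH: "\<mu>' < (1 + 1 / (8192 * m)) * \<mu>" if "cubic_value \<mu>' q'" "reach A G q q' (1 / \<mu>)" for q' \<mu>'
    using that unfolding m_def by (blast intro: leI)
  have "m \<ge> 1" using DIM_positive[where 'a = "complex ^ 'n"] unfolding m_def by linarith
  then have m: "1 + 1 / (8192 * m) \<le> 2" by (simp add: field_simps)
  obtain P r0 w0 where P: "r0 > 0" "flat_param A nabla (ball 0 r0) P" "P 0 = q" "pull P 0 w0 w0 = 1" "cub P 0 w0 w0 w0 = \<mu>"
    and pin: "\<forall>a b. pull P 0 a b = a \<bullet> b"
    using cubic_value_normalized[OF v] by (elim exE conjE)
  define R where "R = 1 / (16 * \<mu>)"
  have R: "R > 0" using \<mu> by (simp add: R_def)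
  have start: "F 0 = q" "pull F 0 a b = pull P 0 a b" "cub F 0 a b c = cub P 0 a b c"
    if F: "locally_flat A nabla (ball 0 r) F" "\<exists>e>0. \<forall>z\<in>ball 0 e. F z = P z" for F r a b c
  proof -
    obtain e where e: "e > 0" "\<And>z. z \<in> ball 0 e \<Longrightarrow> F z = P z" using F(2) by blast
    have 0: "(0 :: complex ^ 'n) \<in> ball 0 e" using e(1) by simp
    show "F 0 = q" using e(2)[OF 0] P(3) by simp
    show "pull F 0 a b = pull P 0 a b" by (rule pull_cong[OF open_ball 0 e(2)])
    show "cub F 0 a b c = cub P 0 a b c"
      by (rule cub_cong[OF F(1) flat_param_locally_flat[OF P(2)] open_ball 0 e(2)])
  qed
  have reach: "reach A G q (F y) (1 / \<mu>)"
    if F: "locally_flat A nabla (ball 0 r) F" "\<exists>e>0. \<forall>z\<in>ball 0 e. F z = P z" and r: "r \<le> R" "y \<in> ball 0 r"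
      and sp: "\<And>t. 0 \<le> t \<Longrightarrow> t \<le> 1 \<Longrightarrow> pull F (t *\<^sub>R y) y y \<le> 4 * (norm y)^2" for F r y
  proof -
    have "reach A G (F 0) (F (0 + y)) (1 / \<mu>)"
    proof (rule reach_locally_flat[OF F(1)])
      fix t :: real assume t: "t \<in> {0..1}"
      have "\<bar>t\<bar> * norm y \<le> norm y" using t by (intro mult_left_le_one_le) auto
      then show "0 + t *\<^sub>R y \<in> ball 0 r" using r(2) by simp
      have "sqrt (pull F (t *\<^sub>R y) y y) \<le> sqrt (4 * (norm y)^2)" using sp t by (intro real_sqrt_le_mono) auto
      also have "\<dots> = 2 * norm y" by (simp add: real_sqrt_mult)
      also have "\<dots> \<le> 2 * R" using r by simp
      also have "\<dots> \<le> 1 / \<mu>" using \<mu> by (simp add: R_def field_simps)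
      finally show "sqrt (pull F (0 + t *\<^sub>R y) y y) \<le> 1 / \<mu>" by simp
    qed (use \<mu> in simp)
    then show ?thesis using start(1)[OF F] by simp
  qed
  \<comment> \<open>The conditional hypothesis of \<open>ray_control\<close>: the speed bound on the
    ray puts F y within reach of q, and only then does the negated claim say anything about
    y.\<close>
  have H: "cub F y w w w \<le> 2 * \<mu>"
    if F: "locally_flat A nabla (ball 0 r) F" "\<exists>e>0. \<forall>z\<in>ball 0 e. F z = P z" and r: "r \<le> R" "y \<in> ball 0 r"
      and sp: "\<And>t. 0 \<le> t \<Longrightarrow> t \<le> 1 \<Longrightarrow> pull F (t *\<^sub>R y) y y \<le> 4 * (norm y)^2" and w: "pull F y w w = 1" for F r y w
  proof -
    have "cub F y w w w < (1 + 1 / (8192 * m)) * \<mu>"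
      by (rule NH[OF cubic_valueI[OF F(1) r(2) w] reach[OF F r sp]])
    also have "\<dots> \<le> 2 * \<mu>" using m \<mu> by (intro mult_right_mono) auto
    finally show ?thesis by simp
  qed
  have control: "pull F x x x \<le> 2 * (norm x)^2" "pull F x a a \<le> 2 * (norm a)^2" "(norm a)^2 \<le> 2 * pull F x a a"
    if F: "locally_flat A nabla (ball 0 r) F" "\<exists>e>0. \<forall>z\<in>ball 0 e. F z = P z" and r: "r \<le> R" "x \<in> ball 0 r" for F r x a
  proof -
    interpret cubic_model "ball 0 r" "pull F" by (rule cubic_model_locally_flat[OF F(1)])
    have g0: "pull F 0 a b = a \<bullet> b" for a b using start(2)[OF F] pin by simp
    note rc = ray_control[OF order_refl \<mu> r(1)[unfolded R_def] g0 H[OF F r(1)] r(2)]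
    show "pull F x x x \<le> 2 * (norm x)^2" "pull F x a a \<le> 2 * (norm a)^2" "(norm a)^2 \<le> 2 * pull F x a a"
      by (rule rc; assumption)+
  qed
  have "\<exists>F. locally_flat A nabla (ball 0 R) F \<and> (\<exists>e>0. \<forall>z\<in>ball 0 e. F z = P z)"
  proof (rule developing_map[OF flat_param_locally_flat[OF P(2)] P(1)])
    fix r F and x :: "complex ^ 'n"
    assume r: "0 < r" "r < R" and F: "locally_flat A nabla (ball 0 r) F" "\<exists>e>0. \<forall>z\<in>ball 0 e. F z = P z" and x: "norm x = r"
    show "\<exists>p. ((\<lambda>t. F (t *\<^sub>R x)) \<longlongrightarrow> p) (at_left 1)"
    proof (rule ray_limit[OF F(1) x, of "2 * r"])
      fix t :: real assume t: "0 \<le> t" "t < 1"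
      have "pull F (t *\<^sub>R x) x x \<le> 2 * (norm x)^2"
        by (rule control(2)[OF F]) (use r t x in auto)
      also have "\<dots> \<le> (2 * r)^2" using x by (simp add: power_mult_distrib)
      finally show "sqrt (pull F (t *\<^sub>R x) x x) \<le> 2 * r" using r by (intro real_le_lsqrt) auto
    qed (use r in simp)
  qed
  then obtain F where F: "locally_flat A nabla (ball 0 R) F" "\<exists>e>0. \<forall>z\<in>ball 0 e. F z = P z" by blast
  interpret F: cubic_model "ball 0 R" "pull F" by (rule cubic_model_locally_flat[OF F(1)])
  have half: "x \<in> ball 0 R" if "norm x \<le> 1 / (32 * \<mu>)" for x :: "complex ^ 'n"
    using that \<mu> by (auto simp: R_def field_simps)
  have "\<exists>y w. norm y \<le> 1 / (32 * \<mu>) \<and> pull F y w w = 1 \<and>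
      (1 + 1 / (8192 * DIM(complex ^ 'n))) * \<mu> \<le> cub F y w w w"
  \<comment> \<open>The matrix argument needs an index type of real dimension 2n; the two truth
    values play the roles of real and imaginary part.\<close>
  proof (rule F.cubic_growth[where 'k = "'n \<times> bool", OF \<mu>])
    show "cball 0 (1 / (32 * \<mu>)) \<subseteq> ball (0 :: complex ^ 'n) R" by (rule subsetI, rule half) simp
    show "(norm a)^2 \<le> 2 * pull F y a a" if "norm y \<le> 1 / (32 * \<mu>)" for y a
      by (rule control(3)[OF F order_refl half[OF that]])
    show "pull F 0 w0 w0 = 1" using start(2)[OF F] P(4) by simp
    show "cub F 0 w0 w0 w0 = \<mu>" using start(3)[OF F] P(5) by simp
    show "CARD('n \<times> bool) = DIM(complex ^ 'n)" by simp
    fix y :: "complex ^ 'n" assume "y \<in> ball 0 R"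
    then obtain r where r: "r > 0" "flat_param A nabla (ball y r) F"
      using F(1) unfolding locally_flat_def by (elim conjE) (drule bspec, assumption, elim exE conjE)
    have "y \<in> ball y r" using r(1) by simp
    from flat_model_param[OF r(2) convex_ball this]
    show "\<exists>r>0. \<exists>om J. flat_model (ball y r) (pull F) om J" using r(1) by (intro exI conjI)
  qed
  then obtain y w where y: "norm y \<le> 1 / (32 * \<mu>)" "pull F y w w = 1" "(1 + 1 / (8192 * m)) * \<mu> \<le> cub F y w w w"
    unfolding m_def by auto
  have "cub F y w w w < (1 + 1 / (8192 * m)) * \<mu>"
  proof (rule NH[OF cubic_valueI[OF F(1) half[OF y(1)] y(2)] reach[OF F order_refl half[OF y(1)]]])
    fix t :: real assume t: "0 \<le> t" "t \<le> 1"
    have "\<bar>t\<bar> * norm y \<le> norm y" using t by (intro mult_left_le_one_le) auto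
    then have "t *\<^sub>R y \<in> ball 0 R" using half[OF y(1)] by simp
    from control(2)[OF F order_refl this, of y] show "pull F (t *\<^sub>R y) y y \<le> 4 * (norm y)^2"
      using zero_le_power2[of "norm y"] by linarith
  qed
  then show False using y(3) by simp
qed

end

section \<open>Vanishing of the cubic form and flatness\<close>

context complete_special_kaehler
begin

lemma reach_refl: assumes "l > 0" shows "reach A G p p l"
proof -
  obtain P r where P: "r > 0" "flat_param A nabla (ball 0 r) P" "P 0 = p"
    using flat_param_exists[OF nabla] by blast
  interpret cubic_model "ball 0 r" "pull P" by (rule cubic_model_locally_flat[OF flat_param_locally_flat[OF P(2)]])
  have 0: "(0 :: complex ^ 'n) \<in> ball 0 r" using P(1) by simp
  have "reach A G (P 0) (P (0 + 0)) l"
    by (rule reach_locally_flat[OF flat_param_locally_flat[OF P(2)]])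
       (use assms 0 linear_0[OF lin[OF 0], of 0] in auto)
  then show ?thesis using P(3) by simp
qed

text \<open>Over a compact coordinate ball the metric is bounded below, so unit vectors stay in a
  compact set, on which the continuous cubic form is bounded.\<close>

lemma cubic_value_bounded:
  "\<exists>N M. open N \<and> p \<in> N \<and> (\<forall>q\<in>N. \<forall>\<mu>. cubic_value \<mu> q \<longrightarrow> \<mu> \<le> M)"
proof -
  obtain P r where P: "r > 0" "flat_param A nabla (ball 0 r) P" "P 0 = p"
    using flat_param_exists[OF nabla] by blast
  interpret cubic_model "ball 0 r" "pull P" by (rule cubic_model_locally_flat[OF flat_param_locally_flat[OF P(2)]])
  define s where "s = r / 2"
  have s: "s > 0" "cball 0 s \<subseteq> ball (0 :: complex ^ 'n) r" using P(1) by (auto simp: s_def)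
  obtain c where c: "c > 0" "\<forall>y\<in>cball 0 s. \<forall>a. c * (norm a)^2 \<le> pull P y a a"
    using pull_lower_bound[OF flat_paramD[OF P(2)] compact_cball s(2)] by blast
  define K where "K = cball (0 :: complex ^ 'n) s \<times> cball (0 :: complex ^ 'n) (sqrt (1 / c))"
  have "continuous_on K (\<lambda>(y, w). cub P y w w w)"
    by (rule continuous_on_subset[OF cubic_continuous]) (use s(2) in \<open>auto simp: K_def\<close>)
  then have "bounded ((\<lambda>(y, w). cub P y w w w) ` K)"
    unfolding K_def by (intro compact_imp_bounded compact_continuous_image compact_Times compact_cball)
  then obtain M where M: "\<And>y w. (y, w) \<in> K \<Longrightarrow> \<bar>cub P y w w w\<bar> \<le> M"
    unfolding bounded_iff by force
  have "\<mu> \<le> M" if q: "q \<in> P ` ball 0 s" "cubic_value \<mu> q" for q \<mu>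
  proof -
    obtain y where y: "y \<in> ball 0 s" "q = P y" using q(1) by blast
    have yr: "y \<in> ball 0 r" using y(1) s(2) ball_subset_cball by blast
    obtain w where w: "pull P y w w = 1" "cub P y w w w = \<mu>"
      using cubic_value_in_param[OF P(2) yr] q(2) y(2) by blast
    have "c * (norm w)^2 \<le> 1" using c(2) y(1) w(1) by (metis ball_subset_cball subsetD)
    then have "(norm w)^2 \<le> 1 / c" using c(1) by (simp add: field_simps)
    then have "norm w \<le> sqrt (1 / c)" by (rule real_le_rsqrt)
    then show ?thesis using M[of y w] w(2) y(1) by (auto simp: K_def)
  qed
  moreover have "open (P ` ball 0 s)" by (rule param_open_image[OF flat_paramD[OF P(2)] _ open_ball]) (use s in auto)
  moreover have "p \<in> P ` ball 0 s" using P(3) s(1) by (intro image_eqI[of _ _ 0]) auto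
  ultimately show ?thesis by blast
qed

theorem cubic_value_nonpos:
  assumes v: "cubic_value \<mu> p"
  shows "\<mu> \<le> 0"
proof (rule ccontr)
  assume "\<not> \<mu> \<le> 0"
  then have \<mu>: "\<mu> > 0" by simp
  define k where "k = 1 + 1 / (8192 * real DIM(complex ^ 'n))"
  have k: "k > 1" by (simp add: k_def)
  define St where "St a b \<longleftrightarrow> cubic_value (snd b) (fst b) \<and> k * snd a \<le> snd b \<and> reach A G (fst a) (fst b) (1 / snd a)"
    for a b :: "'a \<times> real"
  have "\<exists>f :: nat \<Rightarrow> 'a \<times> real. (cubic_value (snd (f 0)) (fst (f 0)) \<and> snd (f 0) \<ge> \<mu>) \<and>
    (\<forall>n. (cubic_value (snd (f n)) (fst (f n)) \<and> snd (f n) \<ge> \<mu>) \<and> St (f n) (f (Suc n)))"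
  proof -
    have "\<exists>f :: nat \<Rightarrow> 'a \<times> real. \<forall>n. (cubic_value (snd (f n)) (fst (f n)) \<and> snd (f n) \<ge> \<mu>) \<and> St (f n) (f (Suc n))"
    proof (rule dependent_nat_choice)
      show "\<exists>x :: 'a \<times> real. cubic_value (snd x) (fst x) \<and> \<mu> \<le> snd x" using v by (intro exI[of _ "(p, \<mu>)"]) simp
      fix x :: "'a \<times> real" and n :: nat assume x: "cubic_value (snd x) (fst x) \<and> \<mu> \<le> snd x"
      then have x0: "snd x > 0" using \<mu> by simp
      obtain q' \<mu>' where q': "cubic_value \<mu>' q'" "k * snd x \<le> \<mu>'" "reach A G (fst x) q' (1 / snd x)"
        using cubic_value_step[OF x[THEN conjunct1] x0] unfolding k_def by (elim exE conjE)
      have "1 * snd x \<le> k * snd x" using k x0 by (intro mult_right_mono) auto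
      then show "\<exists>y. (cubic_value (snd y) (fst y) \<and> \<mu> \<le> snd y) \<and> St x y"
        using q' x by (intro exI[of _ "(q', \<mu>')"]) (simp add: St_def)
    qed
    then show ?thesis by blast
  qed
  then obtain f :: "nat \<Rightarrow> 'a \<times> real" where f: "\<And>n. cubic_value (snd (f n)) (fst (f n))" "\<And>n. St (f n) (f (Suc n))" "snd (f 0) \<ge> \<mu>"
    by blast
  define q where "q n = fst (f n)" for n
  define \<theta> where "\<theta> = 1 / k"
  have \<theta>: "0 < \<theta>" "\<theta> < 1" using k by (simp_all add: \<theta>_def)
  have big: "\<mu> * k ^ n \<le> snd (f n)" for n
  proof (induction n)
    case 0 then show ?case using f(3) by simp
  next
    case (Suc n)
    have "\<mu> * k ^ Suc n \<le> k * snd (f n)" using mult_left_mono[OF Suc, of k] k by (simp add: mult_ac)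
    also have "\<dots> \<le> snd (f (Suc n))" using f(2)[of n] by (simp add: St_def)
    finally show ?case .
  qed
  have step: "reach A G (q n) (q (Suc n)) (\<theta> ^ n / \<mu>)" for n
  proof (rule reach_mono)
    show "reach A G (q n) (q (Suc n)) (1 / snd (f n))" using f(2)[of n] by (simp add: St_def q_def)
    have "1 / snd (f n) \<le> 1 / (\<mu> * k ^ n)" using big[of n] \<mu> k by (intro frac_le) auto
    then show "1 / snd (f n) \<le> \<theta> ^ n / \<mu>" by (simp add: \<theta>_def power_one_over field_simps)
  qed
  \<comment> \<open>The tail of the geometric series with terms \<open>\<theta> ^ j / \<mu>\<close>:
    a bound for the total length of all steps from the n-th on.\<close>
  define t where "t n = \<theta> ^ n / (\<mu> * (1 - \<theta>))" for n
  have t_pos: "t n > 0" for n using \<theta> \<mu> by (simp add: t_def)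
  have t_step: "\<theta> ^ n / \<mu> + t (Suc n) = t n" for n using \<theta> \<mu> by (simp add: t_def field_simps)
  have far: "reach A G (q n) (q (n + d)) (t n)" for n d
  proof (induction d arbitrary: n)
    case 0 then show ?case using reach_refl[OF t_pos] by simp
  next
    case (Suc d)
    then show ?case using reach_add[OF step[of n] Suc[of "Suc n"]] unfolding t_step by simp
  qed
  have dec: "t n \<le> t m" if "m \<le> n" for m n
    unfolding t_def using \<theta> \<mu> that by (intro divide_right_mono power_decreasing) auto
  have "t \<longlonglongrightarrow> 0 / (\<mu> * (1 - \<theta>))" unfolding t_def using \<theta> by (intro tendsto_divide LIMSEQ_power_zero tendsto_const) (use \<mu> in auto)
  then have t0: "t \<longlonglongrightarrow> 0" by simp
  have "\<exists>l. q \<longlonglongrightarrow> l"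
  proof (rule convergent_sequence)
    fix e :: real assume e: "e > 0"
    obtain N where N: "t N < e" using order_tendstoD(2)[OF t0 e] by (auto simp: eventually_sequentially)
    have fwd: "reach A G (q m) (q n) e" if "N \<le> m" "m \<le> n" for m n
      using reach_mono[OF far[of m "n - m"], of e] dec[OF that(1)] N that(2) by simp
    have "reach A G (q m) (q n) e" if "N \<le> m" "N \<le> n" for m n
      using fwd[of m n] reach_reverse[OF fwd[of n m]] that by (cases "m \<le> n") auto
    then show "\<exists>N. \<forall>m\<ge>N. \<forall>n\<ge>N. reach A G (q m) (q n) e" by blast
  qed
  then obtain l where l: "q \<longlonglongrightarrow> l" by blast
  obtain N M where N: "open N" "l \<in> N" "\<forall>q\<in>N. \<forall>\<mu>. cubic_value \<mu> q \<longrightarrow> \<mu> \<le> M"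
    using cubic_value_bounded[of l] by (elim exE conjE)
  have "\<forall>\<^sub>F n in sequentially. q n \<in> N" by (rule topological_tendstoD[OF l N(1,2)])
  then obtain n0 where n0: "\<And>n. n \<ge> n0 \<Longrightarrow> q n \<in> N" by (auto simp: eventually_sequentially)
  have le: "\<mu> * k ^ n \<le> M" if "n \<ge> n0" for n
    using big[of n] f(1)[of n] N(3) n0[OF that] unfolding q_def by (meson order_trans)
  obtain n where "M / \<mu> < k ^ n" using real_arch_pow[OF k] by blast
  then have "M < \<mu> * k ^ n" using \<mu> by (simp add: field_simps)
  also have "\<dots> \<le> \<mu> * k ^ (max n n0)" using k \<mu> by (intro mult_left_mono power_increasing) auto
  finally show False using le[of "max n n0"] by simp
qed

text \<open>\<open>T_bound\<close> with M = 0 annihilates T(b, a, a); an upper bound alone suffices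
  because \<open>T\<close> is odd on the diagonal. Polarization in the last two arguments gives the
  other values.\<close>

lemma cubic_zero:
  assumes P: "flat_param A nabla B P" and y: "y \<in> B"
  shows "cub P y a b c = 0"
proof -
  note lf = flat_param_locally_flat[OF P]
  interpret cubic_model B "pull P" by (rule cubic_model_locally_flat[OF lf])
  have "cub P y w w w \<le> 0" if "pull P y w w = 1" for w
    by (rule cubic_value_nonpos[OF cubic_valueI[OF lf y that]])
  from T_bound[OF y this] have z: "cub P y b a a = 0" for b a by simp
  have "cub P y a (b + c) (b + c) = cub P y a b b + cub P y a b c + (cub P y a c b + cub P y a c c)"
    by (simp add: linear_add[OF T_lin2[OF y]] linear_add[OF T_lin3[OF y]])
  then show ?thesis using z[of a "b + c"] z[of a b] z[of a c] T_perm(2)[OF y, of a c b] by simp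
qed

text \<open>The metric is constant in \<open>\<nabla>\<close>-flat coordinates, so its Levi-Civita connection has vanishing Christoffel symbols.\<close>

lemma levi_civita_flat_param:
  assumes D: "levi_civita A G D" and P: "flat_param A nabla B P"
  shows "flat_param A D B P"
proof -
  note par = flat_paramD[OF P] and lf = flat_param_locally_flat[OF P]
  have D': "connection A D" "torsion_free A D" "parallel_form A D G"
    using D unfolding levi_civita_def by simp_all
  interpret connection_param A D B P by unfold_locales (rule D' par)+
  have \<Gamma>0: "\<Gamma> y a b = 0" if y: "y \<in> B" for y a b
  proof -
    \<comment> \<open>The Koszul argument: with constant metric coefficients S is antisymmetric in b
      and c, without torsion it is symmetric in a and b, and only 0 is both.\<close>
    define S where "S a b c = pull P y (\<Gamma> y a b) c" for a b c
    have anti: "S a b c = - S a c b" for a b c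
    proof -
      have "cov_deriv_form D G (X a) (X b) (X c) (P y) = 0"
        using D'(3)[unfolded parallel_form_def, rule_format, OF oR Xvf Xvf Xvf imageI[OF y]] .
      then have e: "pv y a (\<lambda>q. G q (X b q) (X c q)) - pull P y (\<Gamma> y a b) c - pull P y b (\<Gamma> y a c) = 0"
        unfolding cov_deriv_form_def cfield_at[OF par y] D_X[OF y] pull_def .
      have sm: "smooth_fun_on A (P ` B) (\<lambda>q. G q (X b q) (X c q))"
        by (rule bilinear[unfolded bilinear_form_field_def, THEN conjunct2, rule_format, OF oR Xvf Xvf])
      have "smooth_fun_at A (P y) (\<lambda>q. G q (X b q) (X c q))"
        unfolding smooth_fun_at_def using sm oR y by blast
      then have "pv y a (\<lambda>q. G q (X b q) (X c q)) = dd (\<lambda>z. G (P z) (X b (P z)) (X c (P z))) a y"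
        by (simp add: push_vec_def)
      also have "\<dots> = dd (\<lambda>z. pull P z b c) a y"
        by (rule dd_cong[OF param_open[OF par] y]) (simp add: pull_def cfield_at[OF par])
      also have "\<dots> = 0" using cubic_zero[OF P y, of a b c] unfolding cub_def[OF lf] .
      finally show ?thesis using e pull_sym[OF par y, of b] by (simp add: S_def)
    qed
    have symm: "S a b c = S b a c" for a b c unfolding S_def \<Gamma>_symmetric[OF D'(2) y, of a b] ..
    have "S a b c = 0" for a b c
      using anti[of a b c] anti[of b c a] anti[of c a b] symm[of a b c] symm[of b c a] symm[of c a b] by linarith
    then have "pull P y (\<Gamma> y a b) (\<Gamma> y a b) = 0" unfolding S_def .
    then show ?thesis using pull_pos[OF par y, of "\<Gamma> y a b"] by fastforce
  qed
  then show ?thesis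
    unfolding flat_param_def using par D_X push_vec_zero[OF par] by simp
qed

end

text \<open>Flat coordinates give zero curvature on coordinate fields at once. Arbitrary fields are
  treated by direct computation with components instead of tensoriality: the bracket is expressed by
  absence of torsion, and what remains is symmetry of the second derivatives of the components of
  Z.\<close>

lemma curvature_flat_param:
  fixes A :: "('a::{t2_space, second_countable_topology}, 'n::finite) atlas"
  assumes D: "connection A D" "torsion_free A D" and P: "flat_param A D B P" and y: "y \<in> B"
    and U: "open U" "P y \<in> U" and XYZ: "vector_field_on A U X" "vector_field_on A U Y" "vector_field_on A U Z"
  shows "curvature A D X Y Z (P y) = 0"
proof -
  note par = flat_paramD[OF P]
  let ?pv = "push_vec A P"
  define W where "W = U \<inter> P ` B"
  have W: "open W" "W \<subseteq> P ` B" "P y \<in> W" "W \<subseteq> U"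
    unfolding W_def using U param_open_range[OF par] y by auto
  define S where "S = B \<inter> P -` W"
  have S: "open S" "y \<in> S" unfolding S_def using param_open_vimage[OF par W(1)] W(3) y by auto
  define cf where "cf V z = coords B P (V (P z))" for V z
  have sub: "vector_field_on A W V" if "vector_field_on A U V" for V by (rule vector_field_on_subset[OF that W(4)])
  have sm: "Cinf_on S (cf V)" if "vector_field_on A U V" for V
    unfolding cf_def S_def by (rule vector_field_coords_smooth[OF par W(1) sub[OF that]])
  have cfe: "V (P z) = ?pv z (cf V z)" if V: "vector_field_on A W V" and z: "z \<in> S" for V z
    unfolding cf_def using z push_vec_coords[OF par, of z] vector_field_tangent[OF V] by (simp add: S_def)
  have Dex: "D (P z) (?pv z a) V = ?pv z (dd \<eta> a z)"
    if V: "vector_field_on A W V" and z: "z \<in> S" and \<eta>: "\<And>z. z \<in> S \<Longrightarrow> V (P z) = ?pv z (\<eta> z)" for V z a \<eta>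
    by (rule flat_param_expand[OF D(1) P W(1,2) V]) (use z \<eta> in \<open>auto simp: S_def\<close>)
  define x where "x V = cf V y" for V
  have second: "D (P y) (V (P y)) (\<lambda>q. D q (V' q) Z) = ?pv y (dd (\<lambda>z. dd (cf Z) (cf V' z) z) (x V) y)"
    if V: "vector_field_on A U V" "vector_field_on A U V'" for V V'
    unfolding cfe[OF sub[OF V(1)] S(2)] x_def
    by (rule Dex[OF connectionD(1)[OF D(1) W(1) sub[OF XYZ(3)] sub[OF V(2)]] S(2)])
       (simp add: cfe[OF sub[OF V(2)]] Dex[OF sub[OF XYZ(3)] _ cfe[OF sub[OF XYZ(3)]]])
  have first: "D (P y) (V (P y)) V' = ?pv y (dd (cf V') (x V) y)"
    if V: "vector_field_on A U V" "vector_field_on A U V'" for V V'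
    unfolding cfe[OF sub[OF V(1)] S(2)] x_def by (rule Dex[OF sub[OF V(2)] S(2) cfe[OF sub[OF V(2)]]])
  have "lie_bracket A X Y (P y) = D (P y) (X (P y)) Y - D (P y) (Y (P y)) X"
    using D(2)[unfolded torsion_free_def, rule_format, OF W(1) sub[OF XYZ(1)] sub[OF XYZ(2)] W(3)] by simp
  also have "\<dots> = ?pv y (dd (cf Y) (x X) y - dd (cf X) (x Y) y)"
    unfolding first[OF XYZ(1,2)] first[OF XYZ(2,1)] push_vec_sub[OF par y] ..
  finally have br: "lie_bracket A X Y (P y) = ?pv y (dd (cf Y) (x X) y - dd (cf X) (x Y) y)" .
  have third: "D (P y) (lie_bracket A X Y (P y)) Z = ?pv y (dd (cf Z) (dd (cf Y) (x X) y - dd (cf X) (x Y) y) y)"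
    unfolding br by (rule Dex[OF sub[OF XYZ(3)] S(2) cfe[OF sub[OF XYZ(3)]]])
  note lZ = dd_linear[OF Cinf_on_differentiable[OF sm[OF XYZ(3)]]]
  \<comment> \<open>Both the base point and the direction of the inner derivative move with z; the
    basis expansion separates the two contributions.\<close>
  have prod: "dd (\<lambda>z. dd (cf Z) (cf V z) z) a y = dd (\<lambda>z. dd (cf Z) (x V) z) a y + dd (cf Z) (dd (cf V) a y) y"
    if V: "vector_field_on A U V" for V a
  proof -
    have eq: "dd (cf Z) (cf V z) z = (\<Sum>b\<in>Basis. (cf V z \<bullet> b) *\<^sub>R dd (cf Z) b z)" if "z \<in> S" for z
      by (rule linear_expand[OF lZ[OF that]])
    have eq2: "dd (cf Z) (x V) z = (\<Sum>b\<in>Basis. (x V \<bullet> b) *\<^sub>R dd (cf Z) b z)" if "z \<in> S" for z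
      by (rule linear_expand[OF lZ[OF that]])
    have der: "((\<lambda>z. \<Sum>b\<in>Basis. (cf V z \<bullet> b) *\<^sub>R dd (cf Z) b z) has_derivative
      (\<lambda>a. \<Sum>b\<in>Basis. (cf V y \<bullet> b) *\<^sub>R dd (dd (cf Z) b) a y + (dd (cf V) a y \<bullet> b) *\<^sub>R dd (cf Z) b y)) (at y)"
      by (intro has_derivative_sum has_derivative_scaleR Cinf_on_has_derivative[OF Cinf_on_dd[OF sm[OF XYZ(3)]] S(2)]
            has_derivative_inner_left Cinf_on_has_derivative[OF sm[OF V] S(2)])
    have der2: "((\<lambda>z. \<Sum>b\<in>Basis. (x V \<bullet> b) *\<^sub>R dd (cf Z) b z) has_derivative
      (\<lambda>a. \<Sum>b\<in>Basis. (x V \<bullet> b) *\<^sub>R dd (dd (cf Z) b) a y)) (at y)"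
      by (intro has_derivative_sum has_derivative_scaleR_right Cinf_on_has_derivative[OF Cinf_on_dd[OF sm[OF XYZ(3)]] S(2)])
    have "dd (\<lambda>z. dd (cf Z) (x V) z) a y = (\<Sum>b\<in>Basis. (x V \<bullet> b) *\<^sub>R dd (dd (cf Z) b) a y)"
      using dd_cong[OF S eq2, where v = a] dd_eqI[OF der2, of a] by simp
    moreover have "dd (cf Z) (dd (cf V) a y) y = (\<Sum>b\<in>Basis. (dd (cf V) a y \<bullet> b) *\<^sub>R dd (cf Z) b y)"
      by (rule linear_expand[OF lZ[OF S(2)]])
    ultimately show ?thesis
      using dd_cong[OF S eq, where v = a] dd_eqI[OF der, of a] by (simp add: sum.distrib x_def)
  qed
  have comm: "dd (dd (cf Z) a) b y = dd (dd (cf Z) b) a y" for a b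
  proof (rule euclidean_eqI)
    fix c :: "complex ^ 'n" assume "c \<in> Basis"
    have i: "dd (\<lambda>z. cf Z z \<bullet> c) a z = dd (cf Z) a z \<bullet> c" if "z \<in> S" for a z
      by (rule dd_eqI[OF has_derivative_inner_left[OF Cinf_on_has_derivative[OF sm[OF XYZ(3)] that]]])
    have ii: "dd (dd (\<lambda>z. cf Z z \<bullet> c) a) b y = dd (dd (cf Z) a) b y \<bullet> c" for a b
    proof -
      have "dd (\<lambda>z. dd (cf Z) a z \<bullet> c) b y = dd (dd (cf Z) a) b y \<bullet> c"
        by (rule dd_eqI[OF has_derivative_inner_left[OF Cinf_on_has_derivative[OF Cinf_on_dd[OF sm[OF XYZ(3)]] S(2)]]])
      then show ?thesis using dd_cong[OF S i[where a = a], where v = b] by simp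
    qed
    show "dd (dd (cf Z) a) b y \<bullet> c = dd (dd (cf Z) b) a y \<bullet> c"
      using dd_commute[OF S(1) Cinf_on_inner[OF S(1) sm[OF XYZ(3)] Cinf_on_const[of _ c]] S(2), where a = a and b = b] unfolding ii .
  qed
  have "dd (\<lambda>z. dd (cf Z) (cf Y z) z) (x X) y - dd (\<lambda>z. dd (cf Z) (cf X z) z) (x Y) y
      - dd (cf Z) (dd (cf Y) (x X) y - dd (cf X) (x Y) y) y = 0"
    unfolding prod[OF XYZ(1)] prod[OF XYZ(2)] linear_diff[OF lZ[OF S(2)]] using comm[of "x X" "x Y"] by simp
  then show ?thesis
    unfolding curvature_def second[OF XYZ(1,2)] second[OF XYZ(2,1)] third push_vec_sub[OF par y, symmetric]
    using push_vec_zero[OF par y] by simp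
qed

theorem theorem2:
  fixes A :: "('a::{t2_space, second_countable_topology}, 'n::finite) atlas"
    and I :: "'a \<Rightarrow> 'a tvec \<Rightarrow> 'a tvec"
    and \<omega> :: "'a \<Rightarrow> 'a tvec \<Rightarrow> 'a tvec \<Rightarrow> real"
    and nabla D :: "'a connection"
  assumes "special_kaehler_manifold A I \<omega> nabla"
    and "complete_metric A (kaehler_metric I \<omega>)"
    and "levi_civita A (kaehler_metric I \<omega>) D"
  shows "curvature_vanishes A D"
proof -
  interpret complete_special_kaehler A I \<omega> nabla
    by (intro complete_special_kaehler.intro complete_special_kaehler_axioms.intro special_kaehler_manifoldD assms)
  have D: "connection A D" "torsion_free A D" using assms(3) unfolding levi_civita_def by simp_all
  show ?thesis
    unfolding curvature_vanishes_def
  proof (intro allI impI ballI)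
    fix U X Y Z p assume U: "open U" "p \<in> U" and XYZ: "vector_field_on A U X" "vector_field_on A U Y" "vector_field_on A U Z"
    obtain P r where P: "r > 0" "flat_param A nabla (ball 0 r) P" "P 0 = p"
      using flat_param_exists[OF nabla] by blast
    have "0 \<in> ball (0 :: complex ^ 'n) r" using P(1) by simp
    from curvature_flat_param[OF D levi_civita_flat_param[OF assms(3) P(2)] this U(1) _ XYZ]
    show "curvature A D X Y Z p = 0" using U(2) P(3) by simp
  qed
qed

end
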